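(* Let $\alpha\in[0,2\pi[$ and $\beta\in\,]0,\pi[$. With the Hilbert space isomorphism $Y: L^2(0,1)\to H^2(\mathbb{T})$ (depending on $\alpha,\beta$), the standard basis $e_n(z)=z^n$ of $H^2(\mathbb{T})$, and the functions $h_n$ on $]0,1[$ defined in the context, one has $$Y^{-1}e_n=h_n\qquad\text{for all }n\in\mathbb{N}_0 .$$
   Context: $\mathbb{R}_+=\{x>0\}$; $\mathbb{T}\subset\mathbb{C}$ is the unit circle with normalized Lebesgue measure; $H^2(\mathbb{T})\subset L^2(\mathbb{T})$ is the Hardy space with orthonormal basis $e_n(z)=z^n$, $n\in\mathbb{N}_0$; $Q_+:L^2(\mathbb{T})\to H^2(\mathbb{T})$ is the orthogonal projection. $\mathcal{F}$ is the unitary Fourier transformation on $L^2(\mathbb{R})$ with $\mathcal{F}f(x)=(2\pi)^{-1/2}\int e^{-ixy}f(y)\,dy$ for $f\in L^1\cap L^2$. $P_+^*:L^2(\mathbb{R}_+)\to L^2(\mathbb{R})$ is extension by zero. Put $d=i\tan(\beta/2)$ and $\chi(x)=e^{i\alpha}\frac{x-i\tan(\beta/2)}{x+i\tan(\beta/2)}$, with inverse $\chi^{-1}(z)=i\tan(\beta/2)\frac{z+e^{i\alpha}}{-z+e^{i\alpha}}$. $X:L^2(\mathbb{R})\to L^2(\mathbb{T})$ is the Hilbert space isomorphism $$(Xf)(z)=(2\pi)^{1/2}e^{i\alpha}\frac{\sqrt{2\tan(\beta/2)}}{-z+e^{i\alpha}}f\big(\chi^{-1}(z)\big),$$ and $X_+:=Q_+X\mathcal{F}^{-1}P_+^*:L^2(\mathbb{R}_+)\to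 H^2(\mathbb{T})$, which is a Hilbert space isomorphism. $V:L^2(0,1)\to L^2(\mathbb{R}_+)$ is the Hilbert space isomorphism $Vh=\operatorname{l.i.m.}_{0<a,a'\to0}\int_a^{1-a'}q_+(s,\cdot)h(s)\,ds$ (limit in $L^2$) with $$q_+(s,x)=\tfrac12\pi^{-3/2}s^{-1}(1-s)^{-1/2}\int_{-1}^1e^{-ixu}(1-u^2)^{-1/2}\exp\Big(\tfrac{i}{2\pi}\ln\big(\tfrac1s-1\big)\ln\big(\tfrac{1-u}{1+u}\big)\Big)du .$$ $Y:=X_+V$. For $n\in\mathbb{N}_0$, $h_n:\,]0,1[\to\mathbb{C}$, $$h_n(s)=e^{in\alpha}\Big(\tfrac{\sin\beta}{\pi}\Big)^{1/2}\big(\tfrac1s-1\big)^{\beta/(2\pi)}(1-s)^{-1/2}\,\mathrm{P}_n^{(1/2)}\Big(\tfrac1{2\pi}\ln\big(\tfrac1s-1\big);\beta\Big),$$ where $\mathrm{P}_n^{(1/2)}(x;\beta)$ is the $n$th Meixner-Pollaczek polynomial of order $1/2$, given by the generating function $\sum_{n\ge0}\mathrm{P}_n^{(1/2)}(x;\beta)q^n=(1-qe^{i\beta})^{-1/2+ix}(1-qe^{-i\beta})^{-1/2-ix}$, $|q|<1$ (principal branches). The $h_n$ form an orthonormal basis of $L^2(0,1)$. *)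

theory Defs
  imports "HOL-Analysis.Analysis"
begin

text \<open>Elements of $L^2$ are represented as almost-everywhere classes of Borel measurable
  functions; every Lebesgue measurable function is a.e. equal to a Borel measurable one.\<close>

definition square_integrable :: "'a measure \<Rightarrow> ('a \<Rightarrow> complex) \<Rightarrow> bool" where
  "square_integrable M f \<longleftrightarrow>
     f \<in> borel_measurable M \<and> integrable M (\<lambda>x. (cmod (f x))\<^sup>2)"

definition ae_class :: "'a measure \<Rightarrow> ('a \<Rightarrow> complex) \<Rightarrow> ('a \<Rightarrow> complex) set" where
  "ae_class M f = {g \<in> borel_measurable M. AE x in M. g x = f x}"

definition L2 :: "'a measure \<Rightarrow> ('a \<Rightarrow> complex) set set" where
  "L2 M = ae_class M ` {f. square_integrable M f}"

text \<open>A chosen representative; everything below depends on it only up to null sets.\<close>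

definition rep :: "('a \<Rightarrow> complex) set \<Rightarrow> 'a \<Rightarrow> complex" where
  "rep F = (SOME f. f \<in> F)"

definition L2_lincomb :: "'a measure \<Rightarrow> complex \<Rightarrow> ('a \<Rightarrow> complex) set \<Rightarrow>
    complex \<Rightarrow> ('a \<Rightarrow> complex) set \<Rightarrow> ('a \<Rightarrow> complex) set" where
  "L2_lincomb M a F b G = ae_class M (\<lambda>x. a * rep F x + b * rep G x)"

abbreviation L2_diff :: "'a measure \<Rightarrow> ('a \<Rightarrow> complex) set \<Rightarrow> ('a \<Rightarrow> complex) set \<Rightarrow>
    ('a \<Rightarrow> complex) set" where
  "L2_diff M F G \<equiv> L2_lincomb M 1 F (-1) G"

definition L2_inner :: "'a measure \<Rightarrow> ('a \<Rightarrow> complex) set \<Rightarrow> ('a \<Rightarrow> complex) set \<Rightarrow> complex" where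
  "L2_inner M F G = (LINT x|M. rep F x * cnj (rep G x))"

definition L2_norm :: "'a measure \<Rightarrow> ('a \<Rightarrow> complex) set \<Rightarrow> real" where
  "L2_norm M F = sqrt (LINT x|M. (cmod (rep F x))\<^sup>2)"

text \<open>The Bochner integral of a non-integrable function is \<open>0\<close>, so convergence in
  $L^2$ has to demand membership in $L^2$ explicitly.\<close>

definition L2_tendsto :: "'a measure \<Rightarrow> ('i \<Rightarrow> ('a \<Rightarrow> complex) set) \<Rightarrow>
    ('a \<Rightarrow> complex) set \<Rightarrow> 'i filter \<Rightarrow> bool" where
  "L2_tendsto M u K \<F> \<longleftrightarrow> K \<in> L2 M \<and> (\<forall>\<^sub>F i in \<F>. u i \<in> L2 M) \<and>
     ((\<lambda>i. L2_norm M (L2_diff M (u i) K)) \<longlongrightarrow> 0) \<F>"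

definition L2_lim :: "'a measure \<Rightarrow> ('i \<Rightarrow> ('a \<Rightarrow> complex) set) \<Rightarrow> 'i filter \<Rightarrow>
    ('a \<Rightarrow> complex) set" where
  "L2_lim M u \<F> = (THE K. L2_tendsto M u K \<F>)"

definition L2_unitary :: "'a measure \<Rightarrow> 'b measure \<Rightarrow>
    (('a \<Rightarrow> complex) set \<Rightarrow> ('b \<Rightarrow> complex) set) \<Rightarrow> bool" where
  "L2_unitary M N T \<longleftrightarrow> bij_betw T (L2 M) (L2 N) \<and>
     (\<forall>F\<in>L2 M. \<forall>G\<in>L2 M. \<forall>a b. T (L2_lincomb M a F b G) = L2_lincomb N a (T F) b (T G)) \<and>
     (\<forall>F\<in>L2 M. \<forall>G\<in>L2 M. L2_inner N (T F) (T G) = L2_inner M F G)"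

definition orth_proj :: "'a measure \<Rightarrow> ('a \<Rightarrow> complex) set set \<Rightarrow>
    ('a \<Rightarrow> complex) set \<Rightarrow> ('a \<Rightarrow> complex) set" where
  "orth_proj M S F = (THE G. G \<in> S \<and> (\<forall>K\<in>S. L2_inner M (L2_diff M F G) K = 0))"

definition unit_interval :: "real measure" where
  "unit_interval = restrict_space lborel {0<..<1}"

definition half_line :: "real measure" where
  "half_line = restrict_space lborel {0<..}"

definition circle :: "complex measure" where
  "circle = distr (uniform_measure lborel {0..<2*pi}) (restrict_space borel (sphere 0 1)) cis"

definition e_mon :: "nat \<Rightarrow> (complex \<Rightarrow> complex) set" where
  "e_mon n = ae_class circle (\<lambda>z. z ^ n)"

text \<open>The closed linear span of the orthonormal system \<open>e_mon n\<close>.\<close>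

definition Hardy2 :: "(complex \<Rightarrow> complex) set set" where
  "Hardy2 = {F \<in> L2 circle. \<forall>\<epsilon>>0. \<exists>N c.
     L2_norm circle (L2_diff circle F (ae_class circle (\<lambda>z. \<Sum>n<N. c n * z ^ n))) < \<epsilon>}"

definition Q_plus :: "(complex \<Rightarrow> complex) set \<Rightarrow> (complex \<Rightarrow> complex) set" where
  "Q_plus = orth_proj circle Hardy2"

definition fourier_integral :: "(real \<Rightarrow> complex) \<Rightarrow> real \<Rightarrow> complex" where
  "fourier_integral f x =
     complex_of_real ((2*pi) powr (-1/2)) *
     (LINT y|lborel. exp (- (\<i> * complex_of_real x * complex_of_real y)) * f y)"

text \<open>The unitary operator given by the integral on $L^1 \cap L^2$. Extensionality only fixes
  the values of the HOL function off $L^2(\mathbb{R})$.\<close>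

definition fourier :: "(real \<Rightarrow> complex) set \<Rightarrow> (real \<Rightarrow> complex) set" where
  "fourier = (THE T. T \<in> extensional (L2 lborel) \<and> L2_unitary lborel lborel T \<and>
     (\<forall>f. integrable lborel f \<and> square_integrable lborel f \<longrightarrow>
        T (ae_class lborel f) = ae_class lborel (fourier_integral f)))"

definition ext_zero :: "(real \<Rightarrow> complex) set \<Rightarrow> (real \<Rightarrow> complex) set" where
  "ext_zero F = ae_class lborel (\<lambda>x. if 0 < x then rep F x else 0)"

definition chi_inv :: "real \<Rightarrow> real \<Rightarrow> complex \<Rightarrow> complex" where
  "chi_inv \<alpha> \<beta> z = \<i> * complex_of_real (tan (\<beta>/2)) * ((z + cis \<alpha>) / (- z + cis \<alpha>))"

text \<open>On the unit circle \<open>chi_inv \<alpha> \<beta> z\<close> is real; \<open>Re\<close> is only a type conversion.\<close>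

definition X_op :: "real \<Rightarrow> real \<Rightarrow> (real \<Rightarrow> complex) set \<Rightarrow> (complex \<Rightarrow> complex) set" where
  "X_op \<alpha> \<beta> F = ae_class circle (\<lambda>z.
     complex_of_real (sqrt (2*pi)) * cis \<alpha> *
     (complex_of_real (sqrt (2 * tan (\<beta>/2))) / (- z + cis \<alpha>)) * rep F (Re (chi_inv \<alpha> \<beta> z)))"

definition X_plus :: "real \<Rightarrow> real \<Rightarrow> (real \<Rightarrow> complex) set \<Rightarrow> (complex \<Rightarrow> complex) set" where
  "X_plus \<alpha> \<beta> F = Q_plus (X_op \<alpha> \<beta> (inv_into (L2 lborel) fourier (ext_zero F)))"

definition q_plus :: "real \<Rightarrow> real \<Rightarrow> complex" where
  "q_plus s x =
     complex_of_real (1/2 * pi powr (-3/2) * (1/s) * (1 - s) powr (-1/2)) *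
     (LINT u:{-1<..<1}|lborel.
        exp (- (\<i> * complex_of_real x * complex_of_real u)) *
        complex_of_real ((1 - u\<^sup>2) powr (-1/2)) *
        exp (\<i> / complex_of_real (2*pi) *
          complex_of_real (ln (1/s - 1)) * complex_of_real (ln ((1 - u) / (1 + u)))))"

definition V_op :: "(real \<Rightarrow> complex) set \<Rightarrow> (real \<Rightarrow> complex) set" where
  "V_op H = L2_lim half_line
     (\<lambda>(a, a'). ae_class half_line (\<lambda>x. LINT s:{a..1-a'}|lborel. q_plus s x * rep H s))
     (at_right 0 \<times>\<^sub>F at_right 0)"

definition Y_op :: "real \<Rightarrow> real \<Rightarrow> (real \<Rightarrow> complex) set \<Rightarrow> (complex \<Rightarrow> complex) set" where
  "Y_op \<alpha> \<beta> H = X_plus \<alpha> \<beta> (V_op H)"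

definition meixner_pollaczek :: "real \<Rightarrow> nat \<Rightarrow> real \<Rightarrow> real \<Rightarrow> complex" where
  "meixner_pollaczek l n x \<beta> = (THE p. \<forall>q. cmod q < 1 \<longrightarrow>
     (\<lambda>n. p n * q ^ n) sums
       ((1 - q * cis \<beta>) powr (- complex_of_real l + \<i> * complex_of_real x) *
        (1 - q * cis (-\<beta>)) powr (- complex_of_real l - \<i> * complex_of_real x))) n"

definition h_fun :: "real \<Rightarrow> real \<Rightarrow> nat \<Rightarrow> real \<Rightarrow> complex" where
  "h_fun \<alpha> \<beta> n s =
     exp (\<i> * of_nat n * complex_of_real \<alpha>) *
     complex_of_real (sqrt (sin \<beta> / pi) * (1/s - 1) powr (\<beta> / (2*pi)) * (1 - s) powr (-1/2)) *
     meixner_pollaczek (1/2) n (1 / (2*pi) * ln (1/s - 1)) \<beta>"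

end

theory Submission
  imports Defs "HOL-Probability.Probability"
begin

text \<open>Put \<open>d = tan (\<beta>/2)\<close>. Each operator in the composition carries one orthonormal basis to another.
  The functions \<open>h0 n\<close> (that is, \<open>h_fun \<alpha> \<beta> n\<close> without the phase \<open>exp (i n \<alpha>)\<close>) are mapped by \<open>V_op\<close> to the
  Laguerre functions with exponential decay \<open>exp (- d x)\<close>, these by the inverse Fourier transformation to the functions
  \<open>y \<mapsto> i (d/\<pi>)^(1/2) (y - i d)^n / (y + i d)^(n + 1)\<close>, and these by \<open>X_op\<close> to \<open>z \<mapsto> (z exp (- i \<alpha>))^n\<close>.

  Completeness of the bases comes from uniqueness theorems for moments and for trigonometric moments. The
  Fourier step is the Laplace transform of the Laguerre functions. For the step through \<open>V_op\<close>, exchanging the order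
  of integration reduces the pairing of the kernel with a Laguerre function to an integral over \<open>]-1, 1[\<close>, whose
  generating function in \<open>n\<close> is the integral of \<open>(1-u^2)^(-1/2) ((1-u)/(1+u))^(i t) / (u - i w)\<close>. After multiplication by
  \<open>(1 + w^2)^(1/2) exp (- 2 t arctan w)\<close> this integral is constant in \<open>w > 0\<close> and in \<open>w < 0\<close>; its behaviour as \<open>w\<close>
  tends to infinity and its jump at \<open>w = 0\<close> determine both constants, and the result is the generating function of
  the Meixner-Pollaczek polynomials.\<close>

section \<open>Square integrable functions\<close>

text \<open>\<open>fourier\<close>, \<open>V_op\<close> and \<open>Q_plus\<close> are definite
  descriptions or limits, so their values must be established before anything can be computed with
  them. For the first two, \<open>onb_unitary\<close> produces an abstract unitary from a pair of
  bases, known only through its coefficients, and this operator is then recognised in the explicit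
  integral. The obstacle is that an integral with bounded kernel, applied to an integrable function,
  is at first only known to be bounded, not square integrable. Completeness of the Laguerre
  functions is therefore proved for all measurable functions that are integrable against exp (- d x
  / 2): two such functions agree a.e. once their pairings with Laguerre functions agree, and Fubini
  moves the kernel onto the Laguerre function, where everything is explicit. \<open>Q_plus\<close>
  acts as the identity because the chain before it already takes values in \<open>Hardy2\<close>.
  The substitution behind \<open>X_op\<close> is obtained from moments as well: normalised Lebesgue
  measure on the circle and the Cauchy distribution carried over by \<open>chi\<close> have the same
  trigonometric moments.\<close>

definition ip :: "'a measure \<Rightarrow> ('a \<Rightarrow> complex) \<Rightarrow> ('a \<Rightarrow> complex) \<Rightarrow> complex" where
  "ip M f g = (LINT x|M. f x * cnj (g x))"

definition nsq :: "'a measure \<Rightarrow> ('a \<Rightarrow> complex) \<Rightarrow> real" where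
  "nsq M f = (LINT x|M. (cmod (f x))\<^sup>2)"

lemma borel_measurable_cnj [measurable]: "cnj \<in> borel_measurable borel"
  by (intro borel_measurable_continuous_onI continuous_intros)

lemma sqi_measurable [measurable_dest]: "square_integrable M f \<Longrightarrow> f \<in> borel_measurable M"
  by (simp add: square_integrable_def)

lemma sqi_integrable: "square_integrable M f \<Longrightarrow> integrable M (\<lambda>x. (cmod (f x))\<^sup>2)"
  by (simp add: square_integrable_def)

lemma sqi_bound:
  assumes "f \<in> borel_measurable M" "integrable M g" "AE x in M. (cmod (f x))\<^sup>2 \<le> g x"
  shows "square_integrable M f"
  unfolding square_integrable_def
  using assms by (auto intro!: Bochner_Integration.integrable_bound[OF assms(2)])

lemma sqi_mult_integrable:
  assumes "square_integrable M f" "square_integrable M g"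
  shows "integrable M (\<lambda>x. f x * g x)"
proof (rule Bochner_Integration.integrable_bound)
  show "integrable M (\<lambda>x. (cmod (f x))\<^sup>2 + (cmod (g x))\<^sup>2)"
    using assms by (simp add: sqi_integrable)
  show "(\<lambda>x. f x * g x) \<in> borel_measurable M"
    using assms by (intro borel_measurable_times) (auto simp: square_integrable_def)
  have "cmod (f x * g x) \<le> (cmod (f x))\<^sup>2 + (cmod (g x))\<^sup>2" for x
    using sum_squares_bound[of "cmod (f x)" "cmod (g x)"]
      mult_nonneg_nonneg[OF norm_ge_zero[of "f x"] norm_ge_zero[of "g x"]]
    unfolding norm_mult by linarith
  thus "AE x in M. norm (f x * g x) \<le> norm ((cmod (f x))\<^sup>2 + (cmod (g x))\<^sup>2)" by simp
qed

lemma sqi_cnj: "square_integrable M f \<Longrightarrow> square_integrable M (\<lambda>x. cnj (f x))"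
  by (auto simp: square_integrable_def)

lemma sqi_scale: "square_integrable M f \<Longrightarrow> square_integrable M (\<lambda>x. c * f x)"
  by (auto simp: square_integrable_def norm_mult power_mult_distrib)

lemma cmod_add_sq: "(cmod (a + b))\<^sup>2 \<le> 2 * (cmod a)\<^sup>2 + 2 * (cmod b)\<^sup>2"
proof -
  have "(cmod (a + b))\<^sup>2 \<le> (cmod a + cmod b)\<^sup>2" by (intro power_mono norm_triangle_ineq) auto
  also have "\<dots> \<le> 2 * (cmod a)\<^sup>2 + 2 * (cmod b)\<^sup>2"
    using sum_squares_bound[of "cmod a" "cmod b"] by (simp add: power2_sum)
  finally show ?thesis .
qed

lemma sqi_add:
  assumes "square_integrable M f" "square_integrable M g"
  shows "square_integrable M (\<lambda>x. f x + g x)"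
proof (rule sqi_bound)
  show "(\<lambda>x. f x + g x) \<in> borel_measurable M" using assms by measurable
  show "integrable M (\<lambda>x. 2 * (cmod (f x))\<^sup>2 + 2 * (cmod (g x))\<^sup>2)"
    using assms by (simp add: sqi_integrable)
qed (simp add: cmod_add_sq)

lemma sqi_diff:
  assumes "square_integrable M f" "square_integrable M g"
  shows "square_integrable M (\<lambda>x. f x - g x)"
  using sqi_add[OF assms(1) sqi_scale[OF assms(2), of "-1"]] by simp

lemma sqi_zero: "square_integrable M (\<lambda>x. 0)"
  by (simp add: square_integrable_def)

lemma sqi_sum:
  assumes "\<And>i. i \<in> A \<Longrightarrow> square_integrable M (f i)"
  shows "square_integrable M (\<lambda>x. \<Sum>i\<in>A. f i x)"
  using assms by (induction A rule: infinite_finite_induct) (auto intro: sqi_zero sqi_add)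

lemma sqi_cong_AE:
  assumes "square_integrable M f" "g \<in> borel_measurable M" "AE x in M. g x = f x"
  shows "square_integrable M g"
proof (rule sqi_bound[OF assms(2) sqi_integrable[OF assms(1)]])
  show "AE x in M. (cmod (g x))\<^sup>2 \<le> (cmod (f x))\<^sup>2" using assms(3) by eventually_elim simp
qed

lemma ip_integrable:
  assumes "square_integrable M f" "square_integrable M g"
  shows "integrable M (\<lambda>x. f x * cnj (g x))"
  using sqi_mult_integrable[OF assms(1) sqi_cnj[OF assms(2)]] .

lemma ip_self: "ip M f f = of_real (nsq M f)"
  by (simp add: ip_def nsq_def complex_norm_square [symmetric] flip: integral_complex_of_real)

lemma nsq_nonneg: "0 \<le> nsq M f"
  by (simp add: nsq_def)

lemma nsq_eq_0_iff: "square_integrable M f \<Longrightarrow> nsq M f = 0 \<longleftrightarrow> (AE x in M. f x = 0)"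
  unfolding nsq_def by (subst integral_nonneg_eq_0_iff_AE) (auto simp: sqi_integrable)

lemma ip_add_left:
  assumes "square_integrable M f" "square_integrable M g" "square_integrable M h"
  shows "ip M (\<lambda>x. f x + g x) h = ip M f h + ip M g h"
  using assms by (simp add: ip_def distrib_right ip_integrable)

lemma ip_scale_left: "ip M (\<lambda>x. c * f x) h = c * ip M f h"
  by (simp add: ip_def mult.assoc)

lemma ip_diff_left:
  assumes "square_integrable M f" "square_integrable M g" "square_integrable M h"
  shows "ip M (\<lambda>x. f x - g x) h = ip M f h - ip M g h"
  using assms by (simp add: ip_def left_diff_distrib ip_integrable)

lemma ip_sum_left:
  assumes "\<And>i. i \<in> A \<Longrightarrow> square_integrable M (f i)" "square_integrable M h"
  shows "ip M (\<lambda>x. \<Sum>i\<in>A. f i x) h = (\<Sum>i\<in>A. ip M (f i) h)"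
  using assms by (simp add: ip_def sum_distrib_right ip_integrable)

lemma ip_cnj: "cnj (ip M f g) = ip M g f"
  unfolding ip_def by (subst Bochner_Integration.integral_cnj [symmetric]) (simp add: mult.commute)

lemma ip_scale_right: "ip M f (\<lambda>x. c * h x) = cnj c * ip M f h"
  using arg_cong[OF ip_scale_left[of M c h f], of cnj] by (simp add: ip_cnj)

lemma ip_diff_right:
  assumes "square_integrable M f" "square_integrable M g" "square_integrable M h"
  shows "ip M h (\<lambda>x. f x - g x) = ip M h f - ip M h g"
  using arg_cong[OF ip_diff_left[OF assms], of cnj] by (simp add: ip_cnj)

lemma ip_sum_right:
  assumes "\<And>i. i \<in> A \<Longrightarrow> square_integrable M (f i)" "square_integrable M h"
  shows "ip M h (\<lambda>x. \<Sum>i\<in>A. f i x) = (\<Sum>i\<in>A. ip M h (f i))"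
  by (subst ip_cnj[symmetric], subst ip_sum_left) (use assms in \<open>auto simp: ip_cnj\<close>)

lemma ip_cong_AE:
  assumes "AE x in M. f x = f' x" "AE x in M. g x = g' x"
    "f \<in> borel_measurable M" "f' \<in> borel_measurable M"
    "g \<in> borel_measurable M" "g' \<in> borel_measurable M"
  shows "ip M f g = ip M f' g'"
  unfolding ip_def
proof (rule integral_cong_AE)
  show "AE x in M. f x * cnj (g x) = f' x * cnj (g' x)"
    using assms(1,2) by eventually_elim simp
qed (use assms in measurable)

lemma nsq_cong_AE:
  assumes "AE x in M. f x = f' x" "f \<in> borel_measurable M" "f' \<in> borel_measurable M"
  shows "nsq M f = nsq M f'"
  unfolding nsq_def
proof (rule integral_cong_AE)
  show "AE x in M. (cmod (f x))\<^sup>2 = (cmod (f' x))\<^sup>2"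
    using assms(1) by eventually_elim simp
qed (use assms in measurable)

lemma nsq_add_le:
  assumes "square_integrable M f" "square_integrable M g"
  shows "nsq M (\<lambda>x. f x + g x) \<le> 2 * nsq M f + 2 * nsq M g"
proof -
  have "nsq M (\<lambda>x. f x + g x) \<le> (LINT x|M. 2 * (cmod (f x))\<^sup>2 + 2 * (cmod (g x))\<^sup>2)"
    unfolding nsq_def
    using assms sqi_add[OF assms] by (intro integral_mono) (auto simp: sqi_integrable cmod_add_sq)
  also have "\<dots> = 2 * nsq M f + 2 * nsq M g"
    using assms by (simp add: sqi_integrable nsq_def)
  finally show ?thesis .
qed

lemma nsq_minus_commute: "nsq M (\<lambda>x. f x - g x) = nsq M (\<lambda>x. g x - f x)"
  by (simp add: nsq_def norm_minus_commute)

lemma nsq_diff_le: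
  assumes "square_integrable M f" "square_integrable M g" "square_integrable M h"
  shows "nsq M (\<lambda>x. f x - h x) \<le> 2 * nsq M (\<lambda>x. f x - g x) + 2 * nsq M (\<lambda>x. g x - h x)"
  using nsq_add_le[OF sqi_diff[OF assms(1,2)] sqi_diff[OF assms(2,3)]] by simp

text \<open>Expanding the squared norm of \<open>B * f - c * g\<close>, where
  \<open>B = nsq M g\<close> and \<open>c = ip M f g\<close>, gives B (B nsq f - |c|^2). This is
  nonnegative, and B > 0 can be divided out; a null \<open>g\<close> is treated apart.\<close>

lemma Cauchy_Schwarz_ip:
  assumes f: "square_integrable M f" and g: "square_integrable M g"
  shows "(cmod (ip M f g))\<^sup>2 \<le> nsq M f * nsq M g"
proof (cases "nsq M g = 0")
  case True
  hence "AE x in M. g x = 0" using nsq_eq_0_iff[OF g] by simp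
  hence "ip M f g = ip M f (\<lambda>x. 0)" using f g by (intro ip_cong_AE) auto
  thus ?thesis using True by (simp add: ip_def)
next
  case False
  define B c where "B = nsq M g" and "c = ip M f g"
  have B: "B > 0" using False nsq_nonneg[of M g] by (simp add: B_def)
  have gf: "ip M g f = cnj c" by (simp add: c_def ip_cnj)
  let ?h = "\<lambda>x. of_real B * f x - c * g x"
  note s = sqi_scale[OF f, of "of_real B"] sqi_scale[OF g, of c]
  have "of_real (nsq M ?h) = ip M ?h ?h" by (simp add: ip_self)
  also have "\<dots> = of_real B * (of_real B * ip M f f) - of_real B * (cnj c * ip M f g)
      - (c * (of_real B * ip M g f) - c * (cnj c * ip M g g))"
    by (simp add: ip_diff_left[OF s sqi_diff[OF s]] ip_diff_right[OF s] s ip_scale_left ip_scale_right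
        ip_diff_right[OF s f] ip_diff_right[OF s g] right_diff_distrib)
  also have "\<dots> = of_real (B * (B * nsq M f - (cmod c)\<^sup>2))"
    by (simp add: ip_self gf flip: B_def c_def)
      (auto simp: algebra_simps complex_norm_square [symmetric] simp flip: of_real_power)
  finally have "nsq M ?h = B * (B * nsq M f - (cmod c)\<^sup>2)" by (simp only: of_real_eq_iff)
  hence "0 \<le> B * (B * nsq M f - (cmod c)\<^sup>2)" by (metis nsq_nonneg)
  hence "0 \<le> B * nsq M f - (cmod c)\<^sup>2" using B by (simp add: zero_le_mult_iff)
  thus ?thesis by (simp add: B_def c_def mult.commute)
qed

lemma tendsto_ip:
  assumes u: "\<And>n. square_integrable M (u n)" and f: "square_integrable M f" and g: "square_integrable M g"
    and lim: "(\<lambda>n. nsq M (\<lambda>x. u n x - f x)) \<longlonglongrightarrow> 0"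
  shows "(\<lambda>n. ip M (u n) g) \<longlonglongrightarrow> ip M f g"
proof -
  have lim': "(\<lambda>n. sqrt (nsq M (\<lambda>x. u n x - f x) * nsq M g)) \<longlonglongrightarrow> sqrt (0 * nsq M g)"
    by (intro tendsto_intros lim)
  have "norm (ip M (u n) g - ip M f g) \<le> sqrt (nsq M (\<lambda>x. u n x - f x) * nsq M g)" for n
    using Cauchy_Schwarz_ip[OF sqi_diff[OF u f] g, of n] ip_diff_left[OF u f g, of n]
    by (simp add: real_le_rsqrt)
  hence "\<forall>\<^sub>F n in sequentially. norm (ip M (u n) g - ip M f g) \<le> sqrt (nsq M (\<lambda>x. u n x - f x) * nsq M g)"
    by simp
  from Lim_null_comparison[OF this] lim' have "(\<lambda>n. ip M (u n) g - ip M f g) \<longlonglongrightarrow> 0" by simp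
  thus ?thesis by (simp add: LIM_zero_iff)
qed

section \<open>Completeness of the space of square integrable functions\<close>

lemma nn_integral_sqi:
  "square_integrable M f \<Longrightarrow> (\<integral>\<^sup>+x. ennreal ((cmod (f x))\<^sup>2) \<partial>M) = ennreal (nsq M f)"
  by (simp add: nsq_def nn_integral_eq_integral sqi_integrable)

lemma sqi_nn_integral:
  assumes "f \<in> borel_measurable M" "(\<integral>\<^sup>+x. ennreal ((cmod (f x))\<^sup>2) \<partial>M) \<le> ennreal b"
  shows "square_integrable M f" "0 \<le> b \<Longrightarrow> nsq M f \<le> b"
proof -
  have "(\<integral>\<^sup>+x. ennreal ((cmod (f x))\<^sup>2) \<partial>M) < \<infinity>" using assms(2) by (simp add: order_le_less_trans)
  hence "integrable M (\<lambda>x. (cmod (f x))\<^sup>2)"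
    using assms(1) by (intro integrableI_bounded) auto
  thus *: "square_integrable M f" using assms(1) by (simp add: square_integrable_def)
  thus "0 \<le> b \<Longrightarrow> nsq M f \<le> b" using assms(2) by (simp add: nn_integral_sqi)
qed

text \<open>A subsequence with rapidly decreasing squared increments converges a.e.; Fatou's lemma
  then bounds the distance of every late \<open>u n\<close> to the pointwise limit, so the whole
  sequence converges in norm. The argument stays with squared norms throughout.\<close>

theorem Riesz_Fischer:
  assumes u: "\<And>n. square_integrable M (u n)"
    and Cauchy: "\<And>e. e > 0 \<Longrightarrow> \<exists>N. \<forall>m\<ge>N. \<forall>n\<ge>N. nsq M (\<lambda>x. u m x - u n x) \<le> e"
  obtains g where "square_integrable M g" "(\<lambda>n. nsq M (\<lambda>x. u n x - g x)) \<longlonglongrightarrow> 0"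
proof -
  have [measurable]: "u n \<in> borel_measurable M" for n using u by measurable
  \<comment> \<open>The rate (1/4)^j leaves room for the weight 2^j below: the weighted squared
    increments still have a geometric series of integrals.\<close>
  have "\<forall>j. \<exists>N. \<forall>m\<ge>N. \<forall>n\<ge>N. nsq M (\<lambda>x. u m x - u n x) \<le> (1/4)^j"
    by (intro allI Cauchy) simp
  then obtain N0 where N0: "\<And>j m n. m \<ge> N0 j \<Longrightarrow> n \<ge> N0 j \<Longrightarrow> nsq M (\<lambda>x. u m x - u n x) \<le> (1/4)^j"
    by metis
  \<comment> \<open>The sum dominates all earlier thresholds, so \<open>k j\<close> and
    \<open>k (Suc j)\<close> both lie beyond \<open>N0 j\<close>; the summand \<open>j\<close> makes
    the indices unbounded.\<close>
  define k where "k j = (\<Sum>i\<le>j. N0 i) + j" for j :: nat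
  have k: "k j \<ge> N0 j" "k (Suc j) \<ge> N0 j" "k j \<ge> j" for j
    using member_le_sum[of j "{..j}" N0] by (auto simp: k_def)
  define D where "D j x = u (k (Suc j)) x - u (k j) x" for j x
  have D: "square_integrable M (D j)" "nsq M (D j) \<le> (1/4)^j" for j
    unfolding D_def using u N0[OF k(2) k(1)] by (auto intro: sqi_diff)
  have [measurable]: "D j \<in> borel_measurable M" for j using D by measurable
  have "(\<integral>\<^sup>+x. (\<Sum>j. ennreal (2^j * (cmod (D j x))\<^sup>2)) \<partial>M)
      = (\<Sum>j. \<integral>\<^sup>+x. ennreal (2^j * (cmod (D j x))\<^sup>2) \<partial>M)"
    by (intro nn_integral_suminf) measurable
  also have "\<dots> = (\<Sum>j. ennreal (2^j * nsq M (D j)))"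
    by (simp add: ennreal_mult' nn_integral_cmult nn_integral_sqi[OF D(1)] nsq_nonneg)
  also have "\<dots> \<le> (\<Sum>j. ennreal ((1/2)^j))"
  proof (intro suminf_le ennreal_leI)
    show "2^j * nsq M (D j) \<le> (1/2)^j" for j
      using mult_left_mono[OF D(2)[of j], of "2^j"] by (simp add: power_mult_distrib[symmetric])
  qed auto
  also have "\<dots> = ennreal 2"
    using geometric_sums[of "1/2::real"] by (intro suminf_ennreal_eq) (auto simp: sums_iff)
  finally have "(\<integral>\<^sup>+x. (\<Sum>j. ennreal (2^j * (cmod (D j x))\<^sup>2)) \<partial>M) \<noteq> \<infinity>"
    by (auto simp: top_unique)
  hence "AE x in M. (\<Sum>j. ennreal (2^j * (cmod (D j x))\<^sup>2)) \<noteq> \<infinity>"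
    by (intro nn_integral_noteq_infinite) measurable
  hence conv: "AE x in M. convergent (\<lambda>j. u (k j) x)"
  proof eventually_elim
    fix x assume "(\<Sum>j. ennreal (2^j * (cmod (D j x))\<^sup>2)) \<noteq> \<infinity>"
    hence s: "summable (\<lambda>j. 2^j * (cmod (D j x))\<^sup>2)" by (intro summable_suminf_not_top) auto
    have "summable (\<lambda>j. ((1/2::real)^j + 2^j * (cmod (D j x))\<^sup>2))"
      by (intro summable_add s summable_geometric) auto
    \<comment> \<open>Either the increment is at most (1/2)^j, or 2^j times it exceeds 1 and
      multiplying by this factor only enlarges it. This turns summability of weighted squares into
      absolute summability.\<close>
    moreover have "cmod (D j x) \<le> (1/2)^j + 2^j * (cmod (D j x))\<^sup>2" for j
    proof (cases "cmod (D j x) \<le> (1/2)^j")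
      case False
      hence "1 * cmod (D j x) \<le> (2^j * cmod (D j x)) * cmod (D j x)"
        by (intro mult_right_mono) (auto simp: field_simps power_divide)
      moreover have "0 \<le> (1/2::real)^j" by simp
      ultimately show ?thesis unfolding power2_eq_square by linarith
    qed (auto intro: add_increasing2)
    ultimately have "summable (\<lambda>j. D j x)" by (rule summable_comparison_test'[where N = 0])
    hence "convergent (\<lambda>n. \<Sum>j<n. D j x)" by (simp add: summable_iff_convergent)
    also have "(\<lambda>n. \<Sum>j<n. D j x) = (\<lambda>n. u (k n) x - u (k 0) x)"
      unfolding D_def by (intro ext sum_lessThan_telescope)
    finally have "convergent (\<lambda>n. u (k n) x - u (k 0) x + u (k 0) x)"
      by (intro convergent_add convergent_const)
    thus "convergent (\<lambda>j. u (k j) x)" by simp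
  qed
  define g where "g x = lim (\<lambda>j. u (k j) x)" for x
  have [measurable]: "g \<in> borel_measurable M" unfolding g_def by (rule borel_measurable_lim_metric) measurable
  \<comment> \<open>Fatou: \<open>u n - g\<close> is the a.e. limit of \<open>u n - u (k j)\<close>,
    and all but finitely many of these have squared norm at most \<open>e\<close>.\<close>
  have le: "(\<integral>\<^sup>+x. ennreal ((cmod (u n x - g x))\<^sup>2) \<partial>M) \<le> ennreal e"
    if N: "\<And>m. m \<ge> N \<Longrightarrow> nsq M (\<lambda>x. u n x - u m x) \<le> e" for n N e
  proof -
    have "(\<integral>\<^sup>+x. ennreal ((cmod (u n x - g x))\<^sup>2) \<partial>M)
       = (\<integral>\<^sup>+x. liminf (\<lambda>j. ennreal ((cmod (u n x - u (k j) x))\<^sup>2)) \<partial>M)"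
    proof (rule nn_integral_cong_AE)
      show "AE x in M. ennreal ((cmod (u n x - g x))\<^sup>2) = liminf (\<lambda>j. ennreal ((cmod (u n x - u (k j) x))\<^sup>2))"
        using conv
      proof eventually_elim
        fix x assume "convergent (\<lambda>j. u (k j) x)"
        hence "(\<lambda>j. u (k j) x) \<longlonglongrightarrow> g x" by (simp add: g_def convergent_LIMSEQ_iff)
        hence "(\<lambda>j. ennreal ((cmod (u n x - u (k j) x))\<^sup>2)) \<longlonglongrightarrow> ennreal ((cmod (u n x - g x))\<^sup>2)"
          by (intro tendsto_intros)
        thus "ennreal ((cmod (u n x - g x))\<^sup>2) = liminf (\<lambda>j. ennreal ((cmod (u n x - u (k j) x))\<^sup>2))"
          by (intro lim_imp_Liminf[symmetric]) auto
      qed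
    qed
    also have "\<dots> \<le> liminf (\<lambda>j. \<integral>\<^sup>+x. ennreal ((cmod (u n x - u (k j) x))\<^sup>2) \<partial>M)"
      by (rule nn_integral_liminf) measurable
    also have "\<dots> = liminf (\<lambda>j. ennreal (nsq M (\<lambda>x. u n x - u (k j) x)))"
      by (simp add: nn_integral_sqi[OF sqi_diff[OF u u]])
    also have "\<dots> \<le> liminf (\<lambda>j. ennreal e)"
    proof (rule Liminf_mono, unfold eventually_sequentially, intro exI allI impI)
      fix j assume "N \<le> j"
      thus "ennreal (nsq M (\<lambda>x. u n x - u (k j) x)) \<le> ennreal e"
        using k(3)[of j] by (intro ennreal_leI N) auto
    qed
    also have "\<dots> = ennreal e" by (simp add: Liminf_const)
    finally show ?thesis .
  qed
  have g: "square_integrable M g"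
  proof -
    have "square_integrable M (\<lambda>x. u (N0 0) x - g x)"
      by (rule sqi_nn_integral(1)[OF _ le[of "N0 0" "N0 0" 1]]) (use N0[of 0 "N0 0"] in auto)
    from sqi_diff[OF u this, of "N0 0"] show ?thesis by simp
  qed
  have "(\<lambda>n. nsq M (\<lambda>x. u n x - g x)) \<longlonglongrightarrow> 0"
  proof (rule LIMSEQ_I)
    fix r :: real assume r: "0 < r"
    obtain N where N: "\<And>m n. m \<ge> N \<Longrightarrow> n \<ge> N \<Longrightarrow> nsq M (\<lambda>x. u m x - u n x) \<le> r/2"
      using Cauchy[of "r/2"] r by auto
    have "nsq M (\<lambda>x. u n x - g x) \<le> r/2" if "n \<ge> N" for n
      by (rule sqi_nn_integral(2)[OF _ le[of N n "r/2"]]) (use N that r in auto)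
    hence "nsq M (\<lambda>x. u n x - g x) < r" if "n \<ge> N" for n using r that by fastforce
    thus "\<exists>no. \<forall>n\<ge>no. norm (nsq M (\<lambda>x. u n x - g x) - 0) < r"
      by (intro exI[of _ N]) (simp add: nsq_nonneg)
  qed
  with g show ?thesis by (rule that)
qed

section \<open>Orthonormal bases\<close>

definition orthonormal_seq :: "'a measure \<Rightarrow> (nat \<Rightarrow> 'a \<Rightarrow> complex) \<Rightarrow> bool" where
  "orthonormal_seq M \<phi> \<longleftrightarrow> (\<forall>n. square_integrable M (\<phi> n)) \<and>
     (\<forall>m n. ip M (\<phi> m) (\<phi> n) = of_bool (m = n))"

text \<open>Completeness is encoded as total orthogonality implying zero a.e., because this is what
  the uniqueness theorems for moments deliver; expansions and Parseval's identity are derived from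
  it.\<close>

definition onb :: "'a measure \<Rightarrow> (nat \<Rightarrow> 'a \<Rightarrow> complex) \<Rightarrow> bool" where
  "onb M \<phi> \<longleftrightarrow> orthonormal_seq M \<phi> \<and>
     (\<forall>f. square_integrable M f \<longrightarrow> (\<forall>n. ip M f (\<phi> n) = 0) \<longrightarrow> (AE x in M. f x = 0))"

context
  fixes M :: "'a measure" and \<phi> :: "nat \<Rightarrow> 'a \<Rightarrow> complex"
  assumes on: "orthonormal_seq M \<phi>"
begin

lemma on_sqi: "square_integrable M (\<phi> n)"
  using on by (simp add: orthonormal_seq_def)

lemma on_ip: "ip M (\<phi> m) (\<phi> n) = of_bool (m = n)"
  using on by (simp add: orthonormal_seq_def)

lemma on_sqi_sum: "square_integrable M (\<lambda>x. \<Sum>n\<in>A. c n * \<phi> n x)"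
  by (intro sqi_sum sqi_scale on_sqi)

lemma on_ip_sum:
  assumes "finite A"
  shows "ip M (\<lambda>x. \<Sum>n\<in>A. c n * \<phi> n x) (\<phi> m) = (if m \<in> A then c m else 0)"
proof -
  have "ip M (\<lambda>x. \<Sum>n\<in>A. c n * \<phi> n x) (\<phi> m) = (\<Sum>n\<in>A. c n * of_bool (n = m))"
    by (subst ip_sum_left) (simp_all add: sqi_scale on_sqi ip_scale_left on_ip)
  also have "\<dots> = (\<Sum>n\<in>A. if n = m then c m else 0)" by (intro sum.cong) auto
  finally show ?thesis using assms by simp
qed

lemma on_nsq_sum:
  assumes "finite A"
  shows "nsq M (\<lambda>x. \<Sum>n\<in>A. c n * \<phi> n x) = (\<Sum>n\<in>A. (cmod (c n))\<^sup>2)"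
proof -
  let ?S = "\<lambda>x. \<Sum>n\<in>A. c n * \<phi> n x"
  have "of_real (nsq M ?S) = ip M ?S ?S" by (simp add: ip_self)
  also have "\<dots> = (\<Sum>n\<in>A. cnj (c n) * ip M ?S (\<phi> n))"
    by (subst ip_sum_right) (simp_all add: sqi_scale on_sqi on_sqi_sum ip_scale_right)
  also have "\<dots> = of_real (\<Sum>n\<in>A. (cmod (c n))\<^sup>2)"
    unfolding of_real_sum
    by (intro sum.cong) (simp_all add: on_ip_sum assms complex_norm_square mult.commute del: of_real_power)
  finally show ?thesis by (simp only: of_real_eq_iff)
qed

text \<open>The squared distance of \<open>f\<close> from its projection onto the finite span equals
  \<open>nsq M f\<close> minus the sum.\<close>

lemma Bessel:
  assumes "finite A" and f: "square_integrable M f"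
  shows "(\<Sum>n\<in>A. (cmod (ip M f (\<phi> n)))\<^sup>2) \<le> nsq M f"
proof -
  define c where "c n = ip M f (\<phi> n)" for n
  let ?S = "\<lambda>x. \<Sum>n\<in>A. c n * \<phi> n x"
  note S = on_sqi_sum[of c A]
  have fS: "ip M f ?S = of_real (\<Sum>n\<in>A. (cmod (c n))\<^sup>2)"
  proof -
    have "ip M f ?S = (\<Sum>n\<in>A. cnj (c n) * ip M f (\<phi> n))"
      by (subst ip_sum_right) (simp_all add: sqi_scale on_sqi f ip_scale_right)
    also have "\<dots> = of_real (\<Sum>n\<in>A. (cmod (c n))\<^sup>2)"
      unfolding of_real_sum
      by (intro sum.cong) (simp_all add: c_def complex_norm_square mult.commute del: of_real_power)
    finally show ?thesis .
  qed
  have Sf: "ip M ?S f = of_real (\<Sum>n\<in>A. (cmod (c n))\<^sup>2)"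
    using fS ip_cnj[of M f ?S] by (metis complex_cnj_complex_of_real)
  have "of_real (nsq M (\<lambda>x. f x - ?S x)) = ip M f f - ip M f ?S - (ip M ?S f - ip M ?S ?S)"
    by (simp only: ip_self [symmetric] ip_diff_left[OF f S sqi_diff[OF f S]] ip_diff_right[OF f S f]
        ip_diff_right[OF f S S])
  also have "\<dots> = of_real (nsq M f - (\<Sum>n\<in>A. (cmod (c n))\<^sup>2))"
    by (simp add: fS Sf ip_self on_nsq_sum assms)
  finally have "nsq M (\<lambda>x. f x - ?S x) = nsq M f - (\<Sum>n\<in>A. (cmod (c n))\<^sup>2)"
    by (simp only: of_real_eq_iff)
  thus ?thesis using nsq_nonneg[of M "\<lambda>x. f x - ?S x"] by (simp add: c_def)
qed

lemma Bessel_summable: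
  assumes "square_integrable M f"
  shows "summable (\<lambda>n. (cmod (ip M f (\<phi> n)))\<^sup>2)"
  by (rule summableI_nonneg_bounded[where x = "nsq M f"]) (simp_all add: Bessel assms)

text \<open>The squared distance of two partial sums is a block of the summable series, so
  \<open>Riesz_Fischer\<close> yields a limit; its coefficients follow by continuity of
  \<open>ip\<close>, since those of the partial sums are eventually constant.\<close>

lemma orthonormal_synthesis:
  assumes c: "summable (\<lambda>n. (cmod (c n))\<^sup>2)"
  obtains g where "square_integrable M g" "(\<lambda>N. nsq M (\<lambda>x. (\<Sum>n<N. c n * \<phi> n x) - g x)) \<longlonglongrightarrow> 0"
    "\<And>n. ip M g (\<phi> n) = c n"
proof -
  let ?S = "\<lambda>N x. \<Sum>n<N. c n * \<phi> n x"
  have 1: "nsq M (\<lambda>x. ?S m x - ?S n x) = (\<Sum>i\<in>{n..<m}. (cmod (c i))\<^sup>2)" if "n \<le> m" for m n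
  proof -
    have "?S m x - ?S n x = (\<Sum>i\<in>{n..<m}. c i * \<phi> i x)" for x
      using that by (simp add: sum_diff_nat_ivl atLeast0LessThan[symmetric])
    thus ?thesis by (simp add: on_nsq_sum)
  qed
  have "\<exists>N. \<forall>m\<ge>N. \<forall>n\<ge>N. nsq M (\<lambda>x. ?S m x - ?S n x) \<le> e" if e: "e > 0" for e
  proof -
    from c have "\<forall>e>0. \<exists>N. \<forall>m\<ge>N. \<forall>n. norm (\<Sum>i\<in>{m..<n}. (cmod (c i))\<^sup>2) < e"
      unfolding summable_Cauchy .
    from this[rule_format, OF e] obtain N
      where N': "\<forall>m\<ge>N. \<forall>n. norm (\<Sum>i\<in>{m..<n}. (cmod (c i))\<^sup>2) < e" by blast
    note N = N'[rule_format]
    have "nsq M (\<lambda>x. ?S m x - ?S n x) \<le> e" if "m \<ge> N" "n \<ge> N" for m n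
    proof (cases "n \<le> m")
      case True
      thus ?thesis using 1[OF True] N[of n m] that by auto
    next
      case False
      thus ?thesis using 1[of m n] N[of m n] that nsq_minus_commute[of M "?S m" "?S n"] by auto
    qed
    thus ?thesis by blast
  qed
  then obtain g where g: "square_integrable M g" "(\<lambda>N. nsq M (\<lambda>x. ?S N x - g x)) \<longlonglongrightarrow> 0"
    by (rule Riesz_Fischer[of M ?S, OF on_sqi_sum])
  have "ip M g (\<phi> n) = c n" for n
  proof (rule LIMSEQ_unique)
    show "(\<lambda>N. ip M (?S N) (\<phi> n)) \<longlonglongrightarrow> ip M g (\<phi> n)"
      by (intro tendsto_ip on_sqi_sum on_sqi g)
    show "(\<lambda>N. ip M (?S N) (\<phi> n)) \<longlonglongrightarrow> c n"
      by (rule tendsto_eventually, rule eventually_sequentiallyI[of "Suc n"]) (simp add: on_ip_sum)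
  qed
  with g show ?thesis by (rule that)
qed

end

context
  fixes M :: "'a measure" and \<phi> :: "nat \<Rightarrow> 'a \<Rightarrow> complex"
  assumes onb: "onb M \<phi>"
begin

lemma onb_on: "orthonormal_seq M \<phi>"
  using onb by (simp add: onb_def)

lemma onb_complete:
  assumes "square_integrable M f" "square_integrable M g" "\<And>n. ip M f (\<phi> n) = ip M g (\<phi> n)"
  shows "AE x in M. f x = g x"
proof -
  have "\<forall>n. ip M (\<lambda>x. f x - g x) (\<phi> n) = 0"
    using assms by (simp add: ip_diff_left on_sqi[OF onb_on])
  hence "AE x in M. f x - g x = 0"
    using onb sqi_diff[OF assms(1,2)] unfolding onb_def by blast
  thus ?thesis by eventually_elim simp
qed

text \<open>Synthesis from the coefficients of \<open>f\<close> gives some limit \<open>g\<close>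
  with these coefficients, and completeness identifies \<open>g\<close> with
  \<open>f\<close>.\<close>

lemma onb_expansion:
  assumes f: "square_integrable M f"
  shows "(\<lambda>N. nsq M (\<lambda>x. (\<Sum>n<N. ip M f (\<phi> n) * \<phi> n x) - f x)) \<longlonglongrightarrow> 0"
proof -
  obtain g where g: "square_integrable M g"
    "(\<lambda>N. nsq M (\<lambda>x. (\<Sum>n<N. ip M f (\<phi> n) * \<phi> n x) - g x)) \<longlonglongrightarrow> 0"
    "\<And>n. ip M g (\<phi> n) = ip M f (\<phi> n)"
    by (rule orthonormal_synthesis[OF onb_on Bessel_summable[OF onb_on f]]) (rule that)
  have fg: "AE x in M. f x = g x" by (intro onb_complete f g(1) g(3)[symmetric])
  have "nsq M (\<lambda>x. (\<Sum>n<N. ip M f (\<phi> n) * \<phi> n x) - f x) = nsq M (\<lambda>x. (\<Sum>n<N. ip M f (\<phi> n) * \<phi> n x) - g x)" for N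
  proof (rule nsq_cong_AE)
    show "AE x in M. (\<Sum>n<N. ip M f (\<phi> n) * \<phi> n x) - f x = (\<Sum>n<N. ip M f (\<phi> n) * \<phi> n x) - g x"
      using fg by eventually_elim simp
  qed (intro sqi_measurable sqi_diff f g(1) on_sqi_sum onb_on)+
  thus ?thesis using g(2) by simp
qed

lemma Parseval:
  assumes f: "square_integrable M f" and g: "square_integrable M g"
  shows "(\<lambda>n. ip M f (\<phi> n) * cnj (ip M g (\<phi> n))) sums ip M f g"
proof -
  have "(\<lambda>N. ip M (\<lambda>x. \<Sum>n<N. ip M f (\<phi> n) * \<phi> n x) g) \<longlonglongrightarrow> ip M f g"
    by (intro tendsto_ip on_sqi_sum onb_on f g onb_expansion)
  also have "(\<lambda>N. ip M (\<lambda>x. \<Sum>n<N. ip M f (\<phi> n) * \<phi> n x) g)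
      = (\<lambda>N. \<Sum>n<N. ip M f (\<phi> n) * cnj (ip M g (\<phi> n)))"
    by (intro ext, subst ip_sum_left) (simp_all add: sqi_scale on_sqi onb_on g ip_scale_left ip_cnj)
  finally show ?thesis by (simp add: sums_def)
qed

end

section \<open>Classes of square integrable functions\<close>

lemma rep_ae_class:
  assumes "f \<in> borel_measurable M"
  shows "rep (ae_class M f) \<in> borel_measurable M" "AE x in M. rep (ae_class M f) x = f x"
proof -
  have "f \<in> ae_class M f" using assms by (simp add: ae_class_def)
  hence "rep (ae_class M f) \<in> ae_class M f" 
    unfolding rep_def by (rule someI[where P = "\<lambda>g. g \<in> ae_class M f"])
  thus "rep (ae_class M f) \<in> borel_measurable M" "AE x in M. rep (ae_class M f) x = f x"
    by (auto simp: ae_class_def)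
qed

lemma ae_class_eqI:
  assumes "AE x in M. f x = g x"
  shows "ae_class M f = ae_class M g"
proof -
  have "(AE x in M. h x = f x) \<longleftrightarrow> (AE x in M. h x = g x)" for h :: "'a \<Rightarrow> complex"
  proof
    assume "AE x in M. h x = f x" thus "AE x in M. h x = g x" using assms by eventually_elim simp
  next
    assume "AE x in M. h x = g x" thus "AE x in M. h x = f x" using assms by eventually_elim simp
  qed
  thus ?thesis by (simp add: ae_class_def)
qed

lemma ae_class_in_L2: "square_integrable M f \<Longrightarrow> ae_class M f \<in> L2 M"
  by (simp add: L2_def)

lemma L2_rep:
  assumes "F \<in> L2 M"
  shows "square_integrable M (rep F)" "ae_class M (rep F) = F"
proof -
  obtain f where f: "square_integrable M f" "F = ae_class M f" using assms by (auto simp: L2_def)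
  note r = rep_ae_class[OF sqi_measurable[OF f(1)]]
  show "square_integrable M (rep F)" using sqi_cong_AE[OF f(1) r] f(2) by simp
  show "ae_class M (rep F) = F" using ae_class_eqI[OF r(2)] f(2) by simp
qed

lemma L2_eqI:
  assumes "F \<in> L2 M" "G \<in> L2 M" "AE x in M. rep F x = rep G x"
  shows "F = G"
  using ae_class_eqI[OF assms(3)] L2_rep(2)[OF assms(1)] L2_rep(2)[OF assms(2)] by simp

lemma L2_lincomb_in:
  assumes "F \<in> L2 M" "G \<in> L2 M"
  shows "L2_lincomb M a F b G \<in> L2 M"
  unfolding L2_lincomb_def by (intro ae_class_in_L2 sqi_add sqi_scale L2_rep assms)

lemma rep_L2_lincomb:
  assumes "F \<in> L2 M" "G \<in> L2 M"
  shows "AE x in M. rep (L2_lincomb M a F b G) x = a * rep F x + b * rep G x"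
  unfolding L2_lincomb_def by (intro rep_ae_class sqi_measurable sqi_add sqi_scale L2_rep assms)

lemma L2_lincomb_ae_class:
  assumes "f \<in> borel_measurable M" "g \<in> borel_measurable M"
  shows "L2_lincomb M a (ae_class M f) b (ae_class M g) = ae_class M (\<lambda>x. a * f x + b * g x)"
  unfolding L2_lincomb_def
proof (rule ae_class_eqI)
  show "AE x in M. a * rep (ae_class M f) x + b * rep (ae_class M g) x = a * f x + b * g x"
    using rep_ae_class(2)[OF assms(1)] rep_ae_class(2)[OF assms(2)] by eventually_elim simp
qed

lemma L2_inner_ip: "L2_inner M F G = ip M (rep F) (rep G)"
  by (simp add: L2_inner_def ip_def)

lemma L2_norm_nsq: "L2_norm M F = sqrt (nsq M (rep F))"
  by (simp add: L2_norm_def nsq_def)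

lemma ip_rep_ae_class:
  assumes "f \<in> borel_measurable M" "g \<in> borel_measurable M"
  shows "ip M (rep (ae_class M f)) g = ip M f g"
  by (intro ip_cong_AE rep_ae_class assms) auto

lemma nsq_rep_ae_class:
  assumes "f \<in> borel_measurable M"
  shows "nsq M (rep (ae_class M f)) = nsq M f"
  by (intro nsq_cong_AE rep_ae_class assms)

lemma nsq_rep_L2_diff:
  assumes "F \<in> L2 M" "G \<in> L2 M"
  shows "nsq M (rep (L2_diff M F G)) = nsq M (\<lambda>x. rep F x - rep G x)"
proof (rule nsq_cong_AE)
  show "AE x in M. rep (L2_diff M F G) x = rep F x - rep G x"
    using rep_L2_lincomb[OF assms, of 1 "-1"] by simp
qed (intro sqi_measurable sqi_diff L2_rep L2_lincomb_in assms)+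

lemma ip_rep_L2_lincomb:
  assumes "F \<in> L2 M" "G \<in> L2 M" "square_integrable M h"
  shows "ip M (rep (L2_lincomb M a F b G)) h = a * ip M (rep F) h + b * ip M (rep G) h"
proof -
  have "ip M (rep (L2_lincomb M a F b G)) h = ip M (\<lambda>x. a * rep F x + b * rep G x) h"
    by (rule ip_cong_AE[OF rep_L2_lincomb[OF assms(1,2)]])
      (auto intro!: sqi_measurable sqi_add sqi_scale L2_rep L2_lincomb_in assms)
  thus ?thesis using assms by (simp add: ip_add_left sqi_scale L2_rep ip_scale_left)
qed

lemma L2_norm_diff_eq_0:
  assumes "F \<in> L2 M" "G \<in> L2 M" "L2_norm M (L2_diff M F G) = 0"
  shows "F = G"
proof (rule L2_eqI[OF assms(1,2)])
  have "nsq M (\<lambda>x. rep F x - rep G x) = 0"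
    using assms(3) by (simp add: L2_norm_nsq nsq_rep_L2_diff[OF assms(1,2)])
  hence "AE x in M. rep F x - rep G x = 0"
    by (subst (asm) nsq_eq_0_iff) (intro sqi_diff L2_rep assms)+
  thus "AE x in M. rep F x = rep G x" by eventually_elim simp
qed

text \<open>The operator copies coefficients from one basis to the other. Bessel and synthesis give
  existence of the image, completeness its uniqueness and hence linearity, Parseval the inner
  products. The last conclusion is all that is known about the operator later, and it suffices to
  identify \<open>fourier\<close> and \<open>V_op\<close>.\<close>

theorem onb_unitary:
  assumes \<phi>: "onb M \<phi>" and \<psi>: "onb N \<psi>"
  obtains T where "T \<in> extensional (L2 M)" "L2_unitary M N T"
    "\<And>F n. F \<in> L2 M \<Longrightarrow> ip N (rep (T F)) (\<psi> n) = ip M (rep F) (\<phi> n)"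
proof -
  note on = onb_on[OF \<phi>] and on' = onb_on[OF \<psi>]
  \<comment> \<open>Stated for arbitrary measures and bases, because surjectivity applies it in the
    opposite direction.\<close>
  have ex: "\<exists>G. G \<in> L2 N' \<and> (\<forall>n. ip N' (rep G) (\<psi>' n) = ip M' (rep F) (\<phi>' n))"
    if F: "F \<in> L2 M'" and on: "orthonormal_seq M' \<phi>'" and on': "orthonormal_seq N' \<psi>'"
    for F :: "('c \<Rightarrow> complex) set" and \<phi>' M' and N' :: "'d measure" and \<psi>'
  proof -
    obtain g where g: "square_integrable N' g" "\<And>n. ip N' g (\<psi>' n) = ip M' (rep F) (\<phi>' n)"
      by (rule orthonormal_synthesis[OF on' Bessel_summable[OF on L2_rep(1)[OF F]]]) (rule that)
    have "ip N' (rep (ae_class N' g)) (\<psi>' n) = ip M' (rep F) (\<phi>' n)" for n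
      by (subst ip_rep_ae_class) (auto simp: g on_sqi[OF on'] sqi_measurable)
    thus ?thesis using ae_class_in_L2[OF g(1)] by blast
  qed
  \<comment> \<open>\<open>restrict\<close> fixes the values off \<open>L2 M\<close>, as the
    description of \<open>fourier\<close> demands extensionality.\<close>
  define T where "T = restrict (\<lambda>F. SOME G. G \<in> L2 N \<and> (\<forall>n. ip N (rep G) (\<psi> n) = ip M (rep F) (\<phi> n))) (L2 M)"
  have T: "T F \<in> L2 N" "\<And>n. ip N (rep (T F)) (\<psi> n) = ip M (rep F) (\<phi> n)" if "F \<in> L2 M" for F
    using someI_ex[OF ex[OF that on on']] that by (auto simp: T_def)
  have uniq: "G = H" if "G \<in> L2 N" "H \<in> L2 N" "\<And>n. ip N (rep G) (\<psi> n) = ip N (rep H) (\<psi> n)" for G H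
    by (intro L2_eqI[OF that(1,2)] onb_complete[OF \<psi> L2_rep(1) L2_rep(1)] that)
  have inner: "L2_inner N (T F) (T G) = L2_inner M F G" if "F \<in> L2 M" "G \<in> L2 M" for F G
    using Parseval[OF \<psi> L2_rep(1)[OF T(1)[OF that(1)]] L2_rep(1)[OF T(1)[OF that(2)]]]
      Parseval[OF \<phi> L2_rep(1)[OF that(1)] L2_rep(1)[OF that(2)]]
    by (simp add: T(2) that L2_inner_ip sums_unique2)
  have "bij_betw T (L2 M) (L2 N)"
  proof (intro bij_betw_imageI inj_onI)
    fix F G assume FG: "F \<in> L2 M" "G \<in> L2 M" "T F = T G"
    show "F = G"
    proof (rule L2_eqI[OF FG(1,2)], rule onb_complete[OF \<phi>])
      show "ip M (rep F) (\<phi> n) = ip M (rep G) (\<phi> n)" for n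
        using T(2)[OF FG(1), of n] T(2)[OF FG(2), of n] FG(3) by simp
    qed (intro L2_rep FG)+
  next
    show "T ` L2 M = L2 N"
    proof (intro equalityI subsetI)
      fix G assume G: "G \<in> L2 N"
      obtain F where F: "F \<in> L2 M" "\<And>n. ip M (rep F) (\<phi> n) = ip N (rep G) (\<psi> n)"
        using ex[OF G on' on] by auto
      have "T F = G" by (intro uniq T G) (simp_all add: T(2) F)
      thus "G \<in> T ` L2 M" using F by auto
    qed (use T in auto)
  qed
  moreover have "T (L2_lincomb M a F b G) = L2_lincomb N a (T F) b (T G)"
    if "F \<in> L2 M" "G \<in> L2 M" for F G a b
    by (intro uniq T L2_lincomb_in that)
      (simp add: T that L2_lincomb_in ip_rep_L2_lincomb on_sqi[OF on] on_sqi[OF on'])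
  ultimately have "L2_unitary M N T"
    unfolding L2_unitary_def using inner by blast
  moreover have "T \<in> extensional (L2 M)" by (simp add: T_def)
  ultimately show ?thesis using that T(2) by blast
qed

text \<open>Extension by zero is not onto, so unitarity is lost along the chain; linearity together
  with preservation of the norm is what survives composition.\<close>

definition L2_isometry :: "'a measure \<Rightarrow> 'b measure \<Rightarrow>
    (('a \<Rightarrow> complex) set \<Rightarrow> ('b \<Rightarrow> complex) set) \<Rightarrow> bool" where
  "L2_isometry M N T \<longleftrightarrow>
     (\<forall>F\<in>L2 M. T F \<in> L2 N \<and> L2_norm N (T F) = L2_norm M F) \<and>
     (\<forall>F\<in>L2 M. \<forall>G\<in>L2 M. \<forall>a b. T (L2_lincomb M a F b G) = L2_lincomb N a (T F) b (T G))"

lemma L2_unitary_isometry: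
  assumes "L2_unitary M N T"
  shows "L2_isometry M N T"
proof -
  have "T F \<in> L2 N" "L2_inner N (T F) (T F) = L2_inner M F F" if "F \<in> L2 M" for F
    using assms that by (auto simp: L2_unitary_def bij_betw_def)
  thus ?thesis
    using assms by (auto simp: L2_isometry_def L2_unitary_def L2_inner_ip L2_norm_nsq ip_self)
qed

lemma L2_unitary_inv_isometry:
  assumes T: "L2_unitary M N T"
  shows "L2_isometry N M (inv_into (L2 M) T)"
proof -
  let ?I = "inv_into (L2 M) T"
  have b: "bij_betw T (L2 M) (L2 N)" using T by (simp add: L2_unitary_def)
  have I: "?I G \<in> L2 M" "T (?I G) = G" if "G \<in> L2 N" for G
    using b that by (auto simp: bij_betw_def inv_into_into f_inv_into_f)
  have IT: "?I (T F) = F" if "F \<in> L2 M" for F using b that by (simp add: bij_betw_def)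
  have "L2_norm M (?I G) = L2_norm N G" if "G \<in> L2 N" for G
    using L2_unitary_isometry[OF T] I[OF that] by (metis L2_isometry_def)
  moreover have "?I (L2_lincomb N a F b G) = L2_lincomb M a (?I F) b (?I G)"
    if "F \<in> L2 N" "G \<in> L2 N" for F G a b
  proof -
    have "T (L2_lincomb M a (?I F) b (?I G)) = L2_lincomb N a F b G"
      using T I[OF that(1)] I[OF that(2)] by (simp add: L2_unitary_def)
    thus ?thesis using IT[OF L2_lincomb_in[OF I(1)[OF that(1)] I(1)[OF that(2)]]] by metis
  qed
  ultimately show ?thesis using I by (simp add: L2_isometry_def)
qed

lemma L2_isometry_compose:
  assumes "L2_isometry M N S" "L2_isometry N K T"
  shows "L2_isometry M K (\<lambda>F. T (S F))"
  using assms by (simp add: L2_isometry_def)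

lemma L2_isometry_diff_norm:
  assumes "L2_isometry M N T" "F \<in> L2 M" "G \<in> L2 M"
  shows "L2_norm N (L2_diff N (T F) (T G)) = L2_norm M (L2_diff M F G)"
  using assms L2_lincomb_in[OF assms(2,3), of 1 "-1"] unfolding L2_isometry_def by metis

lemma L2_isometry_inj:
  assumes T: "L2_isometry M N T" and F: "F \<in> L2 M" and G: "G \<in> L2 M" and eq: "T F = T G"
  shows "F = G"
proof (rule L2_norm_diff_eq_0[OF F G])
  have TG: "T G \<in> L2 N" using T G by (simp add: L2_isometry_def)
  have "L2_norm M (L2_diff M F G) = L2_norm N (L2_diff N (T G) (T G))"
    using L2_isometry_diff_norm[OF T F G] eq by simp
  also have "\<dots> = 0" by (simp add: L2_norm_nsq nsq_rep_L2_diff[OF TG TG]) (simp add: nsq_def)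
  finally show "L2_norm M (L2_diff M F G) = 0" .
qed

section \<open>Uniqueness theorems\<close>

text \<open>Dominated convergence for the partial sums, with one majorant for the sums of absolute
  values. Every later exchange of a generating function with an integral goes through this
  form.\<close>

lemma sums_integral_dominated:
  fixes f :: "nat \<Rightarrow> 'a \<Rightarrow> complex"
  assumes f [measurable]: "\<And>k. f k \<in> borel_measurable M" and g [measurable]: "g \<in> borel_measurable M"
    and sums: "AE x in M. (\<lambda>k. f k x) sums g x"
    and B: "integrable M B" "AE x in M. \<forall>n. (\<Sum>k<n. norm (f k x)) \<le> B x"
  shows "integrable M g" "\<And>k. integrable M (f k)" "(\<lambda>k. LINT x|M. f k x) sums (LINT x|M. g x)"
proof -
  have B': "AE x in M. norm (\<Sum>k<n. f k x) \<le> B x" for n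
    using B(2)
  proof eventually_elim
    fix x assume "\<forall>n. (\<Sum>k<n. norm (f k x)) \<le> B x"
    thus "norm (\<Sum>k<n. f k x) \<le> B x" using norm_sum[of "\<lambda>k. f k x" "{..<n}"] order_trans by blast
  qed
  have int: "integrable M (f k)" for k
  proof (rule Bochner_Integration.integrable_bound[OF B(1)])
    show "AE x in M. norm (f k x) \<le> norm (B x)" using B(2)
    proof eventually_elim
      fix x assume b: "\<forall>n. (\<Sum>k<n. norm (f k x)) \<le> B x"
      have "norm (f k x) \<le> (\<Sum>k<Suc k. norm (f k x))" by (simp add: sum_nonneg)
      also have "\<dots> \<le> B x" using b by blast
      finally show "norm (f k x) \<le> norm (B x)" by simp
    qed
  qed simp
  have lim: "AE x in M. (\<lambda>n. \<Sum>k<n. f k x) \<longlonglongrightarrow> g x" using sums by (simp add: sums_def)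
  have m: "(\<lambda>x. \<Sum>k<n. f k x) \<in> borel_measurable M" for n by measurable
  show "integrable M g" by (rule integrable_dominated_convergence[OF g m B(1) lim B'])
  have "(\<lambda>n. LINT x|M. (\<Sum>k<n. f k x)) \<longlonglongrightarrow> (LINT x|M. g x)"
    by (rule integral_dominated_convergence[OF g m B(1) lim B'])
  thus "(\<lambda>k. LINT x|M. f k x) sums (LINT x|M. g x)"
    by (simp add: sums_def int)
  show "integrable M (f k)" for k by (rule int)
qed

text \<open>Positive and negative part of \<open>G\<close>, normalised to probability densities,
  give \<open>\<phi>\<close> the same characteristic function, hence by Levy's theorem the same
  distribution. The left inverse \<open>\<psi>\<close> carries this equality back to
  \<open>M\<close>, where the two densities must agree a.e.\<close>

lemma real_char_unique:
  fixes G :: "'a \<Rightarrow> real" and \<phi> :: "'a \<Rightarrow> real"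
  assumes G: "integrable M G" and \<phi> [measurable]: "\<phi> \<in> borel_measurable M"
    and \<psi> [measurable]: "\<psi> \<in> measurable borel M" and inv: "\<And>x. x \<in> space M \<Longrightarrow> \<psi> (\<phi> x) = x"
    and zero: "\<And>\<xi>. (LINT x|M. of_real (G x) * iexp (\<xi> * \<phi> x)) = 0"
  shows "AE x in M. G x = 0"
proof -
  have [measurable]: "G \<in> borel_measurable M" using G by simp
  define P where "P s x = max 0 (s * G x)" for s x
  have P_int: "integrable M (P s)" for s unfolding P_def using G by (intro integrable_max) auto
  have P_nn: "P s x \<ge> 0" for s x by (simp add: P_def)
  have [measurable]: "P s \<in> borel_measurable M" for s using P_int by simp
  have GP: "G x = P 1 x - P (-1) x" for x by (auto simp: P_def)
  define c where "c = (LINT x|M. P 1 x)"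
  \<comment> \<open>Frequency 0 shows that both parts have the same mass \<open>c\<close>, so one
    normalisation serves both.\<close>
  have "(LINT x|M. of_real (G x)) = (0::complex)" using zero[of 0] by simp
  hence "(LINT x|M. G x) = 0" by simp
  hence c': "(LINT x|M. P (-1) x) = c" unfolding GP using P_int by (simp add: c_def)
  show ?thesis
  proof (cases "c = 0")
    case True
    have "AE x in M. P s x = 0" if "s \<in> {1, -1}" for s
    proof (subst integral_nonneg_eq_0_iff_AE[symmetric])
      show "(LINT x|M. P s x) = 0" using that True c' c_def by auto
    qed (use P_nn P_int in auto)
    from this[of 1] this[of "-1"] have "AE x in M. P 1 x = 0" "AE x in M. P (-1) x = 0" by auto
    thus ?thesis by eventually_elim (simp add: GP)
  next
    case False
    have c: "c > 0"
      using False by (metis c_def P_nn integral_nonneg_AE AE_I2 less_eq_real_def)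
    have cs: "(LINT x|M. P s x) = c" if "s \<in> {1, -1}" for s using that c' c_def by auto
    define N where "N s = density M (\<lambda>x. ennreal (P s x / c))" for s
    have [measurable_cong]: "sets (N s) = sets M" for s by (simp add: N_def)
    have spN: "space (N s) = space M" for s by (simp add: N_def)
    have N: "prob_space (N s)" if s: "s \<in> {1, -1}" for s
    proof
      have "emeasure (N s) (space (N s)) = (\<integral>\<^sup>+x. ennreal (P s x / c) \<partial>M)"
        by (simp add: N_def emeasure_density nn_integral_set_ennreal[symmetric] cong: nn_integral_cong)
      also have "\<dots> = ennreal (LINT x|M. P s x / c)"
        using P_nn c P_int by (intro nn_integral_eq_integral) auto
      also have "\<dots> = 1" using cs[OF s] c by simp
      finally show "emeasure (N s) (space (N s)) = 1" .
    qed
    have charN: "char (distr (N s) borel \<phi>) t = of_real (1 / c) * (LINT x|M. of_real (P s x) * iexp (t * \<phi> x))"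
      for s t
    proof -
      have "char (distr (N s) borel \<phi>) t = (LINT x|N s. iexp (t * \<phi> x))"
        unfolding char_def by (subst integral_distr) auto
      also have "\<dots> = (LINT x|M. (P s x / c) *\<^sub>R iexp (t * \<phi> x))"
        unfolding N_def using P_nn c by (subst integral_density) auto
      also have "\<dots> = (LINT x|M. of_real (1 / c) * (of_real (P s x) * iexp (t * \<phi> x)))"
        by (simp add: scaleR_conv_of_real)
      finally show ?thesis by simp
    qed
    have int: "integrable M (\<lambda>x. of_real (P s x) * iexp (t * \<phi> x))" for s t
      using P_int[of s] by (intro Bochner_Integration.integrable_bound[OF P_int[of s]]) (auto simp: norm_mult)
    have "(LINT x|M. of_real (P 1 x) * iexp (t * \<phi> x)) = (LINT x|M. of_real (P (-1) x) * iexp (t * \<phi> x))" for t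
      using zero[of t] int[of 1 t] int[of "-1" t] unfolding GP by (simp add: left_diff_distrib)
    hence "char (distr (N 1) borel \<phi>) = char (distr (N (-1)) borel \<phi>)" by (intro ext) (simp add: charN)
    hence eq: "distr (N 1) borel \<phi> = distr (N (-1)) borel \<phi>"
      by (intro Levy_uniqueness prob_space.real_distribution_distr N) auto
    \<comment> \<open>Pushing forward along \<open>\<phi>\<close> and then along
      \<open>\<psi>\<close> restores the measure, so nothing is lost by passing to the real
      line.\<close>
    have id: "distr (distr (N s) borel \<phi>) M \<psi> = N s" for s
    proof -
      have "distr (distr (N s) borel \<phi>) M \<psi> = distr (N s) M (\<psi> \<circ> \<phi>)" by (subst distr_distr) auto
      also have "\<dots> = distr (N s) M (\<lambda>x. x)" by (intro distr_cong) (auto simp: spN inv)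
      finally show ?thesis by (simp add: distr_id2 N_def)
    qed
    have "N 1 = N (-1)" using eq id by metis
    hence "AE x in M. ennreal (P 1 x / c) = ennreal (P (-1) x / c)"
    proof (subst (asm) N_def, subst (asm) N_def, subst (asm) finite_density_unique)
      have "(\<integral>\<^sup>+x. ennreal (P 1 x / c) \<partial>M) = ennreal (LINT x|M. P 1 x / c)"
        using P_nn c P_int by (intro nn_integral_eq_integral) auto
      thus "(\<integral>\<^sup>+x. ennreal (P 1 x / c) \<partial>M) \<noteq> \<infinity>" by simp
    qed auto
    thus ?thesis
    proof eventually_elim
      fix x assume "ennreal (P 1 x / c) = ennreal (P (-1) x / c)"
      thus "G x = 0" using c P_nn[of 1 x] P_nn[of "-1" x] by (simp add: GP divide_simps)
    qed
  qed
qed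

text \<open>The transform of the conjugate at xi is the conjugate of the transform at -xi. Hence the
  transforms of real and imaginary part vanish as well, and the real case applies to each.\<close>

lemma integrable_char_unique:
  fixes F :: "'a \<Rightarrow> complex" and \<phi> :: "'a \<Rightarrow> real"
  assumes F: "integrable M F" and \<phi> [measurable]: "\<phi> \<in> borel_measurable M"
    and \<psi>: "\<psi> \<in> measurable borel M" "\<And>x. x \<in> space M \<Longrightarrow> \<psi> (\<phi> x) = x"
    and zero: "\<And>\<xi>. (LINT x|M. F x * iexp (\<xi> * \<phi> x)) = 0"
  shows "AE x in M. F x = 0"
proof -
  have [measurable]: "F \<in> borel_measurable M" using F by simp
  have int: "integrable M (\<lambda>x. F x * iexp (t * \<phi> x))" for t
    by (intro Bochner_Integration.integrable_bound[OF F]) (auto simp: norm_mult)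
  have int': "integrable M (\<lambda>x. cnj (F x) * iexp (t * \<phi> x))" for t
    by (intro Bochner_Integration.integrable_bound[OF F]) (auto simp: norm_mult)
  have zero': "(LINT x|M. cnj (F x) * iexp (\<xi> * \<phi> x)) = 0" for \<xi>
  proof -
    have "(LINT x|M. cnj (F x) * iexp (\<xi> * \<phi> x)) = (LINT x|M. cnj (F x * iexp ((-\<xi>) * \<phi> x)))"
      by (simp add: exp_cnj)
    also have "\<dots> = 0" by (subst Bochner_Integration.integral_cnj) (simp add: zero[of "-\<xi>", simplified])
    finally show ?thesis .
  qed
  have "AE x in M. Re (F x) = 0"
  proof (rule real_char_unique[OF _ \<phi> \<psi>])
    fix \<xi>
    have "(LINT x|M. of_real (Re (F x)) * iexp (\<xi> * \<phi> x))
        = (LINT x|M. (1/2) * (F x * iexp (\<xi> * \<phi> x) + cnj (F x) * iexp (\<xi> * \<phi> x)))"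
      by (intro Bochner_Integration.integral_cong refl) (simp flip: distrib_right add: complex_add_cnj)
    also have "\<dots> = 0"
      unfolding integral_mult_right_zero using int int' zero zero'
      by (subst Bochner_Integration.integral_add) auto
    finally show "(LINT x|M. of_real (Re (F x)) * iexp (\<xi> * \<phi> x)) = 0" .
  qed (use F in auto)
  moreover have "AE x in M. Im (F x) = 0"
  proof (rule real_char_unique[OF _ \<phi> \<psi>])
    fix \<xi>
    have "(LINT x|M. of_real (Im (F x)) * iexp (\<xi> * \<phi> x))
        = (LINT x|M. (1/(2*\<i>)) * (F x * iexp (\<xi> * \<phi> x) - cnj (F x) * iexp (\<xi> * \<phi> x)))"
      by (intro Bochner_Integration.integral_cong refl)
        (simp flip: left_diff_distrib add: complex_diff_cnj complex_eq_iff)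
    also have "\<dots> = 0"
      unfolding integral_mult_right_zero using int int' zero zero'
      by (subst Bochner_Integration.integral_diff) auto
    finally show "(LINT x|M. of_real (Im (F x)) * iexp (\<xi> * \<phi> x)) = 0" .
  qed (use F in auto)
  ultimately show ?thesis by eventually_elim (simp add: complex_eq_iff)
qed

section \<open>Moments of functions with exponential decay\<close>

lemma sum_pow_div_fact_le_exp:
  fixes y :: real
  assumes "y \<ge> 0"
  shows "(\<Sum>k<n. y ^ k / fact k) \<le> exp y"
proof -
  have s: "(\<lambda>k. y ^ k / fact k) sums exp y"
    using exp_converges[of y] by (simp add: field_simps)
  have "(\<Sum>k<n. y ^ k / fact k) \<le> (\<Sum>k. y ^ k / fact k)"
    using s assms by (intro sum_le_suminf) (auto simp: sums_iff)
  thus ?thesis using s by (simp add: sums_iff)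
qed

lemma pow_le_fact_exp:
  fixes y :: real
  assumes "y \<ge> 0"
  shows "y ^ n \<le> fact n * exp y"
proof -
  have "y ^ n / fact n \<le> (\<Sum>k<Suc n. y ^ k / fact k)" using assms by (simp add: sum_nonneg)
  also have "\<dots> \<le> exp y" by (rule sum_pow_div_fact_le_exp[OF assms])
  finally show ?thesis by (simp add: field_simps)
qed

text \<open>The transform is analytic on a strip of width \<open>\<epsilon>\<close>, so vanishing of all derivatives at one
  real point propagates along the real axis in steps of length \<open>\<epsilon> / 2\<close>.\<close>

lemma moments_char_zero:
  fixes F :: "'a \<Rightarrow> complex" and \<phi> :: "'a \<Rightarrow> real"
  assumes F [measurable]: "F \<in> borel_measurable M" and \<phi> [measurable]: "\<phi> \<in> borel_measurable M"
    and int: "integrable M (\<lambda>x. norm (F x) * exp (\<epsilon> * \<bar>\<phi> x\<bar>))" and \<epsilon>: "\<epsilon> > 0"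
    and mom: "\<And>n. (LINT x|M. F x * of_real (\<phi> x) ^ n) = 0"
  shows "(LINT x|M. F x * iexp (\<xi> * \<phi> x)) = 0"
proof -
  \<comment> \<open>The statement carries all powers \<open>n\<close> at once: they represent the
    derivatives at \<open>a\<close>, and the Taylor expansion of each derivative at
    \<open>a + \<eta>\<close> needs those of higher order.\<close>
  have step: "(LINT x|M. F x * of_real (\<phi> x) ^ n * iexp ((a + \<eta>) * \<phi> x)) = 0"
    if \<eta>: "\<bar>\<eta>\<bar> \<le> \<epsilon> / 2" and a: "\<And>n. (LINT x|M. F x * of_real (\<phi> x) ^ n * iexp (a * \<phi> x)) = 0" for n a \<eta>
  proof -
    define f where "f k x = F x * of_real (\<phi> x) ^ n * iexp (a * \<phi> x) *
      ((\<i> * of_real (\<eta> * \<phi> x)) ^ k /\<^sub>R fact k)" for k x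
    \<comment> \<open>The decay rate \<open>\<epsilon>\<close> is split in halves: one half absorbs
      the power of order \<open>n\<close>, at the cost of this constant, the other half absorbs the
      exponential series in \<open>\<eta>\<close>.\<close>
    define C where "C = fact n * (2/\<epsilon>) ^ n"
    have "(\<lambda>k. LINT x|M. f k x) sums (LINT x|M. F x * of_real (\<phi> x) ^ n * iexp ((a + \<eta>) * \<phi> x))"
    proof (rule sums_integral_dominated(3))
      show "f k \<in> borel_measurable M" for k unfolding f_def by measurable
      show "(\<lambda>x. F x * of_real (\<phi> x) ^ n * iexp ((a + \<eta>) * \<phi> x)) \<in> borel_measurable M" by measurable
      show "AE x in M. (\<lambda>k. f k x) sums (F x * of_real (\<phi> x) ^ n * iexp ((a + \<eta>) * \<phi> x))"
      proof (intro AE_I2)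
        fix x
        have "iexp ((a + \<eta>) * \<phi> x) = iexp (a * \<phi> x) * exp (\<i> * of_real (\<eta> * \<phi> x))"
          by (simp add: exp_add[symmetric] algebra_simps)
        hence "F x * of_real (\<phi> x) ^ n * iexp ((a + \<eta>) * \<phi> x)
            = F x * of_real (\<phi> x) ^ n * iexp (a * \<phi> x) * exp (\<i> * of_real (\<eta> * \<phi> x))"
          by (simp only: mult.assoc)
        thus "(\<lambda>k. f k x) sums (F x * of_real (\<phi> x) ^ n * iexp ((a + \<eta>) * \<phi> x))"
          unfolding f_def using sums_mult[OF exp_converges[of "\<i> * of_real (\<eta> * \<phi> x)"],
              of "F x * of_real (\<phi> x) ^ n * iexp (a * \<phi> x)"] by (simp only:)
      qed
      show "integrable M (\<lambda>x. C * (norm (F x) * exp (\<epsilon> * \<bar>\<phi> x\<bar>)))" using int by simp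
      show "AE x in M. \<forall>m. (\<Sum>k<m. norm (f k x)) \<le> C * (norm (F x) * exp (\<epsilon> * \<bar>\<phi> x\<bar>))"
      proof (intro AE_I2 allI)
        fix x m
        let ?y = "\<bar>\<phi> x\<bar>"
        have "(\<Sum>k<m. norm (f k x)) = norm (F x) * ?y ^ n * (\<Sum>k<m. (\<bar>\<eta>\<bar> * ?y) ^ k / fact k)"
          by (simp add: f_def norm_mult norm_power sum_distrib_left abs_mult divide_inverse mult_ac)
        also have "\<dots> \<le> norm (F x) * (C * exp (\<epsilon>/2 * ?y)) * exp (\<epsilon>/2 * ?y)"
        proof (intro mult_mono)
          have "(\<epsilon>/2 * ?y) ^ n \<le> fact n * exp (\<epsilon>/2 * ?y)" using \<epsilon> by (intro pow_le_fact_exp) auto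
          thus "?y ^ n \<le> C * exp (\<epsilon>/2 * ?y)"
            using \<epsilon> by (simp add: C_def power_mult_distrib power_divide field_simps)
          have "(\<Sum>k<m. (\<bar>\<eta>\<bar> * ?y) ^ k / fact k) \<le> exp (\<bar>\<eta>\<bar> * ?y)"
            by (intro sum_pow_div_fact_le_exp) auto
          also have "\<dots> \<le> exp (\<epsilon>/2 * ?y)" using mult_right_mono[OF \<eta>, of ?y] by simp
          finally show "(\<Sum>k<m. (\<bar>\<eta>\<bar> * ?y) ^ k / fact k) \<le> exp (\<epsilon>/2 * ?y)" .
        qed (use \<epsilon> in \<open>auto intro!: sum_nonneg simp: C_def\<close>)
        also have "\<dots> = C * (norm (F x) * exp (\<epsilon> * ?y))"
          by (simp add: exp_add[symmetric])
        finally show "(\<Sum>k<m. norm (f k x)) \<le> C * (norm (F x) * exp (\<epsilon> * ?y))" .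
      qed
    qed
    moreover have "(LINT x|M. f k x) = 0" for k
    proof -
      have "f k x = (\<i> * of_real \<eta>) ^ k /\<^sub>R fact k * (F x * of_real (\<phi> x) ^ (n + k) * iexp (a * \<phi> x))" for x
        by (simp add: f_def power_mult_distrib power_add scaleR_conv_of_real)
      thus ?thesis using a[of "n + k"] by simp
    qed
    ultimately show ?thesis by (simp add: sums_iff)
  qed
  \<comment> \<open>Enough steps to reach \<open>\<xi>\<close> with step length at most
    \<open>\<epsilon> / 2\<close>; passing to \<open>Suc N0\<close> keeps the divisor positive even
    for \<open>\<xi> = 0\<close>.\<close>
  obtain N0 :: nat where N0: "\<bar>\<xi>\<bar> / (\<epsilon>/2) \<le> real N0" using real_arch_simple by blast
  define N where "N = Suc N0"
  have N: "N > 0" "\<bar>\<xi>\<bar> / (\<epsilon>/2) \<le> real N" unfolding N_def of_nat_Suc using N0 by (simp, linarith)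
  define \<eta> where "\<eta> = \<xi> / real N"
  have \<eta>: "\<bar>\<eta>\<bar> \<le> \<epsilon>/2" 
  proof -
    have "\<bar>\<xi>\<bar> \<le> real N * (\<epsilon>/2)" using N(2) \<epsilon> by (subst (asm) pos_divide_le_eq) auto
    moreover have "\<bar>\<eta>\<bar> = \<bar>\<xi>\<bar> / real N" by (simp add: \<eta>_def)
    ultimately show ?thesis using N(1) by (simp add: pos_divide_le_eq mult.commute)
  qed
  have all: "\<forall>n. (LINT x|M. F x * of_real (\<phi> x) ^ n * iexp (real j * \<eta> * \<phi> x)) = 0" for j
  proof (induction j)
    case 0
    thus ?case using mom by simp
  next
    case (Suc j)
    have e: "real (Suc j) * \<eta> = real j * \<eta> + \<eta>" by (simp add: distrib_right)
    show ?case unfolding e by (rule allI, rule step[OF \<eta> Suc.IH[rule_format]])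
  qed
  have e: "real N * \<eta> = \<xi>" using N(1) by (simp add: \<eta>_def)
  have "(LINT x|M. F x * of_real (\<phi> x) ^ 0 * iexp (real N * \<eta> * \<phi> x)) = 0" by (rule all[rule_format])
  thus ?thesis unfolding e by (simp only: power_0 mult_1_right)
qed

lemma exp_bound_integrable:
  fixes F :: "'a \<Rightarrow> complex" and \<phi> :: "'a \<Rightarrow> real"
  assumes "F \<in> borel_measurable M" "integrable M (\<lambda>x. norm (F x) * exp (\<epsilon> * \<bar>\<phi> x\<bar>))" "\<epsilon> > 0"
  shows "integrable M F"
proof (rule Bochner_Integration.integrable_bound[OF assms(2) assms(1)], rule AE_I2)
  fix x
  have "norm (F x) * 1 \<le> norm (F x) * exp (\<epsilon> * \<bar>\<phi> x\<bar>)" using assms(3) by (intro mult_left_mono) auto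
  thus "norm (F x) \<le> norm (norm (F x) * exp (\<epsilon> * \<bar>\<phi> x\<bar>))" by simp
qed

theorem moments_unique:
  fixes F :: "'a \<Rightarrow> complex" and \<phi> :: "'a \<Rightarrow> real"
  assumes "F \<in> borel_measurable M" "\<phi> \<in> borel_measurable M"
    and "\<psi> \<in> measurable borel M" "\<And>x. x \<in> space M \<Longrightarrow> \<psi> (\<phi> x) = x"
    and "integrable M (\<lambda>x. norm (F x) * exp (\<epsilon> * \<bar>\<phi> x\<bar>))" "\<epsilon> > 0"
    and "\<And>n. (LINT x|M. F x * of_real (\<phi> x) ^ n) = 0"
  shows "AE x in M. F x = 0"
  by (rule integrable_char_unique[OF exp_bound_integrable[OF assms(1,5,6)] assms(2,3,4)
        moments_char_zero[OF assms(1,2,5,6,7)]])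

subsection \<open>Trigonometric moments\<close>

text \<open>Multiplying by an absolutely convergent power series in \<open>\<zeta>\<close> expresses
  each new trigonometric moment as a series in the old ones. So equality of all moments of two
  functions passes on to such products, and the step can be repeated with the conjugate of
  \<open>\<zeta>\<close>.\<close>

lemma trig_moment_step:
  fixes F \<zeta> :: "'a \<Rightarrow> complex" and F' \<zeta>' :: "'b \<Rightarrow> complex"
  assumes F: "integrable M F" and \<zeta> [measurable]: "\<zeta> \<in> borel_measurable M" and n: "\<And>x. x \<in> space M \<Longrightarrow> cmod (\<zeta> x) = 1"
    and a: "summable (\<lambda>k. cmod (a k))"
  shows "integrable M (\<lambda>x. F x * (\<Sum>k. a k * \<zeta> x ^ k))"
    "(\<lambda>k. a k * (LINT x|M. F x * \<zeta> x powi (m + int k))) sums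
        (LINT x|M. F x * (\<Sum>k. a k * \<zeta> x ^ k) * \<zeta> x powi m)"
proof -
  have [measurable]: "F \<in> borel_measurable M" using F by simp
  have pw [measurable]: "(\<lambda>x. \<zeta> x powi i) \<in> borel_measurable M" for i
    unfolding power_int_def by measurable
  have main: "integrable M (\<lambda>x. F x * (\<Sum>k. a k * \<zeta> x ^ k) * \<zeta> x powi m)"
    "(\<lambda>k. LINT x|M. F x * (a k * \<zeta> x ^ k) * \<zeta> x powi m) sums
        (LINT x|M. F x * (\<Sum>k. a k * \<zeta> x ^ k) * \<zeta> x powi m)" for m
  proof -
    have s: "AE x in M. (\<lambda>k. F x * (a k * \<zeta> x ^ k) * \<zeta> x powi m) sums (F x * (\<Sum>k. a k * \<zeta> x ^ k) * \<zeta> x powi m)"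
    proof (rule AE_I2)
      fix x assume "x \<in> space M"
      hence "summable (\<lambda>k. norm (a k * \<zeta> x ^ k))" using a by (simp add: norm_mult norm_power n)
      hence "(\<lambda>k. a k * \<zeta> x ^ k) sums (\<Sum>k. a k * \<zeta> x ^ k)" by (rule summable_sums[OF summable_norm_cancel])
      thus "(\<lambda>k. F x * (a k * \<zeta> x ^ k) * \<zeta> x powi m) sums (F x * (\<Sum>k. a k * \<zeta> x ^ k) * \<zeta> x powi m)"
        by (rule sums_mult2[OF sums_mult])
    qed
    have b: "AE x in M. \<forall>N. (\<Sum>k<N. norm (F x * (a k * \<zeta> x ^ k) * \<zeta> x powi m)) \<le> norm (F x) * (\<Sum>k. cmod (a k))"
    proof (intro AE_I2 allI)
      fix x N assume x: "x \<in> space M"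
      have "(\<Sum>k<N. norm (F x * (a k * \<zeta> x ^ k) * \<zeta> x powi m)) = norm (F x) * (\<Sum>k<N. cmod (a k))"
        by (simp add: norm_mult norm_power norm_power_int n[OF x] sum_distrib_left)
      also have "\<dots> \<le> norm (F x) * (\<Sum>k. cmod (a k))"
        by (intro mult_left_mono sum_le_suminf a) auto
      finally show "(\<Sum>k<N. norm (F x * (a k * \<zeta> x ^ k) * \<zeta> x powi m)) \<le> norm (F x) * (\<Sum>k. cmod (a k))" .
    qed
    have B: "integrable M (\<lambda>x. norm (F x) * (\<Sum>k. cmod (a k)))" using F by simp
    have m1: "(\<lambda>x. F x * (a k * \<zeta> x ^ k) * \<zeta> x powi m) \<in> borel_measurable M" for k
      by (intro borel_measurable_times pw) measurable
    have m2: "(\<lambda>x. F x * (\<Sum>k. a k * \<zeta> x ^ k) * \<zeta> x powi m) \<in> borel_measurable M"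
      by (intro borel_measurable_times borel_measurable_suminf pw) measurable
    note * = sums_integral_dominated[OF m1 m2 s B b]
    show "integrable M (\<lambda>x. F x * (\<Sum>k. a k * \<zeta> x ^ k) * \<zeta> x powi m)" by (rule *(1))
    show "(\<lambda>k. LINT x|M. F x * (a k * \<zeta> x ^ k) * \<zeta> x powi m) sums
        (LINT x|M. F x * (\<Sum>k. a k * \<zeta> x ^ k) * \<zeta> x powi m)" by (rule *(3))
  qed
  show "integrable M (\<lambda>x. F x * (\<Sum>k. a k * \<zeta> x ^ k))" using main(1)[of 0] by (simp only: power_int_0_right mult_1_right)
  have e: "(LINT x|M. F x * (a k * \<zeta> x ^ k) * \<zeta> x powi m) = a k * (LINT x|M. F x * \<zeta> x powi (m + int k))" for k
  proof -
    have "(LINT x|M. F x * (a k * \<zeta> x ^ k) * \<zeta> x powi m) = (LINT x|M. a k * (F x * \<zeta> x powi (m + int k)))"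
    proof (intro Bochner_Integration.integral_cong refl)
      fix x assume "x \<in> space M"
      hence "\<zeta> x \<noteq> 0" using n[of x] by auto
      hence e: "\<zeta> x powi (m + int k) = \<zeta> x powi m * \<zeta> x ^ k" by (simp add: power_int_add)
      show "F x * (a k * \<zeta> x ^ k) * \<zeta> x powi m = a k * (F x * \<zeta> x powi (m + int k))"
        unfolding e by (simp only: mult_ac)
    qed
    thus ?thesis by (simp only: Bochner_Integration.integral_mult_right_zero)
  qed
  show "(\<lambda>k. a k * (LINT x|M. F x * \<zeta> x powi (m + int k))) sums
        (LINT x|M. F x * (\<Sum>k. a k * \<zeta> x ^ k) * \<zeta> x powi m)"
    using main(2)[of m] unfolding e .
qed

text \<open>The logarithms of \<open>w\<close> and its conjugate have equal real part, so only twice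
  the argument remains. In the right half plane the argument is an arctangent of the slope.\<close>

lemma powr_phase:
  assumes "Re w > 0"
  shows "w powr of_real \<xi> * cnj w powr of_real (- \<xi>) = iexp (\<xi> * (2 * arctan (Im w / Re w)))"
proof -
  have w: "w \<noteq> 0" "w \<notin> \<real>\<^sub>\<le>\<^sub>0" using assms by (auto simp: complex_nonpos_Reals_iff)
  have "w powr of_real \<xi> * cnj w powr of_real (- \<xi>) = exp (of_real \<xi> * (Ln w - cnj (Ln w)))"
    using w by (simp add: powr_def exp_add[symmetric] cnj_Ln algebra_simps)
  also have "Ln w - cnj (Ln w) = \<i> * of_real (2 * Im (Ln w))"
    by (simp add: complex_diff_cnj)
  also have "Im (Ln w) = arctan (Im w / Re w)"
    using arg_conv_arctan[OF assms] w by (simp add: Arg_eq_Im_Ln)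
  finally show ?thesis by (simp add: mult_ac)
qed

section \<open>The angle on the punctured unit circle\<close>

lemma cmod_1_Re: "cmod z = 1 \<Longrightarrow> Re z \<le> 1" "cmod z = 1 \<Longrightarrow> z \<noteq> 1 \<Longrightarrow> Re z < 1"
proof -
  show 1: "cmod z = 1 \<Longrightarrow> Re z \<le> 1" using complex_Re_le_cmod[of z] by simp
  assume z: "cmod z = 1" "z \<noteq> 1"
  have "Re z \<noteq> 1"
  proof
    assume "Re z = 1"
    moreover have "(Re z)\<^sup>2 + (Im z)\<^sup>2 = 1" using z(1) by (simp add: cmod_power2 [symmetric])
    ultimately have "z = 1" by (simp add: complex_eq_iff)
    thus False using z by simp
  qed
  thus "Re z < 1" using 1[OF z(1)] by simp
qed

text \<open>For \<open>z \<noteq> 1\<close> on the unit circle this is \<open>Arg (-z)\<close>, and it is continuous there.\<close>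

definition circle_angle :: "complex \<Rightarrow> real" where
  "circle_angle z = 2 * arctan (- Im z / (1 - Re z))"

lemma circle_angle_measurable [measurable]: "circle_angle \<in> borel_measurable borel"
  unfolding circle_angle_def [abs_def] by measurable

text \<open>The phases are unimodular, so \<open>norm (G x)\<close> dominates; away from the point 1
  the denominators stay nonzero in the limit and the arctangents converge.\<close>

lemma circle_angle_limit:
  fixes G \<theta> :: "'a \<Rightarrow> complex"
  assumes G: "integrable N G" and \<theta> [measurable]: "\<theta> \<in> borel_measurable N"
    and n: "\<And>x. x \<in> space N \<Longrightarrow> cmod (\<theta> x) = 1" and ne: "AE x in N. \<theta> x \<noteq> 1"
    and r_lim: "r \<longlonglongrightarrow> 1"
  shows "(\<lambda>j. LINT x|N. G x * iexp (\<xi> * (2 * arctan (- (r j * Im (\<theta> x)) / (1 - r j * Re (\<theta> x))))))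
      \<longlonglongrightarrow> (LINT x|N. G x * iexp (\<xi> * circle_angle (\<theta> x)))"
proof (rule integral_dominated_convergence[where w = "\<lambda>x. norm (G x)"])
  have [measurable]: "G \<in> borel_measurable N" using G by simp
  show "(\<lambda>x. G x * iexp (\<xi> * circle_angle (\<theta> x))) \<in> borel_measurable N" by measurable
  show "(\<lambda>x. G x * iexp (\<xi> * (2 * arctan (- (r j * Im (\<theta> x)) / (1 - r j * Re (\<theta> x)))))) \<in> borel_measurable N" for j
    by measurable
  show "AE x in N. (\<lambda>j. G x * iexp (\<xi> * (2 * arctan (- (r j * Im (\<theta> x)) / (1 - r j * Re (\<theta> x))))))
    \<longlonglongrightarrow> G x * iexp (\<xi> * circle_angle (\<theta> x))"
    using ne AE_space
  proof eventually_elim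
    fix x assume "\<theta> x \<noteq> 1" "x \<in> space N"
    hence "1 - Re (\<theta> x) \<noteq> 0" using cmod_1_Re(2)[OF n] by force
    hence "(\<lambda>j. - (r j * Im (\<theta> x)) / (1 - r j * Re (\<theta> x)))
        \<longlonglongrightarrow> - (1 * Im (\<theta> x)) / (1 - 1 * Re (\<theta> x))"
      by (intro tendsto_intros r_lim) simp
    hence l: "(\<lambda>j. - (r j * Im (\<theta> x)) / (1 - r j * Re (\<theta> x))) \<longlonglongrightarrow> - Im (\<theta> x) / (1 - Re (\<theta> x))"
      by simp
    show "(\<lambda>j. G x * iexp (\<xi> * (2 * arctan (- (r j * Im (\<theta> x)) / (1 - r j * Re (\<theta> x))))))
      \<longlonglongrightarrow> G x * iexp (\<xi> * circle_angle (\<theta> x))"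
      unfolding circle_angle_def by (intro tendsto_intros l)
  qed
qed (use G in \<open>auto simp: norm_mult\<close>)

text \<open>The function \<open>exp (i\<xi> circle_angle \<zeta>)\<close> is the boundedly convergent limit, as \<open>r\<close> tends to
  \<open>1\<close>, of the absolutely convergent Fourier series \<open>(1 - r\<zeta>)\<^sup>\<xi> (1 - r/\<zeta>)\<^sup>-\<^sup>\<xi>\<close>.\<close>

theorem trig_moments_determine:
  fixes F \<zeta> :: "'a \<Rightarrow> complex" and F' \<zeta>' :: "'b \<Rightarrow> complex"
  assumes F: "integrable M F" and \<zeta> [measurable]: "\<zeta> \<in> borel_measurable M"
    and n: "\<And>x. x \<in> space M \<Longrightarrow> cmod (\<zeta> x) = 1" and ne: "AE x in M. \<zeta> x \<noteq> 1"
    and F': "integrable M' F'" and \<zeta>' [measurable]: "\<zeta>' \<in> borel_measurable M'"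
    and n': "\<And>x. x \<in> space M' \<Longrightarrow> cmod (\<zeta>' x) = 1" and ne': "AE x in M'. \<zeta>' x \<noteq> 1"
    and mom: "\<And>m. (LINT x|M. F x * \<zeta> x powi m) = (LINT x|M'. F' x * \<zeta>' x powi m)"
  shows "(LINT x|M. F x * iexp (\<xi> * circle_angle (\<zeta> x))) = (LINT x|M'. F' x * iexp (\<xi> * circle_angle (\<zeta>' x)))"
proof -
  have cn: "cnj z powi m = z powi (- m)" if "cmod z = 1" for z :: complex and m
  proof -
    have "cnj z = inverse z" using that complex_norm_square[of z] by (simp add: inverse_unique)
    thus ?thesis by (simp add: power_int_minus power_int_inverse)
  qed
  \<comment> \<open>Coefficients of the binomial series of (1 - r z)^xi; for r < 1 they are
    absolutely summable on the unit circle.\<close>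
  define a where "a (\<xi>::real) (r::real) k = (complex_of_real \<xi> gchoose k) * (- of_real r) ^ k" for \<xi> r k
  have a: "(\<lambda>k. a \<xi> r k * z ^ k) sums (1 - of_real r * z) powr of_real \<xi>" "summable (\<lambda>k. cmod (a \<xi> r k))"
    if r: "0 < r" "r < 1" and z: "cmod z = 1" for \<xi> r z
  proof -
    have "cmod (- of_real r * z) < 1" using r z by (simp add: norm_mult)
    note g = gen_binomial_complex[OF this, of "of_real \<xi>"]
    have e: "a \<xi> r k * z ^ k = (of_real \<xi> gchoose k) * (- of_real r * z) ^ k" for k
      by (simp only: a_def power_mult_distrib mult.assoc)
    have w: "1 - of_real r * z = 1 + - of_real r * z" by simp
    show "(\<lambda>k. a \<xi> r k * z ^ k) sums (1 - of_real r * z) powr of_real \<xi>"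
      unfolding e w by (rule g)
    have "ereal (cmod (- of_real r)) < conv_radius (\<lambda>k. complex_of_real \<xi> gchoose k)"
      using r by (simp add: conv_radius_gchoose)
    from abs_summable_in_conv_radius[OF this] show "summable (\<lambda>k. cmod (a \<xi> r k))" by (simp add: a_def)
  qed
  have main: "(LINT x|M. F x * iexp (\<xi> * (2 * arctan (- (r * Im (\<zeta> x)) / (1 - r * Re (\<zeta> x))))))
      = (LINT x|M'. F' x * iexp (\<xi> * (2 * arctan (- (r * Im (\<zeta>' x)) / (1 - r * Re (\<zeta>' x))))))"
    if r: "0 < r" "r < 1" for r
  proof -
    \<comment> \<open>On the unit circle \<open>P \<xi> z\<close> is (1 - r z)^xi. Against
      \<open>P (-\<xi>)\<close> at the conjugate point the moduli cancel and only the phase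
      survives.\<close>
    define P where "P \<xi> z = (\<Sum>k. a \<xi> r k * z ^ k)" for \<xi> z
    have P: "P \<xi> z * P (-\<xi>) (cnj z) = iexp (\<xi> * (2 * arctan (- (r * Im z) / (1 - r * Re z))))"
      if z: "cmod z = 1" for z
    proof -
      define w where "w = 1 - of_real r * z"
      have 1: "P \<xi> z = w powr of_real \<xi>" "P (-\<xi>) (cnj z) = cnj w powr of_real (-\<xi>)"
        using a(1)[OF r, of z \<xi>] a(1)[OF r, of "cnj z" "-\<xi>"] z by (simp_all add: P_def w_def sums_iff)
      have "r * Re z \<le> r * 1" using r cmod_1_Re(1)[OF z] by (intro mult_left_mono) auto
      hence "r * Re z < 1" using r by linarith
      hence "Re w > 0" by (simp add: w_def)
      from powr_phase[OF this, of \<xi>] show ?thesis unfolding 1 by (simp add: w_def)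
    qed
    have s: "summable (\<lambda>k. cmod (a \<xi> r k))" for \<xi> using a(2)[OF r norm_one] .
    note st = trig_moment_step[OF F \<zeta> n s[of \<xi>]]
    note st' = trig_moment_step[OF F' \<zeta>' n' s[of \<xi>]]
    have 1: "(LINT x|M. F x * P \<xi> (\<zeta> x) * \<zeta> x powi m) = (LINT x|M'. F' x * P \<xi> (\<zeta>' x) * \<zeta>' x powi m)" for m
    proof -
      have e: "(\<lambda>k. a \<xi> r k * (LINT x|M. F x * \<zeta> x powi (m + int k)))
          = (\<lambda>k. a \<xi> r k * (LINT x|M'. F' x * \<zeta>' x powi (m + int k)))"
        by (intro ext) (simp only: mom)
      show ?thesis unfolding P_def by (rule sums_unique2[OF st(2)[of m, unfolded e] st'(2)[of m]])
    qed
    \<comment> \<open>On the unit circle, conjugation negates the exponent. Equality of all integer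
      moments is therefore symmetric, and the second factor can be attached as a series in the
      conjugate variable.\<close>
    have 2: "(LINT x|M. F x * P \<xi> (\<zeta> x) * cnj (\<zeta> x) powi m) = (LINT x|M'. F' x * P \<xi> (\<zeta>' x) * cnj (\<zeta>' x) powi m)" for m
    proof -
      have "(LINT x|M. F x * P \<xi> (\<zeta> x) * cnj (\<zeta> x) powi m) = (LINT x|M. F x * P \<xi> (\<zeta> x) * \<zeta> x powi (-m))"
        by (intro Bochner_Integration.integral_cong refl) (simp add: cn n)
      also have "\<dots> = (LINT x|M'. F' x * P \<xi> (\<zeta>' x) * \<zeta>' x powi (-m))" by (rule 1)
      also have "\<dots> = (LINT x|M'. F' x * P \<xi> (\<zeta>' x) * cnj (\<zeta>' x) powi m)"
        by (intro Bochner_Integration.integral_cong refl) (simp add: cn n')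
      finally show ?thesis .
    qed
    have c: "(\<lambda>x. cnj (\<zeta> x)) \<in> borel_measurable M" "(\<lambda>x. cnj (\<zeta>' x)) \<in> borel_measurable M'" by measurable
    have "(LINT x|M. F x * P \<xi> (\<zeta> x) * P (-\<xi>) (cnj (\<zeta> x)) * cnj (\<zeta> x) powi 0)
       = (LINT x|M'. F' x * P \<xi> (\<zeta>' x) * P (-\<xi>) (cnj (\<zeta>' x)) * cnj (\<zeta>' x) powi 0)"
    proof -
      have "cmod (cnj (\<zeta> x)) = 1" if "x \<in> space M" for x using n[OF that] by simp
      note S = trig_moment_step(2)[OF st(1) c(1) this s[of "-\<xi>"], of 0]
      have "cmod (cnj (\<zeta>' x)) = 1" if "x \<in> space M'" for x using n'[OF that] by simp
      note S' = trig_moment_step(2)[OF st'(1) c(2) this s[of "-\<xi>"], of 0]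
      have e: "(\<lambda>k. a (-\<xi>) r k * (LINT x|M. F x * (\<Sum>k. a \<xi> r k * \<zeta> x ^ k) * cnj (\<zeta> x) powi (0 + int k)))
          = (\<lambda>k. a (-\<xi>) r k * (LINT x|M'. F' x * (\<Sum>k. a \<xi> r k * \<zeta>' x ^ k) * cnj (\<zeta>' x) powi (0 + int k)))"
        by (intro ext) (simp only: 2[unfolded P_def])
      show ?thesis unfolding P_def by (rule sums_unique2[OF S[unfolded e] S'])
    qed
    hence e: "(LINT x|M. F x * (P \<xi> (\<zeta> x) * P (-\<xi>) (cnj (\<zeta> x)))) = (LINT x|M'. F' x * (P \<xi> (\<zeta>' x) * P (-\<xi>) (cnj (\<zeta>' x))))"
      by (simp add: mult.assoc)
    have e1: "(LINT x|M. F x * (P \<xi> (\<zeta> x) * P (-\<xi>) (cnj (\<zeta> x))))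
      = (LINT x|M. F x * iexp (\<xi> * (2 * arctan (- (r * Im (\<zeta> x)) / (1 - r * Re (\<zeta> x))))))"
      by (intro Bochner_Integration.integral_cong refl) (simp only: P n)
    have e2: "(LINT x|M'. F' x * (P \<xi> (\<zeta>' x) * P (-\<xi>) (cnj (\<zeta>' x))))
      = (LINT x|M'. F' x * iexp (\<xi> * (2 * arctan (- (r * Im (\<zeta>' x)) / (1 - r * Re (\<zeta>' x))))))"
      by (intro Bochner_Integration.integral_cong refl) (simp only: P n')
    show ?thesis by (rule e[unfolded e1 e2])
  qed
  define r where "r j = 1 - 1 / (real j + 2)" for j
  have r: "0 < r j" "r j < 1" for j by (simp_all add: r_def field_simps)
  have "(\<lambda>j. 1 / (real j + 2)) \<longlonglongrightarrow> 0"
    using LIMSEQ_ignore_initial_segment[OF lim_1_over_n, of 2] by (simp add: add.commute)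
  from tendsto_diff[OF tendsto_const[of 1] this] have r_lim: "r \<longlonglongrightarrow> 1" by (simp add: r_def[abs_def])
  show ?thesis
    using circle_angle_limit[OF F \<zeta> n ne r_lim, of \<xi>] circle_angle_limit[OF F' \<zeta>' n' ne' r_lim, of \<xi>]
    unfolding main[OF r] by (rule LIMSEQ_unique)
qed

section \<open>Laguerre functions on the half line\<close>

lemma space_half_line [simp]: "space half_line = {0<..}"
  by (simp add: half_line_def space_restrict_space)

lemma borel_half_line: "f \<in> borel_measurable borel \<Longrightarrow> f \<in> borel_measurable half_line"
  unfolding half_line_def by (intro measurable_restrict_space1) simp

lemma integrable_half_line: "integrable half_line f \<longleftrightarrow> integrable lborel (\<lambda>x. indicator {0<..} x *\<^sub>R f x)"
  for f :: "real \<Rightarrow> 'a::{banach, second_countable_topology}"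
  unfolding half_line_def by (rule integrable_restrict_space) simp

lemma integral_half_line: "(LINT x|half_line. f x) = (LINT x|lborel. indicator {0<..} x *\<^sub>R f x)"
  for f :: "real \<Rightarrow> 'a::{banach, second_countable_topology}"
  unfolding half_line_def by (rule integral_restrict_space) simp

lemma AE_half_line: "(AE x in half_line. P x) \<longleftrightarrow> (AE x in lborel. 0 < x \<longrightarrow> P x)"
  unfolding half_line_def by (subst AE_restrict_space_iff) auto

lemma half_line_FTC:
  fixes f F :: "real \<Rightarrow> complex"
  assumes F: "\<And>x. 0 < x \<Longrightarrow> (F has_vector_derivative f x) (at x)"
    and f: "\<And>x. 0 < x \<Longrightarrow> isCont f x" and int: "integrable half_line f"
    and A: "(F \<longlongrightarrow> A) (at_right 0)" and B: "(F \<longlongrightarrow> B) at_top"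
  shows "(LINT x|half_line. f x) = B - A"
proof -
  have "(LBINT x=ereal 0..\<infinity>. f x) = B - A"
  proof (rule interval_integral_FTC_integrable[where F = F])
    show "set_integrable lborel (einterval (ereal 0) \<infinity>) f"
      using int by (simp add: integrable_half_line set_integrable_def)
    show "((F \<circ> real_of_ereal) \<longlongrightarrow> A) (at_right (ereal 0))"
      unfolding ereal_tendsto_simps1 by (rule A)
    show "((F \<circ> real_of_ereal) \<longlongrightarrow> B) (at_left \<infinity>)"
      unfolding ereal_tendsto_simps1 by (rule B)
  qed (use F f in auto)
  thus ?thesis
    by (simp add: interval_lebesgue_integral_def integral_half_line set_lebesgue_integral_def)
qed

lemma exp_integrable_half_line:
  fixes a :: real
  assumes "a > 0"
  shows "integrable half_line (\<lambda>x. exp (- a * x))"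
proof (rule integrableI_nonneg)
  show "(\<lambda>x. exp (- a * x)) \<in> borel_measurable half_line" by (intro borel_half_line) measurable
  have "((\<lambda>x. - exp (- a * x) / a) \<longlongrightarrow> - 0 / a) at_top"
    using assms by (intro tendsto_intros filterlim_compose[OF exp_at_bot] filterlim_tendsto_neg_mult_at_bot[OF tendsto_const _ filterlim_ident]) auto
  hence lim: "((\<lambda>x. - exp (- a * x) / a) \<longlongrightarrow> 0) at_top" by simp
  have "(\<integral>\<^sup>+x. ennreal (exp (- a * x)) * indicator {0 ..} x \<partial>lborel) = 0 - (- exp (- a * 0) / a)"
    using assms by (intro nn_integral_FTC_atLeast lim) (auto intro!: derivative_eq_intros)
  moreover have "(\<integral>\<^sup>+x. ennreal (exp (- a * x)) \<partial>half_line) \<le> (\<integral>\<^sup>+x. ennreal (exp (- a * x)) * indicator {0 ..} x \<partial>lborel)"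
    unfolding half_line_def
    by (subst nn_integral_restrict_space) (auto intro!: nn_integral_mono split: split_indicator)
  ultimately show "(\<integral>\<^sup>+x. ennreal (exp (- a * x)) \<partial>half_line) < \<infinity>"
    by (simp add: le_less_trans)
qed auto

lemma pow_exp_bound:
  fixes a x :: real
  assumes "a > 0" "x \<ge> 0"
  shows "x ^ k \<le> fact k * (1 / a) ^ k * exp (a * x)"
  using pow_le_fact_exp[of "a * x" k] assms by (simp add: power_mult_distrib field_simps)

lemma exp_power_integrable:
  fixes c :: complex
  assumes c: "Re c > 0"
  shows "integrable half_line (\<lambda>x. of_real x ^ k * exp (- c * of_real x))"
proof (rule Bochner_Integration.integrable_bound)
  \<comment> \<open>Half of the decay rate pays for the power of \<open>x\<close>, the other half
    keeps the majorant integrable.\<close>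
  let ?a = "Re c / 2"
  show "integrable half_line (\<lambda>x. fact k * (1 / ?a) ^ k * exp (- ?a * x))"
    using c by (intro integrable_mult_right exp_integrable_half_line) auto
  show "(\<lambda>x. of_real x ^ k * exp (- c * of_real x)) \<in> borel_measurable half_line"
    by (intro borel_half_line) measurable
  show "AE x in half_line. norm (of_real x ^ k * exp (- c * of_real x)) \<le> norm (fact k * (1 / ?a) ^ k * exp (- ?a * x))"
  proof (rule AE_I2)
    fix x assume "x \<in> space half_line"
    hence x: "x > 0" by simp
    have "norm (of_real x ^ k * exp (- c * of_real x)) = x ^ k * exp (- Re c * x)"
      using x by (simp add: norm_mult norm_power)
    also have "\<dots> \<le> fact k * (1 / ?a) ^ k * exp (?a * x) * exp (- Re c * x)"
      using c x by (intro mult_right_mono pow_exp_bound) auto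
    also have "\<dots> = fact k * (1 / ?a) ^ k * (exp (?a * x) * exp (- Re c * x))" by simp
    also have "exp (?a * x) * exp (- Re c * x) = exp (- ?a * x)"
      unfolding exp_add[symmetric] by (simp add: field_simps)
    finally show "norm (of_real x ^ k * exp (- c * of_real x)) \<le> norm (fact k * (1 / ?a) ^ k * exp (- ?a * x))"
      by (rule order_trans) (rule abs_ge_self[of "fact k * (1 / ?a) ^ k * exp (- ?a * x)", folded real_norm_def])
  qed
qed

lemma exp_power_tendsto_0:
  fixes c :: complex
  assumes c: "Re c > 0"
  shows "((\<lambda>x. of_real x ^ k * exp (- c * of_real x)) \<longlongrightarrow> 0) at_top"
proof (rule Lim_null_comparison)
  let ?a = "Re c / 2"
  have "((\<lambda>x. fact k * (1 / ?a) ^ k * exp (- ?a * x)) \<longlongrightarrow> fact k * (1 / ?a) ^ k * 0) at_top"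
    using c by (intro tendsto_intros filterlim_compose[OF exp_at_bot] filterlim_tendsto_neg_mult_at_bot[OF tendsto_const _ filterlim_ident]) auto
  thus "((\<lambda>x. fact k * (1 / ?a) ^ k * exp (- ?a * x)) \<longlongrightarrow> 0) at_top" by simp
  show "eventually (\<lambda>x. norm (of_real x ^ k * exp (- c * of_real x)) \<le> fact k * (1 / ?a) ^ k * exp (- ?a * x)) at_top"
    using eventually_gt_at_top[of 0]
  proof eventually_elim
    fix x :: real assume x: "x > 0"
    have "norm (of_real x ^ k * exp (- c * of_real x)) = x ^ k * exp (- Re c * x)"
      using x by (simp add: norm_mult norm_power)
    also have "\<dots> \<le> fact k * (1 / ?a) ^ k * exp (?a * x) * exp (- Re c * x)"
      using c x by (intro mult_right_mono pow_exp_bound) auto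
    also have "\<dots> = fact k * (1 / ?a) ^ k * (exp (?a * x) * exp (- Re c * x))" by simp
    also have "exp (?a * x) * exp (- Re c * x) = exp (- ?a * x)"
      unfolding exp_add[symmetric] by (simp add: field_simps)
    finally show "norm (of_real x ^ k * exp (- c * of_real x)) \<le> fact k * (1 / ?a) ^ k * exp (- ?a * x)" .
  qed
qed

text \<open>For the induction step, \<open>?f\<close> is the derivative of x^(k+1) exp (- c x),
  which vanishes at both ends of the half line; its zero integral is the recursion.\<close>

lemma exp_power_integral:
  fixes c :: complex
  assumes c: "Re c > 0"
  shows "(LINT x|half_line. of_real x ^ k * exp (- c * of_real x)) = fact k / c ^ Suc k"
proof (induction k)
  case 0
  have c0: "c \<noteq> 0" using c by auto
  have "(LINT x|half_line. of_real x ^ 0 * exp (- c * of_real x)) = 0 - (- 1 / c)"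
  proof (rule half_line_FTC[where F = "\<lambda>x. - exp (- c * of_real x) / c"])
    show "((\<lambda>x. - exp (- c * of_real x) / c) has_vector_derivative of_real x ^ 0 * exp (- c * of_real x)) (at x)" for x
      using c0 by (auto intro!: derivative_eq_intros has_vector_derivative_real_field)
    show "isCont (\<lambda>x. of_real x ^ 0 * exp (- c * of_real x)) x" for x :: real by (intro continuous_intros)
    show "integrable half_line (\<lambda>x. of_real x ^ 0 * exp (- c * of_real x))" by (rule exp_power_integrable[OF c])
    have "((\<lambda>x. - exp (- c * of_real x) / c) \<longlongrightarrow> - exp (- c * of_real 0) / c) (at_right 0)"
      using c0 by (intro tendsto_intros) auto
    thus "((\<lambda>x. - exp (- c * of_real x) / c) \<longlongrightarrow> - 1 / c) (at_right 0)" by simp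
    have "((\<lambda>x. - (of_real x ^ 0 * exp (- c * of_real x)) / c) \<longlongrightarrow> - 0 / c) at_top"
      using c0 by (intro tendsto_divide tendsto_minus exp_power_tendsto_0 c tendsto_const)
    thus "((\<lambda>x. - exp (- c * of_real x) / c) \<longlongrightarrow> 0) at_top" by simp
  qed
  thus ?case by simp
next
  case (Suc k)
  have c0: "c \<noteq> 0" using c by auto
  let ?f = "\<lambda>x. of_nat (Suc k) * (of_real x ^ k * exp (- c * of_real x)) - c * (of_real x ^ Suc k * exp (- c * of_real x))"
  have "(LINT x|half_line. ?f x) = 0 - 0"
  proof (rule half_line_FTC[where F = "\<lambda>x. of_real x ^ Suc k * exp (- c * of_real x)"])
    fix x :: real
    have "((\<lambda>z. z ^ Suc k * exp (- c * z)) has_field_derivative ?f x) (at (of_real x))"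
      by (rule derivative_eq_intros refl)+ (simp add: algebra_simps)
    thus "((\<lambda>x. of_real x ^ Suc k * exp (- c * of_real x)) has_vector_derivative ?f x) (at x)"
      by (rule has_vector_derivative_real_field)
    show "isCont ?f x" by (intro continuous_intros)
  next
    show "integrable half_line ?f"
      by (intro Bochner_Integration.integrable_diff integrable_mult_right exp_power_integrable c)
    have "((\<lambda>x. of_real x ^ Suc k * exp (- c * of_real x)) \<longlongrightarrow> of_real 0 ^ Suc k * exp (- c * of_real 0)) (at_right 0)"
      by (intro tendsto_intros)
    thus "((\<lambda>x. of_real x ^ Suc k * exp (- c * of_real x)) \<longlongrightarrow> 0) (at_right 0)" by simp
    show "((\<lambda>x. of_real x ^ Suc k * exp (- c * of_real x)) \<longlongrightarrow> 0) at_top"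
      by (rule exp_power_tendsto_0[OF c])
  qed
  moreover have "(LINT x|half_line. ?f x) = of_nat (Suc k) * (LINT x|half_line. of_real x ^ k * exp (- c * of_real x))
      - c * (LINT x|half_line. of_real x ^ Suc k * exp (- c * of_real x))"
    by (subst Bochner_Integration.integral_diff)
      (simp_all only: integral_mult_right_zero integrable_mult_right exp_power_integrable c)
  ultimately have e: "c * (LINT x|half_line. of_real x ^ Suc k * exp (- c * of_real x)) = of_nat (Suc k) * (fact k / c ^ Suc k)"
    unfolding Suc.IH by simp
  have "(LINT x|half_line. of_real x ^ Suc k * exp (- c * of_real x)) = (of_nat (Suc k) * (fact k / c ^ Suc k)) / c"
    unfolding e[symmetric] using c0 by simp
  also have "\<dots> = fact (Suc k) / c ^ Suc (Suc k)" by simp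
  finally show ?case .
qed

lemma exp_power_integral_real:
  fixes a :: real
  assumes a: "a > 0"
  shows "integrable half_line (\<lambda>x. x ^ k * exp (- a * x))"
    "(LINT x|half_line. x ^ k * exp (- a * x)) = fact k / a ^ Suc k"
proof -
  have c: "Re (complex_of_real a) > 0" using a by simp
  have e: "of_real x ^ k * exp (- complex_of_real a * of_real x) = of_real (x ^ k * exp (- a * x))" for x
    by (simp add: exp_of_real [symmetric])
  have "integrable half_line (\<lambda>x. complex_of_real (x ^ k * exp (- a * x)))"
    using exp_power_integrable[OF c, of k] unfolding e .
  thus "integrable half_line (\<lambda>x. x ^ k * exp (- a * x))" by (simp only: complex_of_real_integrable_eq)
  have "complex_of_real (LINT x|half_line. x ^ k * exp (- a * x)) = fact k / complex_of_real a ^ Suc k"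
    using exp_power_integral[OF c, of k] unfolding e integral_complex_of_real .
  also have "\<dots> = of_real (fact k / a ^ Suc k)" by simp
  finally have "complex_of_real (LINT x|half_line. x ^ k * exp (- a * x)) = of_real (fact k / a ^ Suc k)" .
  thus "(LINT x|half_line. x ^ k * exp (- a * x)) = fact k / a ^ Suc k" by (simp only: of_real_eq_iff)
qed

section \<open>Laguerre polynomials and their orthogonality\<close>

lemma sum_choose_Suc:
  fixes f :: "nat \<Rightarrow> real"
  shows "(\<Sum>k\<le>Suc n. real (Suc n choose k) * f k) = (\<Sum>k\<le>n. real (n choose k) * f k) + (\<Sum>k\<le>n. real (n choose k) * f (Suc k))"
proof -
  have "(\<Sum>k\<le>Suc n. real (Suc n choose k) * f k) = f 0 + (\<Sum>k\<le>n. real (Suc n choose Suc k) * f (Suc k))"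
    by (subst sum.atMost_Suc_shift) simp
  also have "(\<Sum>k\<le>n. real (Suc n choose Suc k) * f (Suc k)) = (\<Sum>k\<le>n. real (n choose k) * f (Suc k)) + (\<Sum>k\<le>n. real (n choose Suc k) * f (Suc k))"
    by (simp add: distrib_right sum.distrib)
  also have "f 0 + ((\<Sum>k\<le>n. real (n choose k) * f (Suc k)) + (\<Sum>k\<le>n. real (n choose Suc k) * f (Suc k)))
      = (\<Sum>k\<le>Suc n. real (n choose k) * f k) + (\<Sum>k\<le>n. real (n choose k) * f (Suc k))"
    by (subst sum.atMost_Suc_shift) simp
  also have "(\<Sum>k\<le>Suc n. real (n choose k) * f k) = (\<Sum>k\<le>n. real (n choose k) * f k)" by simp
  finally show ?thesis .
qed

text \<open>Up to sign this is the n-th finite difference of the polynomial a -> (a choose i), and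
  each difference lowers \<open>i\<close> by one. The induction needs \<open>a\<close> arbitrary
  because Pascal's rule shifts it.\<close>

lemma alternating_choose_sum:
  "(\<Sum>k\<le>n. real (n choose k) * ((-1) ^ k * real ((a + k) choose i)))
     = (if n \<le> i then (-1) ^ n * real (a choose (i - n)) else 0)"
proof (induction n arbitrary: a)
  case 0
  thus ?case by simp
next
  case (Suc n)
  have "(\<Sum>k\<le>Suc n. real (Suc n choose k) * ((-1) ^ k * real ((a + k) choose i)))
      = (\<Sum>k\<le>n. real (n choose k) * ((-1) ^ k * real ((a + k) choose i)))
        - (\<Sum>k\<le>n. real (n choose k) * ((-1) ^ k * real ((Suc a + k) choose i)))"
    by (subst sum_choose_Suc) (simp add: sum_negf)
  also have "\<dots> = (if n \<le> i then (-1) ^ n * real (a choose (i - n)) else 0)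
      - (if n \<le> i then (-1) ^ n * real (Suc a choose (i - n)) else 0)"
    by (simp only: Suc.IH)
  also have "\<dots> = (if Suc n \<le> i then (-1) ^ Suc n * real (a choose (i - Suc n)) else 0)"
  proof (cases "Suc n \<le> i")
    case True
    then obtain j where "i - n = Suc j" "i - Suc n = j" by (metis Suc_diff_le diff_Suc_Suc)
    thus ?thesis using True by (simp add: algebra_simps)
  qed auto
  finally show ?case .
qed

definition laguerre :: "nat \<Rightarrow> real \<Rightarrow> real" where
  "laguerre n x = (\<Sum>k\<le>n. real (n choose k) * (-1) ^ k / fact k * x ^ k)"

text \<open>Since \<open>fact (j + k)\<close> is a moment of exp (- x), this is orthonormality of
  the Laguerre polynomials written in coefficients. The sum over \<open>k\<close> collapses to a
  binomial coefficient in \<open>j\<close>; the sum over \<open>j\<close> is then a finite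
  difference at 0, which vanishes unless the two degrees agree.\<close>

lemma laguerre_orthonormal:
  "(\<Sum>j\<le>m. \<Sum>k\<le>n. (real (m choose j) * (-1) ^ j / fact j) * (real (n choose k) * (-1) ^ k / fact k) * fact (j + k))
     = of_bool (m = n)"
proof -
  have inner: "(\<Sum>k\<le>n. (real (n choose k) * (-1) ^ k / fact k) * fact (j + k)) = fact j * (-1) ^ n * real (j choose n)" for j
  proof -
    have "(\<Sum>k\<le>n. (real (n choose k) * (-1) ^ k / fact k) * fact (j + k))
        = fact j * (\<Sum>k\<le>n. real (n choose k) * ((-1) ^ k * real ((j + k) choose j)))"
      unfolding sum_distrib_left
      by (intro sum.cong refl) (simp add: binomial_fact field_simps)
    also have "\<dots> = fact j * (-1) ^ n * real (j choose n)"
      unfolding alternating_choose_sum by (auto simp: binomial_symmetric[symmetric])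
    finally show ?thesis .
  qed
  have "(\<Sum>j\<le>m. \<Sum>k\<le>n. (real (m choose j) * (-1) ^ j / fact j) * (real (n choose k) * (-1) ^ k / fact k) * fact (j + k))
      = (\<Sum>j\<le>m. (real (m choose j) * (-1) ^ j / fact j) * (fact j * (-1) ^ n * real (j choose n)))"
    unfolding inner[symmetric] sum_distrib_left by (intro sum.cong refl) (simp only: mult.assoc)
  also have "\<dots> = (-1) ^ n * (\<Sum>j\<le>m. real (m choose j) * ((-1) ^ j * real ((0 + j) choose n)))"
    unfolding sum_distrib_left by (intro sum.cong refl) simp
  also have "\<dots> = of_bool (m = n)"
    unfolding alternating_choose_sum by (auto simp: power_add[symmetric])
  finally show ?thesis .
qed

text \<open>The classical Laguerre functions of order 0, dilated by 2 d; the factor sqrt (2 d) keeps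
  them normalised on the half line.\<close>

definition laguerre_fun :: "real \<Rightarrow> nat \<Rightarrow> real \<Rightarrow> complex" where
  "laguerre_fun d n x = of_real (sqrt (2 * d) * exp (- d * x) * laguerre n (2 * d * x))"

definition cayley_fun :: "real \<Rightarrow> nat \<Rightarrow> real \<Rightarrow> complex" where
  "cayley_fun d n y = \<i> * of_real (sqrt (d / pi)) * (of_real y - \<i> * of_real d) ^ n / (of_real y + \<i> * of_real d) ^ Suc n"

lemma laguerre_measurable [measurable]: "laguerre n \<in> borel_measurable borel"
  unfolding laguerre_def [abs_def] by measurable

lemma laguerre_fun_measurable [measurable]: "laguerre_fun d n \<in> borel_measurable borel"
  unfolding laguerre_fun_def [abs_def] by measurable

lemma cnj_laguerre_fun [simp]: "cnj (laguerre_fun d n x) = laguerre_fun d n x"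
  by (simp add: laguerre_fun_def)

context
  fixes d :: real
  assumes d: "d > 0"
begin

lemma laguerre_fun_ip:
  "integrable half_line (\<lambda>x. laguerre_fun d m x * laguerre_fun d n x)"
  "(LINT x|half_line. laguerre_fun d m x * laguerre_fun d n x) = of_bool (m = n)"
proof -
  define c where "c n k = real (n choose k) * (-1) ^ k / fact k" for n k
  have l: "laguerre n x = (\<Sum>k\<le>n. c n k * x ^ k)" for n x by (simp add: laguerre_def c_def)
  define g where "g j k x = 2 * d * (2 * d) ^ (j + k) * c m j * c n k * (x ^ (j + k) * exp (- (2 * d) * x))" for j k x
  have e: "laguerre_fun d m x * laguerre_fun d n x = of_real (\<Sum>j\<le>m. \<Sum>k\<le>n. g j k x)" for x
  proof -
    have "(\<Sum>j\<le>m. \<Sum>k\<le>n. g j k x) = 2 * d * exp (- (2 * d) * x) * ((\<Sum>j\<le>m. c m j * (2 * d * x) ^ j) * (\<Sum>k\<le>n. c n k * (2 * d * x) ^ k))"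
      unfolding sum_product unfolding sum_distrib_left g_def
      by (intro sum.cong refl) (simp add: power_mult_distrib power_add)
    also have "\<dots> = (sqrt (2 * d) * exp (- d * x) * laguerre m (2 * d * x)) * (sqrt (2 * d) * exp (- d * x) * laguerre n (2 * d * x))"
    proof -
      have e2: "exp (- d * x) * exp (- d * x) = exp (- (2 * d) * x)" unfolding exp_add[symmetric] by simp
      have s2: "sqrt (2 * d) * sqrt (2 * d) = 2 * d" using d by simp
      have gen: "(s * e * a) * (s * e * b) = (s * s) * (e * e) * (a * b)" for s e a b :: real
        by (simp only: mult_ac)
      show ?thesis unfolding l[symmetric] gen e2 s2 ..
    qed
    finally show ?thesis by (simp add: laguerre_fun_def)
  qed
  have g: "integrable half_line (g j k)" "(LINT x|half_line. g j k x) = c m j * c n k * fact (j + k)" for j k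
  proof -
    have d2: "2 * d > 0" using d by simp
    show "integrable half_line (g j k)"
      unfolding g_def [abs_def] by (intro integrable_mult_right exp_power_integral_real(1) d2)
    show "(LINT x|half_line. g j k x) = c m j * c n k * fact (j + k)"
      unfolding g_def using d by (simp add: exp_power_integral_real(2)[OF d2, of "j + k", simplified])
  qed
  have "integrable half_line (\<lambda>x. \<Sum>j\<le>m. \<Sum>k\<le>n. g j k x)"
    by (intro Bochner_Integration.integrable_sum g)
  thus "integrable half_line (\<lambda>x. laguerre_fun d m x * laguerre_fun d n x)"
    unfolding e by (simp only: complex_of_real_integrable_eq)
  have "(LINT x|half_line. (\<Sum>j\<le>m. \<Sum>k\<le>n. g j k x)) = (\<Sum>j\<le>m. \<Sum>k\<le>n. c m j * c n k * fact (j + k))"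
    by (simp add: Bochner_Integration.integral_sum Bochner_Integration.integrable_sum g)
  also have "\<dots> = of_bool (m = n)" unfolding c_def by (rule laguerre_orthonormal)
  finally have "(LINT x|half_line. (\<Sum>j\<le>m. \<Sum>k\<le>n. g j k x)) = of_bool (m = n)" .
  thus "(LINT x|half_line. laguerre_fun d m x * laguerre_fun d n x) = of_bool (m = n)"
    unfolding e integral_complex_of_real by simp
qed

lemma laguerre_fun_orthonormal: "orthonormal_seq half_line (laguerre_fun d)"
  unfolding orthonormal_seq_def
proof (intro conjI allI)
  fix n m
  have "(cmod (laguerre_fun d n x))\<^sup>2 = Re (laguerre_fun d n x * laguerre_fun d n x)" for x
    by (simp add: laguerre_fun_def power2_eq_square del: of_real_mult)
  moreover have "integrable half_line (\<lambda>x. Re (laguerre_fun d n x * laguerre_fun d n x))"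
    by (rule integrable_Re[OF laguerre_fun_ip(1)])
  ultimately show "square_integrable half_line (laguerre_fun d n)"
    unfolding square_integrable_def by (simp add: borel_half_line)
  show "ip half_line (laguerre_fun d m) (laguerre_fun d n) = of_bool (m = n)"
    unfolding ip_def by (simp add: laguerre_fun_ip)
qed

text \<open>With w = d - i y the k-th monomial contributes (n choose k) (- 2 d / w)^k / w up to a
  common factor, and the binomial theorem sums this to ((w - 2 d) / w)^n / w. Rotating by i, via i w
  = y + i d, gives the Cayley form.\<close>

lemma laguerre_fun_laplace:
  "integrable half_line (laguerre_fun d n)"
  "(LINT x|half_line. iexp (y * x) * laguerre_fun d n x) = of_real (sqrt (2 * pi)) * cayley_fun d n y"
proof -
  define c where "c k = real (n choose k) * (-1) ^ k / fact k" for k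
  define g where "g z k x = of_real (sqrt (2 * d) * c k * (2 * d) ^ k) * (of_real x ^ k * exp (- z * of_real x))" for z :: complex and k x
  have e: "iexp (y * x) * laguerre_fun d n x = (\<Sum>k\<le>n. g (of_real d - \<i> * of_real y) k x)" for x y
  proof -
    have i: "iexp (y * x) * exp (- of_real d * of_real x) = exp (- (of_real d - \<i> * of_real y) * of_real x)"
      unfolding exp_add[symmetric] by (simp add: algebra_simps)
    have L: "laguerre_fun d n x = exp (- of_real d * of_real x) * (\<Sum>k\<le>n. of_real (sqrt (2 * d) * c k * (2 * d) ^ k * x ^ k))"
      unfolding laguerre_fun_def laguerre_def c_def
      by (simp add: sum_distrib_left exp_of_real[symmetric] power_mult_distrib mult_ac)
    have "iexp (y * x) * laguerre_fun d n x
      = exp (- (of_real d - \<i> * of_real y) * of_real x) * (\<Sum>k\<le>n. of_real (sqrt (2 * d) * c k * (2 * d) ^ k * x ^ k))"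
      unfolding L i[symmetric] by (simp only: mult.assoc)
    thus ?thesis unfolding g_def by (simp add: sum_distrib_left mult_ac)
  qed
  have g: "integrable half_line (g (of_real d - \<i> * of_real y) k)"
    "(LINT x|half_line. g (of_real d - \<i> * of_real y) k x) = of_real (sqrt (2 * d) * c k * (2 * d) ^ k) * (fact k / (of_real d - \<i> * of_real y) ^ Suc k)" for y k
  proof -
    have r: "Re (of_real d - \<i> * of_real y) > 0" using d by simp
    show "integrable half_line (g (of_real d - \<i> * of_real y) k)"
      unfolding g_def [abs_def] by (intro integrable_mult_right exp_power_integrable r)
    show "(LINT x|half_line. g (of_real d - \<i> * of_real y) k x) = of_real (sqrt (2 * d) * c k * (2 * d) ^ k) * (fact k / (of_real d - \<i> * of_real y) ^ Suc k)"
      unfolding g_def integral_mult_right_zero exp_power_integral[OF r] ..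
  qed
  have "integrable half_line (\<lambda>x. iexp (0 * x) * laguerre_fun d n x)"
    unfolding e by (intro Bochner_Integration.integrable_sum g)
  thus "integrable half_line (laguerre_fun d n)" by simp
  define w where "w = of_real d - \<i> * complex_of_real y"
  have w: "w \<noteq> 0" using d by (simp add: w_def complex_eq_iff)
  have "(LINT x|half_line. iexp (y * x) * laguerre_fun d n x)
      = (\<Sum>k\<le>n. of_real (sqrt (2 * d) * c k * (2 * d) ^ k) * (fact k / w ^ Suc k))"
    unfolding e by (subst Bochner_Integration.integral_sum) (simp_all only: g w_def)
  also have "\<dots> = of_real (sqrt (2 * d)) / w * (\<Sum>k\<le>n. of_nat (n choose k) * (- of_real (2 * d) / w) ^ k * 1 ^ (n - k))"
  proof -
    have p: "(- of_real (2 * d) / w) ^ k = (-1) ^ k * of_real (2 * d) ^ k / w ^ k" for k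
      unfolding power_divide power_minus[of "of_real (2 * d)"] ..
    show ?thesis
      unfolding sum_distrib_left p
      by (intro sum.cong refl) (simp add: c_def power_mult_distrib mult_ac)
  qed
  also have "(\<Sum>k\<le>n. of_nat (n choose k) * (- of_real (2 * d) / w) ^ k * 1 ^ (n - k)) = (- of_real (2 * d) / w + 1) ^ n"
    by (rule binomial_ring[symmetric])
  also have "- of_real (2 * d) / w + 1 = (of_real y - \<i> * of_real d) / (of_real y + \<i> * of_real d)"
  proof -
    have a: "of_real y + \<i> * of_real d = \<i> * w" by (simp add: w_def algebra_simps)
    have b: "of_real y - \<i> * of_real d = \<i> * (w - of_real (2 * d))" by (simp add: w_def algebra_simps)
    have "\<i> * (w - of_real (2 * d)) / (\<i> * w) = (w - of_real (2 * d)) / w" by simp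
    also have "\<dots> = - of_real (2 * d) / w + 1" using w by (simp add: diff_divide_distrib)
    finally show ?thesis unfolding a b by (rule sym)
  qed
  also have "of_real (sqrt (2 * d)) / w * ((of_real y - \<i> * of_real d) / (of_real y + \<i> * of_real d)) ^ n
      = of_real (sqrt (2 * d)) * \<i> * ((of_real y - \<i> * of_real d) ^ n / (of_real y + \<i> * of_real d) ^ Suc n)"
  proof -
    have "of_real y + \<i> * of_real d = \<i> * w" by (simp add: w_def algebra_simps)
    hence "1 / w = \<i> / (of_real y + \<i> * of_real d)" by simp
    hence "of_real (sqrt (2 * d)) / w = of_real (sqrt (2 * d)) * (\<i> / (of_real y + \<i> * of_real d))"
      by (simp add: divide_inverse)
    thus ?thesis by (simp add: power_divide)
  qed
  also have "sqrt (2 * d) = sqrt (2 * pi) * sqrt (d / pi)" by (simp add: real_sqrt_mult real_sqrt_divide)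
  finally show "(LINT x|half_line. iexp (y * x) * laguerre_fun d n x) = of_real (sqrt (2 * pi)) * cayley_fun d n y"
    by (simp add: cayley_fun_def mult_ac)
qed

text \<open>Of the decay exp (- d x) in the Laguerre functions one half makes the pairings converge
  and the other half serves as the exponential weight of \<open>moments_unique\<close>. Assuming
  only weighted integrability admits bounded functions, which is how integral transforms enter
  before they are known to be square integrable.\<close>

lemma laguerre_fun_complete:
  assumes f [measurable]: "f \<in> borel_measurable half_line"
    and int: "integrable half_line (\<lambda>x. norm (f x) * exp (- d / 2 * x))"
    and zero: "\<And>n. (LINT x|half_line. f x * laguerre_fun d n x) = 0"
  shows "AE x in half_line. f x = 0"
proof -
  define F where "F x = f x * of_real (exp (- d * x))" for x
  have id [measurable]: "(\<lambda>x. x) \<in> borel_measurable half_line" by (intro borel_half_line) measurable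
  have F [measurable]: "F \<in> borel_measurable half_line" unfolding F_def by measurable
  have int': "integrable half_line (\<lambda>x. norm (F x) * exp (d / 2 * \<bar>x\<bar>))"
  proof (rule Bochner_Integration.integrable_cong[THEN iffD1, OF refl _ int])
    fix x assume "x \<in> space half_line"
    hence x: "x > 0" by simp
    have "exp (- d / 2 * x) = exp (- d * x) * exp (d / 2 * x)" unfolding exp_add[symmetric] by (simp add: field_simps)
    thus "norm (f x) * exp (- d / 2 * x) = norm (F x) * exp (d / 2 * \<bar>x\<bar>)"
      using x by (simp add: F_def norm_mult)
  qed
  have intk: "integrable half_line (\<lambda>x. F x * of_real x ^ k)" for k
  proof (rule Bochner_Integration.integrable_bound)
    let ?C = "fact k * (1 / (d / 2)) ^ k"
    show "integrable half_line (\<lambda>x. ?C * (norm (F x) * exp (d / 2 * \<bar>x\<bar>)))" using int' by (rule integrable_mult_right)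
    show "AE x in half_line. norm (F x * of_real x ^ k) \<le> norm (?C * (norm (F x) * exp (d / 2 * \<bar>x\<bar>)))"
    proof (rule AE_I2)
      fix x assume "x \<in> space half_line"
      hence x: "x > 0" by simp
      have "norm (F x * of_real x ^ k) = norm (F x) * x ^ k" using x by (simp add: norm_mult norm_power)
      also have "\<dots> \<le> norm (F x) * (?C * exp (d / 2 * x))"
        using d x by (intro mult_left_mono pow_exp_bound) auto
      also have "\<dots> = norm (?C * (norm (F x) * exp (d / 2 * \<bar>x\<bar>)))"
        using x d by (simp add: norm_mult)
      finally show "norm (F x * of_real x ^ k) \<le> norm (?C * (norm (F x) * exp (d / 2 * \<bar>x\<bar>)))" .
    qed
  qed measurable
  have mom: "(LINT x|half_line. F x * of_real x ^ n) = 0" for n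
  proof (induction n rule: less_induct)
    case (less n)
    define c where "c k = complex_of_real (sqrt (2 * d) * (real (n choose k) * (-1) ^ k / fact k) * (2 * d) ^ k)" for k
    have e: "f x * laguerre_fun d n x = (\<Sum>k\<le>n. c k * (F x * of_real x ^ k))" for x
      unfolding F_def laguerre_fun_def laguerre_def c_def
      by (simp add: sum_distrib_left power_mult_distrib mult_ac)
    \<comment> \<open>Triangular system: the lower moments vanish by induction, and the leading
      coefficient of \<open>laguerre n\<close> is nonzero.\<close>
    have "0 = (\<Sum>k\<le>n. c k * (LINT x|half_line. F x * of_real x ^ k))"
      using zero[of n] unfolding e
      by (subst (asm) Bochner_Integration.integral_sum) (simp_all only: integrable_mult_right intk integral_mult_right_zero)
    also have "\<dots> = c n * (LINT x|half_line. F x * of_real x ^ n)"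
      by (subst lessThan_Suc_atMost[symmetric], subst sum.lessThan_Suc) (simp add: less)
    finally show ?case using d by (simp add: c_def)
  qed
  \<comment> \<open>A Borel left inverse of the inclusion; the value 1 on the other half is an
    arbitrary point of the half line.\<close>
  have meas: "(\<lambda>x. if 0 < x then x else 1) \<in> measurable borel half_line"
    unfolding half_line_def by (intro measurable_restrict_space2) auto
  have d2: "d / 2 > 0" using d by simp
  have "AE x in half_line. F x = 0"
    by (rule moments_unique[OF F id meas _ int' d2 mom]) simp
  thus ?thesis by eventually_elim (simp add: F_def)
qed

lemma sqi_exp_weight:
  assumes f: "square_integrable half_line f"
  shows "integrable half_line (\<lambda>x. norm (f x) * exp (- d / 2 * x))"
proof -
  have "square_integrable half_line (\<lambda>x. of_real (exp (- d / 2 * x)))"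
    unfolding square_integrable_def
  proof
    show "(\<lambda>x. complex_of_real (exp (- d / 2 * x))) \<in> borel_measurable half_line" by (intro borel_half_line) measurable
    have "(cmod (of_real (exp (- d / 2 * x))))\<^sup>2 = exp (- d * x)" for x
      by (simp add: power2_eq_square exp_add[symmetric])
    thus "integrable half_line (\<lambda>x. (cmod (of_real (exp (- d / 2 * x))))\<^sup>2)"
      using exp_integrable_half_line[OF d] by simp
  qed
  from integrable_norm[OF sqi_mult_integrable[OF f this]] show ?thesis by (simp add: norm_mult)
qed

lemma laguerre_fun_onb: "onb half_line (laguerre_fun d)"
  unfolding onb_def
proof (intro conjI laguerre_fun_orthonormal allI impI)
  fix f assume f: "square_integrable half_line f" and z: "\<forall>n. ip half_line f (laguerre_fun d n) = 0"
  show "AE x in half_line. f x = 0"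
    using z by (intro laguerre_fun_complete sqi_measurable f sqi_exp_weight) (simp add: ip_def)
qed

end

section \<open>The Fourier transformation\<close>

lemma integral_lborel_pos:
  fixes f :: "real \<Rightarrow> 'a::{banach, second_countable_topology}"
  shows "(LINT x|lborel. (if 0 < x then f x else 0)) = (LINT x|half_line. f x)"
    "integrable lborel (\<lambda>x. if 0 < x then f x else 0) \<longleftrightarrow> integrable half_line f"
proof -
  have e: "(if 0 < x then f x else 0) = indicator {0<..} x *\<^sub>R f x" for x by simp
  show "(LINT x|lborel. (if 0 < x then f x else 0)) = (LINT x|half_line. f x)"
    "integrable lborel (\<lambda>x. if 0 < x then f x else 0) \<longleftrightarrow> integrable half_line f"
    unfolding e integral_half_line integrable_half_line by simp_all
qed

lemma integral_lborel_neg: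
  fixes f :: "real \<Rightarrow> 'a::{banach, second_countable_topology}"
  shows "(LINT x|lborel. (if x < 0 then f (- x) else 0)) = (LINT x|half_line. f x)"
    "integrable lborel (\<lambda>x. if x < 0 then f (- x) else 0) \<longleftrightarrow> integrable half_line f"
proof -
  have e: "(if x < 0 then f (- x) else 0) = (\<lambda>x. if 0 < x then f x else 0) (0 + (-1) * x)" for x by simp
  show "(LINT x|lborel. (if x < 0 then f (- x) else 0)) = (LINT x|half_line. f x)"
    unfolding e integral_lborel_pos(1)[symmetric]
    by (subst (2) lborel_integral_real_affine[where c = "-1" and t = 0]) simp_all
  show "integrable lborel (\<lambda>x. if x < 0 then f (- x) else 0) \<longleftrightarrow> integrable half_line f"
    unfolding e integral_lborel_pos(2)[symmetric]
    by (rule lborel_integrable_real_affine_iff) simp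
qed

lemma AE_lborel_split:
  assumes "Measurable.pred borel P" and P: "AE x in half_line. P x" "AE x in half_line. P (- x)"
  shows "AE x in lborel. P x"
proof -
  have "Measurable.pred borel (\<lambda>x. P (- x))" using assms(1) by measurable
  hence m: "Measurable.pred borel (\<lambda>x::real. 0 < x \<longrightarrow> P (- x))" by measurable
  have "AE x in lborel. 0 < x \<longrightarrow> P (- x)" using P(2) by (simp add: AE_half_line)
  from AE_borel_affine[OF _ m this, of "-1" 0] have "AE x in lborel. x < 0 \<longrightarrow> P x" by simp
  moreover have "AE x in lborel. 0 < x \<longrightarrow> P x" using P(1) by (simp add: AE_half_line)
  ultimately show ?thesis using AE_lborel_singleton[of 0]
    by eventually_elim (metis linorder_neqE)
qed

text \<open>Reflection fills the negative half line, giving a family on the whole line indexed by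
  the integers. The sign and the index shift \<open>- 1 - n\<close> are forced: with them the
  inverse Fourier transform is given by one formula, \<open>cayley_int\<close>, for exponents of
  either sign.\<close>

definition laguerre_int :: "real \<Rightarrow> int \<Rightarrow> real \<Rightarrow> complex" where
  "laguerre_int d n x = (if 0 \<le> n then (if 0 < x then laguerre_fun d (nat n) x else 0)
     else (if x < 0 then - laguerre_fun d (nat (- 1 - n)) (- x) else 0))"

definition cayley :: "real \<Rightarrow> real \<Rightarrow> complex" where
  "cayley d y = (of_real y - \<i> * of_real d) / (of_real y + \<i> * of_real d)"

definition cayley_int :: "real \<Rightarrow> int \<Rightarrow> real \<Rightarrow> complex" where
  "cayley_int d n y = \<i> * of_real (sqrt (d / pi)) * cayley d y powi n / (of_real y + \<i> * of_real d)"

text \<open>Density of the Cauchy distribution of scale \<open>d\<close>. It is the squared modulus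
  of every \<open>cayley_int d n\<close> and also the image of normalised arc length under the
  inverse Cayley transform.\<close>

definition cauchy_density :: "real \<Rightarrow> real \<Rightarrow> real" where
  "cauchy_density d y = d / (pi * (y\<^sup>2 + d\<^sup>2))"

lemma laguerre_int_measurable [measurable]: "laguerre_int d n \<in> borel_measurable borel"
  unfolding laguerre_int_def [abs_def] by measurable

lemma cayley_measurable [measurable]: "cayley d \<in> borel_measurable borel"
  unfolding cayley_def [abs_def] by measurable

lemma cauchy_density_measurable [measurable]: "cauchy_density d \<in> borel_measurable borel"
  unfolding cauchy_density_def [abs_def] by measurable

lemma power_int_measurable [measurable (raw)]:
  fixes f :: "'a \<Rightarrow> complex"
  assumes [measurable]: "f \<in> borel_measurable M"
  shows "(\<lambda>x. f x powi n) \<in> borel_measurable M"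
  unfolding power_int_def by measurable

lemma cayley_int_measurable [measurable]: "cayley_int d n \<in> borel_measurable borel"
  unfolding cayley_int_def [abs_def] by measurable

lemma cnj_laguerre_int [simp]: "cnj (laguerre_int d n x) = laguerre_int d n x"
  by (simp add: laguerre_int_def)

lemma laguerre_int_integral:
  "(LINT x|lborel. g x * laguerre_int d n x) =
     (if 0 \<le> n then (LINT x|half_line. g x * laguerre_fun d (nat n) x)
      else - (LINT x|half_line. g (- x) * laguerre_fun d (nat (- 1 - n)) x))"
  "integrable lborel (\<lambda>x. g x * laguerre_int d n x) \<longleftrightarrow>
     (if 0 \<le> n then integrable half_line (\<lambda>x. g x * laguerre_fun d (nat n) x)
      else integrable half_line (\<lambda>x. g (- x) * laguerre_fun d (nat (- 1 - n)) x))"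
proof -
  have p: "g x * laguerre_int d n x = (if 0 < x then g x * laguerre_fun d (nat n) x else 0)" if "0 \<le> n" for x
    using that by (simp add: laguerre_int_def)
  note N = integral_lborel_neg[of "\<lambda>x. - (g (- x) * laguerre_fun d (nat (- 1 - n)) x)"]
  have q: "g x * laguerre_int d n x = (if x < 0 then - (g (- (- x)) * laguerre_fun d (nat (- 1 - n)) (- x)) else 0)"
    if "\<not> 0 \<le> n" for x
    using that by (simp add: laguerre_int_def)
  show "(LINT x|lborel. g x * laguerre_int d n x) =
     (if 0 \<le> n then (LINT x|half_line. g x * laguerre_fun d (nat n) x)
      else - (LINT x|half_line. g (- x) * laguerre_fun d (nat (- 1 - n)) x))"
  proof (cases "0 \<le> n")
    case True
    show ?thesis unfolding p[OF True] integral_lborel_pos using True by simp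
  next
    case False
    show ?thesis unfolding q[OF False] N(1) using False by simp
  qed
  show "integrable lborel (\<lambda>x. g x * laguerre_int d n x) \<longleftrightarrow>
     (if 0 \<le> n then integrable half_line (\<lambda>x. g x * laguerre_fun d (nat n) x)
      else integrable half_line (\<lambda>x. g (- x) * laguerre_fun d (nat (- 1 - n)) x))"
  proof (cases "0 \<le> n")
    case True
    show ?thesis unfolding p[OF True] integral_lborel_pos using True by simp
  next
    case False
    show ?thesis unfolding q[OF False] N(2) using False by simp
  qed
qed

context
  fixes d :: real
  assumes d: "d > 0"
begin

section \<open>The Cayley transform and the Cauchy distribution\<close>

lemma cayley_denom: "of_real y + \<i> * of_real d \<noteq> 0" "of_real y - \<i> * of_real d \<noteq> 0"
  using d by (simp_all add: complex_eq_iff)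

lemma cayley_nonzero [simp]: "cayley d y \<noteq> 0"
  using cayley_denom[of y] by (simp add: cayley_def)

lemma cmod_cayley: "cmod (cayley d y) = 1"
proof -
  have "cmod (of_real y - \<i> * of_real d) = cmod (of_real y + \<i> * of_real d)" by (simp add: cmod_def)
  thus ?thesis using cayley_denom[of y] by (simp add: cayley_def norm_divide)
qed

lemma cnj_cayley: "cnj (cayley d y) = inverse (cayley d y)"
  by (simp add: cayley_def)

lemma cayley_mult: "(of_real y - \<i> * of_real d) * (of_real y + \<i> * of_real d) = of_real (y\<^sup>2 + d\<^sup>2)"
  by (simp add: algebra_simps power2_eq_square)

lemma cayley_neq_1: "cayley d y \<noteq> 1"
proof
  assume "cayley d y = 1"
  hence "of_real y - \<i> * of_real d = of_real y + \<i> * of_real d"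
    using cayley_denom[of y] by (simp add: cayley_def divide_eq_1_iff)
  hence "\<i> * of_real d = 0" by simp
  thus False using d by simp
qed

lemma cayley_int_nat: "cayley_int d (int n) y = cayley_fun d n y"
  by (simp add: cayley_int_def cayley_fun_def cayley_def power_divide)

lemma cayley_int_neg: "cayley_int d (- 1 - int n) y = - cnj (cayley_fun d n y)"
proof -
  have "- 1 - int n = - int (Suc n)" by simp
  hence "cayley d y powi (- 1 - int n) = inverse (cayley d y ^ Suc n)"
    by (simp only: power_int_minus power_int_of_nat)
  thus ?thesis using cayley_denom[of y]
    by (simp add: cayley_int_def cayley_fun_def cayley_def power_divide divide_simps)
qed

lemma sum_sq_pos: "y\<^sup>2 + d\<^sup>2 > 0"
  using d by (intro add_nonneg_pos) auto

lemma cauchy_density_pos: "cauchy_density d y > 0"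
  using d sum_sq_pos[of y] by (simp add: cauchy_density_def)

lemma cauchy_density_integral: "integrable lborel (cauchy_density d)" "(LINT y|lborel. cauchy_density d y) = 1"
proof -
  let ?F = "\<lambda>y. arctan (y / d) / pi"
  have F: "(?F has_real_derivative cauchy_density d y) (at y)" for y
  proof -
    define S where "S = y\<^sup>2 + d\<^sup>2"
    have S: "S > 0" using sum_sq_pos[of y] by (simp add: S_def)
    have e: "1 + (y / d)\<^sup>2 = S / d\<^sup>2" using d by (simp add: S_def power_divide field_simps)
    have "((\<lambda>y. y / d) has_real_derivative 1 / d) (at y)" by (rule DERIV_cdivide[OF DERIV_ident])
    from DERIV_cdivide[OF DERIV_chain2[OF DERIV_arctan this], of pi]
    have "(?F has_real_derivative inverse (1 + (y / d)\<^sup>2) * (1 / d) / pi) (at y)" .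
    also have "inverse (1 + (y / d)\<^sup>2) * (1 / d) / pi = cauchy_density d y"
      unfolding e cauchy_density_def S_def[symmetric] using d S by (simp add: power2_eq_square)
    finally show ?thesis .
  qed
  have top: "(?F \<longlongrightarrow> (pi / 2) / pi) at_top"
    using d by (intro tendsto_divide tendsto_const filterlim_compose[OF tendsto_arctan_at_top]
        filterlim_tendsto_pos_mult_at_top[OF tendsto_const _ filterlim_ident, of "1 / d", simplified])
      (auto simp: divide_inverse mult.commute)
  have bot: "(?F \<longlongrightarrow> (- (pi / 2)) / pi) at_bot"
    using d by (intro tendsto_divide tendsto_const filterlim_compose[OF tendsto_arctan_at_bot]
        filterlim_tendsto_pos_mult_at_bot[OF tendsto_const _ filterlim_ident, of "1 / d", simplified])
      (auto simp: divide_inverse mult.commute)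
  have cont: "isCont (cauchy_density d) y" for y
    unfolding cauchy_density_def [abs_def] using sum_sq_pos[of y] by (intro continuous_intros) auto
  have 1: "set_integrable lborel (einterval (-\<infinity>) \<infinity>) (cauchy_density d)"
    "(LBINT y=-\<infinity>..\<infinity>. cauchy_density d y) = 1 / 2 - (- 1 / 2)"
    by (rule interval_integral_FTC_nonneg[where F = ?F];
        use F cont cauchy_density_pos top bot in \<open>auto simp: ereal_tendsto_simps1 less_imp_le\<close>)+
  show "integrable lborel (cauchy_density d)" using 1(1) by (simp add: set_integrable_def)
  show "(LINT y|lborel. cauchy_density d y) = 1"
    using 1(2) by (simp add: interval_lebesgue_integral_def set_lebesgue_integral_def)
qed

text \<open>The derivative of \<open>cayley d\<close> is 2 pi i times \<open>cauchy_density\<close>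
  times \<open>cayley d\<close>, so for k different from 0 the integrand has the primitive cayley^k
  / (2 pi i k). It takes the same limit at both ends, because the Cayley transform tends to 1
  there.\<close>

lemma cauchy_density_moments:
  "integrable lborel (\<lambda>y. of_real (cauchy_density d y) * cayley d y powi k)"
  "(LINT y|lborel. of_real (cauchy_density d y) * cayley d y powi k) = of_bool (k = 0)"
proof -
  show int: "integrable lborel (\<lambda>y. of_real (cauchy_density d y) * cayley d y powi k)"
    by (rule Bochner_Integration.integrable_bound[OF cauchy_density_integral(1)])
      (auto simp: norm_mult norm_power_int cmod_cayley)
  show "(LINT y|lborel. of_real (cauchy_density d y) * cayley d y powi k) = of_bool (k = 0)"
  proof (cases "k = 0")
    case True
    thus ?thesis by (simp add: cauchy_density_integral(2))
  next
    case False
    let ?F = "\<lambda>y. cayley d y powi k / (2 * of_real pi * \<i> * of_int k)"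
    have der: "((\<lambda>z. (z - \<i> * of_real d) / (z + \<i> * of_real d)) has_field_derivative
        2 * \<i> * of_real d / (of_real y + \<i> * of_real d)\<^sup>2) (at (of_real y))" for y
      using cayley_denom[of y]
      by (auto intro!: derivative_eq_intros simp: field_simps power2_eq_square)
    have eq: "of_int k * cayley d y powi (k - 1) * (2 * \<i> * of_real d / (of_real y + \<i> * of_real d)\<^sup>2) / (2 * of_real pi * \<i> * of_int k)
        = of_real (cauchy_density d y) * cayley d y powi k" for y
    proof -
      define u v where "u = of_real y - \<i> * complex_of_real d" and "v = of_real y + \<i> * complex_of_real d"
      have uv: "u \<noteq> 0" "v \<noteq> 0" "of_real (y\<^sup>2 + d\<^sup>2) = u * v"
        using cayley_denom[of y] cayley_mult[of y] by (simp_all add: u_def v_def)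
      define C where "C = cayley d y powi (k - 1)"
      have cv: "cayley d y = u / v" by (simp add: cayley_def u_def v_def)
      have "cayley d y powi k = C * cayley d y"
        using power_int_add[of "cayley d y" "k - 1" 1] by (simp add: C_def)
      hence pk: "cayley d y powi k = C * (u / v)" unfolding cv .
      have dens: "of_real (cauchy_density d y) = of_real d / (of_real pi * (u * v))"
        unfolding cauchy_density_def uv(3)[symmetric] by simp
      show ?thesis unfolding pk dens v_def[symmetric] C_def[symmetric] using False uv(1,2)
        by (simp add: field_simps power2_eq_square)
    qed
    have F: "(?F has_vector_derivative of_real (cauchy_density d y) * cayley d y powi k) (at y)" for y
    proof -
      have "((\<lambda>z. ((z - \<i> * of_real d) / (z + \<i> * of_real d)) powi k / (2 * of_real pi * \<i> * of_int k)) has_field_derivative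
        of_int k * cayley d y powi (k - 1) * (2 * \<i> * of_real d / (of_real y + \<i> * of_real d)\<^sup>2) / (2 * of_real pi * \<i> * of_int k)) (at (of_real y))"
        unfolding cayley_def using cayley_denom[of y]
        by (intro DERIV_cdivide DERIV_power_int[OF der]) simp
      from has_vector_derivative_real_field[OF this] show ?thesis
        unfolding cayley_def by (simp only: eq[unfolded cayley_def])
    qed
    have lim: "(?F \<longlongrightarrow> 1 powi k / (2 * of_real pi * \<i> * of_int k)) G" if G: "filterlim (\<lambda>y::real. y) at_infinity G" for G
    proof -
      have "filterlim (\<lambda>y. complex_of_real y) at_infinity G"
        using G by (simp add: filterlim_at_infinity_conv_norm_at_top)
      hence "filterlim (\<lambda>y. complex_of_real y + \<i> * of_real d) at_infinity G"
        by (rule tendsto_add_filterlim_at_infinity'[OF _ tendsto_const])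
      from tendsto_divide_0[OF tendsto_const[of "2 * \<i> * of_real d"] this]
      have "((\<lambda>y. 1 - 2 * \<i> * of_real d / (of_real y + \<i> * of_real d)) \<longlongrightarrow> 1 - 0) G"
        by (intro tendsto_diff tendsto_const)
      moreover have "1 - 2 * \<i> * of_real d / (of_real y + \<i> * of_real d) = cayley d y" for y
        using cayley_denom[of y] by (simp add: cayley_def field_simps)
      ultimately have "(cayley d \<longlongrightarrow> 1) G" by simp
      thus ?thesis using False by (intro tendsto_divide tendsto_power_int tendsto_const) auto
    qed
    have "(LBINT y=-\<infinity>..\<infinity>. of_real (cauchy_density d y) * cayley d y powi k)
       = 1 powi k / (2 * of_real pi * \<i> * of_int k) - 1 powi k / (2 * of_real pi * \<i> * of_int k)"
    proof (rule interval_integral_FTC_integrable[where F = ?F])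
      show "isCont (\<lambda>y. of_real (cauchy_density d y) * cayley d y powi k) y" for y
        unfolding cauchy_density_def cayley_def using sum_sq_pos[of y] cayley_denom[of y]
        by (intro continuous_intros) auto
      show "set_integrable lborel (einterval (-\<infinity>) \<infinity>) (\<lambda>y. of_real (cauchy_density d y) * cayley d y powi k)"
        using int by (simp add: set_integrable_def)
      show "((?F \<circ> real_of_ereal) \<longlongrightarrow> 1 powi k / (2 * of_real pi * \<i> * of_int k)) (at_right (-\<infinity>))"
        unfolding ereal_tendsto_simps1 by (rule lim) (rule filterlim_mono[OF filterlim_ident at_bot_le_at_infinity order_refl])
      show "((?F \<circ> real_of_ereal) \<longlongrightarrow> 1 powi k / (2 * of_real pi * \<i> * of_int k)) (at_left \<infinity>)"
        unfolding ereal_tendsto_simps1 by (rule lim) (rule filterlim_mono[OF filterlim_ident at_top_le_at_infinity order_refl])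
    qed (use F in auto)
    thus ?thesis using False by (simp add: interval_lebesgue_integral_def set_lebesgue_integral_def)
  qed
qed

lemma cayley_int_mult:
  "cayley_int d m y * cnj (cayley_int d n y) = of_real (cauchy_density d y) * cayley d y powi (m - n)"
proof -
  have s: "complex_of_real (sqrt (d / pi)) * of_real (sqrt (d / pi)) = of_real (d / pi)"
    using d by (simp flip: of_real_mult)
  have c: "cayley d y powi (m - n) = cayley d y powi m * cnj (cayley d y powi n)"
    by (simp add: power_int_diff cnj_cayley power_int_inverse divide_inverse)
  have e: "of_real (cauchy_density d y) = of_real (d / pi) / ((of_real y + \<i> * of_real d) * (of_real y - \<i> * of_real d))"
    using cayley_mult[of y] by (simp add: cauchy_density_def mult.commute)
  have "cayley_int d m y * cnj (cayley_int d n y) = (of_real (sqrt (d / pi)) * of_real (sqrt (d / pi)))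
     * (cayley d y powi m * cnj (cayley d y powi n)) / ((of_real y + \<i> * of_real d) * (of_real y - \<i> * of_real d))"
    using cayley_denom[of y] by (simp add: cayley_int_def field_simps)
  thus ?thesis unfolding s c e by simp
qed

lemma cayley_int_sqi: "square_integrable lborel (cayley_int d n)"
  unfolding square_integrable_def
proof
  have "(cmod (cayley_int d n y))\<^sup>2 = cauchy_density d y" for y
    using cayley_int_mult[of n y n] by (simp add: complex_norm_square [symmetric] flip: of_real_power)
  thus "integrable lborel (\<lambda>x. (cmod (cayley_int d n x))\<^sup>2)" by (simp add: cauchy_density_integral)
qed simp

text \<open>The angle is an explicit injective function of \<open>y\<close>, with left inverse t ->
  d tan (t / 2). Characteristic functions in the angle therefore separate functions on the
  line.\<close>

lemma circle_angle_cayley: "circle_angle (cayley d y) = 2 * arctan (y / d)"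
proof -
  have "cayley d y = (of_real y - \<i> * of_real d)\<^sup>2 / of_real (y\<^sup>2 + d\<^sup>2)"
    unfolding cayley_mult[symmetric] using cayley_denom[of y] by (simp add: cayley_def power2_eq_square)
  also have "\<dots> = Complex ((y\<^sup>2 - d\<^sup>2) / (y\<^sup>2 + d\<^sup>2)) (- 2 * y * d / (y\<^sup>2 + d\<^sup>2))"
    by (simp add: complex_eq_iff power2_eq_square)
  finally have "cayley d y = Complex ((y\<^sup>2 - d\<^sup>2) / (y\<^sup>2 + d\<^sup>2)) (- 2 * y * d / (y\<^sup>2 + d\<^sup>2))" .
  moreover have "(2 * y * d / (y\<^sup>2 + d\<^sup>2)) / (1 - (y\<^sup>2 - d\<^sup>2) / (y\<^sup>2 + d\<^sup>2)) = y / d"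
  proof -
    define S where "S = y\<^sup>2 + d\<^sup>2"
    have S: "S > 0" using sum_sq_pos[of y] by (simp add: S_def)
    have m: "y\<^sup>2 - d\<^sup>2 = S - 2 * d\<^sup>2" by (simp add: S_def)
    have e: "1 - (y\<^sup>2 - d\<^sup>2) / S = 2 * d\<^sup>2 / S" unfolding m using S by (simp add: field_simps)
    show ?thesis unfolding S_def[symmetric] e using S d by (simp add: power2_eq_square)
  qed
  ultimately show ?thesis by (simp add: circle_angle_def)
qed

text \<open>Orthonormality is the moment formula for the Cauchy distribution. For completeness,
  multiplying by the conjugate of \<open>cayley_int d 0\<close> turns the coefficients of
  \<open>f\<close> into trigonometric moments of an integrable function \<open>F\<close>.
  \<open>int_decode\<close> enumerates the integers.\<close>

lemma cayley_int_onb: "onb lborel (\<lambda>k. cayley_int d (int_decode k))"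
  unfolding onb_def orthonormal_seq_def
proof (intro conjI allI impI cayley_int_sqi)
  show "ip lborel (cayley_int d (int_decode m)) (cayley_int d (int_decode n)) = of_bool (m = n)" for m n
    unfolding ip_def cayley_int_mult cauchy_density_moments(2) by (simp add: int_decode_eq)
next
  fix f assume f: "square_integrable lborel f" and z: "\<forall>k. ip lborel f (cayley_int d (int_decode k)) = 0"
  define F where "F y = f y * cnj (cayley_int d 0 y)" for y
  have F: "integrable lborel F" unfolding F_def by (intro ip_integrable f cayley_int_sqi)
  have "(LINT y|lborel. F y * cayley d y powi m) = (LINT y|lborel. 0 * cayley d y powi m)" for m
  proof -
    have "cnj (cayley_int d 0 y) * cayley d y powi m = cnj (cayley_int d (- m) y)" for y
      by (simp add: cayley_int_def cnj_cayley power_int_inverse power_int_minus)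
    hence "(LINT y|lborel. F y * cayley d y powi m) = ip lborel f (cayley_int d (- m))"
      by (simp add: F_def ip_def mult.assoc)
    also have "\<dots> = 0" using z[rule_format, of "int_encode (- m)"] by simp
    finally show ?thesis by simp
  qed
  \<comment> \<open>Comparison with the zero function in place of \<open>F'\<close>: all moments
    agree, so the transform of \<open>F\<close> in the angle vanishes.\<close>
  from trig_moments_determine[OF F _ _ _ _ _ _ _ this]
  have "(LINT y|lborel. F y * iexp (\<xi> * circle_angle (cayley d y))) = 0" for \<xi>
    by (simp add: cmod_cayley cayley_neq_1)
  hence F0: "(LINT y|lborel. F y * iexp (\<xi> * (2 * arctan (y / d)))) = 0" for \<xi>
    unfolding circle_angle_cayley .
  have "AE y in lborel. F y = 0"
  proof (rule integrable_char_unique[OF F _ _ _ F0])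
    show "(\<lambda>y. 2 * arctan (y / d)) \<in> borel_measurable lborel" by measurable
    show "(\<lambda>t. d * tan (t / 2)) \<in> borel \<rightarrow>\<^sub>M lborel" unfolding tan_def by measurable
    show "d * tan (2 * arctan (y / d) / 2) = y" for y using d by (simp add: tan_arctan)
  qed
  thus "AE y in lborel. f y = 0"
  proof eventually_elim
    fix y assume "F y = 0"
    thus "f y = 0" using d cayley_denom[of y] by (simp add: F_def cayley_int_def)
  qed
qed

text \<open>Nonnegative and negative indices have disjoint supports, so both orthonormality and
  completeness decouple into the two half lines.\<close>

lemma laguerre_int_onb: "onb lborel (\<lambda>k. laguerre_int d (int_decode k))"
  and laguerre_int_sqi: "square_integrable lborel (laguerre_int d m)"
proof -
  have ip_int: "integrable half_line (\<lambda>x. laguerre_fun d m x * laguerre_fun d n x)" for m n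
    by (rule laguerre_fun_ip(1)[OF d])
  have prod: "(LINT x|lborel. laguerre_int d m x * laguerre_int d n x) = of_bool (m = n)
      \<and> integrable lborel (\<lambda>x. laguerre_int d m x * laguerre_int d n x)" for m n
  proof -
    have 1: "(LINT x|half_line. laguerre_int d m x * laguerre_fun d k x) = (if 0 \<le> m then of_bool (nat m = k) else 0)
       \<and> integrable half_line (\<lambda>x. laguerre_int d m x * laguerre_fun d k x)" for k
    proof (cases "0 \<le> m")
      case True
      hence e: "laguerre_int d m x * laguerre_fun d k x = laguerre_fun d (nat m) x * laguerre_fun d k x" if "x \<in> space half_line" for x
        using that by (simp add: laguerre_int_def)
      from Bochner_Integration.integral_cong[OF refl[of half_line] e] Bochner_Integration.integrable_cong[OF refl[of half_line] e]
      show ?thesis using True ip_int laguerre_fun_ip(2)[OF d] by simp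
    next
      case False
      hence e: "laguerre_int d m x * laguerre_fun d k x = 0" if "x \<in> space half_line" for x
        using that by (simp add: laguerre_int_def)
      from Bochner_Integration.integral_cong[OF refl[of half_line] e] Bochner_Integration.integrable_cong[OF refl[of half_line] e]
      show ?thesis using False by simp
    qed
    have 2: "(LINT x|half_line. laguerre_int d m (- x) * laguerre_fun d k x) = (if 0 \<le> m then 0 else - of_bool (nat (- 1 - m) = k))
       \<and> integrable half_line (\<lambda>x. laguerre_int d m (- x) * laguerre_fun d k x)" for k
    proof (cases "0 \<le> m")
      case True
      hence e: "laguerre_int d m (- x) * laguerre_fun d k x = 0" if "x \<in> space half_line" for x
        using that by (simp add: laguerre_int_def)
      from Bochner_Integration.integral_cong[OF refl[of half_line] e] Bochner_Integration.integrable_cong[OF refl[of half_line] e]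
      show ?thesis using True by simp
    next
      case False
      hence e: "laguerre_int d m (- x) * laguerre_fun d k x = - (laguerre_fun d (nat (- 1 - m)) x * laguerre_fun d k x)" if "x \<in> space half_line" for x
        using that by (simp add: laguerre_int_def)
      from Bochner_Integration.integral_cong[OF refl[of half_line] e] Bochner_Integration.integrable_cong[OF refl[of half_line] e]
      show ?thesis using False ip_int laguerre_fun_ip(2)[OF d] by simp
    qed
    show ?thesis
      unfolding laguerre_int_integral(1,2)[of "laguerre_int d m"] using 1 2 by auto
  qed
  show sqi: "square_integrable lborel (laguerre_int d m)" for m
    unfolding square_integrable_def
  proof
    have "(cmod (laguerre_int d m x))\<^sup>2 = Re (laguerre_int d m x * laguerre_int d m x)" for x
    proof -
      have h: "complex_of_real ((cmod (laguerre_int d m x))\<^sup>2) = laguerre_int d m x * laguerre_int d m x"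
        using complex_norm_square[of "laguerre_int d m x"] by (simp only: cnj_laguerre_int)
      show ?thesis using arg_cong[OF h, of Re] by (simp only: Re_complex_of_real)
    qed
    thus "integrable lborel (\<lambda>x. (cmod (laguerre_int d m x))\<^sup>2)"
      using integrable_Re[OF conjunct2[OF prod[of m m]]] by simp
  qed simp
  show "onb lborel (\<lambda>k. laguerre_int d (int_decode k))"
    unfolding onb_def orthonormal_seq_def
  proof (intro conjI allI impI sqi)
    show "ip lborel (laguerre_int d (int_decode m)) (laguerre_int d (int_decode n)) = of_bool (m = n)" for m n
      unfolding ip_def using prod[of "int_decode m" "int_decode n"] by (simp add: int_decode_eq)
  next
    fix f assume f: "square_integrable lborel f" and "\<forall>k. ip lborel f (laguerre_int d (int_decode k)) = 0"
    hence z: "(LINT x|lborel. f x * laguerre_int d n x) = 0" for n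
      by (simp add: ip_def) (metis int_encode_inverse)
    have [measurable]: "f \<in> borel_measurable borel" using sqi_measurable[OF f] by simp
    have fi: "integrable lborel (\<lambda>x. if 0 < x then (cmod (f x))\<^sup>2 else 0)"
      "integrable lborel (\<lambda>x. if x < 0 then (cmod (f (- (- x))))\<^sup>2 else 0)"
      by (auto intro!: Bochner_Integration.integrable_bound[OF sqi_integrable[OF f]])
    have s: "square_integrable half_line f" "square_integrable half_line (\<lambda>x. f (- x))"
      unfolding square_integrable_def using fi
      by (auto intro!: borel_half_line simp: integral_lborel_pos(2) integral_lborel_neg(2)[of "\<lambda>x. (cmod (f (- x)))\<^sup>2"])
    have "AE x in half_line. f x = 0"
    proof (rule onb_complete[OF laguerre_fun_onb[OF d] s(1) sqi_zero])
      show "ip half_line f (laguerre_fun d n) = ip half_line (\<lambda>x. 0) (laguerre_fun d n)" for n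
        using z[of "int n"] unfolding laguerre_int_integral by (simp add: ip_def)
    qed
    moreover have "AE x in half_line. f (- x) = 0"
    proof (rule onb_complete[OF laguerre_fun_onb[OF d] s(2) sqi_zero])
      show "ip half_line (\<lambda>x. f (- x)) (laguerre_fun d n) = ip half_line (\<lambda>x. 0) (laguerre_fun d n)" for n
        using z[of "- 1 - int n"] unfolding laguerre_int_integral by (simp add: ip_def)
    qed
    ultimately show "AE x in lborel. f x = 0" by (intro AE_lborel_split) auto
  qed
qed

text \<open>The weighted form is needed for Fourier integrals of integrable functions, for which
  only boundedness is available at that point.\<close>

lemma laguerre_int_complete:
  assumes f [measurable]: "f \<in> borel_measurable borel"
    and int: "integrable lborel (\<lambda>x. norm (f x) * exp (- d / 2 * \<bar>x\<bar>))"
    and zero: "\<And>n. (LINT x|lborel. f x * laguerre_int d n x) = 0"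
  shows "AE x in lborel. f x = 0"
proof (rule AE_lborel_split)
  have i: "integrable lborel (\<lambda>x. if 0 < x then norm (f x) * exp (- d / 2 * x) else 0)"
    "integrable lborel (\<lambda>x. if x < 0 then norm (f (- (- x))) * exp (- d / 2 * (- x)) else 0)"
    by (rule Bochner_Integration.integrable_bound[OF int]; auto)+
  show "AE x in half_line. f x = 0"
  proof (rule laguerre_fun_complete[OF d])
    show "integrable half_line (\<lambda>x. norm (f x) * exp (- d / 2 * x))" using i(1) by (simp only: integral_lborel_pos)
    show "(LINT x|half_line. f x * laguerre_fun d n x) = 0" for n
      using zero[of "int n"] unfolding laguerre_int_integral by simp
  qed (intro borel_half_line f)
  show "AE x in half_line. f (- x) = 0"
  proof (rule laguerre_fun_complete[OF d])
    show "integrable half_line (\<lambda>x. norm (f (- x)) * exp (- d / 2 * x))"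
      using i(2) integral_lborel_neg(2)[of "\<lambda>x. norm (f (- x)) * exp (- d / 2 * x)"] by simp
    show "(LINT x|half_line. f (- x) * laguerre_fun d n x) = 0" for n
      using zero[of "- 1 - int n"] unfolding laguerre_int_integral by simp
  qed (intro borel_half_line, measurable)
qed measurable

lemma laguerre_int_fourier:
  "integrable lborel (laguerre_int d n)"
  "(LINT x|lborel. iexp (- (x * y)) * laguerre_int d n x) = of_real (sqrt (2 * pi)) * cnj (cayley_int d n y)"
proof -
  show "integrable lborel (laguerre_int d n)"
    using laguerre_int_integral(2)[of "\<lambda>x. 1" d n] laguerre_fun_laplace(1)[OF d] by simp
  have "(LINT x|lborel. iexp (y * x) * laguerre_int d n x) = of_real (sqrt (2 * pi)) * cayley_int d n y" for y
  proof (cases "0 \<le> n")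
    case True
    thus ?thesis unfolding laguerre_int_integral(1)
      using laguerre_fun_laplace(2)[OF d, of y "nat n"] cayley_int_nat[of "nat n" y] by simp
  next
    case False
    hence n: "- 1 - int (nat (- 1 - n)) = n" by simp
    have h: "(LINT x|half_line. iexp (y * (- x)) * laguerre_fun d k x) = of_real (sqrt (2 * pi)) * cnj (cayley_fun d k y)" for k
    proof -
      have "(LINT x|half_line. iexp (y * (- x)) * laguerre_fun d k x) = (LINT x|half_line. cnj (iexp (y * x) * laguerre_fun d k x))"
        by (simp add: exp_cnj)
      also have "\<dots> = cnj (of_real (sqrt (2 * pi)) * cayley_fun d k y)"
        unfolding Bochner_Integration.integral_cnj laguerre_fun_laplace(2)[OF d] ..
      finally show ?thesis by simp
    qed
    have c: "cayley_int d n y = - cnj (cayley_fun d (nat (- 1 - n)) y)"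
      using cayley_int_neg[of "nat (- 1 - n)" y] unfolding n .
    show ?thesis unfolding laguerre_int_integral(1) if_not_P[OF False] h c by simp
  qed
  note l = this
  have "(LINT x|lborel. iexp (- (x * y)) * laguerre_int d n x) = (LINT x|lborel. cnj (iexp (y * x) * laguerre_int d n x))"
    by (simp add: exp_cnj mult.commute)
  thus "(LINT x|lborel. iexp (- (x * y)) * laguerre_int d n x) = of_real (sqrt (2 * pi)) * cnj (cayley_int d n y)"
    unfolding Bochner_Integration.integral_cnj l by simp
qed

end

lemma (in pair_sigma_finite) integrable_product_bound:
  fixes f :: "'a \<Rightarrow> complex" and g :: "'b \<Rightarrow> complex" and k :: "'a \<Rightarrow> 'b \<Rightarrow> complex"
  assumes f: "integrable M1 f" and g: "integrable M2 g"
    and k: "case_prod k \<in> borel_measurable (M1 \<Otimes>\<^sub>M M2)"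
    and b: "\<And>x y. x \<in> space M1 \<Longrightarrow> y \<in> space M2 \<Longrightarrow> norm (k x y) \<le> norm (f x) * norm (g y)"
  shows "integrable (M1 \<Otimes>\<^sub>M M2) (case_prod k)"
proof (rule Bochner_Integration.integrable_bound[OF _ k])
  have [measurable]: "f \<in> borel_measurable M1" "g \<in> borel_measurable M2" using f g by auto
  show "integrable (M1 \<Otimes>\<^sub>M M2) (\<lambda>(x, y). norm (f x) * norm (g y))"
  proof (rule Fubini_integrable)
    show "(\<lambda>(x, y). norm (f x) * norm (g y)) \<in> borel_measurable (M1 \<Otimes>\<^sub>M M2)" by measurable
    show "integrable M1 (\<lambda>x. LINT y|M2. norm (case (x, y) of (x, y) \<Rightarrow> norm (f x) * norm (g y)))"
      using f g by (simp add: abs_mult)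
    show "AE x in M1. integrable M2 (\<lambda>y. case (x, y) of (x, y) \<Rightarrow> norm (f x) * norm (g y))"
      using g by simp
  qed
  show "AE z in M1 \<Otimes>\<^sub>M M2. norm (case_prod k z) \<le> norm (case z of (x, y) \<Rightarrow> norm (f x) * norm (g y))"
  proof (rule AE_I2)
    fix z assume "z \<in> space (M1 \<Otimes>\<^sub>M M2)"
    then obtain x y where "z = (x, y)" "x \<in> space M1" "y \<in> space M2" by (auto simp: space_pair_measure)
    thus "norm (case_prod k z) \<le> norm (case z of (x, y) \<Rightarrow> norm (f x) * norm (g y))"
      using b[of x y] by simp
  qed
qed

section \<open>Identification of the Fourier transformation\<close>

lemma fourier_integral_measurable [measurable]:
  assumes [measurable]: "f \<in> borel_measurable borel"
  shows "fourier_integral f \<in> borel_measurable borel"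
  unfolding fourier_integral_def [abs_def] by measurable

lemma fourier_integral_bound:
  assumes f: "integrable lborel f"
  shows "norm (fourier_integral f x) \<le> (2 * pi) powr (- 1 / 2) * (LINT y|lborel. norm (f y))"
proof -
  have "norm (LINT y|lborel. exp (- (\<i> * of_real x * of_real y)) * f y)
      \<le> (LINT y|lborel. norm (exp (- (\<i> * of_real x * of_real y)) * f y))"
    by (rule integral_norm_bound)
  also have "\<dots> = (LINT y|lborel. norm (f y))" by (simp add: norm_mult)
  finally show ?thesis unfolding fourier_integral_def norm_mult by (simp add: mult_left_mono)
qed

lemma sqrt_2pi_powr: "(2 * pi) powr (- 1 / 2) * sqrt (2 * pi) = 1"
  by (simp add: powr_half_sqrt[symmetric] powr_add[symmetric])

text \<open>Fubini moves the transformation onto the Laguerre function, whose transform is known;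
  its factor sqrt (2 pi) cancels the normalisation of \<open>fourier_integral\<close>.\<close>

lemma fourier_integral_pairing:
  assumes d: "d > 0" and f: "integrable lborel f"
  shows "(LINT x|lborel. fourier_integral f x * laguerre_int d n x) = (LINT y|lborel. f y * cnj (cayley_int d n y))"
proof -
  define c where "c = complex_of_real ((2 * pi) powr (- 1 / 2))"
  define k where "k x y = c * iexp (- (x * y)) * f y * laguerre_int d n x" for x y
  have [measurable]: "f \<in> borel_measurable borel" using f by simp
  have "(LINT x|lborel. fourier_integral f x * laguerre_int d n x) = (LINT x|lborel. LINT y|lborel. k x y)"
  proof (rule Bochner_Integration.integral_cong[OF refl])
    fix x
    have "fourier_integral f x * laguerre_int d n x = (c * laguerre_int d n x) * (LINT y|lborel. iexp (- (x * y)) * f y)"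
      by (simp add: fourier_integral_def c_def mult_ac)
    also have "\<dots> = (LINT y|lborel. k x y)"
      unfolding Bochner_Integration.integral_mult_right_zero[symmetric] k_def
      by (intro Bochner_Integration.integral_cong refl) (simp only: mult_ac)
    finally show "fourier_integral f x * laguerre_int d n x = (LINT y|lborel. k x y)" .
  qed
  also have "\<dots> = (LINT y|lborel. LINT x|lborel. k x y)"
  proof (rule lborel_pair.Fubini_integral[symmetric], rule lborel_pair.integrable_product_bound)
    show "integrable lborel (\<lambda>x. c * laguerre_int d n x)"
      by (intro integrable_mult_right laguerre_int_fourier(1) d)
    show "integrable lborel f" by (rule f)
    show "case_prod k \<in> borel_measurable (lborel \<Otimes>\<^sub>M lborel)" unfolding k_def by measurable
    show "norm (k x y) \<le> norm (c * laguerre_int d n x) * norm (f y)" for x y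
      by (simp add: k_def norm_mult)
  qed
  also have "\<dots> = (LINT y|lborel. f y * cnj (cayley_int d n y))"
  proof (rule Bochner_Integration.integral_cong[OF refl])
    fix y
    have "(LINT x|lborel. k x y) = (c * f y) * (LINT x|lborel. iexp (- (x * y)) * laguerre_int d n x)"
      unfolding Bochner_Integration.integral_mult_right_zero[symmetric] k_def
      by (intro Bochner_Integration.integral_cong refl) (simp only: mult_ac)
    also have "\<dots> = (c * of_real (sqrt (2 * pi))) * (f y * cnj (cayley_int d n y))"
      unfolding laguerre_int_fourier(2)[OF d] by (simp only: mult_ac)
    also have "c * of_real (sqrt (2 * pi)) = 1"
      unfolding c_def of_real_mult[symmetric] sqrt_2pi_powr by simp
    finally show "(LINT x|lborel. k x y) = f y * cnj (cayley_int d n y)" by simp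
  qed
  finally show ?thesis .
qed

lemma exp_abs_integrable:
  assumes a: "a > 0"
  shows "integrable lborel (\<lambda>x::real. exp (- a * \<bar>x\<bar>))"
proof -
  have i: "integrable lborel (\<lambda>x::real. (if 0 < x then exp (- a * x) else 0) + (if x < 0 then exp (- a * (- x)) else 0))"
    using exp_integrable_half_line[OF a]
    by (intro Bochner_Integration.integrable_add)
      (simp_all only: integral_lborel_pos(2) integral_lborel_neg(2)[of "\<lambda>x. exp (- a * x)"])
  have ae: "AE x in lborel. exp (- a * \<bar>x\<bar>) = (if 0 < x then exp (- a * x) else 0) + (if x < 0 then exp (- a * (- x)) else 0)"
    using AE_lborel_singleton[of 0] by eventually_elim auto
  show ?thesis by (subst integrable_cong_AE[OF _ _ ae]) (use i in auto)
qed

lemma sqi_exp_abs: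
  assumes a: "a > 0" and f: "square_integrable lborel f"
  shows "integrable lborel (\<lambda>x::real. norm (f x) * exp (- a * \<bar>x\<bar>))"
proof -
  have "square_integrable lborel (\<lambda>x. complex_of_real (exp (- a * \<bar>x\<bar>)))"
    unfolding square_integrable_def
  proof
    have "(cmod (complex_of_real (exp (- a * \<bar>x\<bar>))))\<^sup>2 = exp (- (2 * a) * \<bar>x\<bar>)" for x
      by (simp add: power2_eq_square exp_add[symmetric])
    thus "integrable lborel (\<lambda>x. (cmod (complex_of_real (exp (- a * \<bar>x\<bar>))))\<^sup>2)"
      using exp_abs_integrable[of "2 * a"] a by simp
  qed measurable
  from integrable_norm[OF sqi_mult_integrable[OF f this]] show ?thesis by (simp add: norm_mult)
qed

lemma L2_isometry_nsq:
  assumes "L2_isometry M N T" "F \<in> L2 M" "G \<in> L2 M"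
  shows "nsq N (\<lambda>x. rep (T F) x - rep (T G) x) = nsq M (\<lambda>x. rep F x - rep G x)"
proof -
  have "T F \<in> L2 N" "T G \<in> L2 N" using assms by (simp_all add: L2_isometry_def)
  thus ?thesis
    using L2_isometry_diff_norm[OF assms] assms(2,3) by (simp add: L2_norm_nsq nsq_rep_L2_diff)
qed

definition is_fourier :: "((real \<Rightarrow> complex) set \<Rightarrow> (real \<Rightarrow> complex) set) \<Rightarrow> bool" where
  "is_fourier T \<longleftrightarrow> T \<in> extensional (L2 lborel) \<and> L2_unitary lborel lborel T \<and>
     (\<forall>f. integrable lborel f \<and> square_integrable lborel f \<longrightarrow>
        T (ae_class lborel f) = ae_class lborel (fourier_integral f))"

text \<open>The candidate is the abstract unitary from \<open>cayley_int\<close> to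
  \<open>laguerre_int\<close>. On integrable, square integrable \<open>f\<close> its value and the
  Fourier integral have equal pairings with every \<open>laguerre_int d n\<close>, hence agree a.e.
  by weighted completeness.\<close>

lemma fourier_exists:
  assumes d: "d > 0"
  obtains T where "is_fourier T" "\<And>n. T (ae_class lborel (cayley_int d n)) = ae_class lborel (laguerre_int d n)"
proof -
  note sqiL = laguerre_int_sqi[OF d] and sqiC = cayley_int_sqi[OF d]
  from onb_unitary[OF cayley_int_onb[OF d] laguerre_int_onb[OF d]] obtain T where
    T: "T \<in> extensional (L2 lborel)" "L2_unitary lborel lborel T"
      "\<And>F k. F \<in> L2 lborel \<Longrightarrow> ip lborel (rep (T F)) (laguerre_int d (int_decode k)) = ip lborel (rep F) (cayley_int d (int_decode k))"
    by blast
  have T3: "ip lborel (rep (T F)) (laguerre_int d n) = ip lborel (rep F) (cayley_int d n)" if "F \<in> L2 lborel" for F n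
    using T(3)[OF that, of "int_encode n"] by simp
  have TL: "T F \<in> L2 lborel" if "F \<in> L2 lborel" for F
    using L2_unitary_isometry[OF T(2)] that by (simp add: L2_isometry_def)
  have 1: "T (ae_class lborel f) = ae_class lborel (fourier_integral f)"
    if f: "integrable lborel f" "square_integrable lborel f" for f
  proof -
    have [measurable]: "f \<in> borel_measurable borel" using f by simp
    define g where "g = rep (T (ae_class lborel f))"
    have L: "T (ae_class lborel f) \<in> L2 lborel" by (intro TL ae_class_in_L2 f)
    have g: "square_integrable lborel g" unfolding g_def by (rule L2_rep(1)[OF L])
    have [measurable]: "g \<in> borel_measurable borel" using sqi_measurable[OF g] by simp
    define C where "C = (2 * pi) powr (- 1 / 2) * (LINT y|lborel. norm (f y))"
    have C: "norm (fourier_integral f x) \<le> C" for x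
      unfolding C_def by (rule fourier_integral_bound[OF f(1)])
    have C0: "C \<ge> 0" using C[of 0] norm_ge_zero order_trans by blast
    have i: "integrable lborel (\<lambda>x. fourier_integral f x * laguerre_int d n x)" for n
    proof (rule Bochner_Integration.integrable_bound)
      show "integrable lborel (\<lambda>x. C * norm (laguerre_int d n x))"
        by (intro integrable_mult_right integrable_norm laguerre_int_fourier(1) d)
      show "AE x in lborel. norm (fourier_integral f x * laguerre_int d n x) \<le> norm (C * norm (laguerre_int d n x))"
        using C C0 by (intro AE_I2) (simp add: norm_mult abs_mult mult_right_mono)
    qed measurable
    have d2: "d / 2 > 0" using d by simp
    have "AE x in lborel. g x - fourier_integral f x = 0"
    proof (rule laguerre_int_complete[OF d])
      show "integrable lborel (\<lambda>x. norm (g x - fourier_integral f x) * exp (- d / 2 * \<bar>x\<bar>))"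
      proof (rule Bochner_Integration.integrable_bound)
        show "integrable lborel (\<lambda>x. norm (g x) * exp (- (d / 2) * \<bar>x\<bar>) + C * exp (- (d / 2) * \<bar>x\<bar>))"
          by (intro Bochner_Integration.integrable_add sqi_exp_abs integrable_mult_right exp_abs_integrable d2 g)
        show "AE x in lborel. norm (norm (g x - fourier_integral f x) * exp (- d / 2 * \<bar>x\<bar>))
          \<le> norm (norm (g x) * exp (- (d / 2) * \<bar>x\<bar>) + C * exp (- (d / 2) * \<bar>x\<bar>))"
        proof (rule AE_I2)
          fix x :: real
          have "norm (g x - fourier_integral f x) \<le> norm (g x) + C"
            using norm_triangle_ineq4[of "g x" "fourier_integral f x"] C[of x] by linarith
          hence "norm (g x - fourier_integral f x) * exp (- d / 2 * \<bar>x\<bar>) \<le> (norm (g x) + C) * exp (- d / 2 * \<bar>x\<bar>)"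
            by (intro mult_right_mono) auto
          also have "\<dots> = norm (g x) * exp (- (d / 2) * \<bar>x\<bar>) + C * exp (- (d / 2) * \<bar>x\<bar>)"
            by (simp add: distrib_right)
          finally show "norm (norm (g x - fourier_integral f x) * exp (- d / 2 * \<bar>x\<bar>))
            \<le> norm (norm (g x) * exp (- (d / 2) * \<bar>x\<bar>) + C * exp (- (d / 2) * \<bar>x\<bar>))"
            using C0 by (simp add: abs_mult)
        qed
      qed measurable
      fix n
      have "(LINT x|lborel. g x * laguerre_int d n x) = ip lborel (rep (T (ae_class lborel f))) (laguerre_int d n)"
        by (simp add: ip_def g_def)
      also have "\<dots> = ip lborel f (cayley_int d n)"
        by (simp add: T3 ae_class_in_L2 f ip_rep_ae_class)
      also have "\<dots> = (LINT x|lborel. fourier_integral f x * laguerre_int d n x)"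
        unfolding fourier_integral_pairing[OF d f(1)] ip_def ..
      finally have e: "(LINT x|lborel. g x * laguerre_int d n x) = (LINT x|lborel. fourier_integral f x * laguerre_int d n x)" .
      have "(LINT x|lborel. (g x - fourier_integral f x) * laguerre_int d n x)
        = (LINT x|lborel. g x * laguerre_int d n x) - (LINT x|lborel. fourier_integral f x * laguerre_int d n x)"
        unfolding left_diff_distrib
        by (intro Bochner_Integration.integral_diff sqi_mult_integrable g sqiL i)
      thus "(LINT x|lborel. (g x - fourier_integral f x) * laguerre_int d n x) = 0" using e by simp
    qed measurable
    hence "AE x in lborel. g x = fourier_integral f x" by eventually_elim simp
    from ae_class_eqI[OF this] show ?thesis using L2_rep(2)[OF L] by (simp add: g_def)
  qed
  have 2: "T (ae_class lborel (cayley_int d n)) = ae_class lborel (laguerre_int d n)" for n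
  proof (rule L2_eqI)
    show L: "T (ae_class lborel (cayley_int d n)) \<in> L2 lborel" by (intro TL ae_class_in_L2 sqiC)
    show L': "ae_class lborel (laguerre_int d n) \<in> L2 lborel" by (intro ae_class_in_L2 sqiL)
    show "AE x in lborel. rep (T (ae_class lborel (cayley_int d n))) x = rep (ae_class lborel (laguerre_int d n)) x"
    proof (rule onb_complete[OF laguerre_int_onb[OF d] L2_rep(1)[OF L] L2_rep(1)[OF L']])
      fix k
      have "ip lborel (cayley_int d n) (cayley_int d (int_decode k)) = ip lborel (laguerre_int d n) (laguerre_int d (int_decode k))"
        using on_ip[OF onb_on[OF cayley_int_onb[OF d]], of "int_encode n" k] on_ip[OF onb_on[OF laguerre_int_onb[OF d]], of "int_encode n" k]
        by simp
      thus "ip lborel (rep (T (ae_class lborel (cayley_int d n)))) (laguerre_int d (int_decode k))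
        = ip lborel (rep (ae_class lborel (laguerre_int d n))) (laguerre_int d (int_decode k))"
        by (simp add: T3 ae_class_in_L2 sqiC ip_rep_ae_class)
    qed
  qed
  show ?thesis using that[of T] T 1 2 by (auto simp: is_fourier_def)
qed

text \<open>Truncations of \<open>f\<close> to [-k, k] are integrable and square integrable, so both
  operators agree on them; as they approximate \<open>f\<close> in norm, isometry extends the
  agreement to all of L2.\<close>

lemma fourier_unique:
  assumes "is_fourier S" "is_fourier T"
  shows "S = T"
proof (rule extensionalityI[of _ "L2 lborel"])
  show "S \<in> extensional (L2 lborel)" "T \<in> extensional (L2 lborel)" using assms by (simp_all add: is_fourier_def)
  fix F :: "(real \<Rightarrow> complex) set" assume F: "F \<in> L2 lborel"
  have iso: "L2_isometry lborel lborel S" "L2_isometry lborel lborel T"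
    using assms by (auto simp: is_fourier_def intro: L2_unitary_isometry)
  have ST: "S F \<in> L2 lborel" "T F \<in> L2 lborel" using iso F by (simp_all add: L2_isometry_def)
  define f where "f = rep F"
  have f: "square_integrable lborel f" unfolding f_def by (rule L2_rep(1)[OF F])
  have [measurable]: "f \<in> borel_measurable borel" using sqi_measurable[OF f] by simp
  define g where "g k x = indicator {- real k..real k} x * f x" for k x
  have [measurable]: "g k \<in> borel_measurable borel" for k unfolding g_def [abs_def] by measurable
  have g_sqi: "square_integrable lborel (g k)" for k
    by (rule sqi_bound[OF _ sqi_integrable[OF f]]) (auto simp: g_def indicator_def)
  have g_int: "integrable lborel (g k)" for k
  proof -
    have "square_integrable lborel (\<lambda>x. indicator {- real k..real k} x :: complex)"
      unfolding square_integrable_def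
    proof
      have "(cmod (indicator {- real k..real k} x))\<^sup>2 = indicator {- real k..real k} x" for x :: real
        by (simp add: indicator_def)
      thus "integrable lborel (\<lambda>x. (cmod (indicator {- real k..real k} x))\<^sup>2)" by simp
    qed measurable
    from sqi_mult_integrable[OF this f] show ?thesis by (simp add: g_def [abs_def])
  qed
  \<comment> \<open>Insert the common image of the truncation. Each of the two differences costs a
    factor 2 in \<open>nsq_diff_le\<close>, and both have the norm of
    \<open>f - g k\<close>.\<close>
  have le: "nsq lborel (\<lambda>x. rep (S F) x - rep (T F) x) \<le> 4 * nsq lborel (\<lambda>x. f x - g k x)" for k
  proof -
    define G where "G = ae_class lborel (g k)"
    have G: "G \<in> L2 lborel" unfolding G_def by (rule ae_class_in_L2[OF g_sqi])
    have SG: "S G = T G" using assms g_int g_sqi by (simp add: is_fourier_def G_def)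
    have SGL: "S G \<in> L2 lborel" using iso G by (simp add: L2_isometry_def)
    have fG: "nsq lborel (\<lambda>x. rep F x - rep G x) = nsq lborel (\<lambda>x. f x - g k x)"
    proof (rule nsq_cong_AE)
      have "AE x in lborel. rep G x = g k x" unfolding G_def by (rule rep_ae_class) simp
      thus "AE x in lborel. rep F x - rep G x = f x - g k x" by eventually_elim (simp add: f_def)
    qed (intro sqi_measurable sqi_diff f g_sqi L2_rep F G)+
    have "nsq lborel (\<lambda>x. rep (S F) x - rep (T F) x)
      \<le> 2 * nsq lborel (\<lambda>x. rep (S F) x - rep (S G) x) + 2 * nsq lborel (\<lambda>x. rep (S G) x - rep (T F) x)"
      by (intro nsq_diff_le L2_rep ST SGL)
    also have "nsq lborel (\<lambda>x. rep (S F) x - rep (S G) x) = nsq lborel (\<lambda>x. f x - g k x)"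
      unfolding L2_isometry_nsq[OF iso(1) F G] fG ..
    also have "nsq lborel (\<lambda>x. rep (S G) x - rep (T F) x) = nsq lborel (\<lambda>x. f x - g k x)"
      unfolding SG nsq_minus_commute[of lborel "rep (T G)"] L2_isometry_nsq[OF iso(2) F G] fG ..
    finally show ?thesis by simp
  qed
  have "(\<lambda>k. nsq lborel (\<lambda>x. f x - g k x)) \<longlonglongrightarrow> (LINT x|(lborel :: real measure). (0::real))"
    unfolding nsq_def
  proof (rule integral_dominated_convergence[where w = "\<lambda>x. (cmod (f x))\<^sup>2"])
    show "AE x in lborel. (\<lambda>k. (cmod (f x - g k x))\<^sup>2) \<longlonglongrightarrow> 0"
    proof (rule AE_I2)
      fix x :: real
      obtain N where N: "\<bar>x\<bar> \<le> real N" using real_arch_simple by blast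
      have "(cmod (f x - g k x))\<^sup>2 = 0" if "k \<ge> N" for k
      proof -
        have "real N \<le> real k" using that by simp
        hence "x \<in> {- real k..real k}" using N by auto
        thus ?thesis by (simp add: g_def)
      qed
      thus "(\<lambda>k. (cmod (f x - g k x))\<^sup>2) \<longlonglongrightarrow> 0"
        by (intro tendsto_eventually eventually_sequentiallyI[of N])
    qed
  qed (auto simp: sqi_integrable[OF f] g_def indicator_def)
  hence "(\<lambda>k. 4 * nsq lborel (\<lambda>x. f x - g k x)) \<longlonglongrightarrow> 4 * 0" by (intro tendsto_mult tendsto_const) simp
  hence "nsq lborel (\<lambda>x. rep (S F) x - rep (T F) x) \<le> 4 * 0"
    by (rule LIMSEQ_le_const) (use le in blast)
  hence "nsq lborel (\<lambda>x. rep (S F) x - rep (T F) x) = 0"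
    using nsq_nonneg[of lborel "\<lambda>x. rep (S F) x - rep (T F) x"] by linarith
  hence "L2_norm lborel (L2_diff lborel (S F) (T F)) = 0" by (simp add: L2_norm_nsq nsq_rep_L2_diff ST)
  thus "S F = T F" by (rule L2_norm_diff_eq_0[OF ST])
qed

text \<open>By uniqueness the candidates built for different \<open>d\<close> are one and the same
  operator, so the formula for \<open>fourier\<close> holds for every \<open>d > 0\<close>.\<close>

theorem fourier_cayley_int:
  assumes d: "d > 0"
  shows "fourier (ae_class lborel (cayley_int d n)) = ae_class lborel (laguerre_int d n)"
    and fourier_unitary: "L2_unitary lborel lborel fourier"
proof -
  obtain T where T: "is_fourier T" "\<And>n. T (ae_class lborel (cayley_int d n)) = ae_class lborel (laguerre_int d n)"
    using fourier_exists[OF d] by blast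
  have "fourier = T"
    unfolding fourier_def is_fourier_def[symmetric]
    by (rule the_equality[where P = is_fourier, OF T(1)]) (rule fourier_unique[OF _ T(1)])
  thus "fourier (ae_class lborel (cayley_int d n)) = ae_class lborel (laguerre_int d n)"
    and "L2_unitary lborel lborel fourier"
    using T by (auto simp: is_fourier_def)
qed

section \<open>Meixner-Pollaczek functions on the unit interval\<close>

lemma powser_unique_aux:
  fixes c :: "nat \<Rightarrow> real"
  assumes \<rho>: "\<rho> > 0" and s: "\<And>q. \<bar>q\<bar> < \<rho> \<Longrightarrow> (\<lambda>n. c n * q ^ n) sums 0"
  shows "c n = 0"
proof (induction n rule: less_induct)
  case (less n)
  have "((\<lambda>q::real. 0::real) \<longlongrightarrow> c (0 + n)) (at 0)"
  proof (rule powser_limit_0_strong[OF \<rho>])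
    fix q :: real assume q: "q \<noteq> 0" "norm q < \<rho>"
    have "(\<lambda>m. c (m + n) * q ^ (m + n)) sums (0 - (\<Sum>i<n. c i * q ^ i))"
      using s[of q] q by (subst sums_iff_shift) simp
    also have "(\<Sum>i<n. c i * q ^ i) = 0" using less by simp
    finally have "(\<lambda>m. c (m + n) * q ^ (m + n) / q ^ n) sums ((0 - 0) / q ^ n)" by (rule sums_divide)
    moreover have "c (m + n) * q ^ (m + n) / q ^ n = c (m + n) * q ^ m" for m using q by (simp add: power_add)
    ultimately show "(\<lambda>m. c (m + n) * q ^ m) sums 0" by simp
  qed
  hence "c (0 + n) = 0" by (rule tendsto_unique[OF _ _ tendsto_const, rotated]) simp
  thus ?case by simp
qed

text \<open>Real arguments near 0 suffice for comparing coefficients. This matters because the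
  generating functions below are put into closed form for real \<open>q\<close> only.\<close>

lemma powser_unique:
  fixes a b :: "nat \<Rightarrow> complex"
  assumes \<rho>: "\<rho> > 0"
    and a: "\<And>q::real. \<bar>q\<bar> < \<rho> \<Longrightarrow> (\<lambda>n. a n * of_real q ^ n) sums f q"
    and b: "\<And>q::real. \<bar>q\<bar> < \<rho> \<Longrightarrow> (\<lambda>n. b n * of_real q ^ n) sums f q"
  shows "a n = b n"
proof -
  have d: "(\<lambda>n. (a n - b n) * of_real q ^ n) sums 0" if "\<bar>q\<bar> < \<rho>" for q
    using sums_diff[OF a[OF that] b[OF that]] by (simp add: left_diff_distrib)
  have "(\<lambda>n. Re (a n - b n) * q ^ n) sums 0" if "\<bar>q\<bar> < \<rho>" for q
    using sums_Re[OF d[OF that]] by (simp flip: of_real_power)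
  from powser_unique_aux[OF \<rho> this] have "Re (a n - b n) = 0" .
  moreover have "(\<lambda>n. Im (a n - b n) * q ^ n) sums 0" if "\<bar>q\<bar> < \<rho>" for q
    using sums_Im[OF d[OF that]] by (simp flip: of_real_power)
  from powser_unique_aux[OF \<rho> this] have "Im (a n - b n) = 0" .
  ultimately show ?thesis by (simp add: complex_eq_iff)
qed

text \<open>Cauchy product of the two binomial series in the generating function: an explicit
  solution of the description in \<open>meixner_pollaczek\<close>.\<close>

definition mp_coeff :: "nat \<Rightarrow> real \<Rightarrow> real \<Rightarrow> complex" where
  "mp_coeff n x \<beta> = (\<Sum>k\<le>n. ((- 1 / 2 + \<i> * of_real x) gchoose k) * (- cis \<beta>) ^ k *
     (((- 1 / 2 - \<i> * of_real x) gchoose (n - k)) * (- cis (- \<beta>)) ^ (n - k)))"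

text \<open>Each Pochhammer factor is at most 1/2 + |x| + i in modulus. The right hand side is the
  corresponding coefficient of (1 - r)^(-(1/2 + |x|)), so the growth in \<open>x\<close> can be read
  off from a real binomial series.\<close>

lemma norm_gchoose_half:
  assumes a: "a = - 1 / 2 + \<i> * of_real x \<or> a = - 1 / 2 - \<i> * of_real x"
  shows "norm (a gchoose k) \<le> (- (1 / 2 + \<bar>x\<bar>) gchoose k) * (- 1) ^ k"
proof -
  have "norm (pochhammer (- a) k) \<le> pochhammer (1 / 2 + \<bar>x\<bar>) k"
    unfolding pochhammer_prod prod_norm[symmetric]
  proof (rule prod_mono, safe)
    fix i
    have "- a + of_nat i = of_real (1 / 2 + real i) + (- a - 1 / 2)" by simp
    also have "norm \<dots> \<le> norm (complex_of_real (1 / 2 + real i)) + norm (- a - 1 / 2)" by (rule norm_triangle_ineq)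
    also have "norm (- a - 1 / 2) = \<bar>x\<bar>" using a by (auto simp: norm_mult)
    also have "norm (complex_of_real (1 / 2 + real i)) = 1 / 2 + real i" unfolding norm_of_real by simp
    finally show "norm (- a + of_nat i) \<le> 1 / 2 + \<bar>x\<bar> + of_nat i" by simp
  qed simp
  hence "norm (a gchoose k) \<le> pochhammer (1 / 2 + \<bar>x\<bar>) k / fact k"
    unfolding gbinomial_pochhammer by (simp add: norm_mult norm_divide norm_power divide_right_mono)
  also have "\<dots> = (- (1 / 2 + \<bar>x\<bar>) gchoose k) * (- 1) ^ k"
    unfolding gbinomial_pochhammer minus_minus by (cases "even k") simp_all
  finally show ?thesis .
qed

lemma gchoose_half_abs_sum:
  assumes a: "a = - 1 / 2 + \<i> * of_real x \<or> a = - 1 / 2 - \<i> * of_real x" and r: "0 \<le> r" "r < 1"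
  shows "summable (\<lambda>k. norm (a gchoose k) * r ^ k)"
    "(\<Sum>k. norm (a gchoose k) * r ^ k) \<le> (1 - r) powr (- (1 / 2 + \<bar>x\<bar>))"
proof -
  let ?b = "- (1 / 2 + \<bar>x\<bar>)"
  have G: "(\<lambda>k. (?b gchoose k) * (- r) ^ k) sums (1 + - r) powr ?b" using r by (intro gen_binomial_real) simp
  have e: "(?b gchoose k) * (- r) ^ k = (?b gchoose k) * (- 1) ^ k * r ^ k" for k
    unfolding power_minus[of r] by (simp only: mult.assoc)
  have w: "1 + - r = 1 - r" by simp
  have s: "(\<lambda>k. (?b gchoose k) * (- 1) ^ k * r ^ k) sums (1 - r) powr ?b" using G unfolding e w .
  have le: "norm (a gchoose k) * r ^ k \<le> (?b gchoose k) * (- 1) ^ k * r ^ k" for k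
    using r by (intro mult_right_mono norm_gchoose_half a) auto
  show sm: "summable (\<lambda>k. norm (a gchoose k) * r ^ k)"
  proof (rule summable_comparison_test'[OF sums_summable[OF s], of 0])
    show "norm (norm (a gchoose k) * r ^ k) \<le> (?b gchoose k) * (- 1) ^ k * r ^ k" for k
      using le[of k] r by (simp add: abs_mult)
  qed
  show "(\<Sum>k. norm (a gchoose k) * r ^ k) \<le> (1 - r) powr (- (1 / 2 + \<bar>x\<bar>))"
    using suminf_le[OF le sm sums_summable[OF s]] s by (simp add: sums_iff)
qed

lemma mp_coeff_sums:
  assumes q: "norm q < 1"
  shows "(\<lambda>n. mp_coeff n x \<beta> * q ^ n) sums
       ((1 - q * cis \<beta>) powr (- 1 / 2 + \<i> * of_real x) * (1 - q * cis (-\<beta>)) powr (- 1 / 2 - \<i> * of_real x))"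
proof -
  have s: "(\<lambda>k. (a gchoose k) * (- cis \<theta>) ^ k * q ^ k) sums (1 - q * cis \<theta>) powr a"
    and n: "summable (\<lambda>k. norm ((a gchoose k) * (- cis \<theta>) ^ k * q ^ k))"
    if a: "a = - 1 / 2 + \<i> * of_real x \<or> a = - 1 / 2 - \<i> * of_real x" for a \<theta>
  proof -
    have "norm (- (q * cis \<theta>)) < 1" using q by (simp add: norm_mult)
    from gen_binomial_complex[OF this, of a]
    have g: "(\<lambda>k. (a gchoose k) * (- (q * cis \<theta>)) ^ k) sums (1 + - (q * cis \<theta>)) powr a" .
    have e: "(a gchoose k) * (- cis \<theta>) ^ k * q ^ k = (a gchoose k) * (- (q * cis \<theta>)) ^ k" for k
      unfolding mult.assoc power_mult_distrib[symmetric] by (simp add: mult.commute)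
    have w: "1 - q * cis \<theta> = 1 + - (q * cis \<theta>)" by simp
    show "(\<lambda>k. (a gchoose k) * (- cis \<theta>) ^ k * q ^ k) sums (1 - q * cis \<theta>) powr a"
      unfolding e w by (rule g)
    have "norm ((a gchoose k) * (- cis \<theta>) ^ k * q ^ k) = norm (a gchoose k) * norm q ^ k" for k
      by (simp add: norm_mult norm_power)
    thus "summable (\<lambda>k. norm ((a gchoose k) * (- cis \<theta>) ^ k * q ^ k))"
      using gchoose_half_abs_sum(1)[OF a, of "norm q"] q by simp
  qed
  define A B where "A k = ((- 1 / 2 + \<i> * of_real x) gchoose k) * (- cis \<beta>) ^ k * q ^ k"
    and "B k = ((- 1 / 2 - \<i> * of_real x) gchoose k) * (- cis (- \<beta>)) ^ k * q ^ k" for k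
  have AB: "A sums (1 - q * cis \<beta>) powr (- 1 / 2 + \<i> * of_real x)" "summable (\<lambda>k. norm (A k))"
    "B sums (1 - q * cis (-\<beta>)) powr (- 1 / 2 - \<i> * of_real x)" "summable (\<lambda>k. norm (B k))"
    unfolding A_def [abs_def] B_def [abs_def] by (rule s n, simp)+
  have "mp_coeff n x \<beta> * q ^ n = (\<Sum>k\<le>n. A k * B (n - k))" for n
    unfolding mp_coeff_def sum_distrib_right
  proof (rule sum.cong[OF refl])
    fix k assume "k \<in> {..n}"
    hence "q ^ n = q ^ k * q ^ (n - k)" by (simp add: power_add[symmetric])
    thus "(- 1 / 2 + \<i> * of_real x gchoose k) * (- cis \<beta>) ^ k * ((- 1 / 2 - \<i> * of_real x gchoose (n - k)) * (- cis (- \<beta>)) ^ (n - k)) * q ^ n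
       = A k * B (n - k)" by (simp only: A_def B_def mult_ac)
  qed
  thus ?thesis using Cauchy_product_sums[OF AB(2,4)] AB(1,3) by (simp add: sums_iff)
qed

text \<open>The point is the dependence on \<open>x\<close>: with 1 - r = exp (- L) the bound grows
  like exp (2 L |x|), so a small radius makes the growth rate as small as the weights on the unit
  interval require.\<close>

lemma mp_coeff_abs_bound:
  assumes r: "0 \<le> r" "r < 1"
  shows "(\<Sum>n<N. norm (mp_coeff n x \<beta>) * r ^ n) \<le> (1 - r) powr (- (1 + 2 * \<bar>x\<bar>))"
proof -
  define u v where "u k = norm ((- 1 / 2 + \<i> * of_real x) gchoose k) * r ^ k"
    and "v k = norm ((- 1 / 2 - \<i> * of_real x) gchoose k) * r ^ k" for k
  have u: "summable u" "suminf u \<le> (1 - r) powr (- (1 / 2 + \<bar>x\<bar>))" "u k \<ge> 0" for k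
    unfolding u_def [abs_def] using gchoose_half_abs_sum[of "- 1 / 2 + \<i> * of_real x" x r] r by auto
  have v: "summable v" "suminf v \<le> (1 - r) powr (- (1 / 2 + \<bar>x\<bar>))" "v k \<ge> 0" for k
    unfolding v_def [abs_def] using gchoose_half_abs_sum[of "- 1 / 2 - \<i> * of_real x" x r] r by auto
  have "summable (\<lambda>k. norm (u k))" "summable (\<lambda>k. norm (v k))" using u v by simp_all
  from Cauchy_product_sums[OF this]
  have P: "(\<lambda>n. \<Sum>k\<le>n. u k * v (n - k)) sums (suminf u * suminf v)" .
  have "norm (mp_coeff n x \<beta>) * r ^ n \<le> (\<Sum>k\<le>n. u k * v (n - k))" for n
  proof -
    have "norm (mp_coeff n x \<beta>) \<le> (\<Sum>k\<le>n. norm ((- 1 / 2 + \<i> * of_real x) gchoose k) * norm ((- 1 / 2 - \<i> * of_real x) gchoose (n - k)))"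
      unfolding mp_coeff_def
      by (rule order_trans[OF norm_sum], rule sum_mono) (simp add: norm_mult norm_power)
    hence "norm (mp_coeff n x \<beta>) * r ^ n \<le> (\<Sum>k\<le>n. norm ((- 1 / 2 + \<i> * of_real x) gchoose k) * norm ((- 1 / 2 - \<i> * of_real x) gchoose (n - k))) * r ^ n"
      using r by (intro mult_right_mono) auto
    also have "\<dots> = (\<Sum>k\<le>n. u k * v (n - k))"
      unfolding sum_distrib_right
    proof (rule sum.cong[OF refl])
      fix k assume "k \<in> {..n}"
      hence "r ^ n = r ^ k * r ^ (n - k)" by (simp add: power_add[symmetric])
      thus "norm ((- 1 / 2 + \<i> * of_real x) gchoose k) * norm ((- 1 / 2 - \<i> * of_real x) gchoose (n - k)) * r ^ n = u k * v (n - k)"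
        by (simp only: u_def v_def mult_ac)
    qed
    finally show ?thesis .
  qed
  hence "(\<Sum>n<N. norm (mp_coeff n x \<beta>) * r ^ n) \<le> (\<Sum>n<N. \<Sum>k\<le>n. u k * v (n - k))" by (rule sum_mono)
  also have "\<dots> \<le> suminf u * suminf v"
    using sum_le_suminf[OF sums_summable[OF P], of "{..<N}"] P u(3) v(3)
    by (simp add: sums_iff sum_nonneg)
  also have "\<dots> \<le> (1 - r) powr (- (1 / 2 + \<bar>x\<bar>)) * (1 - r) powr (- (1 / 2 + \<bar>x\<bar>))"
    using u v by (intro mult_mono suminf_nonneg) auto
  also have "\<dots> = (1 - r) powr (- (1 + 2 * \<bar>x\<bar>))"
    unfolding powr_add[symmetric] by simp
  finally show ?thesis .
qed

lemma meixner_pollaczek_half: "meixner_pollaczek (1 / 2) n x \<beta> = mp_coeff n x \<beta>"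
proof -
  let ?G = "\<lambda>q. (1 - q * cis \<beta>) powr (- complex_of_real (1 / 2) + \<i> * of_real x) * (1 - q * cis (-\<beta>)) powr (- complex_of_real (1 / 2) - \<i> * of_real x)"
  have s: "(\<lambda>n. mp_coeff n x \<beta> * q ^ n) sums ?G q" if "norm q < 1" for q
    using mp_coeff_sums[OF that, of x \<beta>] by simp
  have "(THE p. \<forall>q. norm q < 1 \<longrightarrow> (\<lambda>n. p n * q ^ n) sums ?G q) = (\<lambda>n. mp_coeff n x \<beta>)"
  proof (rule the_equality)
    show "\<forall>q. norm q < 1 \<longrightarrow> (\<lambda>n. mp_coeff n x \<beta> * q ^ n) sums ?G q" using s by blast
    fix p assume p: "\<forall>q. norm q < 1 \<longrightarrow> (\<lambda>n. p n * q ^ n) sums ?G q"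
    show "p = (\<lambda>n. mp_coeff n x \<beta>)"
    proof
      fix n show "p n = mp_coeff n x \<beta>"
      proof (rule powser_unique[of 1])
        fix q :: real assume "\<bar>q\<bar> < 1"
        hence "norm (complex_of_real q) < 1" by simp
        from p[rule_format, OF this] s[OF this]
        show "(\<lambda>n. p n * of_real q ^ n) sums ?G (of_real q)" "(\<lambda>n. mp_coeff n x \<beta> * of_real q ^ n) sums ?G (of_real q)" .
      qed simp
    qed
  qed
  thus ?thesis unfolding meixner_pollaczek_def by simp
qed

lemma gbinomial_measurable [measurable (raw)]:
  fixes f :: "'a \<Rightarrow> complex"
  assumes [measurable]: "f \<in> borel_measurable M"
  shows "(\<lambda>x. f x gchoose k) \<in> borel_measurable M"
  unfolding gbinomial_prod_rev by measurable

lemma mp_coeff_measurable [measurable]: "(\<lambda>x. mp_coeff n x \<beta>) \<in> borel_measurable borel"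
  unfolding mp_coeff_def by measurable

section \<open>Closed form of the generating function for real arguments\<close>

locale mp_param =
  fixes \<beta> :: real
  assumes \<beta>: "0 < \<beta>" "\<beta> < pi"
begin

definition d :: real where "d = tan (\<beta> / 2)"

lemma cos_half_pos: "cos (\<beta> / 2) > 0" and sin_half_pos: "sin (\<beta> / 2) > 0"
  using \<beta> by (auto intro!: cos_gt_zero_pi sin_gt_zero)

lemma d_pos: "d > 0"
  unfolding d_def tan_def using cos_half_pos sin_half_pos by simp

lemma sin_half: "sin (\<beta> / 2) = d * cos (\<beta> / 2)"
  unfolding d_def tan_def using cos_half_pos by simp

lemma sin_beta: "sin \<beta> = 2 * d * (cos (\<beta> / 2))\<^sup>2"
  using sin_double[of "\<beta> / 2"] by (simp add: sin_half power2_eq_square)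

lemma cos_beta: "cos \<beta> = (cos (\<beta> / 2))\<^sup>2 - d\<^sup>2 * (cos (\<beta> / 2))\<^sup>2"
  using cos_double[of "\<beta> / 2"] by (simp add: sin_half power_mult_distrib)

text \<open>Determined by (u - i d) - q (u + i d) = (1 - q) (u - i w): summing the powers of the
  conjugate Cayley transform against q^n moves the pole from i d to i w.\<close>

definition mp_w :: "real \<Rightarrow> real" where "mp_w q = d * (1 + q) / (1 - q)"

definition mp_b :: "real \<Rightarrow> real" where "mp_b q = arctan (mp_w q)"

lemma mp_w_pos: "\<bar>q\<bar> < 1 \<Longrightarrow> mp_w q > 0"
  using d_pos by (auto simp: mp_w_def)

lemma mp_b_bounds: "\<bar>q\<bar> < 1 \<Longrightarrow> 0 < mp_b q" "mp_b q < pi / 2" "cos (mp_b q) > 0"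
  unfolding mp_b_def using mp_w_pos[of q] arctan_bounded[of "mp_w q"] by (auto simp: cos_arctan intro!: divide_pos_pos add_pos_nonneg)

lemma sin_mp_b: "sin (mp_b q) = mp_w q * cos (mp_b q)"
  using mp_b_bounds(3)[of q] tan_arctan[of "mp_w q"] unfolding mp_b_def tan_def by (simp add: field_simps)

text \<open>Polar form of the first factor of the generating function. Multiplying out, both
  coordinates reduce to \<open>(1 - q) * mp_w q = d * (1 + q)\<close> and the half angle formulas
  for \<open>\<beta>\<close>.\<close>

lemma mp_base:
  assumes q: "\<bar>q\<bar> < 1"
  shows "1 - of_real q * cis \<beta> = of_real ((1 - q) * cos (\<beta> / 2) / cos (mp_b q)) * cis (\<beta> / 2 - mp_b q)"
proof -
  let ?c = "cos (\<beta> / 2)" and ?C = "cos (mp_b q)"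
  have C: "?C \<noteq> 0" using mp_b_bounds(3)[of q] by simp
  have w: "(1 - q) * mp_w q = d * (1 + q)" using q by (simp add: mp_w_def)
  have cs: "?c\<^sup>2 + d\<^sup>2 * ?c\<^sup>2 = 1" using sin_cos_squared_add[of "\<beta> / 2"] by (simp add: sin_half power_mult_distrib)
  have D: "cos (\<beta> / 2 - mp_b q) = ?C * (?c + d * ?c * mp_w q)"
    by (simp add: cos_diff sin_half sin_mp_b algebra_simps)
  have "(1 - q) * ?c / ?C * cos (\<beta> / 2 - mp_b q) = (1 - q) * ?c * (?c + d * ?c * mp_w q)"
    unfolding D using C by simp
  also have "\<dots> = (1 - q) * ?c\<^sup>2 + d * ?c\<^sup>2 * ((1 - q) * mp_w q)"
    by (simp only: power2_eq_square distrib_left mult_ac)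
  also have "\<dots> = (?c\<^sup>2 + d\<^sup>2 * ?c\<^sup>2) - q * (?c\<^sup>2 - d\<^sup>2 * ?c\<^sup>2)"
    unfolding w by (simp add: algebra_simps power2_eq_square)
  also have "\<dots> = 1 - q * cos \<beta>" by (simp only: cs cos_beta)
  finally have R: "(1 - q) * ?c / ?C * cos (\<beta> / 2 - mp_b q) = 1 - q * cos \<beta>" .
  have D': "sin (\<beta> / 2 - mp_b q) = ?C * (d * ?c - ?c * mp_w q)"
    by (simp add: sin_diff sin_half sin_mp_b algebra_simps)
  have "(1 - q) * ?c / ?C * sin (\<beta> / 2 - mp_b q) = (1 - q) * ?c * (d * ?c - ?c * mp_w q)"
    unfolding D' using C by simp
  also have "\<dots> = (1 - q) * d * ?c\<^sup>2 - ?c\<^sup>2 * ((1 - q) * mp_w q)"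
    by (simp add: power2_eq_square algebra_simps)
  also have "\<dots> = - q * sin \<beta>" unfolding w sin_beta by (simp add: algebra_simps)
  finally have I: "(1 - q) * ?c / ?C * sin (\<beta> / 2 - mp_b q) = - q * sin \<beta>" .
  show ?thesis
    using R I by (simp add: complex_eq_iff)
qed

text \<open>For real \<open>q\<close> the two bases are conjugate, with argument
  \<open>\<theta>\<close> and \<open>-\<theta>\<close> inside the principal range. The exponents
  -1/2 combine to the reciprocal modulus, the imaginary exponents to the real factor exp (- 2 x
  theta).\<close>

lemma mp_generating_real:
  assumes q: "\<bar>q\<bar> < 1"
  shows "(1 - of_real q * cis \<beta>) powr (- 1 / 2 + \<i> * of_real x) * (1 - of_real q * cis (-\<beta>)) powr (- 1 / 2 - \<i> * of_real x)
    = of_real (cos (mp_b q) / ((1 - q) * cos (\<beta> / 2)) * exp (2 * x * (mp_b q - \<beta> / 2)))"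
proof -
  define R \<theta> where "R = (1 - q) * cos (\<beta> / 2) / cos (mp_b q)" and "\<theta> = \<beta> / 2 - mp_b q"
  have R: "R > 0" using q cos_half_pos mp_b_bounds(3)[of q] by (auto simp: R_def)
  have \<theta>: "- pi < \<theta>" "\<theta> < pi" using \<beta> mp_b_bounds(1)[OF q] mp_b_bounds(2)[of q] by (auto simp: \<theta>_def)
  have z: "1 - of_real q * cis \<beta> = exp (of_real (ln R) + \<i> * of_real \<theta>)"
    using mp_base[OF q] R by (simp add: exp_add exp_of_real R_def[symmetric] \<theta>_def[symmetric] cis_conv_exp)
  have z': "1 - of_real q * cis (- \<beta>) = exp (of_real (ln R) - \<i> * of_real \<theta>)"
    using arg_cong[OF z, of cnj] by (simp add: exp_cnj cis_cnj)
  have L: "Ln (exp (of_real (ln R) + \<i> * of_real \<theta>)) = of_real (ln R) + \<i> * of_real \<theta>"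
    "Ln (exp (of_real (ln R) - \<i> * of_real \<theta>)) = of_real (ln R) - \<i> * of_real \<theta>"
    using \<theta> by (auto intro!: Ln_exp)
  have "(1 - of_real q * cis \<beta>) powr (- 1 / 2 + \<i> * of_real x) * (1 - of_real q * cis (-\<beta>)) powr (- 1 / 2 - \<i> * of_real x)
     = exp ((- 1 / 2 + \<i> * of_real x) * (of_real (ln R) + \<i> * of_real \<theta>) + (- 1 / 2 - \<i> * of_real x) * (of_real (ln R) - \<i> * of_real \<theta>))"
    unfolding z z' powr_def L if_not_P[OF exp_not_eq_zero] by (rule exp_add[symmetric])
  also have "(- 1 / 2 + \<i> * of_real x) * (of_real (ln R) + \<i> * of_real \<theta>) + (- 1 / 2 - \<i> * of_real x) * (of_real (ln R) - \<i> * of_real \<theta>)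
     = of_real (- ln R + 2 * x * (- \<theta>))"
    by (simp add: algebra_simps)
  also have "exp (complex_of_real (- ln R + 2 * x * (- \<theta>))) = of_real (exp (- ln R) * exp (2 * x * (- \<theta>)))"
    unfolding exp_of_real exp_add ..
  also have "exp (- ln R) = cos (mp_b q) / ((1 - q) * cos (\<beta> / 2))" using R by (simp add: exp_minus R_def)
  finally show ?thesis by (simp add: \<theta>_def)
qed

lemma mp_coeff_sums_real:
  assumes q: "\<bar>q\<bar> < 1"
  shows "(\<lambda>n. mp_coeff n x \<beta> * of_real q ^ n) sums
    of_real (cos (mp_b q) / ((1 - q) * cos (\<beta> / 2)) * exp (2 * x * (mp_b q - \<beta> / 2)))"
  using mp_coeff_sums[of "of_real q" x \<beta>] q unfolding mp_generating_real[OF q] by simp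

text \<open>The generating function is real for real \<open>q\<close>, so conjugating the
  coefficients does not change its sum.\<close>

lemma cnj_mp_coeff: "cnj (mp_coeff n x \<beta>) = mp_coeff n x \<beta>"
proof (rule powser_unique[of 1])
  fix q :: real assume q: "\<bar>q\<bar> < 1"
  show "(\<lambda>n. mp_coeff n x \<beta> * of_real q ^ n) sums
    of_real (cos (mp_b q) / ((1 - q) * cos (\<beta> / 2)) * exp (2 * x * (mp_b q - \<beta> / 2)))"
    by (rule mp_coeff_sums_real[OF q])
  thus "(\<lambda>n. cnj (mp_coeff n x \<beta>) * of_real q ^ n) sums
    of_real (cos (mp_b q) / ((1 - q) * cos (\<beta> / 2)) * exp (2 * x * (mp_b q - \<beta> / 2)))"
    by (subst (asm) sums_cnj[symmetric]) (simp del: of_real_mult of_real_divide)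
qed simp

end

section \<open>Beta integrals on the unit interval\<close>

lemma space_unit_interval [simp]: "space unit_interval = {0<..<1}"
  by (simp add: unit_interval_def space_restrict_space)

lemma borel_unit_interval: "f \<in> borel_measurable borel \<Longrightarrow> f \<in> borel_measurable unit_interval"
  unfolding unit_interval_def by (intro measurable_restrict_space1) simp

text \<open>The integrand is s^(-a) (1 - s)^(a - 1), a Beta integral with parameters 1 - a and a,
  which Euler's reflection formula evaluates.\<close>

lemma beta_integral:
  assumes a: "0 < a" "a < 1"
  shows "integrable unit_interval (\<lambda>s. (1 / s - 1) powr a * (1 - s) powr (- 1))"
    "(LINT s|unit_interval. (1 / s - 1) powr a * (1 - s) powr (- 1)) = pi / sin (pi * a)"
proof -
  let ?g = "\<lambda>s::real. (1 / s - 1) powr a * (1 - s) powr (- 1)"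
  have e: "?g s = s powr (1 - a - 1) * (1 - s) powr (a - 1)" if "s \<in> {0<..<1}" for s
  proof -
    have "1 / s - 1 = (1 - s) / s" using that by (simp add: field_simps)
    hence "?g s = ((1 - s) powr a / s powr a) * (1 - s) powr (- 1)" using that by (simp add: powr_divide)
    also have "\<dots> = s powr (- a) * ((1 - s) powr a * (1 - s) powr (- 1))" by (simp add: powr_minus field_simps)
    also have "(1 - s) powr a * (1 - s) powr (- 1) = (1 - s) powr (a - 1)"
      unfolding powr_add[symmetric] by simp
    finally show ?thesis by simp
  qed
  have "((\<lambda>s. s powr (1 - a - 1) * (1 - s) powr (a - 1)) has_integral Beta (1 - a) a) {0<..<1}"
    using has_integral_Beta_real[of "1 - a" a] a by (simp add: has_integral_Icc_iff_Ioo)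
  hence I: "(?g has_integral Beta (1 - a) a) {0<..<1}" by (subst has_integral_cong[OF e])
  have B: "Beta (1 - a) a = pi / sin (pi * a)"
  proof -
    have "complex_of_real (Gamma a * Gamma (1 - a)) = of_real (pi / sin (pi * a))"
    proof -
      have 1: "1 - complex_of_real a = of_real (1 - a)" "complex_of_real pi * of_real a = of_real (pi * a)" by simp_all
      show ?thesis
        using Gamma_reflection_complex[of "of_real a"]
        unfolding 1 Gamma_complex_of_real sin_of_real of_real_mult[symmetric] of_real_divide[symmetric] .
    qed
    hence "Gamma a * Gamma (1 - a) = pi / sin (pi * a)" by (simp only: of_real_eq_iff)
    thus ?thesis by (simp add: Beta_def mult.commute)
  qed
  have "0 < pi * a" "pi * a < pi" using a by (simp_all add: mult_less_cancel_left1)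
  hence pos: "pi / sin (pi * a) \<ge> 0" by (intro divide_nonneg_nonneg less_imp_le[OF sin_gt_zero]) auto
  have nn: "(\<integral>\<^sup>+s. ennreal (?g s) \<partial>unit_interval) = ennreal (pi / sin (pi * a))"
  proof -
    have "(\<integral>\<^sup>+s. ennreal (?g s) \<partial>unit_interval) = (\<integral>\<^sup>+s. ennreal (?g s) * indicator {0<..<1} s \<partial>lborel)"
      unfolding unit_interval_def by (rule nn_integral_restrict_space) simp
    also have "\<dots> = ennreal (Beta (1 - a) a)" by (rule nn_integral_has_integral_lebesgue'[OF _ I]) auto
    finally show ?thesis unfolding B .
  qed
  have m: "?g \<in> borel_measurable unit_interval" by (intro borel_unit_interval) measurable
  show "integrable unit_interval ?g"
  proof (rule integrableI_nonneg[OF m])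
    show "(\<integral>\<^sup>+s. ennreal (?g s) \<partial>unit_interval) < \<infinity>" unfolding nn by simp
  qed simp
  show "(LINT s|unit_interval. ?g s) = pi / sin (pi * a)"
  proof (subst integral_eq_nn_integral[OF m])
    show "enn2real (\<integral>\<^sup>+s. ennreal (?g s) \<partial>unit_interval) = pi / sin (pi * a)"
      unfolding nn using pos by (rule enn2real_ennreal)
  qed simp
qed

definition ui_log :: "real \<Rightarrow> real" where
  "ui_log s = 1 / (2 * pi) * ln (1 / s - 1)"

lemma ui_log_measurable [measurable]: "ui_log \<in> borel_measurable borel"
  unfolding ui_log_def [abs_def] by measurable

lemma exp_ui_log:
  assumes "0 < s" "s < 1"
  shows "exp (c * ui_log s) = (1 / s - 1) powr (c / (2 * pi))"
proof -
  have "1 / s - 1 > 0" using assms by (simp add: field_simps)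
  hence "1 / s - 1 \<noteq> 0" by linarith
  thus ?thesis unfolding powr_def ui_log_def by simp
qed

section \<open>The basis h0 and its generating function\<close>

context mp_param
begin

definition kap :: "real \<Rightarrow> real" where
  "kap s = sqrt (sin \<beta> / pi) * (1 / s - 1) powr (\<beta> / (2 * pi)) * (1 - s) powr (- 1 / 2)"

definition h0 :: "nat \<Rightarrow> real \<Rightarrow> complex" where
  "h0 n s = of_real (kap s) * mp_coeff n (ui_log s) \<beta>"

text \<open>Closed form of the generating function of the \<open>h0 n\<close> at real
  \<open>q\<close>. In it \<open>q\<close> enters the dependence on \<open>s\<close> only through
  the exponent \<open>mp_b q\<close>, so products of two of them stay within Beta integrals.\<close>

definition gen_h :: "real \<Rightarrow> real \<Rightarrow> real" where
  "gen_h q s = sqrt (2 * d / pi) * (1 - s) powr (- 1 / 2) * (1 / s - 1) powr (mp_b q / pi) * (cos (mp_b q) / (1 - q))"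

lemma h_fun_h0: "h_fun \<alpha> \<beta> n s = exp (\<i> * of_nat n * of_real \<alpha>) * h0 n s"
  unfolding h_fun_def h0_def kap_def ui_log_def meixner_pollaczek_half by (simp only: mult.assoc)

lemma kap_measurable [measurable]: "kap \<in> borel_measurable borel"
  unfolding kap_def [abs_def] by measurable

lemma h0_measurable [measurable]: "h0 n \<in> borel_measurable borel"
  unfolding h0_def [abs_def] by measurable

lemma gen_h_measurable [measurable]: "gen_h q \<in> borel_measurable borel"
  unfolding gen_h_def [abs_def] by measurable

lemma sin_beta_pos: "sin \<beta> > 0"
  using \<beta> by (simp add: sin_gt_zero)

lemma kap_pos: "0 < s \<Longrightarrow> s < 1 \<Longrightarrow> kap s > 0"
  using sin_beta_pos by (simp add: kap_def)

lemma cnj_h0 [simp]: "cnj (h0 n s) = h0 n s"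
  by (simp add: h0_def cnj_mp_coeff)

lemma gen_h_kap:
  assumes s: "0 < s" "s < 1" and q: "\<bar>q\<bar> < 1"
  shows "gen_h q s = kap s * (cos (mp_b q) / ((1 - q) * cos (\<beta> / 2)) * exp (2 * ui_log s * (mp_b q - \<beta> / 2)))"
proof -
  have "exp (2 * ui_log s * (mp_b q - \<beta> / 2)) = exp (2 * (mp_b q - \<beta> / 2) * ui_log s)" by (simp only: mult_ac)
  also have "\<dots> = (1 / s - 1) powr ((mp_b q - \<beta> / 2) / pi)" 
  proof -
    have "2 * (mp_b q - \<beta> / 2) / (2 * pi) = (mp_b q - \<beta> / 2) / pi" by (simp add: field_simps)
    thus ?thesis unfolding exp_ui_log[OF s] by (simp only:)
  qed
  finally have e: "exp (2 * ui_log s * (mp_b q - \<beta> / 2)) = (1 / s - 1) powr ((mp_b q - \<beta> / 2) / pi)" .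
  have p: "(1 / s - 1) powr (\<beta> / (2 * pi)) * (1 / s - 1) powr ((mp_b q - \<beta> / 2) / pi) = (1 / s - 1) powr (mp_b q / pi)"
    unfolding powr_add[symmetric] by (simp add: diff_divide_distrib)
  have "sqrt (sin \<beta> / pi) = sqrt ((2 * d / pi) * (cos (\<beta> / 2))\<^sup>2)" unfolding sin_beta by simp
  hence r: "sqrt (sin \<beta> / pi) = sqrt (2 * d / pi) * cos (\<beta> / 2)"
    using cos_half_pos unfolding real_sqrt_mult by simp
  have "kap s * (cos (mp_b q) / ((1 - q) * cos (\<beta> / 2)) * exp (2 * ui_log s * (mp_b q - \<beta> / 2)))
    = sqrt (2 * d / pi) * (1 - s) powr (- 1 / 2) * ((1 / s - 1) powr (\<beta> / (2 * pi)) * (1 / s - 1) powr ((mp_b q - \<beta> / 2) / pi))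
      * (cos (\<beta> / 2) * (cos (mp_b q) / ((1 - q) * cos (\<beta> / 2))))"
    unfolding kap_def r e by (simp only: mult_ac)
  also have "cos (\<beta> / 2) * (cos (mp_b q) / ((1 - q) * cos (\<beta> / 2))) = cos (mp_b q) / (1 - q)"
    using cos_half_pos by simp
  finally show ?thesis unfolding p gen_h_def by (rule sym)
qed

lemma h0_sums:
  assumes s: "0 < s" "s < 1" and q: "\<bar>q\<bar> < 1"
  shows "(\<lambda>n. h0 n s * of_real q ^ n) sums of_real (gen_h q s)"
  using sums_mult[OF mp_coeff_sums_real[OF q, of "ui_log s"], of "of_real (kap s)"]
  unfolding gen_h_kap[OF s q] h0_def of_real_mult[of "kap s"] mult.assoc .

text \<open>Small enough that beta + 2 L0 and beta - 2 L0 both lie strictly between 0 and pi; after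
  division by pi these are the exponents allowed in \<open>beta_integral\<close>.\<close>

definition L0 :: real where "L0 = min \<beta> (pi - \<beta>) / 4"

text \<open>Chosen so that the bound (1 - r0)^(-(1 + 2 |x|)) of the coefficient sums equals exp L0
  exp (2 L0 |x|).\<close>

definition r0 :: real where "r0 = 1 - exp (- L0)"

definition h_bound :: "real \<Rightarrow> real" where
  "h_bound s = kap s * exp L0 * exp (2 * L0 * \<bar>ui_log s\<bar>)"

lemma L0_pos: "L0 > 0" and r0: "0 < r0" "r0 < 1"
  using \<beta> by (simp_all add: L0_def r0_def)

lemma h_bound_measurable [measurable]: "h_bound \<in> borel_measurable borel"
  unfolding h_bound_def [abs_def] by measurable

lemma h0_abs_sum:
  assumes s: "0 < s" "s < 1" and q: "\<bar>q\<bar> \<le> r0"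
  shows "(\<Sum>n<N. norm (h0 n s * of_real q ^ n)) \<le> h_bound s"
proof -
  have "(\<Sum>n<N. norm (h0 n s * of_real q ^ n)) = kap s * (\<Sum>n<N. norm (mp_coeff n (ui_log s) \<beta>) * \<bar>q\<bar> ^ n)"
    unfolding sum_distrib_left using kap_pos[OF s] by (simp add: h0_def norm_mult norm_power mult.assoc)
  also have "(\<Sum>n<N. norm (mp_coeff n (ui_log s) \<beta>) * \<bar>q\<bar> ^ n) \<le> (\<Sum>n<N. norm (mp_coeff n (ui_log s) \<beta>) * r0 ^ n)"
    using q by (intro sum_mono mult_left_mono power_mono) auto
  also have "\<dots> \<le> (1 - r0) powr (- (1 + 2 * \<bar>ui_log s\<bar>))"
    using r0 by (intro mp_coeff_abs_bound) auto
  also have "\<dots> = exp L0 * exp (2 * L0 * \<bar>ui_log s\<bar>)"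
    unfolding r0_def exp_add[symmetric] by (simp add: powr_def algebra_simps)
  finally show ?thesis using kap_pos[OF s] unfolding h_bound_def by (simp add: mult.assoc mult_left_mono)
qed

text \<open>Squaring produces exp (4 L0 |x|) at x = \<open>ui_log s\<close>, which is at most the
  sum of the exponentials of 4 L0 x and - 4 L0 x. Each of these is a power of 1/s - 1, so two
  convergent Beta integrals majorise.\<close>

lemma h_bound_sqi: "square_integrable unit_interval (\<lambda>s. of_real (h_bound s))"
proof (rule sqi_bound)
  show "(\<lambda>s. complex_of_real (h_bound s)) \<in> borel_measurable unit_interval" by (intro borel_unit_interval) measurable
  let ?p = "\<lambda>c s. (1 / s - 1) powr ((\<beta> + c) / pi) * (1 - s) powr (- 1)"
  let ?C = "sin \<beta> / pi * exp (2 * L0)"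
  have "0 < (\<beta> + 2 * L0) / pi" "(\<beta> + 2 * L0) / pi < 1" "0 < (\<beta> + - 2 * L0) / pi" "(\<beta> + - 2 * L0) / pi < 1"
    using \<beta> by (auto simp: L0_def min_def field_simps)
  thus "integrable unit_interval (\<lambda>s. ?C * (?p (2 * L0) s + ?p (- 2 * L0) s))"
    by (intro integrable_mult_right Bochner_Integration.integrable_add beta_integral(1))
  show "AE s in unit_interval. (cmod (of_real (h_bound s)))\<^sup>2 \<le> ?C * (?p (2 * L0) s + ?p (- 2 * L0) s)"
  proof (rule AE_I2)
    fix s assume "s \<in> space unit_interval"
    hence s: "0 < s" "s < 1" by auto
    have y: "1 / s - 1 > 0" using s by (simp add: field_simps)
    have k: "(kap s)\<^sup>2 = sin \<beta> / pi * ((1 / s - 1) powr (\<beta> / pi) * (1 - s) powr (- 1))"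
    proof -
      have "((1 / s - 1) powr (\<beta> / (2 * pi)))\<^sup>2 = (1 / s - 1) powr (\<beta> / pi)"
        unfolding power2_eq_square powr_add[symmetric] by simp
      moreover have "((1 - s) powr (- 1 / 2))\<^sup>2 = (1 - s) powr (- 1)"
        unfolding power2_eq_square powr_add[symmetric] by simp
      moreover have "(sqrt (sin \<beta> / pi))\<^sup>2 = sin \<beta> / pi" using sin_beta_pos by (intro real_sqrt_pow2) auto
      ultimately show ?thesis unfolding kap_def power_mult_distrib by simp
    qed
    have e: "(exp (2 * L0 * \<bar>ui_log s\<bar>))\<^sup>2 \<le> (1 / s - 1) powr (2 * L0 / pi) + (1 / s - 1) powr (- 2 * L0 / pi)"
    proof -
      have "(exp (2 * L0 * \<bar>ui_log s\<bar>))\<^sup>2 = exp (4 * L0 * \<bar>ui_log s\<bar>)" unfolding power2_eq_square exp_add[symmetric] by simp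
      also have "\<dots> \<le> exp (4 * L0 * ui_log s) + exp (- 4 * L0 * ui_log s)" by (cases "ui_log s \<ge> 0") auto
      also have "\<dots> = (1 / s - 1) powr (2 * L0 / pi) + (1 / s - 1) powr (- 2 * L0 / pi)"
        unfolding exp_ui_log[OF s] by simp
      finally show ?thesis .
    qed
    have "(cmod (of_real (h_bound s)))\<^sup>2 = (kap s)\<^sup>2 * exp (2 * L0) * (exp (2 * L0 * \<bar>ui_log s\<bar>))\<^sup>2"
    proof -
      have "(exp L0)\<^sup>2 = exp (2 * L0)" unfolding power2_eq_square exp_add[symmetric] by simp
      thus ?thesis unfolding norm_of_real power2_abs h_bound_def power_mult_distrib by simp
    qed
    also have "\<dots> \<le> (kap s)\<^sup>2 * exp (2 * L0) * ((1 / s - 1) powr (2 * L0 / pi) + (1 / s - 1) powr (- 2 * L0 / pi))"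
      using e by (intro mult_left_mono) auto
    also have "\<dots> = ?C * (?p (2 * L0) s + ?p (- 2 * L0) s)"
      unfolding k by (simp add: powr_add add_divide_distrib algebra_simps diff_divide_distrib powr_diff powr_minus divide_inverse)
    finally show "(cmod (of_real (h_bound s)))\<^sup>2 \<le> ?C * (?p (2 * L0) s + ?p (- 2 * L0) s)" .
  qed
qed

lemma h0_sqi: "square_integrable unit_interval (h0 n)"
proof (rule sqi_bound)
  show "h0 n \<in> borel_measurable unit_interval" by (intro borel_unit_interval) measurable
  show "integrable unit_interval (\<lambda>s. (1 / r0 ^ n)\<^sup>2 * (cmod (of_real (h_bound s)))\<^sup>2)"
    by (intro integrable_mult_right sqi_integrable h_bound_sqi)
  show "AE s in unit_interval. (cmod (h0 n s))\<^sup>2 \<le> (1 / r0 ^ n)\<^sup>2 * (cmod (of_real (h_bound s)))\<^sup>2"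
  proof (rule AE_I2)
    fix s assume "s \<in> space unit_interval"
    hence s: "0 < s" "s < 1" by auto
    have "norm (h0 n s * of_real r0 ^ n) \<le> (\<Sum>n<Suc n. norm (h0 n s * of_real r0 ^ n))" by (simp add: sum_nonneg)
    also have "\<dots> \<le> h_bound s" using r0 by (intro h0_abs_sum s) auto
    finally have "cmod (h0 n s) * r0 ^ n \<le> h_bound s" using r0 by (simp add: norm_mult norm_power)
    hence "cmod (h0 n s) \<le> 1 / r0 ^ n * h_bound s" using r0 by (simp add: field_simps)
    also have "\<dots> \<le> 1 / r0 ^ n * cmod (of_real (h_bound s))" using r0 by (intro mult_left_mono) auto
    finally have "cmod (h0 n s) \<le> 1 / r0 ^ n * cmod (of_real (h_bound s))" .
    from power_mono[OF this norm_ge_zero, of 2] show "(cmod (h0 n s))\<^sup>2 \<le> (1 / r0 ^ n)\<^sup>2 * (cmod (of_real (h_bound s)))\<^sup>2"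
      unfolding power_mult_distrib .
  qed
qed

text \<open>Termwise integration, dominated by \<open>norm (f s) * h_bound s\<close>, which is
  integrable as a product of two square integrable functions.\<close>

lemma h0_expansion:
  assumes f: "square_integrable unit_interval f" and q: "\<bar>q\<bar> < r0"
  shows "(\<lambda>n. (LINT s|unit_interval. f s * h0 n s) * of_real q ^ n) sums (LINT s|unit_interval. f s * of_real (gen_h q s))"
proof -
  have [measurable]: "f \<in> borel_measurable unit_interval" by (rule sqi_measurable[OF f])
  have h [measurable]: "h0 n \<in> borel_measurable unit_interval" "gen_h q \<in> borel_measurable unit_interval" for n
    by (intro borel_unit_interval, measurable)+
  have "(\<lambda>n. LINT s|unit_interval. f s * (h0 n s * of_real q ^ n)) sums (LINT s|unit_interval. f s * of_real (gen_h q s))"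
  proof (rule sums_integral_dominated(3))
    show "AE s in unit_interval. (\<lambda>n. f s * (h0 n s * of_real q ^ n)) sums (f s * of_real (gen_h q s))"
      using q r0 by (intro AE_I2 sums_mult h0_sums) auto
    show "integrable unit_interval (\<lambda>s. norm (f s * of_real (h_bound s)))"
      by (intro integrable_norm sqi_mult_integrable f h_bound_sqi)
    show "AE s in unit_interval. \<forall>N. (\<Sum>n<N. norm (f s * (h0 n s * of_real q ^ n))) \<le> norm (f s * of_real (h_bound s))"
    proof (intro AE_I2 allI)
      fix s N assume "s \<in> space unit_interval"
      hence s: "0 < s" "s < 1" by auto
      have "(\<Sum>n<N. norm (f s * (h0 n s * of_real q ^ n))) = norm (f s) * (\<Sum>n<N. norm (h0 n s * of_real q ^ n))"
        by (simp only: norm_mult sum_distrib_left)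
      also have "\<dots> \<le> norm (f s) * h_bound s" using q by (intro mult_left_mono h0_abs_sum s) auto
      also have "\<dots> \<le> norm (f s * of_real (h_bound s))" unfolding norm_mult by (intro mult_left_mono) auto
      finally show "(\<Sum>n<N. norm (f s * (h0 n s * of_real q ^ n))) \<le> norm (f s * of_real (h_bound s))" .
    qed
  qed measurable
  moreover have "(LINT s|unit_interval. f s * (h0 n s * of_real q ^ n)) = (LINT s|unit_interval. f s * h0 n s) * of_real q ^ n" for n
    unfolding mult.assoc[symmetric] by (rule Bochner_Integration.integral_mult_left_zero)
  ultimately show ?thesis by simp
qed

lemma gen_h_sqi:
  assumes q: "\<bar>q\<bar> < r0"
  shows "square_integrable unit_interval (\<lambda>s. of_real (gen_h q s))"
proof (rule sqi_bound[OF _ sqi_integrable[OF h_bound_sqi]])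
  show "(\<lambda>s. complex_of_real (gen_h q s)) \<in> borel_measurable unit_interval" by (intro borel_unit_interval) measurable
  show "AE s in unit_interval. (cmod (of_real (gen_h q s)))\<^sup>2 \<le> (cmod (of_real (h_bound s)))\<^sup>2"
  proof (rule AE_I2)
    fix s assume "s \<in> space unit_interval"
    hence s: "0 < s" "s < 1" by auto
    have "\<bar>q\<bar> < 1" using q r0 by simp
    from tendsto_norm[OF h0_sums[OF s this, unfolded sums_def]]
    have "cmod (of_real (gen_h q s)) \<le> h_bound s"
    proof (rule LIMSEQ_le_const2, intro exI allI impI)
      fix N :: nat
      show "norm (\<Sum>n<N. h0 n s * of_real q ^ n) \<le> h_bound s"
        using h0_abs_sum[OF s, of q N] q norm_sum[of "\<lambda>n. h0 n s * of_real q ^ n" "{..<N}"] by linarith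
    qed
    hence "cmod (of_real (gen_h q s)) \<le> cmod (of_real (h_bound s))" by simp
    thus "(cmod (of_real (gen_h q s)))\<^sup>2 \<le> (cmod (of_real (h_bound s)))\<^sup>2" by (intro power_mono) auto
  qed
qed

text \<open>The exponents add up, so one Beta integral remains, with value pi / sin (mp_b p + mp_b
  q). The addition theorem turns this sine into a multiple of \<open>mp_w p + mp_w q\<close>, and
  the cosines cancel. The result 1 / (1 - p q) is the generating function of the Kronecker
  delta.\<close>

lemma gen_h_integral:
  assumes p: "\<bar>p\<bar> < 1" and q: "\<bar>q\<bar> < 1"
  shows "(LINT s|unit_interval. gen_h p s * gen_h q s) = 1 / (1 - p * q)"
proof -
  let ?a = "(mp_b p + mp_b q) / pi" and ?C = "2 * d / pi * (cos (mp_b p) / (1 - p) * (cos (mp_b q) / (1 - q)))"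
  have a: "0 < ?a" "?a < 1" using mp_b_bounds[of p] mp_b_bounds[of q] p q by (auto simp: field_simps)
  have e: "gen_h p s * gen_h q s = ?C * ((1 / s - 1) powr ?a * (1 - s) powr (- 1))" for s
  proof -
    have 1: "sqrt (2 * d / pi) * sqrt (2 * d / pi) = 2 * d / pi" using d_pos by simp
    have 2: "(1 - s) powr (- 1 / 2) * (1 - s) powr (- 1 / 2) = (1 - s) powr (- 1)" unfolding powr_add[symmetric] by simp
    have 3: "(1 / s - 1) powr (mp_b p / pi) * (1 / s - 1) powr (mp_b q / pi) = (1 / s - 1) powr ?a"
      unfolding powr_add[symmetric] by (simp add: add_divide_distrib)
    have "gen_h p s * gen_h q s = (sqrt (2 * d / pi) * sqrt (2 * d / pi)) * ((1 - s) powr (- 1 / 2) * (1 - s) powr (- 1 / 2))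
      * ((1 / s - 1) powr (mp_b p / pi) * (1 / s - 1) powr (mp_b q / pi)) * (cos (mp_b p) / (1 - p) * (cos (mp_b q) / (1 - q)))"
      unfolding gen_h_def by (simp only: mult_ac)
    thus ?thesis unfolding 1 2 3 by (simp only: mult_ac)
  qed
  have "(LINT s|unit_interval. gen_h p s * gen_h q s) = ?C * (pi / sin (pi * ?a))"
    unfolding e Bochner_Integration.integral_mult_right_zero beta_integral(2)[OF a] ..
  also have "pi * ?a = mp_b p + mp_b q" by simp
  also have "sin (mp_b p + mp_b q) = cos (mp_b p) * cos (mp_b q) * (mp_w p + mp_w q)"
    unfolding sin_add sin_mp_b by (simp add: algebra_simps)
  also have "?C * (pi / (cos (mp_b p) * cos (mp_b q) * (mp_w p + mp_w q))) = 2 * d / ((1 - p) * (1 - q) * (mp_w p + mp_w q))"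
    using mp_b_bounds(3)[of p] mp_b_bounds(3)[of q] by simp
  also have "(1 - p) * (1 - q) * (mp_w p + mp_w q) = 2 * d * (1 - p * q)"
  proof -
    have w: "(1 - p) * mp_w p = d * (1 + p)" "(1 - q) * mp_w q = d * (1 + q)" using p q by (simp_all add: mp_w_def)
    have "(1 - p) * (1 - q) * (mp_w p + mp_w q) = ((1 - p) * mp_w p) * (1 - q) + (1 - p) * ((1 - q) * mp_w q)"
      by (simp only: distrib_left mult_ac)
    thus ?thesis unfolding w by (simp add: algebra_simps)
  qed
  also have "2 * d / (2 * d * (1 - p * q)) = 1 / (1 - p * q)" using d_pos by simp
  finally show ?thesis .
qed

lemma h0_orthonormal: "orthonormal_seq unit_interval h0"
  unfolding orthonormal_seq_def
proof (intro conjI allI h0_sqi)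
  fix m n
  \<comment> \<open>Orthonormality by comparing coefficients twice: here in \<open>q\<close> with
    \<open>p\<close> fixed, afterwards in \<open>p\<close>.\<close>
  have 1: "(LINT s|unit_interval. of_real (gen_h p s) * h0 n s) = of_real p ^ n" if p: "\<bar>p\<bar> < r0" for p n
  proof (rule powser_unique[OF r0(1), where n = n and b = "\<lambda>n. of_real p ^ n" and
        a = "\<lambda>n. LINT s|unit_interval. of_real (gen_h p s) * h0 n s"])
    fix q assume q: "\<bar>q\<bar> < r0"
    have pq: "\<bar>p\<bar> < 1" "\<bar>q\<bar> < 1" using p q r0 by auto
    have "(LINT s|unit_interval. of_real (gen_h p s) * of_real (gen_h q s)) = complex_of_real (1 / (1 - p * q))"
      unfolding of_real_mult[symmetric] integral_complex_of_real gen_h_integral[OF pq] ..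
    with h0_expansion[OF gen_h_sqi[OF p] q]
    show "(\<lambda>n. (LINT s|unit_interval. of_real (gen_h p s) * h0 n s) * of_real q ^ n) sums of_real (1 / (1 - p * q))" by simp
    have "\<bar>p * q\<bar> < 1" unfolding abs_mult using mult_strict_mono[of "\<bar>p\<bar>" 1 "\<bar>q\<bar>" 1] pq by simp
    hence "norm (complex_of_real (p * q)) < 1" unfolding norm_of_real .
    from geometric_sums[OF this]
    show "(\<lambda>n. of_real p ^ n * of_real q ^ n) sums complex_of_real (1 / (1 - p * q))"
      by (simp add: power_mult_distrib)
  qed
  have "(LINT s|unit_interval. h0 n s * h0 m s) = of_bool (m = n)"
  proof (rule powser_unique[OF r0(1), where n = m and b = "\<lambda>m. of_bool (m = n)" and
        a = "\<lambda>m. LINT s|unit_interval. h0 n s * h0 m s"])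
    fix p assume p: "\<bar>p\<bar> < r0"
    have "(LINT s|unit_interval. h0 n s * of_real (gen_h p s)) = of_real p ^ n"
      using 1[OF p, of n] by (simp add: mult.commute)
    with h0_expansion[OF h0_sqi p, of n]
    show "(\<lambda>m. (LINT s|unit_interval. h0 n s * h0 m s) * of_real p ^ m) sums of_real p ^ n" by simp
    have "(\<lambda>m. if m = n then complex_of_real p ^ m else 0) sums of_real p ^ n" by (rule sums_single)
    also have "(\<lambda>m. if m = n then complex_of_real p ^ m else 0) = (\<lambda>m. of_bool (m = n) * of_real p ^ m)" by auto
    finally show "(\<lambda>m. of_bool (m = n) * of_real p ^ m) sums complex_of_real p ^ n" .
  qed
  thus "ip unit_interval (h0 m) (h0 n) = of_bool (m = n)"
    by (simp add: ip_def mult.commute)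
qed

text \<open>Near q = 0 the exponent l = 2 \<open>mp_b q\<close> - \<open>\<beta>\<close> fills a
  neighbourhood of 0. Vanishing of all coefficients thus becomes vanishing of a Laplace transform on
  an interval.\<close>

lemma gen_parameter:
  obtains \<delta> where "\<delta> > 0" "\<And>l. \<bar>l\<bar> < \<delta> \<Longrightarrow> \<exists>q. \<bar>q\<bar> < r0 \<and> mp_b q = \<beta> / 2 + l / 2"
proof -
  \<comment> \<open>Solution for \<open>q\<close> of \<open>mp_w q\<close> = tan (beta / 2 + l /
    2).\<close>
  define Q where "Q l = (tan (\<beta> / 2 + l / 2) - d) / (tan (\<beta> / 2 + l / 2) + d)" for l :: real
  have c: "cos (\<beta> / 2 + 0 / 2) \<noteq> 0" using cos_half_pos by simp
  have "isCont (\<lambda>l. \<beta> / 2 + l / 2) (0::real)" by (intro continuous_intros) simp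
  from isCont_tan'[OF this c] have t: "isCont (\<lambda>l. tan (\<beta> / 2 + l / 2)) 0" .
  have "isCont Q 0" unfolding Q_def using d_pos by (intro continuous_intros t) (simp add: d_def)
  moreover have Q0: "Q 0 = 0" by (simp add: Q_def d_def)
  ultimately have "Q \<midarrow>0\<rightarrow> 0" by (simp add: isCont_def)
  from LIM_D[OF this r0(1)] obtain \<delta>1 where \<delta>1: "\<delta>1 > 0" "\<And>l. l \<noteq> 0 \<Longrightarrow> norm l < \<delta>1 \<Longrightarrow> norm (Q l) < r0"
    by auto
  \<comment> \<open>The second bound keeps beta / 2 + l / 2 inside ]0, pi/2[, where
    \<open>arctan\<close> inverts \<open>tan\<close>.\<close>
  define \<delta> where "\<delta> = min \<delta>1 (min \<beta> (pi - \<beta>))"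
  show ?thesis
  proof (rule that)
    show "\<delta> > 0" using \<delta>1 \<beta> by (simp add: \<delta>_def)
    fix l assume l: "\<bar>l\<bar> < \<delta>"
    have q: "\<bar>Q l\<bar> < r0" using \<delta>1(2)[of l] l Q0 r0 by (cases "l = 0") (auto simp: \<delta>_def)
    define x where "x = \<beta> / 2 + l / 2"
    have x: "0 < x" "x < pi / 2" using l by (auto simp: \<delta>_def x_def abs_less_iff)
    have W: "tan x > 0" using x by (intro tan_gt_zero)
    have "1 + Q l = 2 * tan x / (tan x + d)" "1 - Q l = 2 * d / (tan x + d)"
      using W d_pos by (simp_all add: Q_def x_def[symmetric] field_simps)
    hence "mp_w (Q l) = tan x" using W d_pos by (simp add: mp_w_def)
    hence "mp_b (Q l) = x" using x by (simp add: mp_b_def arctan_tan)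
    thus "\<exists>q. \<bar>q\<bar> < r0 \<and> mp_b q = \<beta> / 2 + l / 2" using q x_def by blast
  qed
qed

text \<open>If all coefficients vanish, so does the integral of \<open>f\<close> against
  \<open>gen_h q\<close>, which up to a constant is the Laplace transform of \<open>f * kap\<close>
  in the variable \<open>ui_log\<close>. Its Taylor coefficients at 0 are the moments in
  \<open>ui_log\<close>, and \<open>moments_unique\<close> applies with rate 2
  \<open>L0\<close>.\<close>

lemma h0_complete:
  assumes f: "square_integrable unit_interval f" and z: "\<And>n. (LINT s|unit_interval. f s * h0 n s) = 0"
  shows "AE s in unit_interval. f s = 0"
proof -
  have [measurable]: "f \<in> borel_measurable unit_interval" by (rule sqi_measurable[OF f])
  have [measurable]: "kap \<in> borel_measurable unit_interval" "ui_log \<in> borel_measurable unit_interval"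
    by (intro borel_unit_interval, measurable)+
  define F where "F s = f s * of_real (kap s)" for s
  have F [measurable]: "F \<in> borel_measurable unit_interval" unfolding F_def [abs_def] by measurable
  have int: "integrable unit_interval (\<lambda>s. norm (F s) * exp (2 * L0 * \<bar>ui_log s\<bar>))"
  proof -
    have "integrable unit_interval (\<lambda>s. exp (- L0) * norm (f s * of_real (h_bound s)))"
      by (intro integrable_mult_right integrable_norm sqi_mult_integrable f h_bound_sqi)
    moreover have "exp (- L0) * norm (f s * of_real (h_bound s)) = norm (F s) * exp (2 * L0 * \<bar>ui_log s\<bar>)" for s
      by (simp add: F_def h_bound_def norm_mult abs_mult exp_minus)
    ultimately show ?thesis by simp
  qed
  obtain \<delta> where \<delta>: "\<delta> > 0" "\<And>l. \<bar>l\<bar> < \<delta> \<Longrightarrow> \<exists>q. \<bar>q\<bar> < r0 \<and> mp_b q = \<beta> / 2 + l / 2"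
    using gen_parameter by blast
  have E: "(LINT s|unit_interval. F s * of_real (exp (l * ui_log s))) = 0" if l: "\<bar>l\<bar> < \<delta>" for l
  proof -
    obtain q where q: "\<bar>q\<bar> < r0" "mp_b q = \<beta> / 2 + l / 2" using \<delta>(2)[OF l] by blast
    have q1: "\<bar>q\<bar> < 1" using q r0 by simp
    define C where "C = cos (mp_b q) / ((1 - q) * cos (\<beta> / 2))"
    have C: "C \<noteq> 0" using mp_b_bounds(3)[of q] cos_half_pos q1 by (auto simp: C_def)
    have "(\<lambda>n. (LINT s|unit_interval. f s * h0 n s) * of_real q ^ n) sums 0" by (simp add: z)
    from sums_unique2[OF h0_expansion[OF f q(1)] this]
    have "0 = (LINT s|unit_interval. f s * of_real (gen_h q s))" by simp
    also have "\<dots> = (LINT s|unit_interval. of_real C * (F s * of_real (exp (l * ui_log s))))"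
    proof (rule Bochner_Integration.integral_cong[OF refl])
      fix s assume "s \<in> space unit_interval"
      hence s: "0 < s" "s < 1" by auto
      have "2 * ui_log s * (mp_b q - \<beta> / 2) = l * ui_log s" by (simp add: q(2))
      hence "gen_h q s = kap s * (C * exp (l * ui_log s))" unfolding gen_h_kap[OF s q1] C_def by simp
      thus "f s * of_real (gen_h q s) = of_real C * (F s * of_real (exp (l * ui_log s)))"
        unfolding F_def by (simp only: of_real_mult mult_ac)
    qed
    also have "\<dots> = of_real C * (LINT s|unit_interval. F s * of_real (exp (l * ui_log s)))"
      by (rule Bochner_Integration.integral_mult_right_zero)
    finally show ?thesis using C by simp
  qed
  define \<rho> where "\<rho> = min \<delta> (2 * L0)"
  have \<rho>: "\<rho> > 0" using \<delta> L0_pos by (simp add: \<rho>_def)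
  \<comment> \<open>The radius \<open>\<rho>\<close> ensures both that \<open>E\<close> is available
    and that the exponential series is dominated by \<open>int\<close>.\<close>
  have mom: "(LINT s|unit_interval. F s * of_real (ui_log s) ^ n) / fact n = 0" for n
  proof (rule powser_unique[OF \<rho>, where n = n and b = "\<lambda>n. 0" and
        a = "\<lambda>n. (LINT s|unit_interval. F s * of_real (ui_log s) ^ n) / fact n"])
    fix l assume l: "\<bar>l\<bar> < \<rho>"
    have "(\<lambda>n. LINT s|unit_interval. F s * of_real ((l * ui_log s) ^ n / fact n)) sums (LINT s|unit_interval. F s * of_real (exp (l * ui_log s)))"
    proof (rule sums_integral_dominated(3)[OF _ _ _ int])
      have "(\<lambda>n. (l * ui_log s) ^ n / fact n) sums exp (l * ui_log s)" for s
        using exp_converges[of "l * ui_log s"] by (simp add: divide_inverse mult.commute)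
      thus "AE s in unit_interval. (\<lambda>n. F s * of_real ((l * ui_log s) ^ n / fact n)) sums (F s * of_real (exp (l * ui_log s)))"
        by (intro AE_I2 sums_mult sums_of_real)
      show "AE s in unit_interval. \<forall>N. (\<Sum>n<N. norm (F s * of_real ((l * ui_log s) ^ n / fact n))) \<le> norm (F s) * exp (2 * L0 * \<bar>ui_log s\<bar>)"
      proof (intro AE_I2 allI)
        fix s N
        have "(\<Sum>n<N. norm (F s * of_real ((l * ui_log s) ^ n / fact n))) = norm (F s) * (\<Sum>n<N. \<bar>l * ui_log s\<bar> ^ n / fact n)"
          unfolding norm_mult norm_of_real sum_distrib_left by (simp add: power_abs)
        also have "\<dots> \<le> norm (F s) * exp \<bar>l * ui_log s\<bar>"
          by (intro mult_left_mono sum_pow_div_fact_le_exp) auto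
        also have "\<bar>l * ui_log s\<bar> \<le> 2 * L0 * \<bar>ui_log s\<bar>" unfolding abs_mult using l by (intro mult_right_mono) (auto simp: \<rho>_def)
        finally show "(\<Sum>n<N. norm (F s * of_real ((l * ui_log s) ^ n / fact n))) \<le> norm (F s) * exp (2 * L0 * \<bar>ui_log s\<bar>)"
          by (simp add: mult_left_mono)
      qed
    qed measurable
    moreover have "(LINT s|unit_interval. F s * of_real ((l * ui_log s) ^ n / fact n))
       = (LINT s|unit_interval. F s * of_real (ui_log s) ^ n) / fact n * of_real l ^ n" for n
    proof -
      have "(LINT s|unit_interval. F s * of_real ((l * ui_log s) ^ n / fact n))
        = (LINT s|unit_interval. (of_real l ^ n / fact n) * (F s * of_real (ui_log s) ^ n))"
        by (intro Bochner_Integration.integral_cong refl) (simp add: power_mult_distrib)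
      thus ?thesis unfolding Bochner_Integration.integral_mult_right_zero by simp
    qed
    ultimately show "(\<lambda>n. (LINT s|unit_interval. F s * of_real (ui_log s) ^ n) / fact n * of_real l ^ n) sums 0"
      using E[of l] l by (simp add: \<rho>_def)
    show "(\<lambda>n. 0 * complex_of_real l ^ n) sums 0" by simp
  qed
  have mom': "(LINT s|unit_interval. F s * of_real (ui_log s) ^ n) = 0" for n using mom[of n] by simp
  have e: "2 * L0 > 0" using L0_pos by simp
  \<comment> \<open>The logistic function inverts \<open>ui_log\<close>, and it maps every real into
    the open unit interval.\<close>
  have \<psi>: "(\<lambda>x. 1 / (1 + exp (2 * pi * x))) \<in> borel \<rightarrow>\<^sub>M unit_interval"
    unfolding unit_interval_def
  proof (rule measurable_restrict_space2)
    show "(\<lambda>x. 1 / (1 + exp (2 * pi * x))) \<in> space borel \<rightarrow> {0<..<1::real}"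
      by (auto simp: add_pos_pos)
  qed measurable
  have inv: "1 / (1 + exp (2 * pi * ui_log s)) = s" if "s \<in> space unit_interval" for s
  proof -
    have "0 < s" "1 / s - 1 > 0" using that by (auto simp: field_simps)
    thus ?thesis by (simp add: ui_log_def)
  qed
  have "AE s in unit_interval. F s = 0"
    by (rule moments_unique[OF F _ \<psi> inv int e mom']) measurable
  thus ?thesis using AE_space
  proof eventually_elim
    fix s assume "F s = 0" "s \<in> space unit_interval"
    thus "f s = 0" using kap_pos[of s] by (simp add: F_def)
  qed
qed

lemma h0_onb: "onb unit_interval h0"
  unfolding onb_def by (auto simp: h0_orthonormal ip_def intro!: h0_complete)

end

section \<open>A singular integral\<close>

definition sym_interval :: "real measure" where
  "sym_interval = restrict_space lborel {-1<..<1}"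

lemma space_sym_interval [simp]: "space sym_interval = {-1<..<1}"
  by (simp add: sym_interval_def space_restrict_space)

lemma borel_sym_interval: "f \<in> borel_measurable borel \<Longrightarrow> f \<in> borel_measurable sym_interval"
  unfolding sym_interval_def by (intro measurable_restrict_space1) simp

lemma integral_sym_interval: "(LINT u:{-1<..<1}|lborel. f u) = (LINT u|sym_interval. f u)"
  for f :: "real \<Rightarrow> complex"
  unfolding sym_interval_def set_lebesgue_integral_def by (subst integral_restrict_space) simp_all

definition arcsin_weight :: "real \<Rightarrow> real" where
  "arcsin_weight u = (1 - u\<^sup>2) powr (- 1 / 2)"

text \<open>At t = \<open>ui_log s\<close> this is the part of the integrand of
  \<open>q_plus s x\<close> that does not involve \<open>x\<close>.\<close>

definition osc_weight :: "real \<Rightarrow> real \<Rightarrow> complex" where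
  "osc_weight t u = of_real (arcsin_weight u) * iexp (t * ln ((1 - u) / (1 + u)))"

lemma arcsin_weight_measurable [measurable]: "arcsin_weight \<in> borel_measurable borel"
  unfolding arcsin_weight_def [abs_def] by measurable

lemma osc_weight_measurable [measurable]: "osc_weight t \<in> borel_measurable borel"
  unfolding osc_weight_def [abs_def] by measurable

lemma one_minus_sq_pos: "- 1 < u \<Longrightarrow> u < 1 \<Longrightarrow> 0 < 1 - (u::real)\<^sup>2"
  using abs_square_less_1[of u] by simp

lemma arcsin_weight_sqrt: "- 1 < u \<Longrightarrow> u < 1 \<Longrightarrow> arcsin_weight u = 1 / sqrt (1 - u\<^sup>2)"
proof -
  assume "- 1 < u" "u < 1"
  hence p: "0 \<le> 1 - u\<^sup>2" using one_minus_sq_pos[of u] by simp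
  have e: "- 1 / 2 = - (1 / 2 :: real)" by simp
  show ?thesis unfolding arcsin_weight_def e powr_minus powr_half_sqrt[OF p] by (rule inverse_eq_divide)
qed

lemma arcsin_weight_pos: "- 1 < u \<Longrightarrow> u < 1 \<Longrightarrow> arcsin_weight u > 0"
  using one_minus_sq_pos[of u] by (simp add: arcsin_weight_sqrt)

lemma norm_osc_weight: "norm (osc_weight t u) = arcsin_weight u"
  by (simp add: osc_weight_def norm_mult arcsin_weight_def)

lemma arcsin_weight_integral: "integrable sym_interval arcsin_weight" "(LINT u|sym_interval. arcsin_weight u) = pi"
proof -
  have lim: "(arcsin \<longlongrightarrow> arcsin x) (at x within {- 1..1})" if "x \<in> {- 1..1}" for x :: real
    using continuous_on_arcsin' that unfolding continuous_on_def by blast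
  have lims: "((arcsin \<circ> real_of_ereal) \<longlongrightarrow> - (pi / 2)) (at_right (ereal (- 1)))"
    "((arcsin \<circ> real_of_ereal) \<longlongrightarrow> pi / 2) (at_left (ereal 1))"
    unfolding ereal_tendsto_simps1 using lim[of "- 1"] lim[of 1]
    by (simp_all add: at_within_Icc_at_right at_within_Icc_at_left)
  have D: "DERIV arcsin u :> arcsin_weight u" if "ereal (- 1) < ereal u" "ereal u < ereal 1" for u
    using DERIV_arcsin[of u] that by (simp add: arcsin_weight_sqrt divide_inverse)
  have c: "isCont arcsin_weight u" if "ereal (- 1) < ereal u" "ereal u < ereal 1" for u
    unfolding arcsin_weight_def [abs_def] using one_minus_sq_pos[of u] that by (intro continuous_intros) auto
  have n: "AE u in lborel. ereal (- 1) < ereal u \<longrightarrow> ereal u < ereal 1 \<longrightarrow> 0 \<le> arcsin_weight u"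
    by (simp add: arcsin_weight_def)
  have l: "ereal (- 1) < ereal 1" by simp
  note 1 = interval_integral_FTC_nonneg[OF l D c n lims]
  show "integrable sym_interval arcsin_weight"
    using 1(1) unfolding sym_interval_def by (subst integrable_restrict_space) (simp_all add: set_integrable_def)
  show "(LINT u|sym_interval. arcsin_weight u) = pi"
    using 1(2) unfolding sym_interval_def
    by (subst integral_restrict_space) (simp_all add: interval_lebesgue_integral_def set_lebesgue_integral_def)
qed

lemma weight_integrable:
  assumes [measurable]: "g \<in> borel_measurable borel" and b: "\<And>u. - 1 < u \<Longrightarrow> u < 1 \<Longrightarrow> norm (g u) \<le> c"
  shows "integrable sym_interval (\<lambda>u. osc_weight t u * g u)"
proof (rule Bochner_Integration.integrable_bound)
  show "integrable sym_interval (\<lambda>u. c * arcsin_weight u)" by (intro integrable_mult_right arcsin_weight_integral)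
  show "(\<lambda>u. osc_weight t u * g u) \<in> borel_measurable sym_interval" by (intro borel_sym_interval) measurable
  show "AE u in sym_interval. norm (osc_weight t u * g u) \<le> norm (c * arcsin_weight u)"
  proof (rule AE_I2)
    fix u assume "u \<in> space sym_interval"
    hence u: "- 1 < u" "u < 1" by auto
    have "norm (osc_weight t u * g u) = norm (g u) * arcsin_weight u" by (simp add: norm_mult norm_osc_weight)
    also have "\<dots> \<le> c * arcsin_weight u" using b[OF u] arcsin_weight_pos[OF u] by (intro mult_right_mono) auto
    finally show "norm (osc_weight t u * g u) \<le> norm (c * arcsin_weight u)" by simp
  qed
qed

section \<open>The integral with a moving pole\<close>

lemma norm_ge_pole: "\<bar>w\<bar> \<le> norm (complex_of_real u - \<i> * of_real w)" "\<bar>u\<bar> \<le> norm (complex_of_real u - \<i> * of_real w)"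
  using abs_Im_le_cmod[of "complex_of_real u - \<i> * of_real w"] abs_Re_le_cmod[of "complex_of_real u - \<i> * of_real w"] by simp_all

lemma pole_nonzero: "w \<noteq> 0 \<Longrightarrow> complex_of_real u - \<i> * of_real w \<noteq> 0"
  by (simp add: complex_eq_iff)

definition pole_integral :: "real \<Rightarrow> real \<Rightarrow> complex" where
  "pole_integral t w = (LINT u|sym_interval. osc_weight t u * (1 / (of_real u - \<i> * of_real w)))"

lemma pole_integrable: "w \<noteq> 0 \<Longrightarrow> integrable sym_interval (\<lambda>u. osc_weight t u * (1 / (of_real u - \<i> * of_real w)))"
  by (rule weight_integrable[where c = "1 / \<bar>w\<bar>"])
    (auto simp: norm_divide intro!: divide_left_mono norm_ge_pole mult_pos_pos pole_nonzero)

text \<open>The reciprocal of the analytic continuation of \<open>osc_weight t\<close> to u = i w,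
  since there 1 - u^2 becomes 1 + w^2 and (1 - u) / (1 + u) becomes exp (- 2 i arctan w).\<close>

definition pole_factor :: "real \<Rightarrow> real \<Rightarrow> real" where
  "pole_factor t w = sqrt (1 + w\<^sup>2) * exp (- 2 * t * arctan w)"

lemma one_plus_sq_pos: "0 < 1 + (w::real)\<^sup>2"
  by (intro add_pos_nonneg) auto

lemma pole_factor_pos: "pole_factor t w > 0"
  using one_plus_sq_pos[of w] by (simp add: pole_factor_def)

lemma pole_factor_deriv: "(pole_factor t has_real_derivative pole_factor t w / (1 + w\<^sup>2) * (w - 2 * t)) (at w)"
proof -
  let ?S = "1 + w\<^sup>2"
  have S: "?S > 0" by (rule one_plus_sq_pos)
  have 1: "((\<lambda>w. sqrt (1 + w\<^sup>2)) has_real_derivative w / sqrt ?S) (at w)"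
  proof -
    have "((\<lambda>w. 1 + w\<^sup>2) has_real_derivative 2 * w) (at w)" by (auto intro!: derivative_eq_intros)
    note DERIV_chain2[OF DERIV_real_sqrt[OF S] this]
    moreover have "inverse X / 2 * (2 * w) = w / X" for X by (simp add: inverse_eq_divide)
    ultimately show ?thesis by (simp only:)
  qed
  have 2: "((\<lambda>w. exp (- 2 * t * arctan w)) has_real_derivative exp (- 2 * t * arctan w) * (- 2 * t * inverse ?S)) (at w)"
    by (auto intro!: derivative_eq_intros)
  have "(pole_factor t has_real_derivative w / sqrt ?S * exp (- 2 * t * arctan w) + exp (- 2 * t * arctan w) * (- 2 * t * inverse ?S) * sqrt ?S) (at w)"
    unfolding pole_factor_def [abs_def] by (rule DERIV_mult[OF 1 2])
  also have "w / sqrt ?S = sqrt ?S * w / ?S"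
  proof -
    have e: "w / q = q * w / (q * q)" if "q \<noteq> 0" for q :: real using that by simp
    have "w / sqrt ?S = sqrt ?S * w / (sqrt ?S * sqrt ?S)" by (rule e) (use S in simp)
    thus ?thesis by (simp only: real_sqrt_mult_self abs_of_pos[OF S])
  qed
  also have "sqrt ?S * w / ?S * exp (- 2 * t * arctan w) + exp (- 2 * t * arctan w) * (- 2 * t * inverse ?S) * sqrt ?S
     = pole_factor t w / ?S * (w - 2 * t)"
    by (simp add: pole_factor_def divide_inverse algebra_simps)
  finally show ?thesis .
qed

lemma pole_factor_bound: "pole_factor t w / (1 + w\<^sup>2) \<le> exp (pi * \<bar>t\<bar>)"
proof -
  have "- 2 * t * arctan w \<le> \<bar>- 2 * t * arctan w\<bar>" by (rule abs_ge_self)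
  also have "\<dots> = 2 * \<bar>arctan w\<bar> * \<bar>t\<bar>" by (simp add: abs_mult)
  also have "\<dots> \<le> pi * \<bar>t\<bar>" using arctan_bounded[of w] by (intro mult_right_mono) auto
  finally have 1: "exp (- 2 * t * arctan w) \<le> exp (pi * \<bar>t\<bar>)" by simp
  have "sqrt (1 + w\<^sup>2) \<le> 1 + w\<^sup>2"
  proof (rule real_le_lsqrt)
    have "1 * (1 + w\<^sup>2) \<le> (1 + w\<^sup>2) * (1 + w\<^sup>2)" by (intro mult_right_mono) auto
    thus "1 + w\<^sup>2 \<le> (1 + w\<^sup>2)\<^sup>2" unfolding power2_eq_square[of "1 + w\<^sup>2"] by simp
  qed simp
  hence "pole_factor t w \<le> (1 + w\<^sup>2) * exp (pi * \<bar>t\<bar>)"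
    unfolding pole_factor_def using 1 by (intro mult_mono) auto
  thus ?thesis using one_plus_sq_pos[of w] by (simp add: pos_divide_le_eq mult.commute)
qed

text \<open>The \<open>w\<close>-derivative of the integrand times \<open>pole_factor\<close> is a total \<open>u\<close>-derivative of a
  function that vanishes at \<open>u = -1\<close> and \<open>u = 1\<close>.\<close>

definition pole_primitive :: "real \<Rightarrow> real \<Rightarrow> real \<Rightarrow> complex" where
  "pole_primitive t w u = - \<i> * of_real (pole_factor t w / (1 + w\<^sup>2)) *
     (osc_weight t u * of_real (1 - u\<^sup>2) / (of_real u - \<i> * of_real w))"

definition pole_deriv :: "real \<Rightarrow> real \<Rightarrow> real \<Rightarrow> complex" where
  "pole_deriv t w u = of_real (pole_factor t w / (1 + w\<^sup>2)) * osc_weight t u *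
     (of_real (w - 2 * t) * (1 / (of_real u - \<i> * of_real w)) + \<i> * of_real (1 + w\<^sup>2) * (1 / (of_real u - \<i> * of_real w))\<^sup>2)"

lemma pole_deriv_w:
  assumes w: "w \<noteq> 0"
  shows "((\<lambda>w. of_real (pole_factor t w) * (osc_weight t u * (1 / (of_real u - \<i> * of_real w)))) has_vector_derivative pole_deriv t w u) (at w)"
proof -
  let ?z = "of_real u - \<i> * complex_of_real w"
  have z: "?z \<noteq> 0" by (rule pole_nonzero[OF w])
  have 1: "((\<lambda>w. complex_of_real (pole_factor t w)) has_vector_derivative of_real (pole_factor t w / (1 + w\<^sup>2) * (w - 2 * t))) (at w)"
    by (rule has_vector_derivative_of_real[OF pole_factor_deriv])
  have "((\<lambda>w. 1 / (of_real u - \<i> * w)) has_field_derivative \<i> * (1 / ?z)\<^sup>2) (at (of_real w))"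
    using z by (auto intro!: derivative_eq_intros simp: power2_eq_square)
  from has_vector_derivative_real_field[OF this]
  have 2: "((\<lambda>w. 1 / (of_real u - \<i> * of_real w)) has_vector_derivative \<i> * (1 / ?z)\<^sup>2) (at w)" .
  have 3: "((\<lambda>w. osc_weight t u * (1 / (of_real u - \<i> * of_real w))) has_vector_derivative osc_weight t u * (\<i> * (1 / ?z)\<^sup>2)) (at w)"
    by (rule has_vector_derivative_mult_right[OF 2])
  have "((\<lambda>w. of_real (pole_factor t w) * (osc_weight t u * (1 / (of_real u - \<i> * of_real w)))) has_vector_derivative
      of_real (pole_factor t w) * (osc_weight t u * (\<i> * (1 / ?z)\<^sup>2)) + of_real (pole_factor t w / (1 + w\<^sup>2) * (w - 2 * t)) * (osc_weight t u * (1 / ?z))) (at w)"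
    by (rule has_vector_derivative_mult[OF 1 3])
  also have "of_real (pole_factor t w) * (osc_weight t u * (\<i> * (1 / ?z)\<^sup>2)) + of_real (pole_factor t w / (1 + w\<^sup>2) * (w - 2 * t)) * (osc_weight t u * (1 / ?z)) = pole_deriv t w u"
  proof -
    have "pole_factor t w = pole_factor t w / (1 + w\<^sup>2) * (1 + w\<^sup>2)" using one_plus_sq_pos[of w] by simp
    hence e: "complex_of_real (pole_factor t w) = of_real (pole_factor t w / (1 + w\<^sup>2)) * of_real (1 + w\<^sup>2)"
      by (metis of_real_mult)
    show ?thesis unfolding pole_deriv_def of_real_mult[of "pole_factor t w / (1 + w\<^sup>2)"] distrib_left
      by (subst e) (simp only: mult_ac add.commute)
  qed
  finally show ?thesis .
qed

lemma osc_weight_deriv: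
  assumes u: "- 1 < u" "u < 1"
  shows "(osc_weight t has_vector_derivative osc_weight t u * ((of_real u - 2 * \<i> * of_real t) / of_real (1 - u\<^sup>2))) (at u)"
proof -
  have p: "1 - u\<^sup>2 > 0" by (rule one_minus_sq_pos[OF u])
  have 1: "(arcsin_weight has_real_derivative arcsin_weight u * (u / (1 - u\<^sup>2))) (at u)"
  proof -
    have "(arcsin_weight has_real_derivative (- 1 / 2) * (1 - u\<^sup>2) powr (- 1 / 2 - 1) * (- (2 * u))) (at u)"
      unfolding arcsin_weight_def [abs_def] using p by (auto intro!: derivative_eq_intros)
    also have "(1 - u\<^sup>2) powr (- 1 / 2 - 1) = arcsin_weight u / (1 - u\<^sup>2)"
      unfolding arcsin_weight_def powr_diff using p by simp
    also have "(- 1 / 2) * (arcsin_weight u / (1 - u\<^sup>2)) * (- (2 * u)) = arcsin_weight u * (u / (1 - u\<^sup>2))"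
    proof -
      have "(- 1 / 2) * (A / P) * (- (2 * u)) = A * (u / P)" for A P :: real by simp
      thus ?thesis .
    qed
    finally show ?thesis .
  qed
  have 2: "((\<lambda>u. t * ln ((1 - u) / (1 + u))) has_real_derivative t * (- 2 / (1 - u\<^sup>2))) (at u)"
  proof -
    have "((\<lambda>u. (1 - u) / (1 + u)) has_real_derivative - 2 / (1 + u)\<^sup>2) (at u)"
      using u by (auto intro!: derivative_eq_intros simp: power2_eq_square field_simps)
    from DERIV_ln_divide[THEN DERIV_chain2, OF _ this]
    have "((\<lambda>u. ln ((1 - u) / (1 + u))) has_real_derivative 1 / ((1 - u) / (1 + u)) * (- 2 / (1 + u)\<^sup>2)) (at u)"
      using u by simp
    also have "1 / ((1 - u) / (1 + u)) * (- 2 / (1 + u)\<^sup>2) = - 2 / ((1 - u) * (1 + u))"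
    proof -
      have gen: "1 / (A / B) * (- 2 / B\<^sup>2) = - 2 / (A * B)" if "A \<noteq> 0" "B \<noteq> 0" for A B :: real
        using that by (simp add: power2_eq_square)
      show ?thesis by (rule gen) (use u in auto)
    qed
    also have "(1 - u) * (1 + u) = 1 - u\<^sup>2" by (simp add: power2_eq_square algebra_simps)
    finally show ?thesis by (rule DERIV_cmult)
  qed
  have 3: "((\<lambda>u. iexp (t * ln ((1 - u) / (1 + u)))) has_vector_derivative \<i> * of_real (t * (- 2 / (1 - u\<^sup>2))) * iexp (t * ln ((1 - u) / (1 + u)))) (at u)"
  proof -
    have "((\<lambda>z. exp (\<i> * z)) has_field_derivative \<i> * iexp (t * ln ((1 - u) / (1 + u)))) (at (of_real (t * ln ((1 - u) / (1 + u)))))"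
      by (auto intro!: derivative_eq_intros)
    from field_vector_diff_chain_at[OF has_vector_derivative_of_real[OF 2] this]
    show ?thesis by (simp add: o_def mult_ac)
  qed
  have "(osc_weight t has_vector_derivative of_real (arcsin_weight u) * (\<i> * of_real (t * (- 2 / (1 - u\<^sup>2))) * iexp (t * ln ((1 - u) / (1 + u))))
     + of_real (arcsin_weight u * (u / (1 - u\<^sup>2))) * iexp (t * ln ((1 - u) / (1 + u)))) (at u)"
    unfolding osc_weight_def [abs_def] by (rule has_vector_derivative_mult[OF has_vector_derivative_of_real[OF 1] 3])
  also have "of_real (arcsin_weight u) * (\<i> * of_real (t * (- 2 / (1 - u\<^sup>2))) * iexp (t * ln ((1 - u) / (1 + u))))
     + of_real (arcsin_weight u * (u / (1 - u\<^sup>2))) * iexp (t * ln ((1 - u) / (1 + u)))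
    = osc_weight t u * ((of_real u - 2 * \<i> * of_real t) / of_real (1 - u\<^sup>2))"
    unfolding osc_weight_def by (simp add: divide_inverse algebra_simps)
  finally show ?thesis .
qed

text \<open>The logarithmic derivative of \<open>osc_weight\<close> has denominator 1 - u^2, which
  the factor \<open>1 - u^2\<close> of the primitive cancels. Over the common denominator (u - i
  w)^2 the claim becomes the polynomial identity \<open>b\<close>.\<close>

lemma pole_primitive_u:
  assumes w: "w \<noteq> 0" and u: "- 1 < u" "u < 1"
  shows "(pole_primitive t w has_vector_derivative pole_deriv t w u) (at u)"
proof -
  let ?z = "of_real u - \<i> * complex_of_real w" and ?P = "complex_of_real (1 - u\<^sup>2)"
  have z: "?z \<noteq> 0" by (rule pole_nonzero[OF w])
  have P: "?P \<noteq> 0" using one_minus_sq_pos[OF u] by (metis of_real_eq_0_iff less_irrefl)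
  have "((\<lambda>v. (1 - v\<^sup>2) / (v - \<i> * of_real w)) has_field_derivative (- 2 * of_real u * ?z - ?P) / ?z\<^sup>2) (at (of_real u))"
    using z by (auto intro!: derivative_eq_intros simp: power2_eq_square)
  from has_vector_derivative_real_field[OF this]
  have 1: "((\<lambda>v. of_real (1 - v\<^sup>2) / (of_real v - \<i> * of_real w)) has_vector_derivative (- 2 * of_real u * ?z - ?P) / ?z\<^sup>2) (at u)"
    by simp
  let ?c = "- \<i> * complex_of_real (pole_factor t w / (1 + w\<^sup>2))"
  have "(pole_primitive t w has_vector_derivative ?c * (osc_weight t u * ((- 2 * of_real u * ?z - ?P) / ?z\<^sup>2)
     + osc_weight t u * ((of_real u - 2 * \<i> * of_real t) / ?P) * (?P / ?z))) (at u)"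
    unfolding pole_primitive_def [abs_def] times_divide_eq_right[symmetric, of "osc_weight t _"]
    by (rule has_vector_derivative_mult_right[OF has_vector_derivative_mult[OF osc_weight_deriv[OF u] 1]])
  also have "?c * (osc_weight t u * ((- 2 * of_real u * ?z - ?P) / ?z\<^sup>2)
     + osc_weight t u * ((of_real u - 2 * \<i> * of_real t) / ?P) * (?P / ?z)) = pole_deriv t w u"
  proof -
    have a: "((of_real u - 2 * \<i> * of_real t) / ?P) * (?P / ?z) = (of_real u - 2 * \<i> * of_real t) * ?z / ?z\<^sup>2"
      using z P by (simp add: power2_eq_square)
    have b: "- \<i> * ((- 2 * of_real u * ?z - ?P) + (of_real u - 2 * \<i> * of_real t) * ?z) = of_real (w - 2 * t) * ?z + \<i> * of_real (1 + w\<^sup>2)"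
      by (simp add: algebra_simps power2_eq_square)
    have d: "of_real (w - 2 * t) * (1 / ?z) + \<i> * of_real (1 + w\<^sup>2) * (1 / ?z)\<^sup>2 = (of_real (w - 2 * t) * ?z + \<i> * of_real (1 + w\<^sup>2)) / ?z\<^sup>2"
      using z by (simp add: power2_eq_square add_divide_distrib)
    have gen: "- \<i> * c * (v * (D1 / Y) + v * (X / Y)) = c * v * ((- \<i> * (D1 + X)) / Y)" for c v D1 X Y :: complex
      by (simp add: divide_inverse algebra_simps)
    show ?thesis unfolding pole_deriv_def d b[symmetric] mult.assoc[of "osc_weight t u"] a by (rule gen)
  qed
  finally show ?thesis .
qed

text \<open>The factor 1 - u^2 overcomes the endpoint singularity of \<open>arcsin_weight\<close>
  and leaves sqrt (1 - u^2), so the boundary terms disappear as u tends to 1 or -1.\<close>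

lemma pole_primitive_bound:
  assumes w: "w \<noteq> 0" and u: "- 1 < u" "u < 1"
  shows "norm (pole_primitive t w u) \<le> exp (pi * \<bar>t\<bar>) * (sqrt (1 - u\<^sup>2) / \<bar>w\<bar>)"
proof -
  have p: "1 - u\<^sup>2 > 0" by (rule one_minus_sq_pos[OF u])
  have e: "arcsin_weight u * (1 - u\<^sup>2) = sqrt (1 - u\<^sup>2)"
    unfolding arcsin_weight_sqrt[OF u] using p by (simp add: real_div_sqrt)
  have "norm (pole_primitive t w u) = pole_factor t w / (1 + w\<^sup>2) * ((arcsin_weight u * (1 - u\<^sup>2)) / norm (of_real u - \<i> * complex_of_real w))"
    unfolding pole_primitive_def using p pole_factor_pos[of t w] one_plus_sq_pos[of w]
    by (simp add: norm_mult norm_divide norm_osc_weight del: of_real_diff of_real_add of_real_divide of_real_power)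
  also have "\<dots> \<le> exp (pi * \<bar>t\<bar>) * (sqrt (1 - u\<^sup>2) / \<bar>w\<bar>)"
  proof -
    have "norm (of_real u - \<i> * complex_of_real w) > 0" unfolding zero_less_norm_iff by (rule pole_nonzero[OF w])
    hence "sqrt (1 - u\<^sup>2) / norm (of_real u - \<i> * complex_of_real w) \<le> sqrt (1 - u\<^sup>2) / \<bar>w\<bar>"
      using w p norm_ge_pole(1)[of w u] by (intro divide_left_mono) auto
    thus ?thesis unfolding e by (rule mult_mono[OF pole_factor_bound]) (use p in auto)
  qed
  finally show ?thesis .
qed

lemma osc_weight_continuous: "continuous_on {-1<..<1} (osc_weight t)"
proof -
  have "isCont (osc_weight t) u" if "u \<in> {-1<..<1}" for u
    using has_vector_derivative_continuous[OF osc_weight_deriv[of u t]] that by simp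
  thus ?thesis by (simp add: continuous_at_imp_continuous_on)
qed

lemma pole_deriv_continuous:
  assumes W: "\<And>w. w \<in> W \<Longrightarrow> w \<noteq> 0" and r: "0 < r" "r < 1"
  shows "continuous_on (W \<times> {- r..r}) (\<lambda>(w, u). pole_deriv t w u)"
proof -
  let ?S = "W \<times> {- r..r}"
  have z: "of_real (snd x) - \<i> * complex_of_real (fst x) \<noteq> 0" if "x \<in> ?S" for x
    using that W by (intro pole_nonzero) auto
  have c1: "continuous_on ?S (\<lambda>x. 1 / (of_real (snd x) - \<i> * complex_of_real (fst x)))"
    using z by (intro continuous_on_divide continuous_intros) blast+
  have "continuous_on UNIV (\<lambda>w. pole_factor t w / (1 + w\<^sup>2))"
  proof (rule continuous_on_divide)
    show "continuous_on UNIV (pole_factor t)"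
      using DERIV_isCont[OF pole_factor_deriv] by (simp add: continuous_at_imp_continuous_on)
    show "\<forall>w\<in>UNIV. 1 + w\<^sup>2 \<noteq> (0::real)" using one_plus_sq_pos by (metis less_irrefl)
  qed (intro continuous_intros)
  hence c2: "continuous_on ?S (\<lambda>x. pole_factor t (fst x) / (1 + (fst x)\<^sup>2))"
    by (rule continuous_on_compose2[where f = fst]) (auto intro: continuous_intros)
  have c3: "continuous_on ?S (\<lambda>x. osc_weight t (snd x))"
    by (rule continuous_on_compose2[OF osc_weight_continuous, where f = snd]) (use r in \<open>auto intro: continuous_intros\<close>)
  show ?thesis
    unfolding pole_deriv_def split_beta by (intro continuous_intros c1 c2 c3)
qed

text \<open>The weight is singular at the endpoints, so differentiation under the integral is done
  on [-r, r], where everything is continuous. The w-derivative is then a difference of boundary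
  values of \<open>pole_primitive\<close>, and the mean value inequality bounds the variation in
  \<open>w\<close>.\<close>

lemma pole_truncated_diff:
  assumes w: "w1 \<le> w2" "0 \<notin> {w1..w2}" and r: "0 < r" "r < 1" and c: "c > 0" "\<And>w. w \<in> {w1..w2} \<Longrightarrow> c \<le> \<bar>w\<bar>"
  shows "norm (integral {- r..r} (\<lambda>u. of_real (pole_factor t w1) * (osc_weight t u * (1 / (of_real u - \<i> * of_real w1))))
    - integral {- r..r} (\<lambda>u. of_real (pole_factor t w2) * (osc_weight t u * (1 / (of_real u - \<i> * of_real w2)))))
    \<le> 2 * exp (pi * \<bar>t\<bar>) * (sqrt (1 - r\<^sup>2) / c) * \<bar>w1 - w2\<bar>"
proof -
  define f where "f w u = of_real (pole_factor t w) * (osc_weight t u * (1 / (of_real u - \<i> * of_real w)))" for w u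
  have nz: "w \<noteq> 0" if "w \<in> {w1..w2}" for w using that w by auto
  have sub: "{- r..r} \<subseteq> {-1<..<1}" using r by auto
  have D: "((\<lambda>w. integral (cbox (- r) r) (f w)) has_vector_derivative integral (cbox (- r) r) (pole_deriv t w)) (at w within {w1..w2})"
    if w': "w \<in> {w1..w2}" for w
  proof (rule leibniz_rule_vector_derivative[OF _ _ _ w'])
    show "((\<lambda>w. f w u) has_vector_derivative pole_deriv t w u) (at w within {w1..w2})" if "w \<in> {w1..w2}" for w u
      unfolding f_def by (rule has_vector_derivative_at_within[OF pole_deriv_w[OF nz[OF that]]])
    show "f w integrable_on cbox (- r) r" if "w \<in> {w1..w2}" for w
      unfolding f_def
    proof (rule integrable_continuous, intro continuous_intros ballI)
      show "continuous_on (cbox (- r) r) (osc_weight t)"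
        using continuous_on_subset[OF osc_weight_continuous sub] by simp
      show "of_real u - \<i> * complex_of_real w \<noteq> 0" for u by (rule pole_nonzero[OF nz[OF that]])
    qed
    show "continuous_on ({w1..w2} \<times> cbox (- r) r) (\<lambda>(w, u). pole_deriv t w u)"
      unfolding cbox_interval by (rule pole_deriv_continuous[OF nz r])
  qed auto
  have I: "integral (cbox (- r) r) (pole_deriv t w) = pole_primitive t w r - pole_primitive t w (- r)" if "w \<in> {w1..w2}" for w
  proof (rule integral_unique, unfold cbox_interval, rule fundamental_theorem_of_calculus)
    show "- r \<le> r" using r by simp
    show "(pole_primitive t w has_vector_derivative pole_deriv t w u) (at u within {- r..r})" if "u \<in> {- r..r}" for u
      using sub that by (intro has_vector_derivative_at_within[OF pole_primitive_u[OF nz[OF \<open>w \<in> _\<close>]]]) auto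
  qed
  have B: "norm (integral (cbox (- r) r) (pole_deriv t w)) \<le> 2 * exp (pi * \<bar>t\<bar>) * (sqrt (1 - r\<^sup>2) / c)" if w': "w \<in> {w1..w2}" for w
  proof -
    have "norm (integral (cbox (- r) r) (pole_deriv t w)) \<le> norm (pole_primitive t w r) + norm (pole_primitive t w (- r))"
      unfolding I[OF w'] by (rule norm_triangle_ineq4)
    also have "\<dots> \<le> exp (pi * \<bar>t\<bar>) * (sqrt (1 - r\<^sup>2) / \<bar>w\<bar>) + exp (pi * \<bar>t\<bar>) * (sqrt (1 - (- r)\<^sup>2) / \<bar>w\<bar>)"
      using r by (intro add_mono pole_primitive_bound nz w') auto
    also have "\<dots> = 2 * exp (pi * \<bar>t\<bar>) * (sqrt (1 - r\<^sup>2) / \<bar>w\<bar>)" by simp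
    also have "\<dots> \<le> 2 * exp (pi * \<bar>t\<bar>) * (sqrt (1 - r\<^sup>2) / c)"
      using c(1) c(2)[OF w'] one_minus_sq_pos[of r] r by (intro mult_left_mono divide_left_mono) auto
    finally show ?thesis .
  qed
  have "norm (integral (cbox (- r) r) (f w1) - integral (cbox (- r) r) (f w2)) \<le> 2 * exp (pi * \<bar>t\<bar>) * (sqrt (1 - r\<^sup>2) / c) * norm (w1 - w2)"
  proof (rule differentiable_bound[where S = "{w1..w2}" and f' = "\<lambda>w x. x *\<^sub>R integral (cbox (- r) r) (pole_deriv t w)"])
    show "((\<lambda>w. integral (cbox (- r) r) (f w)) has_derivative (\<lambda>x. x *\<^sub>R integral (cbox (- r) r) (pole_deriv t w))) (at w within {w1..w2})"
      if "w \<in> {w1..w2}" for w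
      using D[OF that] by (simp add: has_vector_derivative_def)
    show "onorm (\<lambda>x. x *\<^sub>R integral (cbox (- r) r) (pole_deriv t w)) \<le> 2 * exp (pi * \<bar>t\<bar>) * (sqrt (1 - r\<^sup>2) / c)"
      if "w \<in> {w1..w2}" for w
    proof (rule onorm_bound)
      show "0 \<le> 2 * exp (pi * \<bar>t\<bar>) * (sqrt (1 - r\<^sup>2) / c)" by (rule order_trans[OF norm_ge_zero B[OF that]])
      show "norm (x *\<^sub>R integral (cbox (- r) r) (pole_deriv t w)) \<le> 2 * exp (pi * \<bar>t\<bar>) * (sqrt (1 - r\<^sup>2) / c) * norm x" for x
        unfolding norm_scaleR mult.commute[of "\<bar>x\<bar>"] real_norm_def by (rule mult_right_mono[OF B[OF that]]) simp
    qed
  qed (use w in auto)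
  thus ?thesis unfolding f_def by simp
qed

lemma truncated_limit:
  fixes f :: "real \<Rightarrow> complex"
  assumes int: "integrable sym_interval f" and r: "\<And>k::nat. 0 < r k" "\<And>k. r k < 1" "r \<longlonglongrightarrow> 1"
  shows "(\<lambda>k. integral {- r k..r k} f) \<longlonglongrightarrow> (LINT u|sym_interval. f u)"
proof -
  have [measurable]: "f \<in> borel_measurable sym_interval" using int by simp
  have "(\<lambda>k. LINT u|sym_interval. indicator {- r k..r k} u * f u) \<longlonglongrightarrow> (LINT u|sym_interval. f u)"
  proof (rule integral_dominated_convergence[where w = "\<lambda>u. norm (f u)"])
    show "AE u in sym_interval. (\<lambda>k. indicator {- r k..r k} u * f u) \<longlonglongrightarrow> f u"
    proof (rule AE_I2)
      fix u assume "u \<in> space sym_interval"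
      hence "\<bar>u\<bar> < 1" by auto
      from order_tendstoD(1)[OF r(3) this] have "\<forall>\<^sub>F k in sequentially. indicator {- r k..r k} u * f u = f u"
        by eventually_elim (auto simp: indicator_def)
      thus "(\<lambda>k. indicator {- r k..r k} u * f u) \<longlonglongrightarrow> f u" by (rule tendsto_eventually)
    qed
    show "(\<lambda>u. indicator {- r k..r k} u * f u) \<in> borel_measurable sym_interval" for k
    proof -
      have [measurable]: "(\<lambda>u. indicator {- r k..r k} u :: complex) \<in> borel_measurable sym_interval"
        by (intro borel_sym_interval) measurable
      show ?thesis by measurable
    qed
  qed (use int in \<open>auto simp: indicator_def\<close>)
  moreover have "(LINT u|sym_interval. indicator {- r k..r k} u * f u) = integral {- r k..r k} f" for k
  proof -
    have "set_integrable lborel {-1<..<1} f"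
      using int unfolding sym_interval_def set_integrable_def by (subst (asm) integrable_restrict_space) simp_all
    hence si: "set_integrable lborel {- r k..r k} f"
      by (rule set_integrable_subset) (use r(1,2)[of k] in auto)
    have "(LINT u|sym_interval. indicator {- r k..r k} u * f u) = (LINT u:{- r k..r k}|lborel. f u)"
      unfolding sym_interval_def set_lebesgue_integral_def
      by (subst integral_restrict_space)
        (auto intro!: Bochner_Integration.integral_cong simp: indicator_def, (use r(1,2)[of k] in linarith)+)
    thus ?thesis using set_borel_integral_eq_integral(2)[OF si] by simp
  qed
  ultimately show ?thesis by simp
qed

text \<open>Letting r tend to 1, the factor sqrt (1 - r^2) removes the variation. The interval has
  to avoid 0, where the pole crosses the path of integration.\<close>

lemma pole_integral_invariant:
  assumes w: "w1 \<le> w2" "0 \<notin> {w1..w2}"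
  shows "of_real (pole_factor t w1) * pole_integral t w1 = of_real (pole_factor t w2) * pole_integral t w2"
proof -
  define r where "r k = 1 - 1 / (real k + 2)" for k :: nat
  have r: "0 < r k" "r k < 1" for k by (simp_all add: r_def field_simps)
  have "(\<lambda>j. 1 / (real j + 2)) \<longlonglongrightarrow> 0"
    using LIMSEQ_ignore_initial_segment[OF lim_1_over_n, of 2] by (simp add: add.commute)
  from tendsto_diff[OF tendsto_const[of 1] this] have r_lim: "r \<longlonglongrightarrow> 1" by (simp add: r_def [abs_def])
  obtain c where c: "c > 0" "\<And>w. w \<in> {w1..w2} \<Longrightarrow> c \<le> \<bar>w\<bar>"
  proof (cases "0 < w1")
    case True
    thus ?thesis using that[of w1] by force
  next
    case False
    hence "w2 < 0" using w by auto
    thus ?thesis using that[of "- w2"] by force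
  qed
  let ?f = "\<lambda>w u. of_real (pole_factor t w) * (osc_weight t u * (1 / (of_real u - \<i> * of_real w)))"
  have nz: "w1 \<noteq> 0" "w2 \<noteq> 0" using w by auto
  have L: "(\<lambda>k. integral {- r k..r k} (?f w)) \<longlonglongrightarrow> of_real (pole_factor t w) * pole_integral t w" if "w \<noteq> 0" for w
    unfolding pole_integral_def Bochner_Integration.integral_mult_right_zero[symmetric]
    by (rule truncated_limit[OF _ r r_lim]) (intro integrable_mult_right pole_integrable that)
  have "(\<lambda>k. 2 * exp (pi * \<bar>t\<bar>) * (sqrt (1 - (r k)\<^sup>2) / c) * \<bar>w1 - w2\<bar>) \<longlonglongrightarrow> 2 * exp (pi * \<bar>t\<bar>) * (sqrt (1 - 1\<^sup>2) / c) * \<bar>w1 - w2\<bar>"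
    using c(1) by (intro tendsto_mult tendsto_divide tendsto_real_sqrt tendsto_diff tendsto_power tendsto_const r_lim) auto
  hence "(\<lambda>k. 2 * exp (pi * \<bar>t\<bar>) * (sqrt (1 - (r k)\<^sup>2) / c) * \<bar>w1 - w2\<bar>) \<longlonglongrightarrow> 0" by simp
  hence "(\<lambda>k. integral {- r k..r k} (?f w1) - integral {- r k..r k} (?f w2)) \<longlonglongrightarrow> 0"
    by (rule Lim_null_comparison[rotated]) (intro always_eventually allI pole_truncated_diff w r c)
  moreover have "(\<lambda>k. integral {- r k..r k} (?f w1) - integral {- r k..r k} (?f w2)) \<longlonglongrightarrow>
      of_real (pole_factor t w1) * pole_integral t w1 - of_real (pole_factor t w2) * pole_integral t w2"
    by (intro tendsto_diff L nz)
  ultimately have "of_real (pole_factor t w1) * pole_integral t w1 - of_real (pole_factor t w2) * pole_integral t w2 = 0"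
    by (rule LIMSEQ_unique[rotated])
  thus ?thesis by simp
qed

lemma filterlim_real_plus_1: "filterlim (\<lambda>n. real n + 1) at_top sequentially"
  using filterlim_tendsto_add_at_top[OF tendsto_const filterlim_real_sequentially, of 1] by (simp only: add.commute)

text \<open>The constant is evaluated at infinity on the side of \<open>\<sigma>\<close>. There w /
  (u - i w) tends to i, while \<open>pole_factor t w / w\<close> tends to \<open>\<sigma>\<close>
  exp (- sigma pi t), because \<open>arctan\<close> tends to \<open>\<sigma>\<close> pi / 2.\<close>

lemma pole_sequence_limit:
  assumes \<sigma>: "\<sigma> = 1 \<or> \<sigma> = - 1"
  shows "of_real (pole_factor t \<sigma>) * pole_integral t \<sigma>
    = of_real (\<sigma> * exp (- \<sigma> * pi * t)) * (\<i> * (LINT u|sym_interval. osc_weight t u))"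
proof -
  define x where "x n = \<sigma> * (real n + 1)" for n
  have x0: "x n \<noteq> 0" for n using \<sigma> by (auto simp: x_def)
  have x_abs: "\<bar>x n\<bar> = real n + 1" for n using \<sigma> by (auto simp: x_def)
  have inf: "filterlim (\<lambda>n. real n + 1) at_top sequentially"
    by (rule filterlim_real_plus_1)
  have inv: "(\<lambda>n. inverse (real n + 1)) \<longlonglongrightarrow> 0" by (rule tendsto_inverse_0_at_top[OF inf])
  have inv': "(\<lambda>n. inverse (x n)) \<longlonglongrightarrow> 0"
  proof -
    have "inverse (x n) = \<sigma> * inverse (real n + 1)" for n using \<sigma> by (auto simp: x_def)
    thus ?thesis using tendsto_mult[OF tendsto_const[of \<sigma>] inv] by simp
  qed
  have ov [measurable]: "osc_weight t \<in> borel_measurable sym_interval" by (intro borel_sym_interval) measurable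
  have 1: "(\<lambda>n. of_real (x n) * pole_integral t (x n)) \<longlonglongrightarrow> \<i> * (LINT u|sym_interval. osc_weight t u)"
  proof -
    have "(\<lambda>n. LINT u|sym_interval. osc_weight t u * (of_real (x n) / (of_real u - \<i> * of_real (x n))))
      \<longlonglongrightarrow> (LINT u|sym_interval. osc_weight t u * \<i>)"
    proof (rule integral_dominated_convergence[where w = arcsin_weight])
      show "AE u in sym_interval. (\<lambda>n. osc_weight t u * (of_real (x n) / (of_real u - \<i> * of_real (x n)))) \<longlonglongrightarrow> osc_weight t u * \<i>"
      proof (rule AE_I2)
        fix u
        have e: "of_real (x n) / (of_real u - \<i> * of_real (x n)) = 1 / (of_real (u * inverse (x n)) - \<i>)" for n
        proof -
          have "of_real (u * inverse (x n)) - \<i> = (of_real u - \<i> * of_real (x n)) / of_real (x n)"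
            using x0[of n] by (simp add: divide_inverse left_diff_distrib)
          thus ?thesis by simp
        qed
        have "(\<lambda>n. of_real (u * inverse (x n)) - \<i>) \<longlonglongrightarrow> complex_of_real (u * 0) - \<i>"
          by (intro tendsto_diff tendsto_of_real tendsto_mult tendsto_const inv')
        hence "(\<lambda>n. 1 / (complex_of_real (u * inverse (x n)) - \<i>)) \<longlonglongrightarrow> 1 / (complex_of_real (u * 0) - \<i>)"
          by (rule tendsto_divide[OF tendsto_const]) simp
        from tendsto_mult[OF tendsto_const[of "osc_weight t u"] this]
        show "(\<lambda>n. osc_weight t u * (of_real (x n) / (of_real u - \<i> * of_real (x n)))) \<longlonglongrightarrow> osc_weight t u * \<i>"
          unfolding e by simp
      qed
      show "AE u in sym_interval. norm (osc_weight t u * (of_real (x n) / (of_real u - \<i> * of_real (x n)))) \<le> arcsin_weight u" for n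
      proof (rule AE_I2)
        fix u assume "u \<in> space sym_interval"
        hence u: "- 1 < u" "u < 1" by auto
        have "norm (complex_of_real (x n) / (of_real u - \<i> * of_real (x n))) \<le> 1"
          unfolding norm_divide norm_of_real using norm_ge_pole(1)[of "x n" u] x0[of n] by (simp add: pole_nonzero divide_le_eq)
        from mult_left_mono[OF this, of "arcsin_weight u"]
        have "arcsin_weight u * norm (complex_of_real (x n) / (of_real u - \<i> * of_real (x n))) \<le> arcsin_weight u * 1"
          using arcsin_weight_pos[OF u] less_imp_le by blast
        thus "norm (osc_weight t u * (of_real (x n) / (of_real u - \<i> * of_real (x n)))) \<le> arcsin_weight u"
          by (simp only: norm_mult[of "osc_weight t u"] norm_osc_weight mult_1_right)
      qed
      show "(\<lambda>u. osc_weight t u * (of_real (x n) / (of_real u - \<i> * of_real (x n)))) \<in> borel_measurable sym_interval" for n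
        by (intro borel_sym_interval) measurable
    qed (use arcsin_weight_integral in measurable)
    moreover have "(LINT u|sym_interval. osc_weight t u * (of_real (x n) / (of_real u - \<i> * of_real (x n)))) = of_real (x n) * pole_integral t (x n)" for n
      unfolding pole_integral_def Bochner_Integration.integral_mult_right_zero[symmetric]
      by (intro Bochner_Integration.integral_cong refl) simp
    moreover have "(LINT u|sym_interval. osc_weight t u * \<i>) = \<i> * (LINT u|sym_interval. osc_weight t u)"
      by (simp add: mult.commute)
    ultimately show ?thesis by (simp only:)
  qed
  have 2: "(\<lambda>n. pole_factor t (x n) / x n) \<longlonglongrightarrow> \<sigma> * exp (- \<sigma> * pi * t)"
  proof -
    have a: "(\<lambda>n. arctan (x n)) \<longlonglongrightarrow> \<sigma> * (pi / 2)"
    proof -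
      have "arctan (x n) = \<sigma> * arctan (real n + 1)" for n using \<sigma> by (auto simp: x_def arctan_minus simp flip: minus_add_distrib)
      moreover have "(\<lambda>n. \<sigma> * arctan (real n + 1)) \<longlonglongrightarrow> \<sigma> * (pi / 2)"
        by (intro tendsto_mult tendsto_const filterlim_compose[OF tendsto_arctan_at_top inf])
      ultimately show ?thesis by simp
    qed
    have "(\<lambda>n. \<sigma> * sqrt ((inverse (real n + 1))\<^sup>2 + 1) * exp (- 2 * t * arctan (x n))) \<longlonglongrightarrow> \<sigma> * sqrt (0\<^sup>2 + 1) * exp (- 2 * t * (\<sigma> * (pi / 2)))"
      by (intro tendsto_mult tendsto_const tendsto_real_sqrt tendsto_add tendsto_power inv tendsto_exp a)
    moreover have "\<sigma> * sqrt ((inverse (real n + 1))\<^sup>2 + 1) * exp (- 2 * t * arctan (x n)) = pole_factor t (x n) / x n" for n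
    proof -
      define y where "y = real n + 1"
      have y: "y > 0" by (simp add: y_def)
      have "(inverse y)\<^sup>2 + 1 = (1 + y\<^sup>2) / y\<^sup>2" using y by (simp add: field_simps)
      hence "sqrt ((inverse y)\<^sup>2 + 1) = sqrt (1 + y\<^sup>2) / y" using y by (simp add: real_sqrt_divide)
      moreover have xy: "x n = \<sigma> * y" by (simp add: x_def y_def)
      moreover have "(x n)\<^sup>2 = y\<^sup>2" unfolding xy power_mult_distrib using \<sigma> by auto
      ultimately show ?thesis using \<sigma> y unfolding pole_factor_def y_def[symmetric] by auto
    qed
    moreover have "\<sigma> * sqrt (0\<^sup>2 + 1) * exp (- 2 * t * (\<sigma> * (pi / 2))) = \<sigma> * exp (- \<sigma> * pi * t)" by (simp add: mult_ac)
    ultimately show ?thesis by (simp only:)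
  qed
  have "(\<lambda>n. of_real (pole_factor t (x n) / x n) * (of_real (x n) * pole_integral t (x n))) \<longlonglongrightarrow>
     of_real (\<sigma> * exp (- \<sigma> * pi * t)) * (\<i> * (LINT u|sym_interval. osc_weight t u))"
    by (intro tendsto_mult tendsto_of_real 1 2)
  \<comment> \<open>By invariance this product is the same for all \<open>n\<close>, as
    \<open>x n\<close> stays on one side of 0.\<close>
  moreover have "of_real (pole_factor t (x n) / x n) * (of_real (x n) * pole_integral t (x n)) = of_real (pole_factor t \<sigma>) * pole_integral t \<sigma>" for n
  proof -
    have "of_real (pole_factor t (x n) / x n) * (of_real (x n) * pole_integral t (x n)) = of_real (pole_factor t (x n)) * pole_integral t (x n)"
      using x0[of n] by simp
    also have "\<dots> = of_real (pole_factor t \<sigma>) * pole_integral t \<sigma>"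
    proof (cases "\<sigma> = 1")
      case True
      thus ?thesis using pole_integral_invariant[of 1 "x n" t] by (simp add: x_def)
    next
      case False
      hence "\<sigma> = - 1" using \<sigma> by simp
      thus ?thesis using pole_integral_invariant[of "x n" "- 1" t] by (simp add: x_def)
    qed
    finally show ?thesis .
  qed
  ultimately have "(\<lambda>n::nat. of_real (pole_factor t \<sigma>) * pole_integral t \<sigma>) \<longlonglongrightarrow>
     of_real (\<sigma> * exp (- \<sigma> * pi * t)) * (\<i> * (LINT u|sym_interval. osc_weight t u))" by simp
  thus ?thesis by (simp add: LIMSEQ_const_iff)
qed

section \<open>The jump across the real axis\<close>

lemma abs_ln_quotient:
  fixes u :: real
  assumes "\<bar>u\<bar> \<le> 1 / 2"
  shows "\<bar>ln ((1 - u) / (1 + u))\<bar> \<le> 4 * \<bar>u\<bar>"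
proof -
  have l: "\<bar>ln (1 + x)\<bar> \<le> 2 * \<bar>x\<bar>" if "\<bar>x\<bar> \<le> 1 / 2" for x :: real
  proof -
    have "2 * x\<^sup>2 = (2 * \<bar>x\<bar>) * \<bar>x\<bar>" by (simp add: power2_eq_square)
    also have "\<dots> \<le> 1 * \<bar>x\<bar>" using that by (intro mult_right_mono) auto
    finally show ?thesis using abs_ln_one_plus_x_minus_x_bound[OF that] by linarith
  qed
  have "ln ((1 - u) / (1 + u)) = ln (1 + - u) - ln (1 + u)"
  proof -
    have "0 < 1 - u" "0 < 1 + u" using assms by (auto simp: abs_le_iff)
    thus ?thesis by (simp add: ln_div)
  qed
  thus ?thesis using l[of u] l[of "- u"] assms by simp
qed

text \<open>The factor |u| is what the concentrating kernel below needs for a majorant. Near 0 the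
  oscillation is estimated by its phase, elsewhere the trivial bound 2 is below 4 |u|; replacing
  \<open>arcsin_weight\<close> by 1 costs one more |u|.\<close>

lemma osc_weight_near_1:
  assumes u: "- 1 < u" "u < 1"
  shows "norm (osc_weight t u - 1) \<le> (4 * \<bar>t\<bar> + 5) * \<bar>u\<bar> * arcsin_weight u"
proof -
  define \<rho> E where "\<rho> = arcsin_weight u" and "E = iexp (t * ln ((1 - u) / (1 + u)))"
  have \<rho>: "\<rho> > 0" unfolding \<rho>_def by (rule arcsin_weight_pos[OF u])
  have p: "0 < 1 - u\<^sup>2" by (rule one_minus_sq_pos[OF u])
  have E: "norm (E - 1) \<le> (4 * \<bar>t\<bar> + 4) * \<bar>u\<bar>"
  proof (cases "\<bar>u\<bar> \<le> 1 / 2")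
    case True
    have "norm (E - 1) \<le> \<bar>t * ln ((1 - u) / (1 + u))\<bar>"
      using iexp_approx1[of "t * ln ((1 - u) / (1 + u))" 0] by (simp add: E_def)
    also have "\<dots> \<le> \<bar>t\<bar> * (4 * \<bar>u\<bar>)" unfolding abs_mult using abs_ln_quotient[OF True] by (intro mult_left_mono) auto
    also have "\<dots> \<le> (4 * \<bar>t\<bar> + 4) * \<bar>u\<bar>" by (simp add: algebra_simps)
    finally show ?thesis .
  next
    case False
    have "norm (E - 1) \<le> norm E + norm (1::complex)" by (rule norm_triangle_ineq4)
    also have "\<dots> = 2" by (simp add: E_def)
    also have "\<dots> \<le> 4 * \<bar>u\<bar>" using False by simp
    also have "\<dots> \<le> (4 * \<bar>t\<bar> + 4) * \<bar>u\<bar>" by (intro mult_right_mono) auto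
    finally show ?thesis .
  qed
  have r: "\<bar>\<rho> - 1\<bar> \<le> \<bar>u\<bar> * \<rho>"
  proof -
    have "1 - u\<^sup>2 \<le> sqrt (1 - u\<^sup>2)"
    proof (rule real_le_rsqrt)
      have "(1 - u\<^sup>2) * (1 - u\<^sup>2) \<le> 1 * (1 - u\<^sup>2)" using p by (intro mult_right_mono) auto
      thus "(1 - u\<^sup>2)\<^sup>2 \<le> 1 - u\<^sup>2" by (simp add: power2_eq_square)
    qed
    moreover have "u\<^sup>2 \<le> \<bar>u\<bar>"
    proof -
      have "\<bar>u\<bar> * \<bar>u\<bar> \<le> 1 * \<bar>u\<bar>" using u by (intro mult_right_mono) auto
      thus ?thesis by (simp add: power2_eq_square)
    qed
    ultimately have a: "1 - sqrt (1 - u\<^sup>2) \<le> \<bar>u\<bar>" by linarith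
    have s: "0 < sqrt (1 - u\<^sup>2)" "sqrt (1 - u\<^sup>2) \<le> 1" using p by auto
    have "\<rho> * sqrt (1 - u\<^sup>2) = 1" using s by (simp add: \<rho>_def arcsin_weight_sqrt[OF u])
    hence b: "\<rho> - 1 = \<rho> * (1 - sqrt (1 - u\<^sup>2))" by (simp add: right_diff_distrib)
    have "\<bar>\<rho> - 1\<bar> = \<rho> * (1 - sqrt (1 - u\<^sup>2))" unfolding b using \<rho> s by simp
    also have "\<dots> \<le> \<rho> * \<bar>u\<bar>" using a \<rho> by (intro mult_left_mono) auto
    finally show ?thesis by (simp add: mult.commute)
  qed
  have "osc_weight t u - 1 = of_real \<rho> * (E - 1) + of_real (\<rho> - 1)"
    by (simp add: osc_weight_def \<rho>_def E_def algebra_simps)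
  hence "norm (osc_weight t u - 1) \<le> norm (of_real \<rho> * (E - 1)) + norm (complex_of_real (\<rho> - 1))"
    using norm_triangle_ineq by metis
  also have "\<dots> = \<rho> * norm (E - 1) + \<bar>\<rho> - 1\<bar>" using \<rho> by (simp add: norm_mult del: of_real_diff)
  also have "\<dots> \<le> \<rho> * ((4 * \<bar>t\<bar> + 4) * \<bar>u\<bar>) + \<bar>u\<bar> * \<rho>" using E \<rho> r by (intro add_mono mult_left_mono) auto
  finally show ?thesis by (simp add: \<rho>_def algebra_simps)
qed

text \<open>2 pi times the Poisson kernel of the half plane; it arises as (1 / (u - i y) - 1 / (u +
  i y)) / i.\<close>

definition delta_kernel :: "real \<Rightarrow> real \<Rightarrow> real" where
  "delta_kernel y u = 2 * y / (u\<^sup>2 + y\<^sup>2)"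

lemma delta_kernel_measurable [measurable]: "delta_kernel y \<in> borel_measurable borel"
  unfolding delta_kernel_def [abs_def] by measurable

lemma delta_kernel_integral:
  assumes y: "y > 0"
  shows "integrable sym_interval (delta_kernel y)" "(LINT u|sym_interval. delta_kernel y u) = 4 * arctan (1 / y)"
proof -
  let ?F = "\<lambda>u. 2 * arctan (u / y)"
  have S: "u\<^sup>2 + y\<^sup>2 > 0" for u using y by (intro add_nonneg_pos) auto
  have F: "(?F has_real_derivative delta_kernel y u) (at u)" for u
  proof -
    have e: "1 + (u / y)\<^sup>2 = (u\<^sup>2 + y\<^sup>2) / y\<^sup>2" using y by (simp add: power_divide field_simps)
    have "(?F has_real_derivative 2 * (inverse (1 + (u / y)\<^sup>2) * (1 / y))) (at u)"
      by (rule DERIV_cmult[OF DERIV_chain2[OF DERIV_arctan DERIV_cdivide[OF DERIV_ident]]])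
    also have "2 * (inverse (1 + (u / y)\<^sup>2) * (1 / y)) = delta_kernel y u"
      unfolding e delta_kernel_def using y S[of u] by (simp add: power2_eq_square)
    finally show ?thesis .
  qed
  have c: "isCont ?F u" for u using DERIV_isCont[OF F] .
  have k: "isCont (delta_kernel y) u" for u
    unfolding delta_kernel_def [abs_def] using S[of u] by (intro continuous_intros) auto
  have n: "AE u in lborel. ereal (- 1) < ereal u \<longrightarrow> ereal u < ereal 1 \<longrightarrow> 0 \<le> delta_kernel y u"
    using y S by (simp add: delta_kernel_def less_imp_le)
  have l: "ereal (- 1) < ereal 1" by simp
  have lims: "((?F \<circ> real_of_ereal) \<longlongrightarrow> ?F (- 1)) (at_right (ereal (- 1)))" "((?F \<circ> real_of_ereal) \<longlongrightarrow> ?F 1) (at_left (ereal 1))"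
    unfolding ereal_tendsto_simps1
    by (rule filterlim_mono[OF c[unfolded isCont_def] order_refl at_le], simp)+
  note 1 = interval_integral_FTC_nonneg[OF l F k n lims]
  show "integrable sym_interval (delta_kernel y)"
    using 1(1) unfolding sym_interval_def by (subst integrable_restrict_space) (simp_all add: set_integrable_def)
  have "?F 1 - ?F (- 1) = 4 * arctan (1 / y)" by (simp add: arctan_minus)
  thus "(LINT u|sym_interval. delta_kernel y u) = 4 * arctan (1 / y)"
    using 1(2) unfolding sym_interval_def
    by (subst integral_restrict_space) (simp_all add: interval_lebesgue_integral_def set_lebesgue_integral_def)
qed

text \<open>Split \<open>osc_weight\<close> into its value 1 at the origin and a remainder. The
  first part gives 4 arctan (1 / y), tending to 2 pi; the remainder tends to 0 by dominated
  convergence, because |u| \<open>delta_kernel y u\<close> is at most 1.\<close>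

lemma delta_limit:
  "(\<lambda>n. LINT u|sym_interval. osc_weight t u * of_real (delta_kernel (1 / (real n + 1)) u)) \<longlonglongrightarrow> of_real (2 * pi)"
proof -
  define y where "y n = 1 / (real n + 1)" for n
  have y: "y n > 0" for n by (simp add: y_def)
  have inf: "filterlim (\<lambda>n. real n + 1) at_top sequentially"
    by (rule filterlim_real_plus_1)
  have y_lim: "y \<longlonglongrightarrow> 0" using tendsto_inverse_0_at_top[OF inf] by (simp add: y_def [abs_def] divide_inverse)
  have m [measurable]: "osc_weight t \<in> borel_measurable sym_interval" "delta_kernel (y n) \<in> borel_measurable sym_interval" for n
    by (intro borel_sym_interval, measurable)+
  have A: "(\<lambda>n. LINT u|sym_interval. complex_of_real (delta_kernel (y n) u)) \<longlonglongrightarrow> of_real (4 * (pi / 2))"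
    unfolding integral_complex_of_real delta_kernel_integral(2)[OF y]
  proof (intro tendsto_of_real tendsto_mult tendsto_const)
    have "1 / y n = real n + 1" for n by (simp add: y_def)
    thus "(\<lambda>n. arctan (1 / y n)) \<longlonglongrightarrow> pi / 2" using filterlim_compose[OF tendsto_arctan_at_top inf] by simp
  qed
  have B: "(\<lambda>n. LINT u|sym_interval. (osc_weight t u - 1) * of_real (delta_kernel (y n) u)) \<longlonglongrightarrow> (LINT u|sym_interval. 0)"
    and Bi: "\<And>n. integrable sym_interval (\<lambda>u. (osc_weight t u - 1) * of_real (delta_kernel (y n) u))"
  proof -
    have b: "norm ((osc_weight t u - 1) * of_real (delta_kernel (y n) u)) \<le> (4 * \<bar>t\<bar> + 5) * arcsin_weight u"
      if "u \<in> space sym_interval" for u n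
    proof -
      have u: "- 1 < u" "u < 1" using that by auto
      have S: "u\<^sup>2 + (y n)\<^sup>2 > 0" using y[of n] by (intro add_nonneg_pos) auto
      have k: "\<bar>u\<bar> * \<bar>delta_kernel (y n) u\<bar> \<le> 1"
      proof -
        have "2 * \<bar>u\<bar> * y n \<le> u\<^sup>2 + (y n)\<^sup>2" using sum_squares_bound[of "\<bar>u\<bar>" "y n"] by simp
        thus ?thesis using S y[of n] by (simp add: delta_kernel_def abs_mult mult_ac)
      qed
      have "norm ((osc_weight t u - 1) * of_real (delta_kernel (y n) u)) \<le> ((4 * \<bar>t\<bar> + 5) * \<bar>u\<bar> * arcsin_weight u) * \<bar>delta_kernel (y n) u\<bar>"
        unfolding norm_mult norm_of_real by (intro mult_right_mono osc_weight_near_1 u) auto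
      also have "\<dots> = ((4 * \<bar>t\<bar> + 5) * arcsin_weight u) * (\<bar>u\<bar> * \<bar>delta_kernel (y n) u\<bar>)" by (simp only: mult_ac)
      also have "\<dots> \<le> ((4 * \<bar>t\<bar> + 5) * arcsin_weight u) * 1"
        using k arcsin_weight_pos[OF u] by (intro mult_left_mono) auto
      finally show ?thesis by simp
    qed
    have w: "integrable sym_interval (\<lambda>u. (4 * \<bar>t\<bar> + 5) * arcsin_weight u)" by (intro integrable_mult_right arcsin_weight_integral)
    have ae: "AE u in sym_interval. (\<lambda>n. (osc_weight t u - 1) * of_real (delta_kernel (y n) u)) \<longlonglongrightarrow> 0"
    proof -
      have "(\<lambda>n. (osc_weight t u - 1) * of_real (delta_kernel (y n) u)) \<longlonglongrightarrow> 0" for u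
      proof (cases "u = 0")
        case True
        thus ?thesis by (simp add: osc_weight_def arcsin_weight_def)
      next
        case False
        have "(\<lambda>n. (osc_weight t u - 1) * of_real (delta_kernel (y n) u)) \<longlonglongrightarrow> (osc_weight t u - 1) * of_real (2 * 0 / (u\<^sup>2 + 0\<^sup>2))"
          unfolding delta_kernel_def using False
          by (intro tendsto_mult tendsto_const tendsto_of_real tendsto_divide tendsto_add tendsto_power y_lim) auto
        thus ?thesis by simp
      qed
      thus ?thesis by simp
    qed
    show "(\<lambda>n. LINT u|sym_interval. (osc_weight t u - 1) * of_real (delta_kernel (y n) u)) \<longlonglongrightarrow> (LINT u|sym_interval. 0)"
      by (rule integral_dominated_convergence[OF _ _ w ae]) (use b in auto)
    show "integrable sym_interval (\<lambda>u. (osc_weight t u - 1) * of_real (delta_kernel (y n) u))" for n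
      by (rule Bochner_Integration.integrable_bound[OF w]) (use b abs_ge_self order_trans in \<open>fastforce+\<close>)
  qed
  have i1: "integrable sym_interval (\<lambda>u. complex_of_real (delta_kernel (y n) u))" for n
    unfolding complex_of_real_integrable_eq by (rule delta_kernel_integral(1)[OF y])
  have "(LINT u|sym_interval. osc_weight t u * of_real (delta_kernel (y n) u)) =
     (LINT u|sym_interval. complex_of_real (delta_kernel (y n) u)) + (LINT u|sym_interval. (osc_weight t u - 1) * of_real (delta_kernel (y n) u))" for n
    by (subst Bochner_Integration.integral_add[OF i1 Bi, symmetric]) (simp add: algebra_simps)
  thus ?thesis using tendsto_add[OF A B] by (simp add: y_def)
qed

text \<open>The constants for w > 0 and w < 0 are multiples of one unknown, the integral
  \<open>J\<close> of \<open>osc_weight\<close>, with factors exp (- pi t) and - exp (pi t) up to i.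
  Their difference is the jump 2 pi i at w = 0, which determines \<open>J\<close> and with it both
  constants.\<close>

theorem pole_integral_value:
  assumes w: "w > 0"
  shows "pole_integral t w = 2 * of_real pi * \<i> / of_real ((1 + exp (2 * pi * t)) * pole_factor t w)"
proof -
  define J where "J = (LINT u|sym_interval. osc_weight t u)"
  define y where "y n = 1 / (real n + 1)" for n
  have y: "y n > 0" "y n \<le> 1" for n by (simp_all add: y_def)
  have inf: "filterlim (\<lambda>n. real n + 1) at_top sequentially"
    by (rule filterlim_real_plus_1)
  have y_lim: "y \<longlonglongrightarrow> 0" using tendsto_inverse_0_at_top[OF inf] by (simp add: y_def [abs_def] divide_inverse)
  define C C' where "C = of_real (pole_factor t 1) * pole_integral t 1" and "C' = of_real (pole_factor t (- 1)) * pole_integral t (- 1)"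
  have CJ: "C = of_real (exp (- pi * t)) * (\<i> * J)" "C' = - of_real (exp (pi * t)) * (\<i> * J)"
    using pole_sequence_limit[of 1 t] pole_sequence_limit[of "- 1" t] by (simp_all add: C_def C'_def J_def)
  have m0: "complex_of_real (pole_factor t z) \<noteq> 0" for z using pole_factor_pos[of t z] by simp
  have K: "pole_integral t (y n) = C / of_real (pole_factor t (y n))" "pole_integral t (- y n) = C' / of_real (pole_factor t (- y n))" for n
    using pole_integral_invariant[of "y n" 1 t] pole_integral_invariant[of "- 1" "- y n" t] y[of n] m0
    by (simp_all add: C_def C'_def field_simps)
  have pf: "isCont (pole_factor t) 0" by (rule DERIV_isCont[OF pole_factor_deriv])
  have "(\<lambda>n. - y n) \<longlonglongrightarrow> - 0" by (rule tendsto_minus[OF y_lim])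
  hence pfl: "(\<lambda>n. pole_factor t (y n)) \<longlonglongrightarrow> 1" "(\<lambda>n. pole_factor t (- y n)) \<longlonglongrightarrow> 1"
    using isCont_tendsto_compose[OF pf y_lim] isCont_tendsto_compose[OF pf, of "\<lambda>n. - y n"] by (simp_all add: pole_factor_def)
  have "(\<lambda>n. pole_integral t (y n) - pole_integral t (- y n)) \<longlonglongrightarrow> C / of_real 1 - C' / of_real 1"
    unfolding K by (intro tendsto_diff tendsto_divide tendsto_const tendsto_of_real pfl) simp_all
  moreover have "(\<lambda>n. pole_integral t (y n) - pole_integral t (- y n)) \<longlonglongrightarrow> \<i> * of_real (2 * pi)"
  proof -
    have "pole_integral t (y n) - pole_integral t (- y n) = \<i> * (LINT u|sym_interval. osc_weight t u * of_real (delta_kernel (y n) u))" for n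
    proof -
      have yn: "y n \<noteq> 0" "- y n \<noteq> 0" using y[of n] by auto
      have "pole_integral t (y n) - pole_integral t (- y n)
        = (LINT u|sym_interval. osc_weight t u * (1 / (of_real u - \<i> * of_real (y n))) - osc_weight t u * (1 / (of_real u - \<i> * of_real (- y n))))"
        unfolding pole_integral_def by (rule Bochner_Integration.integral_diff[symmetric]) (intro pole_integrable yn)+
      also have "\<dots> = (LINT u|sym_interval. \<i> * (osc_weight t u * of_real (delta_kernel (y n) u)))"
      proof (rule Bochner_Integration.integral_cong[OF refl])
        fix u
        let ?a = "of_real u - \<i> * complex_of_real (y n)" and ?b = "of_real u - \<i> * complex_of_real (- y n)"
        have nz: "?a \<noteq> 0" "?b \<noteq> 0" by (rule pole_nonzero[OF yn(1)], rule pole_nonzero[OF yn(2)])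
        have ab: "?a * ?b = of_real (u\<^sup>2 + (y n)\<^sup>2)" by (simp add: algebra_simps power2_eq_square)
        have "1 / ?a - 1 / ?b = (?b - ?a) / (?a * ?b)" using nz by (simp add: diff_divide_eq_iff divide_diff_eq_iff)
        also have "\<dots> = \<i> * of_real (delta_kernel (y n) u)" unfolding ab by (simp add: delta_kernel_def)
        finally have e: "1 / ?a - 1 / ?b = \<i> * of_real (delta_kernel (y n) u)" .
        show "osc_weight t u * (1 / ?a) - osc_weight t u * (1 / ?b) = \<i> * (osc_weight t u * of_real (delta_kernel (y n) u))"
          unfolding right_diff_distrib[symmetric] e by (simp only: mult_ac)
      qed
      finally show ?thesis by (simp only: Bochner_Integration.integral_mult_right_zero)
    qed
    thus ?thesis using tendsto_mult[OF tendsto_const[of \<i>] delta_limit[of t, folded y_def]] by simp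
  qed
  ultimately have "C / of_real 1 - C' / of_real 1 = \<i> * of_real (2 * pi)" by (rule LIMSEQ_unique)
  \<comment> \<open>One linear equation for \<open>J\<close>; multiplying by exp (pi t) brings it to
    the denominator 1 + exp (2 pi t).\<close>
  hence "of_real (exp (- pi * t) + exp (pi * t)) * (\<i> * J) = \<i> * of_real (2 * pi)"
    unfolding CJ by (simp add: distrib_right)
  hence "of_real (exp (pi * t)) * (of_real (exp (- pi * t) + exp (pi * t)) * (\<i> * J)) = of_real (exp (pi * t)) * (\<i> * of_real (2 * pi))"
    by simp
  moreover have "exp (pi * t) * (exp (- pi * t) + exp (pi * t)) = 1 + exp (2 * pi * t)"
    unfolding distrib_left exp_add[symmetric] by simp
  ultimately have 1: "of_real (1 + exp (2 * pi * t)) * (\<i> * J) = of_real (exp (pi * t)) * (\<i> * of_real (2 * pi))"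
    by (metis (no_types) mult.assoc of_real_mult)
  have "of_real (1 + exp (2 * pi * t)) * C = of_real (exp (- pi * t)) * (of_real (1 + exp (2 * pi * t)) * (\<i> * J))"
    unfolding CJ by (simp only: mult_ac)
  also have "\<dots> = of_real (exp (- pi * t) * exp (pi * t)) * (\<i> * of_real (2 * pi))" unfolding 1 by simp
  also have "exp (- pi * t) * exp (pi * t) = 1" unfolding exp_add[symmetric] by simp
  finally have 2: "of_real (1 + exp (2 * pi * t)) * C = 2 * of_real pi * \<i>" by simp
  have "of_real (pole_factor t w) * pole_integral t w = C"
    using pole_integral_invariant[of w 1 t] pole_integral_invariant[of 1 w t] w unfolding C_def by (cases "w \<le> 1") auto
  hence 3: "of_real ((1 + exp (2 * pi * t)) * pole_factor t w) * pole_integral t w = 2 * of_real pi * \<i>"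
    unfolding 2[symmetric] by simp
  have "(1 + exp (2 * pi * t)) * pole_factor t w > 0" using pole_factor_pos[of t w] by (intro mult_pos_pos add_pos_pos) auto
  hence "complex_of_real ((1 + exp (2 * pi * t)) * pole_factor t w) \<noteq> 0" by (metis less_irrefl of_real_eq_0_iff)
  thus ?thesis using 3 by (simp add: eq_divide_eq mult.commute)
qed

section \<open>The diagonalizing transformation\<close>

lemma q_plus_eq:
  "q_plus s x = of_real (1/2 * pi powr (-3/2) * (1/s) * (1 - s) powr (-1/2)) *
     (LINT u|sym_interval. iexp (- (x * u)) * osc_weight (ui_log s) u)"
proof -
  have "exp (- (\<i> * of_real x * of_real u)) * of_real ((1 - u\<^sup>2) powr (-1/2)) *
        exp (\<i> / of_real (2*pi) * of_real (ln (1/s - 1)) * of_real (ln ((1 - u) / (1 + u))))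
     = iexp (- (x * u)) * osc_weight (ui_log s) u" for u
  proof -
    have "\<i> / of_real (2*pi) * of_real (ln (1/s - 1)) * of_real (ln ((1 - u) / (1 + u)))
      = \<i> * complex_of_real (ui_log s * ln ((1 - u) / (1 + u)))" by (simp add: ui_log_def)
    moreover have "- (\<i> * of_real x * of_real u) = \<i> * complex_of_real (- (x * u))" by simp
    ultimately show ?thesis unfolding osc_weight_def arcsin_weight_def by (simp only: mult.assoc)
  qed
  thus ?thesis unfolding q_plus_def integral_sym_interval by simp
qed

lemma q_plus_measurable [measurable]: "(\<lambda>p. q_plus (fst p) (snd p)) \<in> borel_measurable (borel \<Otimes>\<^sub>M borel)"
  unfolding q_plus_def set_lebesgue_integral_def by measurable

lemma q_plus_bound:
  assumes s: "0 < s" "s < 1"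
  shows "norm (q_plus s x) \<le> 1/2 * pi powr (-3/2) * (1/s) * (1 - s) powr (-1/2) * pi"
proof -
  have "norm (LINT u|sym_interval. iexp (- (x * u)) * osc_weight (ui_log s) u)
     \<le> (LINT u|sym_interval. norm (iexp (- (x * u)) * osc_weight (ui_log s) u))" by (rule integral_norm_bound)
  also have "\<dots> = pi" unfolding norm_mult norm_osc_weight by (simp add: arcsin_weight_integral(2))
  finally have "norm (LINT u|sym_interval. iexp (- (x * u)) * osc_weight (ui_log s) u) \<le> pi" .
  moreover have "0 \<le> 1/2 * pi powr (-3/2) * (1/s) * (1 - s) powr (-1/2)" using s by (intro mult_nonneg_nonneg) auto
  ultimately show ?thesis unfolding q_plus_eq norm_mult norm_of_real by (simp only: abs_of_nonneg mult_left_mono)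
qed

lemma sigma_finite_half_line: "sigma_finite_measure half_line"
  and sigma_finite_sym_interval: "sigma_finite_measure sym_interval"
  and sigma_finite_unit_interval: "sigma_finite_measure unit_interval"
  unfolding half_line_def sym_interval_def unit_interval_def
  by (rule sigma_finite_measure_restrict_space[OF sigma_finite_lborel], simp)+

context mp_param
begin

text \<open>Compare generating functions in \<open>n\<close>. On the left the geometric series in
  the conjugate Cayley transform is a single pole at i \<open>mp_w q\<close>, so
  \<open>pole_integral_value\<close> applies; on the right stands \<open>gen_h\<close>. The
  prefactor is what remains after matching the two closed forms.\<close>

lemma cayley_pairing:
  assumes s: "0 < s" "s < 1"
  shows "(LINT u|sym_interval. osc_weight (ui_log s) u * cnj (cayley_fun d n u)) = of_real (sqrt 2 * pi * s * sqrt (1 - s)) * h0 n s"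
proof (rule powser_unique[of 1, where n = n and b = "\<lambda>n. of_real (sqrt 2 * pi * s * sqrt (1 - s)) * h0 n s" and
      a = "\<lambda>n. LINT u|sym_interval. osc_weight (ui_log s) u * cnj (cayley_fun d n u)"])
  fix q :: real assume q: "\<bar>q\<bar> < 1"
  let ?t = "ui_log s" and ?w = "mp_w q"
  let ?C = "sqrt 2 * pi * s * sqrt (1 - s)"
  show "(\<lambda>n. of_real ?C * h0 n s * of_real q ^ n) sums of_real (?C * gen_h q s)"
    using sums_mult[OF h0_sums[OF s q], of "of_real ?C"] by (simp only: of_real_mult mult.assoc)
  have w: "?w > 0" by (rule mp_w_pos[OF q])
  define K0 where "K0 = - \<i> * complex_of_real (sqrt (d / pi))"
  have cf: "cnj (cayley_fun d n u) = K0 / (of_real u - \<i> * of_real d) * cnj (cayley d u) ^ n" for n u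
    unfolding cayley_int_nat[OF d_pos, symmetric] cayley_int_def K0_def by simp
  have S: "(\<lambda>n. LINT u|sym_interval. osc_weight ?t u * (cnj (cayley_fun d n u) * of_real q ^ n)) sums
     (LINT u|sym_interval. osc_weight ?t u * (K0 / of_real (1 - q) * (1 / (of_real u - \<i> * of_real ?w))))"
  proof (rule sums_integral_dominated(3))
    show "(\<lambda>u. osc_weight ?t u * (cnj (cayley_fun d n u) * of_real q ^ n)) \<in> borel_measurable sym_interval" for n
      unfolding cf by (intro borel_sym_interval) measurable
    show "(\<lambda>u. osc_weight ?t u * (K0 / of_real (1 - q) * (1 / (of_real u - \<i> * of_real ?w)))) \<in> borel_measurable sym_interval"
      by (intro borel_sym_interval) measurable
    show "AE u in sym_interval. (\<lambda>n. osc_weight ?t u * (cnj (cayley_fun d n u) * of_real q ^ n)) sums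
        (osc_weight ?t u * (K0 / of_real (1 - q) * (1 / (of_real u - \<i> * of_real ?w))))"
    proof (rule AE_I2, rule sums_mult)
      fix u
      let ?a = "of_real u - \<i> * complex_of_real d" and ?b = "of_real u + \<i> * complex_of_real d"
      define c where "c = cnj (cayley d u)"
      have ab: "?a \<noteq> 0" "?b \<noteq> 0" using cayley_denom[OF d_pos, of u] by auto
      have c: "c = ?b / ?a" unfolding c_def cayley_def by simp
      have "norm (of_real q * c) < 1" using q cmod_cayley[OF d_pos, of u] by (simp add: c_def norm_mult)
      from sums_mult[OF geometric_sums[OF this], of "K0 / ?a"]
      have "(\<lambda>n. K0 / ?a * (of_real q * c) ^ n) sums (K0 / ?a * (1 / (1 - of_real q * c)))" .
      \<comment> \<open>The defining property of \<open>mp_w\<close>: the sum of the geometric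
        series has its pole at i \<open>mp_w q\<close> instead of i d.\<close>
      moreover have "K0 / ?a * (1 / (1 - of_real q * c)) = K0 / of_real (1 - q) * (1 / (of_real u - \<i> * of_real ?w))"
      proof -
        have "?a * (1 - of_real q * c) = ?a - of_real q * ?b" unfolding c using ab by (simp add: right_diff_distrib)
        also have "\<dots> = of_real (1 - q) * (of_real u - \<i> * of_real ?w)"
        proof -
          have "(1 - q) * ?w = d * (1 + q)" using q by (simp add: mp_w_def)
          hence "complex_of_real (1 - q) * of_real ?w = of_real (d * (1 + q))" by (metis of_real_mult)
          hence "of_real (1 - q) * (of_real u - \<i> * of_real ?w) = of_real (1 - q) * of_real u - \<i> * of_real (d * (1 + q))"
            by (simp add: right_diff_distrib mult.left_commute del: of_real_mult of_real_diff of_real_add)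
          thus ?thesis by (simp add: algebra_simps)
        qed
        finally show ?thesis by simp
      qed
      moreover have "cnj (cayley_fun d n u) * of_real q ^ n = K0 / ?a * (of_real q * c) ^ n" for n
        unfolding cf c_def[symmetric] power_mult_distrib by (simp only: mult_ac)
      ultimately show "(\<lambda>n. cnj (cayley_fun d n u) * of_real q ^ n) sums (K0 / of_real (1 - q) * (1 / (of_real u - \<i> * of_real ?w)))"
        by (simp only:)
    qed
    show "integrable sym_interval (\<lambda>u. (sqrt (d / pi) / d * (1 / (1 - \<bar>q\<bar>))) * arcsin_weight u)"
      by (intro integrable_mult_right arcsin_weight_integral)
    show "AE u in sym_interval. \<forall>N. (\<Sum>n<N. norm (osc_weight ?t u * (cnj (cayley_fun d n u) * of_real q ^ n))) \<le> (sqrt (d / pi) / d * (1 / (1 - \<bar>q\<bar>))) * arcsin_weight u"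
    proof (intro AE_I2 allI)
      fix u N assume "u \<in> space sym_interval"
      hence u: "- 1 < u" "u < 1" by auto
      have n1: "norm (cnj (cayley_fun d n u)) \<le> sqrt (d / pi) / d" for n
      proof -
        have "norm (cnj (cayley_fun d n u)) = sqrt (d / pi) / norm (of_real u - \<i> * complex_of_real d)"
          unfolding cf using d_pos by (simp add: norm_mult norm_divide norm_power cmod_cayley K0_def)
        also have "\<dots> \<le> sqrt (d / pi) / d"
          using d_pos norm_ge_pole(1)[of d u] by (intro divide_left_mono mult_pos_pos) auto
        finally show ?thesis .
      qed
      have "(\<Sum>n<N. norm (osc_weight ?t u * (cnj (cayley_fun d n u) * of_real q ^ n))) \<le> (\<Sum>n<N. arcsin_weight u * (sqrt (d / pi) / d * \<bar>q\<bar> ^ n))"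
      proof (rule sum_mono)
        fix n
        have "norm (osc_weight ?t u * (cnj (cayley_fun d n u) * of_real q ^ n)) = arcsin_weight u * (norm (cnj (cayley_fun d n u)) * \<bar>q\<bar> ^ n)"
          by (simp add: norm_mult norm_osc_weight norm_power)
        also have "\<dots> \<le> arcsin_weight u * (sqrt (d / pi) / d * \<bar>q\<bar> ^ n)"
          using arcsin_weight_pos[OF u] by (intro mult_left_mono mult_right_mono n1) auto
        finally show "norm (osc_weight ?t u * (cnj (cayley_fun d n u) * of_real q ^ n)) \<le> arcsin_weight u * (sqrt (d / pi) / d * \<bar>q\<bar> ^ n)" .
      qed
      also have "\<dots> = arcsin_weight u * (sqrt (d / pi) / d) * (\<Sum>n<N. \<bar>q\<bar> ^ n)"
        by (simp only: sum_distrib_left mult.assoc)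
      also have "\<dots> \<le> arcsin_weight u * (sqrt (d / pi) / d) * (1 / (1 - \<bar>q\<bar>))"
      proof (rule mult_left_mono)
        have "(\<Sum>n<N. \<bar>q\<bar> ^ n) \<le> (\<Sum>n. \<bar>q\<bar> ^ n)" using q by (intro sum_le_suminf summable_geometric) auto
        thus "(\<Sum>n<N. \<bar>q\<bar> ^ n) \<le> 1 / (1 - \<bar>q\<bar>)" using suminf_geometric[of "\<bar>q\<bar>"] q by simp
        show "0 \<le> arcsin_weight u * (sqrt (d / pi) / d)" using arcsin_weight_pos[OF u] d_pos by simp
      qed
      also have "\<dots> = (sqrt (d / pi) / d * (1 / (1 - \<bar>q\<bar>))) * arcsin_weight u" by (simp only: mult_ac)
      finally show "(\<Sum>n<N. norm (osc_weight ?t u * (cnj (cayley_fun d n u) * of_real q ^ n))) \<le> (sqrt (d / pi) / d * (1 / (1 - \<bar>q\<bar>))) * arcsin_weight u" .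
    qed
  qed
  have "(LINT u|sym_interval. osc_weight ?t u * (K0 / of_real (1 - q) * (1 / (of_real u - \<i> * of_real ?w)))) = of_real (?C * gen_h q s)"
  proof -
    have "(LINT u|sym_interval. osc_weight ?t u * (K0 / of_real (1 - q) * (1 / (of_real u - \<i> * of_real ?w))))
        = (LINT u|sym_interval. (K0 / of_real (1 - q)) * (osc_weight ?t u * (1 / (of_real u - \<i> * of_real ?w))))"
      by (intro Bochner_Integration.integral_cong refl) (simp only: mult_ac)
    also have "\<dots> = (K0 / of_real (1 - q)) * pole_integral ?t ?w"
      unfolding pole_integral_def by (rule Bochner_Integration.integral_mult_right_zero)
    also have "\<dots> = of_real (sqrt (d / pi) / (1 - q) * (2 * pi / ((1 + exp (2 * pi * ?t)) * pole_factor ?t ?w)))"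
    proof -
      have "- \<i> * a * \<i> = a" for a :: complex by (simp add: complex_eq_iff)
      hence "K0 * \<i> = of_real (sqrt (d / pi))" unfolding K0_def .
      hence "(K0 / of_real (1 - q)) * (2 * of_real pi * \<i> / X) = of_real (sqrt (d / pi)) / of_real (1 - q) * (of_real (2 * pi) / X)" for X
        by (simp add: field_simps)
      thus ?thesis unfolding pole_integral_value[OF w] by (simp only: of_real_mult of_real_divide)
    qed
    also have "sqrt (d / pi) / (1 - q) * (2 * pi / ((1 + exp (2 * pi * ?t)) * pole_factor ?t ?w)) = ?C * gen_h q s"
    proof -
      have y: "1 / s - 1 > 0" using s by (simp add: field_simps)
      \<comment> \<open>At t = \<open>ui_log s\<close> the factor 1 + exp (2 pi t) is exactly 1 / s;
        this is where the logarithm in the kernel pays off.\<close>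
      have e: "1 + exp (2 * pi * ?t) = 1 / s" using y by (simp add: ui_log_def)
      \<comment> \<open>Here cos (arctan w) = 1 / sqrt (1 + w^2), and exp (2 t arctan w) is the
        power of 1/s - 1 with exponent \<open>mp_b q / pi\<close>.\<close>
      have p: "2 * pi / (1 / s * pole_factor ?t ?w) = 2 * pi * s * (cos (mp_b q) * (1 / s - 1) powr (mp_b q / pi))"
      proof -
        have "(1 / s - 1) powr (mp_b q / pi) = exp (2 * mp_b q * ?t)" unfolding exp_ui_log[OF s] by simp
        also have "\<dots> = 1 / exp (- 2 * ?t * arctan ?w)" unfolding mp_b_def by (simp add: exp_minus field_simps)
        finally have "cos (mp_b q) * (1 / s - 1) powr (mp_b q / pi) = 1 / pole_factor ?t ?w"
          unfolding pole_factor_def mp_b_def cos_arctan by simp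
        thus ?thesis using s by simp
      qed
      have g: "sqrt (1 - s) * (1 - s) powr (- 1 / 2) = 1"
      proof -
        have "sqrt (1 - s) = (1 - s) powr (1 / 2)" using s by (simp add: powr_half_sqrt)
        thus ?thesis using s by (simp add: powr_add[symmetric])
      qed
      have r: "sqrt 2 * sqrt (2 * d / pi) = 2 * sqrt (d / pi)"
      proof -
        have "sqrt 2 * sqrt (2 * d / pi) = sqrt (2\<^sup>2 * (d / pi))" unfolding real_sqrt_mult[symmetric] by (simp add: power2_eq_square)
        thus ?thesis unfolding real_sqrt_mult by simp
      qed
      have "?C * gen_h q s = (sqrt 2 * sqrt (2 * d / pi)) * pi * s * (sqrt (1 - s) * (1 - s) powr (- 1 / 2)) * ((1 / s - 1) powr (mp_b q / pi) * (cos (mp_b q) / (1 - q)))"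
        unfolding gen_h_def by (simp only: mult_ac)
      also have "\<dots> = sqrt (d / pi) / (1 - q) * (2 * pi * s * (cos (mp_b q) * (1 / s - 1) powr (mp_b q / pi)))"
        unfolding g r by simp
      finally show ?thesis unfolding e p by simp
    qed
    finally show ?thesis .
  qed
  moreover have "(LINT u|sym_interval. osc_weight ?t u * (cnj (cayley_fun d n u) * of_real q ^ n))
     = (LINT u|sym_interval. osc_weight ?t u * cnj (cayley_fun d n u)) * of_real q ^ n" for n
    unfolding mult.assoc[symmetric] by (rule Bochner_Integration.integral_mult_left_zero)
  ultimately show "(\<lambda>n. (LINT u|sym_interval. osc_weight ?t u * cnj (cayley_fun d n u)) * of_real q ^ n) sums of_real (?C * gen_h q s)"
    using S by simp
qed simp

text \<open>Fubini makes the inner integral over \<open>x\<close> a conjugate Laplace transform of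
  the Laguerre function, leaving the pairing just computed; the constants of \<open>q_plus\<close>
  are the ones that cancel its prefactor.\<close>

lemma q_plus_pairing:
  assumes s: "0 < s" "s < 1"
  shows "(LINT x|half_line. q_plus s x * laguerre_fun d n x) = h0 n s"
proof -
  define c where "c = complex_of_real (1/2 * pi powr (-3/2) * (1/s) * (1 - s) powr (-1/2))"
  define k where "k x u = iexp (- (x * u)) * osc_weight (ui_log s) u * laguerre_fun d n x" for x u
  interpret P: pair_sigma_finite half_line sym_interval
    by (intro pair_sigma_finite.intro sigma_finite_half_line sigma_finite_sym_interval)
  have [measurable]: "(\<lambda>x. x) \<in> half_line \<rightarrow>\<^sub>M borel" "(\<lambda>x. x) \<in> sym_interval \<rightarrow>\<^sub>M borel"
    by (intro borel_half_line borel_sym_interval, measurable)+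
  have km: "case_prod k \<in> borel_measurable (half_line \<Otimes>\<^sub>M sym_interval)"
  proof -
    have 1: "case_prod k \<in> borel_measurable (borel \<Otimes>\<^sub>M borel)" unfolding k_def by measurable
    have 2: "(\<lambda>p. (fst p, snd p)) \<in> half_line \<Otimes>\<^sub>M sym_interval \<rightarrow>\<^sub>M borel \<Otimes>\<^sub>M borel" by measurable
    from measurable_compose[OF 2 1] show ?thesis by simp
  qed
  have osc_int: "integrable sym_interval (osc_weight (ui_log s))"
    using weight_integrable[of "\<lambda>_. 1" 1 "ui_log s"] by simp
  have int: "integrable (half_line \<Otimes>\<^sub>M sym_interval) (case_prod k)"
    by (rule P.integrable_product_bound[OF laguerre_fun_laplace(1)[OF d_pos, of n] osc_int km]) (simp add: k_def norm_mult)
  have "(LINT x|half_line. q_plus s x * laguerre_fun d n x) = (LINT x|half_line. c * (LINT u|sym_interval. k x u))"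
  proof (rule Bochner_Integration.integral_cong[OF refl])
    fix x
    have "(LINT u|sym_interval. k x u) = (LINT u|sym_interval. iexp (- (x * u)) * osc_weight (ui_log s) u) * laguerre_fun d n x"
      unfolding k_def by (rule Bochner_Integration.integral_mult_left_zero)
    thus "q_plus s x * laguerre_fun d n x = c * (LINT u|sym_interval. k x u)"
      unfolding q_plus_eq c_def by (simp only: mult.assoc)
  qed
  also have "\<dots> = c * (LINT x|half_line. LINT u|sym_interval. k x u)" by (rule Bochner_Integration.integral_mult_right_zero)
  also have "(LINT x|half_line. LINT u|sym_interval. k x u) = (LINT u|sym_interval. LINT x|half_line. k x u)"
    by (rule P.Fubini_integral[OF int, symmetric])
  also have "\<dots> = (LINT u|sym_interval. of_real (sqrt (2 * pi)) * (osc_weight (ui_log s) u * cnj (cayley_fun d n u)))"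
  proof (rule Bochner_Integration.integral_cong[OF refl])
    fix u
    have "(LINT x|half_line. k x u) = (LINT x|half_line. osc_weight (ui_log s) u * cnj (iexp (u * x) * laguerre_fun d n x))"
      unfolding k_def by (intro Bochner_Integration.integral_cong refl) (simp add: exp_cnj mult_ac)
    also have "\<dots> = osc_weight (ui_log s) u * cnj (of_real (sqrt (2 * pi)) * cayley_fun d n u)"
      unfolding Bochner_Integration.integral_mult_right_zero Bochner_Integration.integral_cnj laguerre_fun_laplace(2)[OF d_pos] ..
    finally show "(LINT x|half_line. k x u) = of_real (sqrt (2 * pi)) * (osc_weight (ui_log s) u * cnj (cayley_fun d n u))"
      by simp
  qed
  also have "\<dots> = of_real (sqrt (2 * pi)) * (of_real (sqrt 2 * pi * s * sqrt (1 - s)) * h0 n s)"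
    unfolding Bochner_Integration.integral_mult_right_zero cayley_pairing[OF s] ..
  also have "c * (of_real (sqrt (2 * pi)) * (of_real (sqrt 2 * pi * s * sqrt (1 - s)) * h0 n s))
     = of_real (1/2 * pi powr (-3/2) * (1/s) * (1 - s) powr (-1/2) * (sqrt (2 * pi) * (sqrt 2 * pi * s * sqrt (1 - s)))) * h0 n s"
    unfolding c_def by (simp only: of_real_mult mult_ac)
  also have "1/2 * pi powr (-3/2) * (1/s) * (1 - s) powr (-1/2) * (sqrt (2 * pi) * (sqrt 2 * pi * s * sqrt (1 - s))) = 1"
  proof -
    have g: "(1 - s) powr (- 1 / 2) * sqrt (1 - s) = 1"
    proof -
      have "sqrt (1 - s) = (1 - s) powr (1 / 2)" using s by (simp add: powr_half_sqrt)
      thus ?thesis using s by (simp add: powr_add[symmetric])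
    qed
    have p: "pi powr (- 3 / 2) * (sqrt pi * pi) = 1"
    proof -
      have "sqrt pi * pi = pi powr (1 / 2 + 1)" unfolding powr_add by (simp add: powr_half_sqrt)
      thus ?thesis by (simp only: powr_add[symmetric]) simp
    qed
    have "1/2 * pi powr (-3/2) * (1/s) * (1 - s) powr (-1/2) * (sqrt (2 * pi) * (sqrt 2 * pi * s * sqrt (1 - s)))
       = (1/2 * (sqrt 2 * sqrt 2)) * (pi powr (- 3 / 2) * (sqrt pi * pi)) * ((1/s) * s) * ((1 - s) powr (- 1 / 2) * sqrt (1 - s))"
      unfolding real_sqrt_mult by (simp only: mult_ac)
    thus ?thesis unfolding g p using s by simp
  qed
  finally show ?thesis by simp
qed

section \<open>Truncations and the limit in the mean\<close>

definition trunc :: "real \<Rightarrow> real \<Rightarrow> (real \<Rightarrow> complex) \<Rightarrow> real \<Rightarrow> complex" where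
  "trunc a a' f s = indicator {a..1 - a'} s * f s"

lemma trunc_measurable: "f \<in> borel_measurable unit_interval \<Longrightarrow> trunc a a' f \<in> borel_measurable unit_interval"
proof -
  assume [measurable]: "f \<in> borel_measurable unit_interval"
  have [measurable]: "(\<lambda>s. indicator {a..1 - a'} s :: complex) \<in> borel_measurable unit_interval"
    by (intro borel_unit_interval) measurable
  show ?thesis unfolding trunc_def [abs_def] by measurable
qed

lemma trunc_sqi:
  assumes f: "square_integrable unit_interval f"
  shows "square_integrable unit_interval (trunc a a' f)"
  by (rule sqi_bound[OF trunc_measurable[OF sqi_measurable[OF f]] sqi_integrable[OF f]])
    (auto simp: trunc_def indicator_def)

lemma unit_interval_one: "square_integrable unit_interval (\<lambda>s. 1)"
  unfolding square_integrable_def unit_interval_def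
  by (subst integrable_restrict_space) (auto intro!: borel_measurable_const)

text \<open>The truncation error shrinks as either cut moves outwards. A single index of a sequence
  of symmetric truncations thus controls all smaller pairs \<open>a\<close>, \<open>a'\<close>,
  which handles the two parameter limit.\<close>

lemma trunc_limit:
  assumes f: "square_integrable unit_interval f" and e: "e > 0"
  obtains \<delta> where "\<delta> > 0" "\<And>a a'. 0 < a \<Longrightarrow> a < \<delta> \<Longrightarrow> 0 < a' \<Longrightarrow> a' < \<delta> \<Longrightarrow> nsq unit_interval (\<lambda>s. trunc a a' f s - f s) < e"
proof -
  define x where "x n = 1 / (real n + 1)" for n
  have x: "x n > 0" for n by (simp add: x_def)
  have inf: "filterlim (\<lambda>n. real n + 1) at_top sequentially"
    by (rule filterlim_real_plus_1)
  have x_lim: "x \<longlonglongrightarrow> 0" using tendsto_inverse_0_at_top[OF inf] by (simp add: x_def [abs_def] divide_inverse)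
  have m: "(\<lambda>s. (cmod (trunc a a' f s - f s))\<^sup>2) \<in> borel_measurable unit_interval" for a a'
    using trunc_measurable[OF sqi_measurable[OF f], of a a'] sqi_measurable[OF f] by measurable
  have "(\<lambda>n. nsq unit_interval (\<lambda>s. trunc (x n) (x n) f s - f s)) \<longlonglongrightarrow> (LINT s|unit_interval. (0::real))"
    unfolding nsq_def
  proof (rule integral_dominated_convergence[OF _ m sqi_integrable[OF f]])
    show "AE s in unit_interval. (\<lambda>n. (cmod (trunc (x n) (x n) f s - f s))\<^sup>2) \<longlonglongrightarrow> 0"
    proof (rule AE_I2)
      fix s assume "s \<in> space unit_interval"
      hence s: "0 < s" "0 < 1 - s" by auto
      have "\<forall>\<^sub>F n in sequentially. (cmod (trunc (x n) (x n) f s - f s))\<^sup>2 = 0"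
        using order_tendstoD(2)[OF x_lim s(1)] order_tendstoD(2)[OF x_lim s(2)]
        by eventually_elim (auto simp: trunc_def)
      thus "(\<lambda>n. (cmod (trunc (x n) (x n) f s - f s))\<^sup>2) \<longlonglongrightarrow> 0" by (rule tendsto_eventually)
    qed
  qed (auto simp: trunc_def indicator_def)
  hence "(\<lambda>n. nsq unit_interval (\<lambda>s. trunc (x n) (x n) f s - f s)) \<longlonglongrightarrow> 0" by simp
  from eventually_happens[OF order_tendstoD(2)[OF this e]] obtain n
    where n: "nsq unit_interval (\<lambda>s. trunc (x n) (x n) f s - f s) < e" by auto
  show ?thesis
  proof (rule that[OF x[of n]])
    fix a a' assume a: "0 < a" "a < x n" "0 < a'" "a' < x n"
    have "nsq unit_interval (\<lambda>s. trunc a a' f s - f s) \<le> nsq unit_interval (\<lambda>s. trunc (x n) (x n) f s - f s)"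
      unfolding nsq_def
      using a by (intro integral_mono sqi_integrable sqi_diff trunc_sqi f) (auto simp: trunc_def indicator_def)
    thus "nsq unit_interval (\<lambda>s. trunc a a' f s - f s) < e" using n by linarith
  qed
qed

text \<open>For truncated \<open>f\<close> the kernel integral converges absolutely and is bounded
  in \<open>x\<close>. By Fubini and \<open>q_plus_pairing\<close> its pairings with Laguerre
  functions are the \<open>h0\<close> coefficients of the truncation, which are also the
  coefficients of the image under \<open>W\<close>; weighted completeness concludes.\<close>

lemma V_truncated:
  assumes W: "L2_unitary unit_interval half_line W"
    and Wip: "\<And>F n. F \<in> L2 unit_interval \<Longrightarrow> ip half_line (rep (W F)) (laguerre_fun d n) = ip unit_interval (rep F) (h0 n)"
    and f: "square_integrable unit_interval f" and a: "0 < a" "0 < a'"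
  shows "ae_class half_line (\<lambda>x. LINT s:{a..1-a'}|lborel. q_plus s x * f s) = W (ae_class unit_interval (trunc a a' f))"
proof -
  define g where "g = trunc a a' f"
  define v where "v x = (LINT s|unit_interval. q_plus s x * g s)" for x
  have g: "square_integrable unit_interval g" unfolding g_def by (rule trunc_sqi[OF f])
  have gm [measurable]: "g \<in> borel_measurable unit_interval" by (rule sqi_measurable[OF g])
  have g_int: "integrable unit_interval g" using sqi_mult_integrable[OF g unit_interval_one] by simp
  have v_eq: "(LINT s:{a..1-a'}|lborel. q_plus s x * f s) = v x" for x
    unfolding v_def unit_interval_def set_lebesgue_integral_def g_def trunc_def
    by (subst integral_restrict_space)
      (use a in \<open>auto intro!: Bochner_Integration.integral_cong simp: indicator_def\<close>)
  \<comment> \<open>Bound of the kernel for \<open>s\<close> between \<open>a\<close> and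
    \<open>1 - a'\<close>, uniform in \<open>x\<close>: 1/s and (1 - s)^(-1/2) take their largest
    values at the two ends.\<close>
  define C where "C = 1/2 * pi powr (-3/2) * (1/a) * a' powr (-1/2) * pi"
  have C0: "C \<ge> 0" using a by (simp add: C_def)
  have b: "norm (q_plus s x * g s) \<le> C * norm (g s)" for s x
  proof (cases "s \<in> {a..1 - a'}")
    case True
    hence s: "0 < s" "s < 1" using a by auto
    have "norm (q_plus s x) \<le> 1/2 * pi powr (-3/2) * (1/s) * (1 - s) powr (-1/2) * pi" by (rule q_plus_bound[OF s])
    also have "\<dots> \<le> C"
    proof -
      have "(1 - s) powr (-1/2) \<le> a' powr (-1/2)" using True a by (intro powr_mono2') auto
      moreover have "1/s \<le> 1/a" using True a by (intro divide_left_mono) auto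
      ultimately show ?thesis unfolding C_def using s a by (intro mult_mono mult_nonneg_nonneg) auto
    qed
    finally show ?thesis unfolding norm_mult by (intro mult_right_mono) auto
  next
    case False
    thus ?thesis by (simp add: g_def trunc_def)
  qed
  interpret P: pair_sigma_finite unit_interval half_line
    by (intro pair_sigma_finite.intro sigma_finite_half_line sigma_finite_unit_interval)
  have [measurable]: "(\<lambda>x. x) \<in> half_line \<rightarrow>\<^sub>M borel" "(\<lambda>x. x) \<in> unit_interval \<rightarrow>\<^sub>M borel"
    by (intro borel_half_line borel_unit_interval, measurable)+
  have qm: "(\<lambda>p. q_plus (fst p) (snd p)) \<in> borel_measurable (unit_interval \<Otimes>\<^sub>M half_line)"
  proof -
    have "(\<lambda>p. (fst p, snd p)) \<in> unit_interval \<Otimes>\<^sub>M half_line \<rightarrow>\<^sub>M borel \<Otimes>\<^sub>M borel" by measurable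
    from measurable_compose[OF this q_plus_measurable] show ?thesis by simp
  qed
  have qm': "(\<lambda>p. q_plus (snd p) (fst p)) \<in> borel_measurable (half_line \<Otimes>\<^sub>M unit_interval)"
  proof -
    have "(\<lambda>p. (snd p, fst p)) \<in> half_line \<Otimes>\<^sub>M unit_interval \<rightarrow>\<^sub>M borel \<Otimes>\<^sub>M borel" by measurable
    from measurable_compose[OF this q_plus_measurable] show ?thesis by simp
  qed
  have vm [measurable]: "v \<in> borel_measurable half_line"
    unfolding v_def [abs_def]
  proof (rule sigma_finite_measure.borel_measurable_lebesgue_integral[OF sigma_finite_unit_interval])
    show "(\<lambda>(x, s). q_plus s x * g s) \<in> borel_measurable (half_line \<Otimes>\<^sub>M unit_interval)"
      unfolding split_beta using qm' by measurable
  qed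
  define D where "D = (LINT s|unit_interval. C * norm (g s))"
  have vb: "norm (v x) \<le> D" for x
  proof -
    have "norm (v x) \<le> (LINT s|unit_interval. norm (q_plus s x * g s))" unfolding v_def by (rule integral_norm_bound)
    also have "\<dots> \<le> D"
    proof (cases "integrable unit_interval (\<lambda>s. norm (q_plus s x * g s))")
      case True
      thus ?thesis unfolding D_def using g_int by (intro integral_mono b) auto
    next
      \<comment> \<open>Without integrability the left integral has the default value 0, and the
        bound is nonnegative.\<close>
      case False
      thus ?thesis unfolding D_def using C0 by (simp add: not_integrable_integral_eq)
    qed
    finally show ?thesis .
  qed
  have D0: "D \<ge> 0" using vb[of 0] norm_ge_zero order_trans by blast
  have pair: "(LINT x|half_line. v x * laguerre_fun d n x) = (LINT s|unit_interval. g s * h0 n s)" for n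
  proof -
    define k where "k s x = q_plus s x * g s * laguerre_fun d n x" for s x
    have Lm [measurable]: "laguerre_fun d n \<in> borel_measurable half_line" by (intro borel_half_line) measurable
    have km: "case_prod k \<in> borel_measurable (unit_interval \<Otimes>\<^sub>M half_line)"
      unfolding k_def split_beta using qm by measurable
    have int: "integrable (unit_interval \<Otimes>\<^sub>M half_line) (case_prod k)"
    proof (rule P.integrable_product_bound[OF _ laguerre_fun_laplace(1)[OF d_pos, of n] km])
      show "integrable unit_interval (\<lambda>s. of_real C * g s)" using g_int by simp
      show "norm (k s x) \<le> norm (of_real C * g s) * norm (laguerre_fun d n x)" for s x
        unfolding k_def norm_mult[of "_ * _" "laguerre_fun d n x"] using b[of s x] C0 by (intro mult_right_mono) (auto simp: norm_mult)
    qed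
    have "(LINT x|half_line. v x * laguerre_fun d n x) = (LINT x|half_line. LINT s|unit_interval. k s x)"
      unfolding v_def k_def by (simp only: Bochner_Integration.integral_mult_left_zero)
    also have "\<dots> = (LINT s|unit_interval. LINT x|half_line. k s x)" by (rule P.Fubini_integral[OF int])
    also have "\<dots> = (LINT s|unit_interval. g s * h0 n s)"
    proof (rule Bochner_Integration.integral_cong[OF refl])
      fix s assume "s \<in> space unit_interval"
      hence s: "0 < s" "s < 1" by auto
      have "(LINT x|half_line. k s x) = (LINT x|half_line. g s * (q_plus s x * laguerre_fun d n x))"
        unfolding k_def by (simp only: mult_ac)
      also have "\<dots> = g s * h0 n s" unfolding Bochner_Integration.integral_mult_right_zero q_plus_pairing[OF s] ..
      finally show "(LINT x|half_line. k s x) = g s * h0 n s" .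
    qed
    finally show ?thesis .
  qed
  let ?G = "ae_class unit_interval g"
  have G: "?G \<in> L2 unit_interval" by (rule ae_class_in_L2[OF g])
  have WG: "W ?G \<in> L2 half_line" using L2_unitary_isometry[OF W] G by (simp add: L2_isometry_def)
  define k where "k = rep (W ?G)"
  have k: "square_integrable half_line k" unfolding k_def by (rule L2_rep(1)[OF WG])
  have km [measurable]: "k \<in> borel_measurable half_line" by (rule sqi_measurable[OF k])
  have d2: "d / 2 > 0" using d_pos by simp
  note Ls = on_sqi[OF laguerre_fun_orthonormal[OF d_pos]]
  have "AE x in half_line. k x - v x = 0"
  proof (rule laguerre_fun_complete[OF d_pos])
    show "(\<lambda>x. k x - v x) \<in> borel_measurable half_line" by measurable
    have em: "(\<lambda>x. exp (- d / 2 * x)) \<in> borel_measurable half_line" by (intro borel_half_line) measurable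
    show "integrable half_line (\<lambda>x. norm (k x - v x) * exp (- d / 2 * x))"
    proof (rule Bochner_Integration.integrable_bound)
      show "integrable half_line (\<lambda>x. norm (k x) * exp (- d / 2 * x) + D * exp (- (d / 2) * x))"
        by (intro Bochner_Integration.integrable_add sqi_exp_weight d_pos k integrable_mult_right exp_integrable_half_line d2)
      show "(\<lambda>x. norm (k x - v x) * exp (- d / 2 * x)) \<in> borel_measurable half_line" using em by measurable
      show "AE x in half_line. norm (norm (k x - v x) * exp (- d / 2 * x)) \<le> norm (norm (k x) * exp (- d / 2 * x) + D * exp (- (d / 2) * x))"
      proof (rule AE_I2)
        fix x
        have "norm (k x - v x) \<le> norm (k x) + D" using norm_triangle_ineq4[of "k x" "v x"] vb[of x] by linarith
        hence "norm (k x - v x) * exp (- d / 2 * x) \<le> (norm (k x) + D) * exp (- d / 2 * x)" by (intro mult_right_mono) auto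
        thus "norm (norm (k x - v x) * exp (- d / 2 * x)) \<le> norm (norm (k x) * exp (- d / 2 * x) + D * exp (- (d / 2) * x))"
          using D0 by (simp add: abs_mult distrib_right)
      qed
    qed
    fix n
    have i1: "integrable half_line (\<lambda>x. k x * laguerre_fun d n x)" by (intro sqi_mult_integrable k Ls)
    have i2: "integrable half_line (\<lambda>x. v x * laguerre_fun d n x)"
    proof (rule Bochner_Integration.integrable_bound)
      show "integrable half_line (\<lambda>x. D * norm (laguerre_fun d n x))"
        by (intro integrable_mult_right integrable_norm laguerre_fun_laplace(1) d_pos)
      show "(\<lambda>x. v x * laguerre_fun d n x) \<in> borel_measurable half_line"
        using borel_half_line[OF laguerre_fun_measurable[of d n]] by measurable
      show "AE x in half_line. norm (v x * laguerre_fun d n x) \<le> norm (D * norm (laguerre_fun d n x))"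
        using vb D0 by (intro AE_I2) (simp add: norm_mult abs_mult mult_right_mono)
    qed
    have "(LINT x|half_line. k x * laguerre_fun d n x) = ip unit_interval (rep ?G) (h0 n)"
      using Wip[OF G, of n] by (simp add: ip_def k_def)
    also have "\<dots> = (LINT s|unit_interval. g s * h0 n s)"
      by (subst ip_rep_ae_class) (auto simp: ip_def intro: gm sqi_measurable[OF h0_sqi])
    also have "\<dots> = (LINT x|half_line. v x * laguerre_fun d n x)" by (rule pair[symmetric])
    finally have e: "(LINT x|half_line. k x * laguerre_fun d n x) = (LINT x|half_line. v x * laguerre_fun d n x)" .
    show "(LINT x|half_line. (k x - v x) * laguerre_fun d n x) = 0"
      unfolding left_diff_distrib Bochner_Integration.integral_diff[OF i1 i2] e by simp
  qed
  hence "AE x in half_line. k x = v x" by eventually_elim simp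
  from ae_class_eqI[OF this] have "W ?G = ae_class half_line v" using L2_rep(2)[OF WG] by (simp add: k_def)
  thus ?thesis unfolding v_eq g_def by simp
qed

lemma L2_tendsto_unique:
  assumes K: "L2_tendsto M u K \<F>" and K': "L2_tendsto M u K' \<F>" and F: "\<F> \<noteq> bot"
  shows "K = K'"
proof -
  have L: "K \<in> L2 M" "K' \<in> L2 M" using K K' by (auto simp: L2_tendsto_def)
  let ?N = "\<lambda>F G. nsq M (\<lambda>x. rep F x - rep G x)"
  have ev: "\<forall>\<^sub>F i in \<F>. u i \<in> L2 M" using K by (simp add: L2_tendsto_def)
  have lim: "((\<lambda>i. (L2_norm M (L2_diff M (u i) G))\<^sup>2) \<longlongrightarrow> 0\<^sup>2) \<F>" if "L2_tendsto M u G \<F>" for G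
    using that by (intro tendsto_power) (simp add: L2_tendsto_def)
  have "((\<lambda>i. 2 * (L2_norm M (L2_diff M (u i) K))\<^sup>2 + 2 * (L2_norm M (L2_diff M (u i) K'))\<^sup>2) \<longlongrightarrow> 2 * 0\<^sup>2 + 2 * 0\<^sup>2) \<F>"
    by (intro tendsto_add tendsto_mult tendsto_const lim K K')
  moreover have "\<forall>\<^sub>F i in \<F>. ?N K K' \<le> 2 * (L2_norm M (L2_diff M (u i) K))\<^sup>2 + 2 * (L2_norm M (L2_diff M (u i) K'))\<^sup>2"
    using ev
  proof eventually_elim
    fix i assume u: "u i \<in> L2 M"
    have "?N K K' \<le> 2 * ?N K (u i) + 2 * ?N (u i) K'" by (intro nsq_diff_le L2_rep L u)
    also have "?N K (u i) = ?N (u i) K" by (rule nsq_minus_commute)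
    finally show "?N K K' \<le> 2 * (L2_norm M (L2_diff M (u i) K))\<^sup>2 + 2 * (L2_norm M (L2_diff M (u i) K'))\<^sup>2"
      by (simp add: L2_norm_nsq nsq_rep_L2_diff u L nsq_nonneg)
  qed
  ultimately have "?N K K' \<le> 2 * 0\<^sup>2 + 2 * 0\<^sup>2" using F by (intro tendsto_lowerbound)
  hence "?N K K' = 0" using nsq_nonneg[of M "\<lambda>x. rep K x - rep K' x"] by simp
  thus ?thesis by (intro L2_norm_diff_eq_0[OF L]) (simp add: L2_norm_nsq nsq_rep_L2_diff L)
qed

text \<open>The truncations of \<open>H\<close> converge to \<open>H\<close>, so by isometry their
  images under \<open>W\<close> converge to \<open>W H\<close>. Hence the limit defining
  \<open>V_op H\<close> exists and equals \<open>W H\<close>, and \<open>V_op\<close> inherits the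
  properties of \<open>W\<close> on L2.\<close>

theorem V_op_isometry: "L2_isometry unit_interval half_line V_op"
  and V_op_h0: "V_op (ae_class unit_interval (h0 n)) = ae_class half_line (laguerre_fun d n)"
proof -
  obtain W where W: "L2_unitary unit_interval half_line W"
    "\<And>F n. F \<in> L2 unit_interval \<Longrightarrow> ip half_line (rep (W F)) (laguerre_fun d n) = ip unit_interval (rep F) (h0 n)"
    by (rule onb_unitary[OF h0_onb laguerre_fun_onb[OF d_pos]]) blast
  note iso = L2_unitary_isometry[OF W(1)]
  have WL: "W F \<in> L2 half_line" if "F \<in> L2 unit_interval" for F using iso that by (simp add: L2_isometry_def)
  have V: "V_op H = W H" if H: "H \<in> L2 unit_interval" for H
  proof -
    define f where "f = rep H"
    have f: "square_integrable unit_interval f" unfolding f_def by (rule L2_rep(1)[OF H])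
    define u where "u = (\<lambda>(a, a'). ae_class half_line (\<lambda>x. LINT s:{a..1-a'}|lborel. q_plus s x * f s))"
    define \<F> where "\<F> = at_right (0::real) \<times>\<^sub>F at_right (0::real)"
    have u: "u (a, a') = W (ae_class unit_interval (trunc a a' f))" if "0 < a" "0 < a'" for a a'
      unfolding u_def using V_truncated[OF W f that] by simp
    have uL: "u (a, a') \<in> L2 half_line" if "0 < a" "0 < a'" for a a'
      unfolding u[OF that] by (intro WL ae_class_in_L2 trunc_sqi f)
    have un: "L2_norm half_line (L2_diff half_line (u (a, a')) (W H)) = sqrt (nsq unit_interval (\<lambda>s. trunc a a' f s - f s))"
      if "0 < a" "0 < a'" for a a'
    proof -
      have T: "ae_class unit_interval (trunc a a' f) \<in> L2 unit_interval" by (intro ae_class_in_L2 trunc_sqi f)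
      have "nsq unit_interval (\<lambda>s. rep (ae_class unit_interval (trunc a a' f)) s - rep H s) = nsq unit_interval (\<lambda>s. trunc a a' f s - f s)"
      proof (rule nsq_cong_AE)
        show "AE s in unit_interval. rep (ae_class unit_interval (trunc a a' f)) s - rep H s = trunc a a' f s - f s"
          using rep_ae_class(2)[OF sqi_measurable[OF trunc_sqi[OF f, of a a']]] by eventually_elim (simp add: f_def)
      qed (intro sqi_measurable sqi_diff trunc_sqi f L2_rep T H)+
      thus ?thesis unfolding u[OF that] L2_isometry_diff_norm[OF iso T H] by (simp add: L2_norm_nsq nsq_rep_L2_diff T H)
    qed
    have pos: "\<forall>\<^sub>F a in at_right (0::real). 0 < a \<and> a < \<delta>" if "\<delta> > 0" for \<delta>
      using that by (subst eventually_at_right[of 0 "\<delta> + 1"]) auto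
    have T: "L2_tendsto half_line u (W H) \<F>"
      unfolding L2_tendsto_def
    proof (intro conjI WL H)
      show "\<forall>\<^sub>F i in \<F>. u i \<in> L2 half_line"
        unfolding \<F>_def eventually_prod_filter using pos[of 1] uL
        by (intro exI[of _ "\<lambda>a. 0 < a \<and> a < 1"]) auto
      show "((\<lambda>i. L2_norm half_line (L2_diff half_line (u i) (W H))) \<longlongrightarrow> 0) \<F>"
      proof (rule tendstoI)
        fix e :: real assume e: "e > 0"
        hence "e\<^sup>2 > 0" by simp
        from trunc_limit[OF f this] obtain \<delta> where \<delta>: "\<delta> > 0"
          "\<And>a a'. 0 < a \<Longrightarrow> a < \<delta> \<Longrightarrow> 0 < a' \<Longrightarrow> a' < \<delta> \<Longrightarrow> nsq unit_interval (\<lambda>s. trunc a a' f s - f s) < e\<^sup>2" by blast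
        have "dist (L2_norm half_line (L2_diff half_line (u (a, a')) (W H))) 0 < e" if "0 < a \<and> a < \<delta>" "0 < a' \<and> a' < \<delta>" for a a'
          using \<delta>(2)[of a a'] that e by (simp add: un nsq_nonneg real_less_lsqrt)
        thus "\<forall>\<^sub>F i in \<F>. dist (L2_norm half_line (L2_diff half_line (u i) (W H))) 0 < e"
          unfolding \<F>_def eventually_prod_filter using pos[OF \<delta>(1)]
          by (intro exI[of _ "\<lambda>a. 0 < a \<and> a < \<delta>"]) auto
      qed
    qed
    have "\<F> \<noteq> bot" unfolding \<F>_def by (simp add: prod_filter_eq_bot)
    hence "L2_lim half_line u \<F> = W H" unfolding L2_lim_def by (intro the_equality T L2_tendsto_unique[OF _ T])
    thus ?thesis unfolding V_op_def u_def \<F>_def f_def .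
  qed
  show "L2_isometry unit_interval half_line V_op"
    using iso by (simp add: L2_isometry_def V L2_lincomb_in)
  have h: "ae_class unit_interval (h0 n) \<in> L2 unit_interval" by (rule ae_class_in_L2[OF h0_sqi])
  note Ls = on_sqi[OF laguerre_fun_orthonormal[OF d_pos]]
  have l: "ae_class half_line (laguerre_fun d n) \<in> L2 half_line" by (rule ae_class_in_L2[OF Ls])
  have "W (ae_class unit_interval (h0 n)) = ae_class half_line (laguerre_fun d n)"
  proof (rule L2_eqI[OF WL[OF h] l], rule onb_complete[OF laguerre_fun_onb[OF d_pos] L2_rep(1)[OF WL[OF h]] L2_rep(1)[OF l]])
    fix k
    show "ip half_line (rep (W (ae_class unit_interval (h0 n)))) (laguerre_fun d k) = ip half_line (rep (ae_class half_line (laguerre_fun d n))) (laguerre_fun d k)"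
      unfolding W(2)[OF h] ip_rep_ae_class[OF sqi_measurable[OF h0_sqi] sqi_measurable[OF h0_sqi]] ip_rep_ae_class[OF sqi_measurable[OF Ls] sqi_measurable[OF Ls]]
      using on_ip[OF h0_orthonormal] on_ip[OF laguerre_fun_orthonormal[OF d_pos]] by simp
  qed
  thus "V_op (ae_class unit_interval (h0 n)) = ae_class half_line (laguerre_fun d n)" by (simp add: V[OF h])
qed

end

section \<open>The circle\<close>

abbreviation circle_space :: "complex measure" where
  "circle_space \<equiv> restrict_space borel (sphere 0 1)"

lemma space_circle [simp]: "space circle = sphere 0 1"
  by (simp add: circle_def space_restrict_space)

lemma sets_circle: "sets circle = sets circle_space"
  by (simp add: circle_def)

lemma measurable_circle: "f \<in> borel_measurable borel \<Longrightarrow> f \<in> borel_measurable circle"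
  for f :: "complex \<Rightarrow> 'b::topological_space"
  unfolding circle_def measurable_distr_eq1 by (rule measurable_restrict_space1)

lemma uniform_density:
  "uniform_measure lborel {0..<2*pi} = density lborel (\<lambda>t. ennreal (indicator {0..<2*pi} t / (2*pi)))"
proof -
  have "indicator {0..<2*pi} t / emeasure lborel {0..<2*pi} = ennreal (indicator {0..<2*pi} t / (2*pi))" for t
    using divide_ennreal[of 1 "2*pi"] by (cases "t \<in> {0..<2*pi}") (simp_all add: indicator_def)
  thus ?thesis unfolding uniform_measure_def by simp
qed

lemma cis_measurable [measurable]: "cis \<in> borel_measurable borel"
  by (intro borel_measurable_continuous_onI continuous_intros)

lemma cis_circle_space: "cis \<in> uniform_measure lborel {0..<2*pi} \<rightarrow>\<^sub>M circle_space"
  by (rule measurable_restrict_space2) auto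

lemma prob_space_circle: "prob_space circle"
  unfolding circle_def
  by (intro prob_space.prob_space_distr prob_space_uniform_measure cis_circle_space) simp_all

lemma circle_moments: "(LINT z|circle. z powi n) = of_bool (n = 0)"
proof (cases "n = 0")
  case True
  thus ?thesis using prob_space.prob_space[OF prob_space_circle] by simp
next
  case False
  let ?F = "\<lambda>t. cis (of_int n * t) / (\<i> * of_int n)"
  have "(LINT z|circle. z powi n) = (LINT t|uniform_measure lborel {0..<2*pi}. cis t powi n)"
    unfolding circle_def
  proof (rule integral_distr[OF cis_circle_space])
    show "(\<lambda>z. z powi n) \<in> borel_measurable circle_space" by (intro measurable_restrict_space1) measurable
  qed
  also have "\<dots> = (LINT t|lborel. (indicator {0..<2*pi} t / (2*pi)) *\<^sub>R (cis t powi n))"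
    unfolding uniform_density by (rule integral_density) auto
  also have "\<dots> = (LINT t|lborel. of_real (1 / (2*pi)) * (indicator {0..<2*pi} t *\<^sub>R cis (of_int n * t)))"
    by (intro Bochner_Integration.integral_cong refl) (simp add: cis_power_int scaleR_conv_of_real)
  also have "\<dots> = of_real (1 / (2*pi)) * (LINT t:{0..<2*pi}|lborel. cis (of_int n * t))"
    unfolding set_lebesgue_integral_def by (rule Bochner_Integration.integral_mult_right_zero)
  also have "(LINT t:{0..<2*pi}|lborel. cis (of_int n * t)) = (LBINT t=0..2*pi. cis (of_int n * t))"
    using interval_integral_Ico[of 0 "2*pi" "\<lambda>t. cis (of_int n * t)"] by (simp add: zero_ereal_def)
  also have "\<dots> = ?F (2*pi) - ?F 0"
    unfolding zero_ereal_def
  proof (rule interval_integral_FTC_finite)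
    show "continuous_on {min 0 (2*pi)..max 0 (2*pi)} (\<lambda>t. cis (of_int n * t))" by (intro continuous_intros)
    fix t :: real
    have "((\<lambda>z. exp (\<i> * of_int n * z) / (\<i> * of_int n)) has_field_derivative exp (\<i> * of_int n * of_real t)) (at (of_real t))"
      using False by (auto intro!: derivative_eq_intros)
    from has_vector_derivative_real_field[OF this]
    have "(?F has_vector_derivative cis (of_int n * t)) (at t)"
      by (simp add: cis_conv_exp mult.assoc)
    thus "(?F has_vector_derivative cis (of_int n * t)) (at t within {min 0 (2*pi)..max 0 (2*pi)})"
      by (rule has_vector_derivative_at_within)
  qed
  also have "\<dots> = 0"
  proof -
    have "cis (of_int n * (2*pi)) = cis (2*pi) powi n" unfolding cis_power_int ..
    thus ?thesis by (simp only: cis_2pi power_int_1_left mult_zero_right cis_zero diff_self)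
  qed
  finally show ?thesis using False by simp
qed

lemma circle_AE_neq:
  assumes "0 \<le> \<alpha>" "\<alpha> < 2*pi"
  shows "AE z in circle. z \<noteq> cis \<alpha>"
proof -
  have "AE t in uniform_measure lborel {0..<2*pi}. cis t \<noteq> cis \<alpha>"
  proof (rule AE_uniform_measureI)
    show "AE t in lborel. t \<in> {0..<2*pi} \<longrightarrow> cis t \<noteq> cis \<alpha>"
      using AE_lborel_singleton[of \<alpha>]
    proof eventually_elim
      fix t assume ne: "t \<noteq> \<alpha>"
      show "t \<in> {0..<2*pi} \<longrightarrow> cis t \<noteq> cis \<alpha>"
      proof (intro impI notI)
        assume t: "t \<in> {0..<2*pi}" and e: "cis t = cis \<alpha>"
        have "cis (t - \<alpha>) = 1" using e by (simp flip: cis_divide)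
        from arg_cong[OF this, of Re] have "cos (t - \<alpha>) = 1" by simp
        then obtain k :: int where k: "t - \<alpha> = of_int k * 2 * pi" unfolding cos_one_2pi_int by blast
        have "\<bar>of_int k * (2 * pi)\<bar> < 1 * (2 * pi)" using k t assms by auto
        hence "\<bar>real_of_int k\<bar> < 1" unfolding abs_mult by (simp del: mult_1)
        hence "k = 0" by simp
        thus False using k ne by simp
      qed
    qed
  qed simp
  moreover have "{z \<in> space circle_space. z \<noteq> cis \<alpha>} \<in> sets circle_space"
  proof -
    have e: "{z \<in> space circle_space. z \<noteq> cis \<alpha>} = sphere 0 1 \<inter> - {cis \<alpha>}"
      unfolding space_restrict_space space_borel by blast
    have "- {cis \<alpha>} \<in> sets borel" by (intro borel_open open_Compl closed_singleton)
    thus ?thesis unfolding e sets_restrict_space by (rule imageI)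
  qed
  ultimately show ?thesis unfolding circle_def by (simp add: AE_distr_iff[OF cis_circle_space])
qed

text \<open>With x = tan of the half angle, |z| = 1 gives 1 + x^2 = 2 / (1 - Re z), and the double
  angle formulas return the coordinates of -z.\<close>

lemma cis_circle_angle:
  assumes z: "cmod z = 1" "z \<noteq> 1"
  shows "cis (circle_angle z) = - z"
proof -
  define a b where "a = Re z" and "b = Im z"
  have a: "a < 1" unfolding a_def by (rule cmod_1_Re(2)[OF z])
  have ab: "a\<^sup>2 + b\<^sup>2 = 1" using z(1) cmod_power2[of z] by (simp add: a_def b_def)
  define x where "x = - b / (1 - a)"
  have q: "1 + x\<^sup>2 = 2 / (1 - a)"
  proof -
    have A: "(1 - a)\<^sup>2 + b\<^sup>2 = 2 * (1 - a)" using ab by (simp add: power2_diff)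
    have B: "1 + x\<^sup>2 = ((1 - a)\<^sup>2 + b\<^sup>2) / (1 - a)\<^sup>2" using a by (simp add: x_def power_divide add_divide_distrib)
    have gen: "2 * X / X\<^sup>2 = 2 / X" if "X \<noteq> 0" for X :: real using that by (simp add: power2_eq_square)
    show ?thesis unfolding B A by (rule gen) (use a in simp)
  qed
  define c where "c = cos (arctan x)"
  have "c\<^sup>2 = 1 / (1 + x\<^sup>2)" unfolding c_def cos_arctan power_divide using one_plus_sq_pos[of x] by simp
  hence c2: "c\<^sup>2 = (1 - a) / 2" unfolding q by simp
  have s: "sin (arctan x) = x * c" unfolding c_def cos_arctan sin_arctan by simp
  have C: "cos (2 * arctan x) = - a" unfolding cos_double_cos c_def[symmetric] c2 by (simp add: field_simps)
  have "sin (2 * arctan x) = x * (2 * c\<^sup>2)" unfolding sin_double c_def[symmetric] s by (simp add: power2_eq_square)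
  also have "\<dots> = - b"
  proof -
    have gen: "- b / X * (2 * (X / 2)) = - b" if "X \<noteq> 0" for X using that by simp
    show ?thesis unfolding c2 x_def by (rule gen) (use a in simp)
  qed
  finally have "sin (2 * arctan x) = - b" .
  moreover have "circle_angle z = 2 * arctan x" by (simp add: circle_angle_def x_def a_def b_def)
  ultimately show ?thesis using C by (simp add: complex_eq_iff a_def b_def)
qed

section \<open>The circle as image of the Cauchy distribution\<close>

locale circle_param = mp_param +
  fixes \<alpha> :: real
  assumes \<alpha>: "0 \<le> \<alpha>" "\<alpha> < 2*pi"
begin

text \<open>The rotated Cayley transform, inverse to \<open>chi_inv\<close>.\<close>

definition chi :: "real \<Rightarrow> complex" where
  "chi y = cis \<alpha> * cayley d y"

abbreviation cauchy_measure :: "real measure" where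
  "cauchy_measure \<equiv> density lborel (\<lambda>y. ennreal (cauchy_density d y))"

lemma chi_measurable [measurable]: "chi \<in> borel_measurable borel"
  unfolding chi_def [abs_def] by measurable

lemma chi_circle_space: "chi \<in> cauchy_measure \<rightarrow>\<^sub>M circle_space"
  by (rule measurable_restrict_space2) (auto simp: chi_def norm_mult cmod_cayley[OF d_pos])

lemma prob_space_cauchy: "prob_space cauchy_measure"
proof (rule prob_spaceI)
  have "emeasure cauchy_measure (space cauchy_measure) = (\<integral>\<^sup>+y. ennreal (cauchy_density d y) \<partial>lborel)"
    by (simp add: emeasure_density)
  also have "\<dots> = 1"
    using cauchy_density_pos[OF d_pos] cauchy_density_integral[OF d_pos]
    by (subst nn_integral_eq_integral) (auto simp: less_imp_le)
  finally show "emeasure cauchy_measure (space cauchy_measure) = 1" .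
qed

text \<open>After undoing the rotation by \<open>\<alpha>\<close>, both measures have the
  trigonometric moments of the Kronecker delta at 0. So the angle has the same characteristic
  function under both, hence the same distribution, and the point is recovered from its angle off a
  null set.\<close>

theorem circle_eq_distr: "circle = distr cauchy_measure circle_space chi"
proof -
  define \<zeta> where "\<zeta> z = z * cis (- \<alpha>)" for z
  define A1 where "A1 z = circle_angle (\<zeta> z)" for z
  define A2 where "A2 y = circle_angle (cayley d y)" for y
  \<comment> \<open>Recovers the point from its angle: \<open>cis (circle_angle z) = - z\<close>
    explains the sign, and the factor \<open>cis \<alpha>\<close> restores the rotation.\<close>
  define \<theta> where "\<theta> x = - cis \<alpha> * cis x" for x
  have cc: "cis \<alpha> * cis (- \<alpha>) = 1" by (simp add: cis_mult)
  have \<zeta>m [measurable]: "\<zeta> \<in> borel_measurable borel" unfolding \<zeta>_def [abs_def] by measurable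
  have A1m: "A1 \<in> borel_measurable circle" unfolding A1_def [abs_def] by (intro measurable_circle) measurable
  have A2m: "A2 \<in> borel_measurable cauchy_measure" unfolding A2_def [abs_def] by measurable
  have \<theta>m: "\<theta> \<in> borel \<rightarrow>\<^sub>M circle_space"
  proof (rule measurable_restrict_space2)
    show "\<theta> \<in> borel_measurable borel" unfolding \<theta>_def [abs_def] by measurable
  qed (auto simp: \<theta>_def norm_mult)
  have \<zeta>n: "cmod (\<zeta> z) = 1" if "z \<in> space circle" for z using that by (simp add: \<zeta>_def norm_mult)
  have \<zeta>1: "AE z in circle. \<zeta> z \<noteq> 1"
    using circle_AE_neq[OF \<alpha>]
  proof eventually_elim
    fix z assume "z \<noteq> cis \<alpha>"
    moreover have "cis \<alpha> * \<zeta> z = z" unfolding \<zeta>_def using cc by (simp add: mult.left_commute)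
    ultimately show "\<zeta> z \<noteq> 1" by auto
  qed
  have int1: "integrable circle (\<lambda>z. 1 :: complex)"
    using prob_space.finite_measure[OF prob_space_circle] by (simp add: finite_measure.integrable_const)
  have key: "(LINT z|circle. 1 * iexp (\<xi> * circle_angle (\<zeta> z))) = (LINT y|lborel. of_real (cauchy_density d y) * iexp (\<xi> * circle_angle (cayley d y)))" for \<xi>
  proof (rule trig_moments_determine[OF int1 measurable_circle[OF \<zeta>m] \<zeta>n \<zeta>1])
    show "integrable lborel (\<lambda>y. complex_of_real (cauchy_density d y))"
      using cauchy_density_moments(1)[OF d_pos, of 0] by simp
    show "(LINT z|circle. 1 * \<zeta> z powi m) = (LINT y|lborel. of_real (cauchy_density d y) * cayley d y powi m)" for m
    proof -
      have "(LINT z|circle. 1 * \<zeta> z powi m) = (LINT z|circle. z powi m * cis (- \<alpha>) powi m)"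
        by (simp add: \<zeta>_def power_int_mult_distrib)
      also have "\<dots> = of_bool (m = 0) * cis (- \<alpha>) powi m"
        unfolding Bochner_Integration.integral_mult_left_zero circle_moments ..
      also have "\<dots> = of_bool (m = 0)" by simp
      finally show ?thesis unfolding cauchy_density_moments(2)[OF d_pos] .
    qed
  qed (simp_all add: cmod_cayley[OF d_pos] cayley_neq_1[OF d_pos])
  have D: "distr circle borel A1 = distr cauchy_measure borel A2"
  proof (rule Levy_uniqueness)
    show "real_distribution (distr circle borel A1)"
      by (rule prob_space.real_distribution_distr[OF prob_space_circle A1m])
    show "real_distribution (distr cauchy_measure borel A2)"
      by (rule prob_space.real_distribution_distr[OF prob_space_cauchy A2m])
    show "char (distr circle borel A1) = char (distr cauchy_measure borel A2)"
    proof
      fix \<xi>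
      have em: "(\<lambda>x. iexp (\<xi> * x)) \<in> borel_measurable borel" by measurable
      have "char (distr circle borel A1) \<xi> = (LINT z|circle. iexp (\<xi> * A1 z))"
        unfolding char_def by (rule integral_distr[OF A1m em])
      also have "\<dots> = (LINT y|lborel. of_real (cauchy_density d y) * iexp (\<xi> * A2 y))"
        using key[of \<xi>] unfolding A1_def A2_def mult_1 .
      also have "\<dots> = (LINT y|lborel. cauchy_density d y *\<^sub>R iexp (\<xi> * A2 y))"
        unfolding scaleR_conv_of_real ..
      also have "\<dots> = (LINT y|cauchy_measure. iexp (\<xi> * A2 y))"
      proof (rule integral_density[symmetric])
        show "(\<lambda>y. iexp (\<xi> * A2 y)) \<in> borel_measurable lborel" using A2m by measurable
        show "AE y in lborel. 0 \<le> cauchy_density d y" using cauchy_density_pos[OF d_pos] by (simp add: less_imp_le)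
      qed simp
      also have "\<dots> = char (distr cauchy_measure borel A2) \<xi>"
        unfolding char_def by (rule integral_distr[OF A2m em, symmetric])
      finally show "char (distr circle borel A1) \<xi> = char (distr cauchy_measure borel A2) \<xi>" .
    qed
  qed
  have "circle = distr circle circle_space (\<lambda>z. z)"
    by (rule distr_id2[OF sets_circle[symmetric], symmetric])
  also have "\<dots> = distr circle circle_space (\<theta> \<circ> A1)"
  proof (rule distr_cong_AE[OF refl refl])
    show "AE z in circle. z = (\<theta> \<circ> A1) z"
      using \<zeta>1 AE_space
    proof eventually_elim
      fix z assume z: "\<zeta> z \<noteq> 1" "z \<in> space circle"
      have "(\<theta> \<circ> A1) z = cis \<alpha> * \<zeta> z"
        unfolding o_def \<theta>_def A1_def cis_circle_angle[OF \<zeta>n[OF z(2)] z(1)] by simp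
      also have "\<dots> = z" unfolding \<zeta>_def using cc by (simp add: mult.left_commute)
      finally show "z = (\<theta> \<circ> A1) z" by simp
    qed
    show "(\<lambda>z. z) \<in> circle \<rightarrow>\<^sub>M circle_space"
      by (rule measurable_ident_sets[OF sets_circle])
    show "\<theta> \<circ> A1 \<in> circle \<rightarrow>\<^sub>M circle_space" by (rule measurable_comp[OF A1m \<theta>m])
  qed
  also have "\<dots> = distr (distr circle borel A1) circle_space \<theta>" by (rule distr_distr[OF \<theta>m A1m, symmetric])
  also have "\<dots> = distr (distr cauchy_measure borel A2) circle_space \<theta>" unfolding D ..
  also have "\<dots> = distr cauchy_measure circle_space (\<theta> \<circ> A2)" by (rule distr_distr[OF \<theta>m A2m])
  also have "\<theta> \<circ> A2 = chi"
  proof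
    fix y
    show "(\<theta> \<circ> A2) y = chi y"
      unfolding o_def \<theta>_def A2_def chi_def cis_circle_angle[OF cmod_cayley[OF d_pos] cayley_neq_1[OF d_pos]] by simp
  qed
  finally show ?thesis .
qed

lemma circle_transfer:
  fixes h :: "complex \<Rightarrow> real"
  assumes h [measurable]: "h \<in> borel_measurable borel"
  shows "integrable circle h \<longleftrightarrow> integrable lborel (\<lambda>y. cauchy_density d y * h (chi y))"
    "(LINT z|circle. h z) = (LINT y|lborel. cauchy_density d y * h (chi y))"
proof -
  have hs: "h \<in> borel_measurable circle_space" by (rule measurable_restrict_space1[OF h])
  have hc: "(\<lambda>y. h (chi y)) \<in> borel_measurable lborel" by measurable
  have p: "AE y in lborel. 0 \<le> cauchy_density d y" using cauchy_density_pos[OF d_pos] by (simp add: less_imp_le)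
  have cm: "cauchy_density d \<in> borel_measurable lborel" by simp
  show "integrable circle h \<longleftrightarrow> integrable lborel (\<lambda>y. cauchy_density d y * h (chi y))"
    unfolding circle_eq_distr integrable_distr_eq[OF chi_circle_space hs] integrable_density[OF hc cm p] by simp
  show "(LINT z|circle. h z) = (LINT y|lborel. cauchy_density d y * h (chi y))"
    unfolding circle_eq_distr integral_distr[OF chi_circle_space hs] integral_density[OF hc cm p] by simp
qed

lemma circle_AE_transfer:
  assumes P: "Measurable.pred borel P" and A: "AE y in lborel. P (chi y)"
  shows "AE z in circle. P z"
proof -
  have e: "{z \<in> space circle_space. P z} = sphere 0 1 \<inter> {z \<in> space borel. P z}"
    unfolding space_restrict_space space_borel by blast
  have "{z \<in> space circle_space. P z} \<in> sets circle_space"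
    unfolding e sets_restrict_space using P unfolding pred_def by (rule imageI)
  moreover have "AE y in cauchy_measure. P (chi y)"
  proof (subst AE_density)
    show "AE y in lborel. 0 < ennreal (cauchy_density d y) \<longrightarrow> P (chi y)" using A by eventually_elim simp
  qed simp
  ultimately show ?thesis unfolding circle_eq_distr by (simp add: AE_distr_iff[OF chi_circle_space])
qed

section \<open>The isometry X\<close>

definition X_weight :: "complex \<Rightarrow> complex" where
  "X_weight z = complex_of_real (sqrt (2*pi)) * cis \<alpha> * (complex_of_real (sqrt (2 * tan (\<beta>/2))) / (- z + cis \<alpha>))"

definition X_fun :: "(real \<Rightarrow> complex) \<Rightarrow> complex \<Rightarrow> complex" where
  "X_fun f z = X_weight z * f (Re (chi_inv \<alpha> \<beta> z))"

lemma X_op_X_fun: "X_op \<alpha> \<beta> F = ae_class circle (X_fun (rep F))"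
  unfolding X_op_def X_fun_def X_weight_def ..

lemma X_fun_measurable [measurable]:
  assumes [measurable]: "f \<in> borel_measurable borel"
  shows "X_fun f \<in> borel_measurable borel"
  unfolding X_fun_def [abs_def] X_weight_def chi_inv_def by measurable

lemma cis_minus_chi: "- chi y + cis \<alpha> = cis \<alpha> * (2 * \<i> * of_real d / (of_real y + \<i> * of_real d))"
  using cayley_denom[OF d_pos, of y] by (simp add: chi_def cayley_def field_simps)

lemma cis_plus_chi: "chi y + cis \<alpha> = cis \<alpha> * (2 * of_real y / (of_real y + \<i> * of_real d))"
  using cayley_denom[OF d_pos, of y] by (simp add: chi_def cayley_def field_simps)

lemma chi_inv_chi: "Re (chi_inv \<alpha> \<beta> (chi y)) = y"
proof -
  have nz: "of_real y + \<i> * of_real d \<noteq> 0" "complex_of_real d \<noteq> 0" using cayley_denom[OF d_pos, of y] d_pos by auto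
  have "chi_inv \<alpha> \<beta> (chi y) = of_real y"
    unfolding chi_inv_def cis_minus_chi cis_plus_chi d_def[symmetric] using nz by simp
  thus ?thesis by simp
qed

lemma X_weight_chi: "X_weight (chi y) = of_real (sqrt (pi / d)) * (of_real y + \<i> * of_real d) / \<i>"
proof -
  have nz: "of_real y + \<i> * of_real d \<noteq> 0" "complex_of_real d \<noteq> 0" using cayley_denom[OF d_pos, of y] d_pos by auto
  have r: "sqrt (2 * pi) * sqrt (2 * d) = sqrt (pi / d) * (2 * d)"
  proof -
    have "sqrt (2 * pi) * sqrt (2 * d) = sqrt ((pi / d) * (2 * d)\<^sup>2)"
      unfolding real_sqrt_mult[symmetric] using d_pos by (simp add: power2_eq_square)
    also have "\<dots> = sqrt (pi / d) * sqrt ((2 * d)\<^sup>2)" by (rule real_sqrt_mult)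
    also have "sqrt ((2 * d)\<^sup>2) = 2 * d" using d_pos unfolding real_sqrt_abs by simp
    finally show ?thesis .
  qed
  have "X_weight (chi y) = of_real (sqrt (2 * pi) * sqrt (2 * d)) * ((of_real y + \<i> * of_real d) / (2 * \<i> * of_real d))"
    unfolding X_weight_def cis_minus_chi d_def[symmetric] by (simp add: mult.assoc)
  also have "\<dots> = of_real (sqrt (pi / d)) * of_real (2 * d) * ((of_real y + \<i> * of_real d) / (2 * \<i> * of_real d))"
    unfolding r of_real_mult ..
  also have "\<dots> = of_real (sqrt (pi / d)) * (of_real y + \<i> * of_real d) / \<i>" using nz by simp
  finally show ?thesis .
qed

text \<open>The Jacobian identity behind the isometry: the squared weight of \<open>X_op\<close>
  compensates the density with which the line is mapped to the circle.\<close>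

lemma X_weight_cauchy: "cauchy_density d y * (cmod (X_weight (chi y)))\<^sup>2 = 1"
proof -
  have "(cmod (X_weight (chi y)))\<^sup>2 = (pi / d) * (y\<^sup>2 + d\<^sup>2)"
    unfolding X_weight_chi using d_pos by (simp add: norm_mult norm_divide power_mult_distrib cmod_power2)
  thus ?thesis using d_pos sum_sq_pos[OF d_pos, of y] by (simp add: cauchy_density_def)
qed

lemma X_fun_chi: "X_fun f (chi y) = X_weight (chi y) * f y"
  unfolding X_fun_def chi_inv_chi ..

lemma X_fun_sqi:
  assumes f: "square_integrable lborel f"
  shows "square_integrable circle (X_fun f)" "nsq circle (X_fun f) = nsq lborel f"
proof -
  have [measurable]: "f \<in> borel_measurable borel" using sqi_measurable[OF f] by simp
  have e: "cauchy_density d y * (cmod (X_fun f (chi y)))\<^sup>2 = (cmod (f y))\<^sup>2" for y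
    unfolding X_fun_chi norm_mult power_mult_distrib mult.assoc[symmetric] X_weight_cauchy by simp
  have m: "(\<lambda>z. (cmod (X_fun f z))\<^sup>2) \<in> borel_measurable borel" by measurable
  show "nsq circle (X_fun f) = nsq lborel f" unfolding nsq_def circle_transfer(2)[OF m] e ..
  have "integrable circle (\<lambda>z. (cmod (X_fun f z))\<^sup>2)" unfolding circle_transfer(1)[OF m] e by (rule sqi_integrable[OF f])
  moreover have "X_fun f \<in> borel_measurable circle" by (rule measurable_circle) measurable
  ultimately show "square_integrable circle (X_fun f)" by (simp add: square_integrable_def)
qed

lemma X_fun_cong_AE:
  assumes [measurable]: "f \<in> borel_measurable borel" "g \<in> borel_measurable borel" and "AE y in lborel. f y = g y"
  shows "AE z in circle. X_fun f z = X_fun g z"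
proof (rule circle_AE_transfer)
  show "Measurable.pred borel (\<lambda>z. X_fun f z = X_fun g z)" by measurable
  show "AE y in lborel. X_fun f (chi y) = X_fun g (chi y)" using assms(3) by eventually_elim (simp add: X_fun_chi)
qed

lemma X_op_ae_class: "f \<in> borel_measurable borel \<Longrightarrow> X_op \<alpha> \<beta> (ae_class lborel f) = ae_class circle (X_fun f)"
  unfolding X_op_X_fun using rep_ae_class[of f lborel] by (intro ae_class_eqI X_fun_cong_AE) simp_all

lemma X_op_isometry: "L2_isometry lborel circle (X_op \<alpha> \<beta>)"
  unfolding L2_isometry_def
proof (intro conjI ballI allI)
  fix F :: "(real \<Rightarrow> complex) set" assume F: "F \<in> L2 lborel"
  note f = L2_rep(1)[OF F]
  show "X_op \<alpha> \<beta> F \<in> L2 circle" unfolding X_op_X_fun by (intro ae_class_in_L2 X_fun_sqi f)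
  show "L2_norm circle (X_op \<alpha> \<beta> F) = L2_norm lborel F"
    unfolding X_op_X_fun L2_norm_nsq nsq_rep_ae_class[OF sqi_measurable[OF X_fun_sqi(1)[OF f]]] X_fun_sqi(2)[OF f] ..
next
  fix F G :: "(real \<Rightarrow> complex) set" and a b assume F: "F \<in> L2 lborel" and G: "G \<in> L2 lborel"
  note L = L2_lincomb_in[OF F G, of a b]
  have m: "rep F \<in> borel_measurable borel" "rep G \<in> borel_measurable borel" "rep (L2_lincomb lborel a F b G) \<in> borel_measurable borel"
    using sqi_measurable[OF L2_rep(1)[OF F]] sqi_measurable[OF L2_rep(1)[OF G]] sqi_measurable[OF L2_rep(1)[OF L]] by simp_all
  have "AE z in circle. X_fun (rep (L2_lincomb lborel a F b G)) z = X_fun (\<lambda>y. a * rep F y + b * rep G y) z"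
  proof (rule X_fun_cong_AE[OF m(3) _ rep_L2_lincomb[OF F G]])
    show "(\<lambda>y. a * rep F y + b * rep G y) \<in> borel_measurable borel" using m(1,2) by measurable
  qed
  moreover have "X_fun (\<lambda>y. a * rep F y + b * rep G y) z = a * X_fun (rep F) z + b * X_fun (rep G) z" for z
    by (simp add: X_fun_def algebra_simps)
  ultimately show "X_op \<alpha> \<beta> (L2_lincomb lborel a F b G) = L2_lincomb circle a (X_op \<alpha> \<beta> F) b (X_op \<alpha> \<beta> G)"
    unfolding X_op_X_fun L2_lincomb_ae_class[OF measurable_circle[OF X_fun_measurable[OF m(1)]] measurable_circle[OF X_fun_measurable[OF m(2)]]]
    by (intro ae_class_eqI) simp
qed

text \<open>At \<open>chi y\<close> the weight cancels denominator and constant of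
  \<open>cayley_int\<close>, leaving the n-th power of the Cayley transform, which is
  \<open>chi y\<close> rotated back by \<open>\<alpha>\<close>.\<close>

lemma X_op_cayley_int: "X_op \<alpha> \<beta> (ae_class lborel (cayley_int d (int n))) = ae_class circle (\<lambda>z. (z * cis (- \<alpha>)) ^ n)"
proof -
  have "AE z in circle. X_fun (cayley_int d (int n)) z = (z * cis (- \<alpha>)) ^ n"
  proof (rule circle_AE_transfer)
    show "Measurable.pred borel (\<lambda>z. X_fun (cayley_int d (int n)) z = (z * cis (- \<alpha>)) ^ n)" by measurable
    have "X_fun (cayley_int d (int n)) (chi y) = (chi y * cis (- \<alpha>)) ^ n" for y
    proof -
      have nz: "of_real y + \<i> * of_real d \<noteq> 0" using cayley_denom[OF d_pos, of y] by auto
      have "sqrt (pi / d) * sqrt (d / pi) = 1" using d_pos by (simp flip: real_sqrt_mult)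
      hence r: "complex_of_real (sqrt (pi / d)) * of_real (sqrt (d / pi)) = 1" by (metis of_real_mult of_real_1)
      have gen: "A * w / \<i> * (\<i> * B * C / w) = A * B * C" if "w \<noteq> 0" for A B C w :: complex
      proof -
        have "A * w / \<i> * (\<i> * B * C / w) = A * (w / w) * (\<i> / \<i>) * B * C" by (simp only: divide_inverse mult_ac)
        thus ?thesis using that by simp
      qed
      have "X_fun (cayley_int d (int n)) (chi y) = (of_real (sqrt (pi / d)) * of_real (sqrt (d / pi))) * cayley d y ^ n"
        unfolding X_fun_chi X_weight_chi cayley_int_def power_int_of_nat by (rule gen[OF nz])
      also have "\<dots> = (chi y * cis (- \<alpha>)) ^ n" unfolding r chi_def by (simp add: mult.assoc mult.left_commute[of "cis \<alpha>"] cis_mult)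
      finally show ?thesis .
    qed
    thus "AE y in lborel. X_fun (cayley_int d (int n)) (chi y) = (chi y * cis (- \<alpha>)) ^ n" by simp
  qed
  thus ?thesis unfolding X_op_ae_class[OF cayley_int_measurable] by (rule ae_class_eqI)
qed

end

section \<open>The composition\<close>

lemma ext_zero_measurable:
  assumes "f \<in> borel_measurable half_line"
  shows "(\<lambda>x. if 0 < x then f x else 0 :: complex) \<in> borel_measurable borel"
proof -
  have "(\<lambda>x. indicator {0<..} x *\<^sub>R f x) \<in> borel_measurable lborel"
    using assms unfolding half_line_def by (subst (asm) borel_measurable_restrict_space_iff) simp_all
  moreover have "indicator {0<..} x *\<^sub>R f x = (if 0 < x then f x else 0)" for x by simp
  ultimately show ?thesis by simp
qed

lemma ext_zero_sqi:
  assumes f: "square_integrable half_line f"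
  shows "square_integrable lborel (\<lambda>x. if 0 < x then f x else 0)" "nsq lborel (\<lambda>x. if 0 < x then f x else 0) = nsq half_line f"
proof -
  have e: "(cmod (if 0 < x then f x else 0))\<^sup>2 = (if 0 < x then (cmod (f x))\<^sup>2 else 0)" for x by simp
  show "nsq lborel (\<lambda>x. if 0 < x then f x else 0) = nsq half_line f" unfolding nsq_def e by (rule integral_lborel_pos(1))
  show "square_integrable lborel (\<lambda>x. if 0 < x then f x else 0)"
    unfolding square_integrable_def e integral_lborel_pos(2)
    using ext_zero_measurable[OF sqi_measurable[OF f]] sqi_integrable[OF f] by simp
qed

lemma ext_zero_cong:
  assumes "AE x in half_line. f x = g x"
  shows "ae_class lborel (\<lambda>x. if 0 < x then f x else 0) = ae_class lborel (\<lambda>x. if 0 < x then g x else 0)"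
proof (rule ae_class_eqI)
  have "AE x in lborel. 0 < x \<longrightarrow> f x = g x" using assms by (simp add: AE_half_line)
  thus "AE x in lborel. (if 0 < x then f x else 0) = (if 0 < x then g x else 0)" by eventually_elim simp
qed

lemma ext_zero_isometry: "L2_isometry half_line lborel ext_zero"
  unfolding L2_isometry_def
proof (intro conjI ballI allI)
  fix F :: "(real \<Rightarrow> complex) set" assume F: "F \<in> L2 half_line"
  note f = L2_rep(1)[OF F]
  show "ext_zero F \<in> L2 lborel" unfolding ext_zero_def by (intro ae_class_in_L2 ext_zero_sqi f)
  show "L2_norm lborel (ext_zero F) = L2_norm half_line F"
    unfolding ext_zero_def L2_norm_nsq nsq_rep_ae_class[OF sqi_measurable[OF ext_zero_sqi(1)[OF f]]] ext_zero_sqi(2)[OF f] ..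
next
  fix F G :: "(real \<Rightarrow> complex) set" and a b assume F: "F \<in> L2 half_line" and G: "G \<in> L2 half_line"
  note f = L2_rep(1)[OF F] and g = L2_rep(1)[OF G]
  have "ext_zero (L2_lincomb half_line a F b G) = ae_class lborel (\<lambda>x. if 0 < x then a * rep F x + b * rep G x else 0)"
    unfolding ext_zero_def by (rule ext_zero_cong[OF rep_L2_lincomb[OF F G]])
  also have "\<dots> = ae_class lborel (\<lambda>x. a * (if 0 < x then rep F x else 0) + b * (if 0 < x then rep G x else 0))"
    by (rule ae_class_eqI) simp
  also have "\<dots> = L2_lincomb lborel a (ext_zero F) b (ext_zero G)"
    unfolding ext_zero_def by (rule L2_lincomb_ae_class[symmetric]; rule sqi_measurable[OF ext_zero_sqi(1)]; rule f g)
  finally show "ext_zero (L2_lincomb half_line a F b G) = L2_lincomb lborel a (ext_zero F) b (ext_zero G)" .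
qed

lemma ext_zero_laguerre: "ext_zero (ae_class half_line (laguerre_fun d n)) = ae_class lborel (laguerre_int d (int n))"
proof -
  have "AE x in half_line. rep (ae_class half_line (laguerre_fun d n)) x = laguerre_fun d n x"
    by (rule rep_ae_class(2)) (intro borel_half_line laguerre_fun_measurable)
  from ext_zero_cong[OF this] have "ext_zero (ae_class half_line (laguerre_fun d n)) = ae_class lborel (\<lambda>x. if 0 < x then laguerre_fun d n x else 0)"
    unfolding ext_zero_def .
  also have "(\<lambda>x. if 0 < x then laguerre_fun d n x else 0) = laguerre_int d (int n)"
    by (rule ext) (simp add: laguerre_int_def)
  finally show ?thesis .
qed

lemma L2_isometry_sum:
  assumes T: "L2_isometry M N T" and \<phi>: "\<And>n::nat. square_integrable M (\<phi> n)" and \<psi>: "\<And>n. \<psi> n \<in> borel_measurable N"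
    and eq: "\<And>n. T (ae_class M (\<phi> n)) = ae_class N (\<psi> n)"
  shows "T (ae_class M (\<lambda>x. \<Sum>n<K. c n * \<phi> n x)) = ae_class N (\<lambda>x. \<Sum>n<K. c n * \<psi> n x)"
proof -
  have lin: "T (ae_class M (\<lambda>x. a * f x + b * g x)) = ae_class N (\<lambda>x. a * f' x + b * g' x)"
    if "square_integrable M f" "square_integrable M g" "f' \<in> borel_measurable N" "g' \<in> borel_measurable N"
      "T (ae_class M f) = ae_class N f'" "T (ae_class M g) = ae_class N g'" for a b f g f' g'
  proof -
    have "T (L2_lincomb M a (ae_class M f) b (ae_class M g)) = L2_lincomb N a (ae_class N f') b (ae_class N g')"
      using T that ae_class_in_L2 unfolding L2_isometry_def by metis
    thus ?thesis
      unfolding L2_lincomb_ae_class[OF sqi_measurable[OF that(1)] sqi_measurable[OF that(2)]] L2_lincomb_ae_class[OF that(3,4)] .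
  qed
  show ?thesis
  proof (induction K)
    case 0
    \<comment> \<open>The empty sum is written as a combination with both coefficients 0.\<close>
    show ?case using lin[OF \<phi> \<phi> \<psi> \<psi> eq eq, of 0 0 0 0] by simp
  next
    case (Suc K)
    have S: "square_integrable M (\<lambda>x. \<Sum>n<K. c n * \<phi> n x)" by (intro sqi_sum sqi_scale \<phi>)
    have S': "(\<lambda>x. \<Sum>n<K. c n * \<psi> n x) \<in> borel_measurable N" using \<psi> by measurable
    show ?case using lin[OF S \<phi> S' \<psi> Suc eq, of 1 "c K" K] by simp
  qed
qed

text \<open>\<open>G\<close> itself meets the description of its projection. Any other candidate
  \<open>F\<close> has \<open>G - F\<close> orthogonal to both \<open>G\<close> and
  \<open>F\<close>, hence of norm 0.\<close>

lemma Q_plus_Hardy2: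
  assumes G: "G \<in> Hardy2"
  shows "Q_plus G = G"
  unfolding Q_plus_def orth_proj_def
proof (rule the_equality)
  have L: "F \<in> L2 circle" if "F \<in> Hardy2" for F using that by (simp add: Hardy2_def)
  have d: "L2_inner circle (L2_diff circle G F) K = ip circle (rep G) (rep K) - ip circle (rep F) (rep K)"
    if "F \<in> Hardy2" "K \<in> Hardy2" for F K
    unfolding L2_inner_ip ip_rep_L2_lincomb[OF L[OF G] L[OF that(1)] L2_rep(1)[OF L[OF that(2)]]] by simp
  show "G \<in> Hardy2 \<and> (\<forall>K\<in>Hardy2. L2_inner circle (L2_diff circle G G) K = 0)" using d G by simp
  fix F assume "F \<in> Hardy2 \<and> (\<forall>K\<in>Hardy2. L2_inner circle (L2_diff circle G F) K = 0)"
  hence F: "F \<in> Hardy2" and z: "\<And>K. K \<in> Hardy2 \<Longrightarrow> ip circle (rep G) (rep K) - ip circle (rep F) (rep K) = 0"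
    using d by auto
  note g = L2_rep(1)[OF L[OF G]] and f = L2_rep(1)[OF L[OF F]]
  let ?D = "\<lambda>z. rep G z - rep F z"
  have "of_real (nsq circle ?D) = ip circle ?D ?D" by (simp only: ip_self)
  also have "\<dots> = 0"
    unfolding ip_diff_right[OF g f sqi_diff[OF g f]] ip_diff_left[OF g f g] ip_diff_left[OF g f f] z[OF G] z[OF F] by simp
  finally have "nsq circle ?D = 0" by simp
  hence "G = F" by (intro L2_norm_diff_eq_0[OF L[OF G] L[OF F]]) (simp add: L2_norm_nsq nsq_rep_L2_diff[OF L[OF G] L[OF F]])
  thus "F = G" by simp
qed

section \<open>The chain of isometries and its range\<close>

context circle_param
begin

text \<open>The chain before \<open>Q_plus\<close>. It can be handled as a composition of
  isometries, and its range is shown to lie in \<open>Hardy2\<close>.\<close>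

definition Z_op :: "(real \<Rightarrow> complex) set \<Rightarrow> (complex \<Rightarrow> complex) set" where
  "Z_op H = X_op \<alpha> \<beta> (inv_into (L2 lborel) fourier (ext_zero (V_op H)))"

lemma Z_op_isometry: "L2_isometry unit_interval circle Z_op"
  unfolding Z_op_def [abs_def]
  by (rule L2_isometry_compose[OF _ X_op_isometry], rule L2_isometry_compose[OF _ L2_unitary_inv_isometry[OF fourier_unitary[OF d_pos]]],
      rule L2_isometry_compose[OF V_op_isometry ext_zero_isometry])

lemma Z_op_h0: "Z_op (ae_class unit_interval (h0 n)) = ae_class circle (\<lambda>z. (z * cis (- \<alpha>)) ^ n)"
proof -
  have b: "inj_on fourier (L2 lborel)" using fourier_unitary[OF d_pos] by (simp add: L2_unitary_def bij_betw_def)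
  have "inv_into (L2 lborel) fourier (fourier (ae_class lborel (cayley_int d (int n)))) = ae_class lborel (cayley_int d (int n))"
    by (rule inv_into_f_f[OF b ae_class_in_L2[OF cayley_int_sqi[OF d_pos]]])
  thus ?thesis
    unfolding Z_op_def V_op_h0 ext_zero_laguerre fourier_cayley_int[OF d_pos] by (simp only: X_op_cayley_int)
qed

lemma rotated_power_measurable: "(\<lambda>z. (z * cis (- \<alpha>)) ^ n) \<in> borel_measurable circle"
  by (rule measurable_circle) measurable

lemma h_fun_sqi: "square_integrable unit_interval (h_fun \<alpha> \<beta> n)"
  using sqi_scale[OF h0_sqi[of n], of "exp (\<i> * of_nat n * of_real \<alpha>)"] unfolding h_fun_h0 [abs_def] .

text \<open>The phase exp (i n alpha) that distinguishes \<open>h_fun\<close> from \<open>h0\<close>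
  is \<open>cis \<alpha> ^ n\<close>, which undoes the rotation in the image of
  \<open>h0 n\<close>.\<close>

lemma Z_op_h_fun: "Z_op (ae_class unit_interval (h_fun \<alpha> \<beta> n)) = e_mon n"
proof -
  define c where "c = exp (\<i> * of_nat n * complex_of_real \<alpha>)"
  have "c = cis (real n * \<alpha>)" unfolding c_def cis_conv_exp by (simp add: mult.assoc)
  hence c: "c = cis \<alpha> ^ n" unfolding Complex.DeMoivre .
  have "T (ae_class M (\<lambda>x. c * \<phi> x)) = ae_class N (\<lambda>x. c * \<psi> x)"
    if "L2_isometry M N T" "square_integrable M \<phi>" "\<psi> \<in> borel_measurable N" "T (ae_class M \<phi>) = ae_class N \<psi>"
    for M :: "real measure" and N :: "complex measure" and T \<phi> \<psi>
    using L2_isometry_sum[of M N T "\<lambda>_. \<phi>" "\<lambda>_. \<psi>" "\<lambda>_. c" 1] that by simp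
  from this[OF Z_op_isometry h0_sqi rotated_power_measurable Z_op_h0]
  have "Z_op (ae_class unit_interval (\<lambda>x. c * h0 n x)) = ae_class circle (\<lambda>z. c * (z * cis (- \<alpha>)) ^ n)" .
  moreover have "c * (z * cis (- \<alpha>)) ^ n = z ^ n" for z
    unfolding c power_mult_distrib[symmetric] by (simp add: mult.left_commute[of "cis \<alpha>"] cis_mult)
  ultimately show ?thesis unfolding h_fun_h0 [abs_def] c_def e_mon_def by simp
qed

text \<open>Partial sums of the \<open>h0\<close> expansion of \<open>F\<close> are mapped to
  classes of polynomials in \<open>z\<close>, and the isometry preserves the quality of
  approximation.\<close>

lemma Z_op_Hardy2:
  assumes F: "F \<in> L2 unit_interval"
  shows "Z_op F \<in> Hardy2"
  unfolding Hardy2_def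
proof (intro CollectI conjI allI impI)
  show "Z_op F \<in> L2 circle" using Z_op_isometry F by (simp add: L2_isometry_def)
  fix \<epsilon> :: real assume \<epsilon>: "\<epsilon> > 0"
  note f = L2_rep(1)[OF F]
  define c where "c n = ip unit_interval (rep F) (h0 n)" for n
  define S where "S N s = (\<Sum>n<N. c n * h0 n s)" for N s
  have S: "square_integrable unit_interval (S N)" for N unfolding S_def [abs_def] by (intro sqi_sum sqi_scale h0_sqi)
  have "(\<lambda>N. nsq unit_interval (\<lambda>s. S N s - rep F s)) \<longlonglongrightarrow> 0"
    using onb_expansion[OF h0_onb f] unfolding S_def c_def .
  from eventually_happens[OF order_tendstoD(2)[OF this, of "\<epsilon>\<^sup>2"]] \<epsilon> obtain N
    where N: "nsq unit_interval (\<lambda>s. S N s - rep F s) < \<epsilon>\<^sup>2" by auto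
  have SL: "ae_class unit_interval (S N) \<in> L2 unit_interval" by (rule ae_class_in_L2[OF S])
  have "Z_op (ae_class unit_interval (S N)) = ae_class circle (\<lambda>z. \<Sum>n<N. c n * (z * cis (- \<alpha>)) ^ n)"
    unfolding S_def [abs_def] by (rule L2_isometry_sum[OF Z_op_isometry h0_sqi rotated_power_measurable Z_op_h0])
  \<comment> \<open>The rotation only changes the coefficients, so the image is an ordinary
    polynomial as \<open>Hardy2\<close> requires.\<close>
  also have "\<dots> = ae_class circle (\<lambda>z. \<Sum>n<N. (c n * cis (- \<alpha>) ^ n) * z ^ n)"
    by (simp add: power_mult_distrib mult_ac)
  finally have ZS: "Z_op (ae_class unit_interval (S N)) = ae_class circle (\<lambda>z. \<Sum>n<N. (c n * cis (- \<alpha>) ^ n) * z ^ n)" .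
  have "L2_norm circle (L2_diff circle (Z_op F) (Z_op (ae_class unit_interval (S N))))
     = sqrt (nsq unit_interval (\<lambda>s. rep F s - rep (ae_class unit_interval (S N)) s))"
    unfolding L2_isometry_diff_norm[OF Z_op_isometry F SL] by (simp only: L2_norm_nsq nsq_rep_L2_diff[OF F SL])
  also have "nsq unit_interval (\<lambda>s. rep F s - rep (ae_class unit_interval (S N)) s) = nsq unit_interval (\<lambda>s. rep F s - S N s)"
  proof (rule nsq_cong_AE)
    show "AE s in unit_interval. rep F s - rep (ae_class unit_interval (S N)) s = rep F s - S N s"
      using rep_ae_class(2)[OF sqi_measurable[OF S]] by eventually_elim simp
  qed (intro sqi_measurable sqi_diff f S L2_rep SL)+
  also have "\<dots> = nsq unit_interval (\<lambda>s. S N s - rep F s)" by (rule nsq_minus_commute)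
  also have "sqrt (nsq unit_interval (\<lambda>s. S N s - rep F s)) < \<epsilon>" using N \<epsilon> by (intro real_less_lsqrt) (auto simp: nsq_nonneg)
  finally have "L2_norm circle (L2_diff circle (Z_op F) (ae_class circle (\<lambda>z. \<Sum>n<N. (c n * cis (- \<alpha>) ^ n) * z ^ n))) < \<epsilon>"
    unfolding ZS .
  thus "\<exists>N c. L2_norm circle (L2_diff circle (Z_op F) (ae_class circle (\<lambda>z. \<Sum>n<N. c n * z ^ n))) < \<epsilon>"
    by (rule exI[of _ N, OF exI[of _ "\<lambda>n. c n * cis (- \<alpha>) ^ n"]])
qed

lemma Y_op_Z_op: "H \<in> L2 unit_interval \<Longrightarrow> Y_op \<alpha> \<beta> H = Z_op H"
  unfolding Y_op_def X_plus_def Z_op_def[symmetric] by (rule Q_plus_Hardy2[OF Z_op_Hardy2])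

text \<open>An isometry is injective on L2, so \<open>inv_into\<close> returns the preimage already
  exhibited.\<close>

lemma inv_Y_op_e_mon: "inv_into (L2 unit_interval) (Y_op \<alpha> \<beta>) (e_mon n) = ae_class unit_interval (h_fun \<alpha> \<beta> n)"
proof -
  have h: "ae_class unit_interval (h_fun \<alpha> \<beta> n) \<in> L2 unit_interval" by (rule ae_class_in_L2[OF h_fun_sqi])
  have "inj_on (Y_op \<alpha> \<beta>) (L2 unit_interval)"
    by (rule inj_onI) (simp add: Y_op_Z_op L2_isometry_inj[OF Z_op_isometry])
  from inv_into_f_f[OF this h] show ?thesis unfolding Y_op_Z_op[OF h] Z_op_h_fun .
qed

end

theorem mainTheorem5:
  fixes \<alpha> \<beta> :: real
  assumes "0 \<le> \<alpha>" and "\<alpha> < 2*pi" and "0 < \<beta>" and "\<beta> < pi"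
  shows "\<forall>n::nat. inv_into (L2 unit_interval) (Y_op \<alpha> \<beta>) (e_mon n)
           = ae_class unit_interval (h_fun \<alpha> \<beta> n)"
proof -
  interpret circle_param \<beta> \<alpha> by unfold_locales (rule assms)+
  show ?thesis by (intro allI inv_Y_op_e_mon)
qed

end
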